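(* Let $\lambda>0$ and let $\psi:\mathbb{R}\to\,]0,\infty[$ be a Borel function with $\int_x^\infty\psi(z)e^{-\lambda z}dz<\infty$ for all $x\in\mathbb{R}$. Let $$\Phi(y)=1-e^{\lambda y}\int_y^\infty\psi(z)e^{-\lambda z}dz,\qquad\varphi(y)=\psi(y)-\lambda e^{\lambda y}\int_y^\infty\psi(z)e^{-\lambda z}dz,$$ and let $Q_0^{\lambda,\varphi}$ be the probability measure on $(\Omega,\mathcal{F}_\infty)$ such that $Q_0^{\lambda,\varphi}(\Gamma_t)=\frac{1}{1-\Phi(0)}E_0[1_{\Gamma_t}M_t^{\lambda,\varphi}]$ for all $t\ge0$, $\Gamma_t\in\mathcal{F}_t$, where $$M_t^{\lambda,\varphi}=\Big\{(1-\Phi(S_t))\cosh(\lambda(S_t-X_t))+\varphi(S_t)\frac{\sinh(\lambda(S_t-X_t))}{\lambda}\Big\}e^{-\lambda^2t/2}.$$ 1. Under $Q_0^{\lambda,\varphi}$, the random variable $S_\infty$ is finite with density function $$\frac{e^{-\lambda x}\big(\varphi(x)+\lambda(1-\Phi(x))\big)}{1-\Phi(0)}=\frac{e^{-\lambda x}\psi(x)}{1-\Phi(0)},\qquad x>0.$$ 2. Let $g=\sup\{t\ge0;X_t=S_\infty\}$. Then $Q_0^{\lambda,\varphi}(0<g<\infty)=1$ and under $Q_0^{\lambda,\varphi}$: (a) $(S_\infty-X_{t+g};t\ge0)$ is independent of $(X_t;0\le t\le g)$ and is distributed as $(Z_t^{(\lambda)};t\ge0)$ under $P_0$, where $Z^{(\lambda)}$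 is the non-negative solution of $$Z_t^{(\lambda)}=X_t+\lambda\int_0^t\coth(\lambda Z_u^{(\lambda)})\,du;$$ (b) conditionally on $S_\infty=x$, $(X_t;t\le g)$ is distributed as a Brownian motion with drift $\lambda$ started at $0$, and stopped when it reaches $x$.
   Context: $\Omega=\mathcal{C}(\mathbb{R}_+,\mathbb{R})$ is the canonical space, $(X_t)_{t\ge0}$ the coordinate process, $\mathcal{F}_t=\sigma(X_s;0\le s\le t)$, $\mathcal{F}_\infty=\sigma(X_s;s\ge0)$; $P_0$ is the Wiener measure started at $0$, with expectation $E_0$. $S_t=\sup_{0\le u\le t}X_u$, $S_\infty=\sup_{u\ge0}X_u$. The process $(M_t^{\lambda,\varphi})$ is a $P_0$-martingale with $M_0^{\lambda,\varphi}=1-\Phi(0)$. Convention: $\sup\emptyset=0$. *)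

theory Defs
  imports "HOL-Probability.Probability"
begin

section \<open>The canonical space\<close>

text \<open>
  A path in \<open>C(\<real>\<^sub>+, \<real>)\<close> is a function on \<open>real\<close> that is continuous on \<open>{0..}\<close> and
  takes the value \<^term>\<open>undefined\<close> off \<open>{0..}\<close>, so that distinct elements are distinct
  continuous functions on the half-line. The coordinate process is \<open>X\<^sub>t \<omega> = \<omega> t\<close>.
\<close>

definition Omega :: "(real \<Rightarrow> real) set" where
  "Omega = {\<omega> \<in> extensional {0..}. continuous_on {0..} \<omega>}"

text \<open>\<open>coord_algebra I = \<sigma>(X\<^sub>s; s \<in> I)\<close>\<close>

definition coord_algebra :: "real set \<Rightarrow> (real \<Rightarrow> real) measure" where
  "coord_algebra I = sigma Omega {{\<omega> \<in> Omega. \<omega> s \<in> A} | s A. s \<in> I \<and> A \<in> sets borel}"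

definition F :: "real \<Rightarrow> (real \<Rightarrow> real) measure" where
  "F t = coord_algebra {0..t}"

definition F_inf :: "(real \<Rightarrow> real) measure" where
  "F_inf = coord_algebra {0..}"

definition wiener_measure :: "(real \<Rightarrow> real) measure \<Rightarrow> bool" where
  "wiener_measure P \<longleftrightarrow>
     prob_space P \<and> sets P = sets F_inf \<and>
     (AE \<omega> in P. \<omega> 0 = 0) \<and>
     (\<forall>s t. 0 \<le> s \<and> s < t \<longrightarrow>
        distributed P lborel (\<lambda>\<omega>. \<omega> t - \<omega> s) (\<lambda>x. ennreal (normal_density 0 (sqrt (t - s)) x)) \<and>
        prob_space.indep_set P (sets (F s))
          (sets (vimage_algebra (space P) (\<lambda>\<omega>. \<omega> t - \<omega> s) borel)))"

section \<open>Suprema and random times\<close>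

definition S :: "real \<Rightarrow> (real \<Rightarrow> real) \<Rightarrow> real" where
  "S t \<omega> = (SUP u\<in>{0..t}. \<omega> u)"

definition S_inf :: "(real \<Rightarrow> real) \<Rightarrow> ereal" where
  "S_inf \<omega> = (SUP u\<in>{0..}. ereal (\<omega> u))"

text \<open>
  Random times take values in \<^typ>\<open>ennreal\<close>. There \<open>\<Squnion>{} = 0\<close>, which is the convention
  wanted for \<open>g\<close>, and \<open>\<Sqinter>{} = \<infinity>\<close>, which is the usual one for hitting times.
\<close>

definition g :: "(real \<Rightarrow> real) \<Rightarrow> ennreal" where
  "g \<omega> = (SUP t\<in>{t. 0 \<le> t \<and> ereal (\<omega> t) = S_inf \<omega>}. ennreal t)"

definition hitting_time :: "real \<Rightarrow> (real \<Rightarrow> real) \<Rightarrow> ennreal" where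
  "hitting_time x \<omega> = (INF t\<in>{t. 0 \<le> t \<and> \<omega> t = x}. ennreal t)"

text \<open>
  The path fragment \<open>(\<omega>\<^sub>t; 0 \<le> t \<le> \<tau>)\<close>, with possibly infinite lifetime \<open>\<tau>\<close>, is encoded by
  its lifetime together with the path frozen at time \<open>\<tau>\<close>.
\<close>

definition stopped_path :: "ennreal \<Rightarrow> (real \<Rightarrow> real) \<Rightarrow> ennreal \<times> (real \<Rightarrow> real)" where
  "stopped_path \<tau> \<omega> = (\<tau>, \<lambda>t\<in>{0..}. \<omega> (enn2real (min (ennreal t) \<tau>)))"

definition stopped_path_space :: "(ennreal \<times> (real \<Rightarrow> real)) measure" where
  "stopped_path_space = borel \<Otimes>\<^sub>M F_inf"

text \<open>
  \<open>(S\<^sub>\<infinity> - X\<^bsub>t+g\<^esub>; t \<ge> 0)\<close>. Where \<open>S\<^sub>\<infinity>\<close> or \<open>g\<close> is infinite the conversions to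
  \<^typ>\<open>real\<close> return 0.
\<close>

definition post_g_path :: "(real \<Rightarrow> real) \<Rightarrow> real \<Rightarrow> real" where
  "post_g_path \<omega> = (\<lambda>t\<in>{0..}. real_of_ereal (S_inf \<omega>) - \<omega> (t + enn2real (g \<omega>)))"

definition drifted_path :: "real \<Rightarrow> (real \<Rightarrow> real) \<Rightarrow> real \<Rightarrow> real" where
  "drifted_path l \<omega> = (\<lambda>t\<in>{0..}. \<omega> t + l * t)"

section \<open>The martingale\<close>

definition Phi :: "real \<Rightarrow> (real \<Rightarrow> real) \<Rightarrow> real \<Rightarrow> real" where
  "Phi l \<psi> y = 1 - exp (l * y) * (LINT z:{y..}|lborel. \<psi> z * exp (- l * z))"

definition phi :: "real \<Rightarrow> (real \<Rightarrow> real) \<Rightarrow> real \<Rightarrow> real" where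
  "phi l \<psi> y = \<psi> y - l * exp (l * y) * (LINT z:{y..}|lborel. \<psi> z * exp (- l * z))"

definition Mart :: "real \<Rightarrow> (real \<Rightarrow> real) \<Rightarrow> real \<Rightarrow> (real \<Rightarrow> real) \<Rightarrow> real" where
  "Mart l \<psi> t \<omega> =
     ((1 - Phi l \<psi> (S t \<omega>)) * cosh (l * (S t \<omega> - \<omega> t))
        + phi l \<psi> (S t \<omega>) * (sinh (l * (S t \<omega> - \<omega> t)) / l)) * exp (- l\<^sup>2 * t / 2)"

section \<open>The equation for \<open>Z\<close>\<close>

definition coth :: "real \<Rightarrow> real" where
  "coth x = cosh x / sinh x"

text \<open>
  \<open>coth\<close> has an infinite limit at \<open>0+\<close>, so finiteness of the drift integral entails \<open>Z\<^sub>u > 0\<close>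
  for almost every \<open>u\<close>. In HOL, however, \<open>coth 0 = 0\<close>, so this is required separately.
\<close>

definition nonneg_solution ::
    "(real \<Rightarrow> real) measure \<Rightarrow> real \<Rightarrow> ((real \<Rightarrow> real) \<Rightarrow> (real \<Rightarrow> real)) \<Rightarrow> bool" where
  "nonneg_solution P l Z \<longleftrightarrow>
     Z \<in> P \<rightarrow>\<^sub>M F_inf \<and>
     (AE \<omega> in P.
        (\<forall>t\<ge>0. 0 \<le> Z \<omega> t) \<and>
        (AE u in lborel. 0 \<le> u \<longrightarrow> 0 < Z \<omega> u) \<and>
        (\<forall>t\<ge>0. set_integrable lborel {0..t} (\<lambda>u. coth (l * Z \<omega> u)) \<and>
               Z \<omega> t = \<omega> t + l * (LINT u:{0..t}|lborel. coth (l * Z \<omega> u))))"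

section \<open>Conditional distributions\<close>

text \<open>
  \<open>\<kappa>\<close> is a regular conditional distribution of \<open>Y\<close> given \<open>X\<close>: a probability kernel with
  \<open>M(Y \<in> B | \<sigma>(X)) = \<kappa> X B\<close> almost surely.
\<close>

definition regular_cond_distr ::
    "'a measure \<Rightarrow> 'b measure \<Rightarrow> ('a \<Rightarrow> 'b) \<Rightarrow> 'c measure \<Rightarrow> ('a \<Rightarrow> 'c) \<Rightarrow> ('b \<Rightarrow> 'c measure) \<Rightarrow> bool" where
  "regular_cond_distr M L X N Y \<kappa> \<longleftrightarrow>
     X \<in> M \<rightarrow>\<^sub>M L \<and> Y \<in> M \<rightarrow>\<^sub>M N \<and> \<kappa> \<in> L \<rightarrow>\<^sub>M prob_algebra N \<and>
     (\<forall>B\<in>sets N. AE \<omega> in M.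
        real_cond_exp M (vimage_algebra (space M) X L) (indicator (Y -` B \<inter> space M)) \<omega>
          = measure (\<kappa> (X \<omega>)) B)"

end

theory Submission
  imports Defs "HOL-Real_Asymp.Real_Asymp" "HOL-Complex_Analysis.Complex_Analysis"
begin

text \<open>
 Up to time \<open>t\<close> the density \<open>Mart\<close> splits into a part carried by \<open>{t < g}\<close> and a part carried by \<open>{g \<le> t}\<close>.
 The first one is a mixture over \<open>x\<close>, with the claimed density of \<open>S_inf\<close> as weights, of the Girsanov densities of
 Brownian motion with drift \<open>l\<close> that has not yet reached \<open>x\<close>. This determines the joint law of \<open>S_inf\<close> and of the path
 stopped at \<open>g\<close>, which gives the density of \<open>S_inf\<close> and the conditional law.

 For the path \<open>Y\<close> after \<open>g\<close>, the functions \<open>z \<mapsto> sin (\<theta> * z) / sinh (l * z)\<close> are eigenfunctions, with eigenvalue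
 \<open>- (\<theta>\<^sup>2 + l\<^sup>2) / 2\<close>, of the generator \<open>D\<^sup>2 / 2 + l * coth (l * z) * D\<close>. Together they separate finite measures on the
 half-line, so the conditional expectations of these functions of \<open>Y\<close> given its past determine the law of a nonnegative process
 started at 0. Under \<open>Q\<close> they are computed from the martingales \<open>sin (\<theta> * (x - X\<^sub>t)) * exp (\<theta>\<^sup>2 * t / 2)\<close>
 of Brownian motion killed at level \<open>x\<close>, also in restriction to events before \<open>g\<close>, which yields the independence. For a solution \<open>Z\<close> they follow from an elementary
 version of Ito's formula; pathwise uniqueness provides the adaptedness of \<open>Z\<close>.
\<close>

section \<open>Measurability on the canonical space\<close>

text \<open>The sine quotients arise as Doob transforms: after \<open>g\<close> the density on
  \<open>F t\<close> carries the factor \<open>sinh (l * (S t w - w t))\<close>, which cancels their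
  denominator and leaves the sine of a killed Brownian motion. The rate
  \<open>\<theta>\<^sup>2 / 2\<close> of the sine and the discount \<open>l\<^sup>2 / 2\<close> in
  \<open>Mart\<close> add up to the eigenvalue. All martingale arguments are reduced to Gaussian
  integrals over a grid. Killing at a level is tested at grid times only; since the functions used
  vanish at the level, the error is the overshoot in the killing step, which a fourth moment
  controls. Two obstacles shape the rest. \<open>g\<close> is not a stopping time, so it is moved up
  to the next grid time, where the event that the maximum is already over has an explicit density.
  And \<open>coth\<close> blows up at 0, so increments of a solution are separated into a Brownian
  and a drift part; of the latter only monotonicity and finite total are used, never a bound on
  \<open>coth\<close>. As \<open>\<psi>\<close> is merely Borel, densities are truncated where
  \<open>\<psi> (S t w)\<close> is large.\<close>

lemma space_coord_algebra [simp]: "space (coord_algebra I) = Omega"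
 unfolding coord_algebra_def by (rule space_measure_of) auto

lemma sets_coord_algebra:
 "sets (coord_algebra I) = sigma_sets Omega {{w \<in> Omega. w s \<in> A} | s A. s \<in> I \<and> A \<in> sets borel}"
 unfolding coord_algebra_def by (rule sets_measure_of) auto

lemma space_F [simp]: "space (F t) = Omega" "space F_inf = Omega"
 by (simp_all add: F_def F_inf_def)

lemma measurable_coord: "s \<in> I ==> (\<lambda>w. w s) \<in> borel_measurable (coord_algebra I)"
proof (rule measurableI)
 fix A :: "real set" assume "s \<in> I" "A \<in> sets borel"
 moreover have "(\<lambda>w. w s) -` A \<inter> space (coord_algebra I) = {w \<in> Omega. w s \<in> A}" by auto
 ultimately show "(\<lambda>w. w s) -` A \<inter> space (coord_algebra I) \<in> sets (coord_algebra I)"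
  unfolding sets_coord_algebra by (simp only:) (blast intro: sigma_sets.Basic)
qed auto

lemma measurable_into_coord_algebra:
 assumes "\<And>x. x \<in> space M ==> f x \<in> Omega"
  and "\<And>s. s \<in> I ==> (\<lambda>x. f x s) \<in> borel_measurable M"
 shows "f \<in> M \<rightarrow>\<^sub>M coord_algebra I"
 unfolding coord_algebra_def
proof (rule measurable_measure_of)
 fix B assume "B \<in> {{w \<in> Omega. w s \<in> A} | s A. s \<in> I \<and> A \<in> sets borel}"
 then obtain s A where B: "B = {w \<in> Omega. w s \<in> A}" "s \<in> I" "A \<in> sets borel" by auto
 have "f -` B \<inter> space M = (\<lambda>x. f x s) -` A \<inter> space M" using B assms(1) by auto
 also have "\<dots> \<in> sets M" using assms(2)[OF B(2)] B(3) by (rule measurable_sets)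
 finally show "f -` B \<inter> space M \<in> sets M" .
qed (use assms(1) in auto)

lemma sets_coord_algebra_mono: "I \<subseteq> J ==> sets (coord_algebra I) \<subseteq> sets (coord_algebra J)"
 unfolding sets_coord_algebra by (rule sigma_sets_mono') blast

lemma measurable_coord_algebra_mono:
 assumes "f \<in> coord_algebra I \<rightarrow>\<^sub>M N" "I \<subseteq> J" shows "f \<in> coord_algebra J \<rightarrow>\<^sub>M N"
 using measurable_mono[OF order_refl refl sets_coord_algebra_mono[OF assms(2)]] assms(1) by auto

lemma F_measurable_mono: "f \<in> F s \<rightarrow>\<^sub>M N ==> s \<le> t ==> f \<in> F t \<rightarrow>\<^sub>M N"
 unfolding F_def by (erule measurable_coord_algebra_mono) auto

lemma F_measurable_F_inf: "f \<in> F s \<rightarrow>\<^sub>M N ==> f \<in> F_inf \<rightarrow>\<^sub>M N"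
 unfolding F_def F_inf_def by (erule measurable_coord_algebra_mono) auto

lemma sets_F_mono: "s \<le> t ==> A \<in> sets (F s) ==> A \<in> sets (F t)"
 unfolding F_def using sets_coord_algebra_mono[of "{0..s}" "{0..t}"] by auto

lemma sets_F_F_inf: "A \<in> sets (F s) ==> A \<in> sets F_inf"
 unfolding F_def F_inf_def using sets_coord_algebra_mono[of "{0..s}" "{0..}"] by auto

lemma coord_F [measurable]: "0 \<le> s ==> s \<le> t ==> (\<lambda>w. w s) \<in> borel_measurable (F t)"
 unfolding F_def by (rule measurable_coord) auto

lemma coord_F_inf [measurable]: "0 \<le> s ==> (\<lambda>w. w s) \<in> borel_measurable F_inf"
 unfolding F_inf_def by (rule measurable_coord) auto

lemma OmegaD: "w \<in> Omega ==> continuous_on {0..} w" "w \<in> Omega ==> w \<in> extensional {0..}"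
 by (auto simp: Omega_def)

lemma restrict_in_Omega: "continuous_on {0..} f ==> (\<lambda>t\<in>{0..}. f t) \<in> Omega"
 by (auto simp: Omega_def elim!: continuous_on_cong[THEN iffD1, rotated 2])

lemma continuous_on_Omega_comp:
 assumes "w \<in> Omega" "continuous_on A h" "\<And>t. t \<in> A ==> 0 \<le> h t"
 shows "continuous_on A (\<lambda>t. w (h t))"
 using continuous_on_compose2[OF OmegaD(1)[OF assms(1)] assms(2)] assms(3) by auto

lemma Omega_tendsto:
 assumes "w \<in> Omega" "x \<longlonglongrightarrow> a" "\<And>n. 0 \<le> x n" "0 \<le> a"
 shows "(\<lambda>n. w (x n)) \<longlonglongrightarrow> w a"
 using continuous_on_tendsto_compose[OF OmegaD(1)[OF assms(1)] assms(2)] assms(3,4) by auto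

section \<open>Discretisation of continuous paths\<close>

lemma floor_grid_tendsto:
 fixes x :: real assumes "0 \<le> x"
 shows "(\<lambda>n. real (nat \<lfloor>real n * x\<rfloor>) / real n) \<longlonglongrightarrow> x"
proof (rule real_tendsto_sandwich)
 show "\<forall>\<^sub>F n in sequentially. real (nat \<lfloor>real n * x\<rfloor>) / real n \<le> x"
  using eventually_gt_at_top[of 0]
 proof eventually_elim
  case (elim n)
  have "real (nat \<lfloor>real n * x\<rfloor>) \<le> real n * x" using assms by (simp add: of_nat_nat)
  then show ?case using elim by (simp add: field_simps)
 qed
 show "\<forall>\<^sub>F n in sequentially. x - 1 / real n \<le> real (nat \<lfloor>real n * x\<rfloor>) / real n"
  using eventually_gt_at_top[of 0]
 proof eventually_elim
  case (elim n)
  have "real n * x - 1 \<le> real (nat \<lfloor>real n * x\<rfloor>)" using assms by simp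
  then have "(real n * x - 1) / real n \<le> real (nat \<lfloor>real n * x\<rfloor>) / real n" using elim by (intro divide_right_mono) auto
  then show ?case using elim by (simp add: diff_divide_distrib)
 qed
 show "(\<lambda>n. x - 1 / real n) \<longlonglongrightarrow> x" by real_asymp
qed simp

text \<open>The grid point just below \<open>t\<close> converges to \<open>t\<close>, so by
  continuity the path also exceeds \<open>y\<close> there. Because this holds for all large
  \<open>n\<close>, and not just for some \<open>n\<close>, it also yields pointwise convergence of
  the indicators of discretised events.\<close>

lemma eventually_grid_exceeds:
 assumes "w \<in> Omega" "0 \<le> p" "p \<le> t" "t \<le> q" "y < w t"
 shows "\<forall>\<^sub>F n in sequentially. \<exists>j\<le>n. y < w (p + (q - p) * (real j / real n))"
proof (cases "p = q")
 case True
 then show ?thesis using assms by (intro always_eventually) auto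
next
 case False
 define x where "x = (t - p) / (q - p)"
 have x: "0 \<le> x" "x \<le> 1" "t = p + (q - p) * x" using assms False by (auto simp: x_def)
 define j where "j n = nat \<lfloor>real n * x\<rfloor>" for n
 have j: "j n \<le> n" for n
 proof -
  have "real n * x \<le> real n" using x mult_left_le[of x "real n"] by simp
  then have "\<lfloor>real n * x\<rfloor> \<le> int n" by linarith
  then show ?thesis unfolding j_def by linarith
 qed
 have "(\<lambda>n. w (p + (q - p) * (real (j n) / real n))) \<longlonglongrightarrow> w (p + (q - p) * x)"
 proof (rule Omega_tendsto[OF assms(1)])
  show "(\<lambda>n. p + (q - p) * (real (j n) / real n)) \<longlonglongrightarrow> p + (q - p) * x"
   unfolding j_def by (intro tendsto_intros floor_grid_tendsto x)
 qed (use assms x in auto)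
 then have "\<forall>\<^sub>F n in sequentially. y < w (p + (q - p) * (real (j n) / real n))"
  using assms(5) x(3) by (intro order_tendstoD) auto
 then show ?thesis by eventually_elim (use j in blast)
qed

text \<open>A condition on uncountably many times becomes one on countably many, which settles
  measurability. The index \<open>n = 0\<close> is harmless: division by zero gives 0, so it tests
  only the point \<open>p\<close>.\<close>

lemma all_le_iff_grid:
 assumes "w \<in> Omega" "0 \<le> p" "p \<le> q"
 shows "(\<forall>t\<in>{p..q}. w t \<le> y) \<longleftrightarrow> (\<forall>n j. j \<le> n --> w (p + (q - p) * (real j / real n)) \<le> y)"
proof (intro iffI allI impI ballI)
 fix n j :: nat assume *: "\<forall>t\<in>{p..q}. w t \<le> y" and "j \<le> n"
 then have "0 \<le> real j / real n" "real j / real n \<le> 1" by (auto simp: divide_le_eq)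
 then have "p + (q - p) * (real j / real n) \<in> {p..q}"
  using assms mult_left_le[of "real j / real n" "q - p"] by auto
 then show "w (p + (q - p) * (real j / real n)) \<le> y" using * by blast
next
 fix t assume *: "\<forall>n j. j \<le> n --> w (p + (q - p) * (real j / real n)) \<le> y" and t: "t \<in> {p..q}"
 show "w t \<le> y"
 proof (rule ccontr)
  assume "\<not> w t \<le> y"
  then have "\<forall>\<^sub>F n in sequentially. \<exists>j\<le>n. y < w (p + (q - p) * (real j / real n))"
   using eventually_grid_exceeds[OF assms(1,2)] t by auto
  then obtain n where "\<exists>j\<le>n. y < w (p + (q - p) * (real j / real n))"
   using eventually_happens' trivial_limit_sequentially by blast
  with * show False by force
 qed
qed

lemma pred_all_le:
 assumes "\<And>x. x \<in> space M ==> Y x \<in> Omega"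
  and "\<And>t. p \<le> t ==> t \<le> q ==> (\<lambda>x. Y x t) \<in> borel_measurable M"
  and L: "L \<in> borel_measurable M" and "0 \<le> p"
 shows "Measurable.pred M (\<lambda>x. \<forall>t\<in>{p..q}. Y x t \<le> L x)"
proof (cases "p \<le> q")
 case True
 have "Measurable.pred M (\<lambda>x. \<forall>n j. j \<le> n --> Y x (p + (q - p) * (real j / real n)) \<le> L x)"
 proof (intro pred_intros_countable pred_intros_imp')
  fix n j :: nat assume "j \<le> n"
  then have "0 \<le> real j / real n" "real j / real n \<le> 1" by (auto simp: divide_le_eq)
  then have "p + (q - p) * (real j / real n) \<in> {p..q}"
   using True mult_left_le[of "real j / real n" "q - p"] by auto
  then have "(\<lambda>x. Y x (p + (q - p) * (real j / real n))) \<in> borel_measurable M"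
   by (intro assms(2)) auto
  then show "Measurable.pred M (\<lambda>x. Y x (p + (q - p) * (real j / real n)) \<le> L x)"
   using L by measurable
 qed
 then show ?thesis
  by (rule measurable_cong[THEN iffD1, rotated]) (simp add: all_le_iff_grid[OF assms(1) assms(4) True])
qed auto

section \<open>Running and overall suprema of a path\<close>

lemma continuous_on_Omega: "w \<in> Omega ==> 0 \<le> p ==> continuous_on {p..q} w"
 by (rule continuous_on_subset[OF OmegaD(1)]) auto

lemma bdd_above_Omega: "w \<in> Omega ==> 0 \<le> p ==> bdd_above (w ` {p..q})"
 by (intro bounded_imp_bdd_above compact_imp_bounded compact_continuous_image continuous_on_Omega) auto

lemma S_le_iff: "w \<in> Omega ==> 0 \<le> t ==> S t w \<le> y \<longleftrightarrow> (\<forall>u\<in>{0..t}. w u \<le> y)"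
 unfolding S_def by (subst cSUP_le_iff) (auto intro: bdd_above_Omega)

lemma S_upper: "w \<in> Omega ==> 0 \<le> u ==> u \<le> t ==> w u \<le> S t w"
 unfolding S_def by (intro cSUP_upper bdd_above_Omega) auto

lemma S_mono: "w \<in> Omega ==> 0 \<le> s ==> s \<le> t ==> S s w \<le> S t w"
 by (subst S_le_iff) (auto intro: S_upper)

lemma S_attained:
 assumes "w \<in> Omega" "0 \<le> t" obtains u where "0 \<le> u" "u \<le> t" "w u = S t w"
proof -
 obtain u where u: "u \<in> {0..t}" "\<forall>v\<in>{0..t}. w v \<le> w u"
  using continuous_attains_sup[of "{0..t}" w] continuous_on_Omega[OF assms(1), of 0 t] assms(2) by auto
 have "S t w \<le> w u" using u assms by (subst S_le_iff) auto
 with u S_upper[OF assms(1), of u t] that show ?thesis by force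
qed

lemma S_measurable_comp:
 assumes "\<And>x. x \<in> space M ==> Y x \<in> Omega"
  and "\<And>u. 0 \<le> u ==> u \<le> t ==> (\<lambda>x. Y x u) \<in> borel_measurable M" "0 \<le> t"
 shows "(\<lambda>x. S t (Y x)) \<in> borel_measurable M"
proof (rule borel_measurable_iff_le[THEN iffD2], intro allI)
 fix a
 have "Measurable.pred M (\<lambda>x. \<forall>u\<in>{0..t}. Y x u \<le> a)"
  using assms by (intro pred_all_le) auto
 then have "{x \<in> space M. \<forall>u\<in>{0..t}. Y x u \<le> a} \<in> sets M" by (simp add: pred_def)
 also have "{x \<in> space M. \<forall>u\<in>{0..t}. Y x u \<le> a} = {x \<in> space M. S t (Y x) \<le> a}"
  using assms by (auto simp: S_le_iff)
 finally show "{x \<in> space M. S t (Y x) \<le> a} \<in> sets M" .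
qed

lemma S_measurable [measurable]: "0 \<le> s ==> s \<le> t ==> S s \<in> borel_measurable (F t)"
 using S_measurable_comp[of "F t" "\<lambda>x. x" s] by auto

lemma S_measurable_F_inf [measurable]: "0 \<le> s ==> S s \<in> borel_measurable F_inf"
 using S_measurable[of s s] F_measurable_F_inf by blast

lemma S_inf_eq: "W \<in> Omega ==> S_inf W = (SUP n. ereal (S (real n) W))"
 unfolding S_inf_def
proof (rule antisym)
 assume w: "W \<in> Omega"
 show "(SUP u\<in>{0..}. ereal (W u)) \<le> (SUP n. ereal (S (real n) W))"
 proof (rule SUP_least)
  fix u :: real assume "u \<in> {0..}"
  then have "ereal (W u) \<le> ereal (S (real (nat \<lceil>u\<rceil>)) W)" using S_upper[OF w, of u] by simp
  then show "ereal (W u) \<le> (SUP n. ereal (S (real n) W))" by (rule order_trans) (auto intro: SUP_upper)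
 qed
 show "(SUP n. ereal (S (real n) W)) \<le> (SUP u\<in>{0..}. ereal (W u))"
 proof (rule SUP_least)
  fix n
  obtain u where u: "0 \<le> u" "W u = S (real n) W" using S_attained[OF w, of "real n"] by auto
  then show "ereal (S (real n) W) \<le> (SUP u\<in>{0..}. ereal (W u))"
   by (intro SUP_upper2[of u]) auto
 qed
qed

lemma S_inf_measurable [measurable]: "S_inf \<in> borel_measurable F_inf"
proof -
 have "(\<lambda>w. SUP n. ereal (S (real n) w)) \<in> borel_measurable F_inf" by measurable
 then show ?thesis by (rule measurable_cong[THEN iffD1, rotated]) (simp add: S_inf_eq)
qed

lemma S_inf_le_iff: "S_inf w \<le> ereal y \<longleftrightarrow> (\<forall>t\<ge>0. w t \<le> y)"
 unfolding S_inf_def by (auto simp: SUP_le_iff)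

lemma S_inf_upper: "0 \<le> t ==> ereal (w t) \<le> S_inf w"
 unfolding S_inf_def by (auto intro: SUP_upper)

section \<open>Transformed paths and the time of the maximum\<close>

lemma time_shift_in_Omega:
 assumes "w \<in> Omega" "0 \<le> a" shows "(\<lambda>t\<in>{0..}. w (t + a)) \<in> Omega"
proof (rule restrict_in_Omega)
 have "continuous_on {0..} (\<lambda>t. t + a)" by (intro continuous_intros)
 then show "continuous_on {0..} (\<lambda>t. w (t + a))"
  using assms by (auto intro: continuous_on_Omega_comp)
qed

lemma reflected_in_Omega: "w \<in> Omega ==> (\<lambda>t\<in>{0..}. c - w t) \<in> Omega"
 by (intro restrict_in_Omega continuous_on_diff continuous_on_const OmegaD(1))

lemma negated_in_Omega: "w \<in> Omega ==> (\<lambda>t\<in>{0..}. - w t) \<in> Omega"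
 using reflected_in_Omega[of w 0] by simp

text \<open>Rationals \<open>a\<close> and \<open>b\<close> bracket a maximiser beyond
  \<open>y\<close>; conversely the supremum over a compact interval is attained, which gives a
  maximiser at or after \<open>a\<close>. Measurability of \<open>g\<close>, a supremum over an
  uncountable random set, follows from this.\<close>

lemma g_greater_iff:
 assumes "w \<in> Omega"
 shows "y < g w \<longleftrightarrow> (\<exists>a b::rat. 0 \<le> a \<and> a \<le> b \<and> y < ennreal (of_rat a) \<and>
   S_inf w = ereal (SUP u\<in>{of_rat a..of_rat b}. w u))" (is "_ \<longleftrightarrow> ?R")
proof
 assume "y < g w"
 then obtain t where t: "0 \<le> t" "ereal (w t) = S_inf w" "y < ennreal t"
  unfolding g_def by (auto simp: less_SUP_iff)
 then obtain a where a: "y < real_of_rat a" "real_of_rat a < ennreal t" using ennreal_rat_dense by blast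
 have "0 \<le> a" using a(1) by (metis ennreal_neg linorder_not_le not_less_zero of_rat_less_0_iff order_less_imp_le)
 have at: "real_of_rat a < t" using a(2) \<open>0 \<le> a\<close> by (simp add: ennreal_less_iff)
 obtain b where b: "t < real_of_rat b" using of_rat_dense[of t "t+1"] by auto
 have "S_inf w = ereal (SUP u\<in>{of_rat a..of_rat b}. w u)"
 proof (rule antisym)
  show "S_inf w \<le> ereal (SUP u\<in>{of_rat a..of_rat b}. w u)"
   using t at b \<open>0 \<le> a\<close> by (auto simp flip: t(2) intro!: cSUP_upper bdd_above_Omega assms)
  have "(SUP u\<in>{of_rat a..of_rat b}. w u) \<le> w t"
  proof (rule cSUP_least)
   fix u assume "u \<in> {real_of_rat a..of_rat b}"
   then have "0 \<le> u" using \<open>0 \<le> a\<close> by (auto intro: order_trans[of _ "real_of_rat a"])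
   then show "w u \<le> w t" using S_inf_upper[of u w] by (simp flip: t(2))
  qed (use at b in auto)
  then show "ereal (SUP u\<in>{of_rat a..of_rat b}. w u) \<le> S_inf w" by (simp flip: t(2))
 qed
 moreover have "a \<le> b" using less_trans[OF at b] by (simp add: of_rat_less)
 ultimately show ?R using \<open>0 \<le> a\<close> a(1) by blast
next
 assume ?R
 then obtain a b :: rat where ab: "0 \<le> a" "a \<le> b" "y < ennreal (of_rat a)"
   "S_inf w = ereal (SUP u\<in>{of_rat a..of_rat b}. w u)" by blast
 have ne: "{real_of_rat a..of_rat b} \<noteq> {}" using ab(2) by (simp add: of_rat_less_eq)
 obtain t where t: "t \<in> {real_of_rat a..of_rat b}" "\<forall>v\<in>{real_of_rat a..of_rat b}. w v \<le> w t"
  using continuous_attains_sup[of "{real_of_rat a..of_rat b}" w] continuous_on_Omega[OF assms, of "of_rat a"] ne ab(1) by auto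
 have "(SUP u\<in>{of_rat a..of_rat b}. w u) \<le> w t" using t ne by (intro cSUP_least) auto
 then have "S_inf w \<le> ereal (w t)" using ab(4) by simp
 moreover have t0: "0 \<le> t" using t(1) ab(1) by (auto intro: order_trans[of _ "real_of_rat a"])
 ultimately have "ereal (w t) = S_inf w" using S_inf_upper[of t w] by auto
 moreover have "y < ennreal t" using ab(3) t(1) by (meson atLeastAtMost_iff ennreal_leI less_le_trans)
 ultimately show "y < g w" unfolding g_def using t0 by (auto simp: less_SUP_iff)
qed

text \<open>Lets the measurability of \<open>S\<close> serve for suprema over intervals that do not
  start at 0.\<close>

lemma SUP_Icc_eq_S:
 assumes "0 \<le> a" "a \<le> b"
 shows "(SUP u\<in>{a..b}. w u) = S (b - a) (\<lambda>t\<in>{0..}. w (t + a))"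
proof -
 have "{a..b} = (\<lambda>t. t + a) ` {0..b - a}" by (simp add: image_add_atLeastAtMost')
 then have "w ` {a..b} = (\<lambda>t. w (t + a)) ` {0..b - a}" by (metis image_image)
 moreover have "(\<lambda>t\<in>{0..}. w (t + a)) ` {0..b - a} = (\<lambda>t. w (t + a)) ` {0..b - a}"
  by (intro image_cong) auto
 ultimately show ?thesis unfolding S_def by simp
qed

lemma g_measurable [measurable]: "g \<in> borel_measurable F_inf"
proof (rule borel_measurableI_greater)
 fix y
 have m: "(\<lambda>w. SUP u\<in>{real_of_rat a..of_rat b}. w u) \<in> borel_measurable F_inf" if "0 \<le> a" "a \<le> b" for a b
 proof -
  have "(\<lambda>w. S (of_rat b - of_rat a) (\<lambda>t\<in>{0..}. w (t + real_of_rat a))) \<in> borel_measurable F_inf"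
   using that by (intro S_measurable_comp) (auto simp: time_shift_in_Omega of_rat_less_eq)
  then show ?thesis using that by (subst SUP_Icc_eq_S) (auto simp: of_rat_less_eq)
 qed
 have "Measurable.pred F_inf (\<lambda>w. \<exists>a b::rat. 0 \<le> a \<and> a \<le> b \<and> y < ennreal (of_rat a) \<and>
   S_inf w = ereal (SUP u\<in>{of_rat a..of_rat b}. w u))"
 proof (intro pred_intros_countable)
  fix a b :: rat
  show "Measurable.pred F_inf (\<lambda>w. 0 \<le> a \<and> a \<le> b \<and> y < ennreal (of_rat a) \<and>
   S_inf w = ereal (SUP u\<in>{of_rat a..of_rat b}. w u))"
  proof (cases "0 \<le> a \<and> a \<le> b")
   case True
   define h where "h = (\<lambda>w. SUP u\<in>{real_of_rat a..of_rat b}. w u :: real)"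
   have [measurable]: "h \<in> borel_measurable F_inf" unfolding h_def using m True by auto
   have "{w \<in> space F_inf. S_inf w = ereal (h w)} \<in> sets F_inf" by measurable
   then have "Measurable.pred F_inf (\<lambda>w. S_inf w = ereal (h w))" by (simp add: pred_def)
   then show ?thesis unfolding h_def by simp
  next
   case False
   then have "(\<lambda>w. 0 \<le> a \<and> a \<le> b \<and> y < ennreal (of_rat a) \<and>
    S_inf w = ereal (SUP u\<in>{of_rat a..of_rat b}. w u)) = (\<lambda>_. False)" by blast
   then show ?thesis by (simp only: measurable_const space_count_space UNIV_I)
  qed
 qed
 moreover have "w \<in> space F_inf ==> y < g w \<longleftrightarrow> (\<exists>a b::rat. 0 \<le> a \<and> a \<le> b \<and> y < ennreal (of_rat a) \<and>
   S_inf w = ereal (SUP u\<in>{of_rat a..of_rat b}. w u))" for w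
  by (rule g_greater_iff) simp
 ultimately have "Measurable.pred F_inf (\<lambda>w. y < g w)"
  by (rule measurable_cong[THEN iffD2, rotated])
 then show "{x \<in> space F_inf. y < g x} \<in> sets F_inf" unfolding pred_def .
qed

section \<open>Evaluation at random times and stopped paths\<close>

lemma eval_measurable:
 assumes T: "T \<in> borel_measurable M" and Y: "Y \<in> M \<rightarrow>\<^sub>M F_inf" and T0: "\<And>x. x \<in> space M ==> 0 \<le> T x"
 shows "(\<lambda>x. Y x (T x) :: real) \<in> borel_measurable M"
proof -
 \<comment> \<open>The random time is rounded down to a multiple of \<open>1 / n\<close>, so that
   only countably many coordinates are read; continuity of the path gives the limit.\<close>
 let ?u = "\<lambda>n x. Y x (real (nat \<lfloor>real n * T x\<rfloor>) / real n)"
 have 1: "(\<lambda>n. ?u n x) \<longlonglongrightarrow> Y x (T x)" if x: "x \<in> space M" for x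
 proof (rule Omega_tendsto[OF _ floor_grid_tendsto])
  show "Y x \<in> Omega" using measurable_space[OF Y x] by auto
 qed (use T0[OF x] in auto)
 have 2: "?u n \<in> borel_measurable M" for n
 proof (rule measurable_compose_countable[where f="\<lambda>k x. Y x (real k / real n)"])
  fix k :: nat
  show "(\<lambda>x. Y x (real k / real n)) \<in> borel_measurable M"
   by (rule measurable_compose[OF Y coord_F_inf]) simp
  show "(\<lambda>x. nat \<lfloor>real n * T x\<rfloor>) \<in> M \<rightarrow>\<^sub>M count_space UNIV"
   using T by measurable
 qed
 show ?thesis by (rule borel_measurable_LIMSEQ_real[OF 1 2])
qed

lemma measurable_into_F_inf:
 assumes "\<And>x. x \<in> space M ==> f x \<in> Omega"
  and "\<And>s. 0 \<le> s ==> (\<lambda>x. f x s) \<in> borel_measurable M"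
 shows "f \<in> M \<rightarrow>\<^sub>M F_inf"
 unfolding F_inf_def using assms by (intro measurable_into_coord_algebra) auto

lemma stop_continuous: "continuous_on {0..} (\<lambda>t. enn2real (min (ennreal t) \<tau>))"
proof (cases \<tau>)
 case (real r)
 have "continuous_on {0..} (\<lambda>t. min t r)" by (intro continuous_intros)
 then show ?thesis by (rule continuous_on_cong[THEN iffD1, rotated 2])
   (use real in \<open>auto simp: min_def ennreal_le_iff2\<close>)
next
 case top
 have "continuous_on {0..} (\<lambda>t::real. t)" by (intro continuous_intros)
 then show ?thesis by (rule continuous_on_cong[THEN iffD1, rotated 2]) (use top in auto)
qed

lemma snd_stopped_path_in_Omega: "w \<in> Omega ==> snd (stopped_path \<tau> w) \<in> Omega"
 unfolding stopped_path_def
 by (auto intro!: restrict_in_Omega continuous_on_Omega_comp[OF _ stop_continuous])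

lemma stopped_path_measurable:
 assumes [measurable]: "T \<in> borel_measurable M" and Y: "Y \<in> M \<rightarrow>\<^sub>M F_inf"
 shows "(\<lambda>x. stopped_path (T x) (Y x)) \<in> M \<rightarrow>\<^sub>M stopped_path_space"
proof -
 have "(\<lambda>x. \<lambda>t\<in>{0..}. Y x (enn2real (min (ennreal t) (T x)))) \<in> M \<rightarrow>\<^sub>M F_inf"
 proof (rule measurable_into_F_inf)
  fix x assume "x \<in> space M"
  then have "Y x \<in> Omega" using measurable_space[OF Y] by auto
  from snd_stopped_path_in_Omega[OF this, of "T x"]
  show "(\<lambda>t\<in>{0..}. Y x (enn2real (min (ennreal t) (T x)))) \<in> Omega"
   by (simp add: stopped_path_def)
 next
  fix s :: real assume "0 \<le> s"
  then show "(\<lambda>x. (\<lambda>t\<in>{0..}. Y x (enn2real (min (ennreal t) (T x)))) s) \<in> borel_measurable M"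
   by (simp, intro eval_measurable[OF _ Y]) auto
 qed
 then show ?thesis unfolding stopped_path_def stopped_path_space_def by measurable
qed

lemma post_g_path_measurable [measurable]: "post_g_path \<in> F_inf \<rightarrow>\<^sub>M F_inf"
proof (rule measurable_into_F_inf)
 fix w assume "w \<in> space F_inf"
 then have "(\<lambda>t\<in>{0..}. real_of_ereal (S_inf w) - (\<lambda>t\<in>{0..}. w (t + enn2real (g w))) t) \<in> Omega"
  by (intro reflected_in_Omega time_shift_in_Omega) auto
 also have "(\<lambda>t\<in>{0..}. real_of_ereal (S_inf w) - (\<lambda>t\<in>{0..}. w (t + enn2real (g w))) t) = post_g_path w"
  by (auto simp: post_g_path_def)
 finally show "post_g_path w \<in> Omega" .
next
 fix s :: real assume s: "0 \<le> s"
 have 1 [measurable]: "(\<lambda>w. s + enn2real (g w)) \<in> borel_measurable F_inf" by measurable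
 define h where "h = (\<lambda>w. w (s + enn2real (g w)) :: real)"
 have [measurable]: "h \<in> borel_measurable F_inf"
  unfolding h_def by (rule eval_measurable[OF 1, of "\<lambda>w. w"]) (use s in \<open>simp_all add: measurable_ident\<close>)
 have "(\<lambda>w. real_of_ereal (S_inf w) - h w) \<in> borel_measurable F_inf" by measurable
 then show "(\<lambda>w. post_g_path w s) \<in> borel_measurable F_inf"
  using s unfolding post_g_path_def h_def by simp
qed

lemma drifted_path_in_Omega: "w \<in> Omega ==> drifted_path l w \<in> Omega"
 unfolding drifted_path_def by (intro restrict_in_Omega continuous_on_add continuous_on_mult continuous_on_const continuous_on_id OmegaD(1))

lemma drifted_path_measurable [measurable]: "drifted_path l \<in> F_inf \<rightarrow>\<^sub>M F_inf"
 by (rule measurable_into_F_inf) (auto simp: drifted_path_in_Omega, auto simp: drifted_path_def)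

section \<open>Hitting times\<close>

lemma hitting_time_attained:
 assumes "w \<in> Omega" "0 \<le> t" "w t = x"
 obtains s where "0 \<le> s" "s \<le> t" "w s = x" "hitting_time x w = ennreal s"
proof -
 have "closed ({0..t} \<inter> w -` {x})"
  using continuous_on_Omega[OF assms(1), of 0 t] by (intro continuous_closed_preimage) auto
 then have "compact ({0..t} \<inter> w -` {x})"
  by (auto simp: compact_eq_bounded_closed intro: bounded_subset[OF bounded_closed_interval])
 moreover have "{0..t} \<inter> w -` {x} \<noteq> {}" using assms by auto
 ultimately obtain s where s: "s \<in> {0..t} \<inter> w -` {x}" "\<forall>u\<in>{0..t} \<inter> w -` {x}. s \<le> u"
  using compact_attains_inf by blast
 have "hitting_time x w = ennreal s" unfolding hitting_time_def
 proof (rule antisym)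
  show "(INF t\<in>{t. 0 \<le> t \<and> w t = x}. ennreal t) \<le> ennreal s" using s by (intro INF_lower) auto
  show "ennreal s \<le> (INF t\<in>{t. 0 \<le> t \<and> w t = x}. ennreal t)"
  proof (rule INF_greatest)
   fix u assume "u \<in> {t. 0 \<le> t \<and> w t = x}"
   then have "s \<le> u" using s by (cases "u \<le> t") auto
   then show "ennreal s \<le> ennreal u" by (rule ennreal_leI)
  qed
 qed
 with s that show ?thesis by auto
qed

lemma hitting_time_greater_iff:
 assumes "w \<in> Omega" "0 \<le> r"
 shows "ennreal r < hitting_time x w \<longleftrightarrow> (\<forall>t\<in>{0..r}. w t \<noteq> x)"
proof (intro iffI ballI notI)
 fix t assume "ennreal r < hitting_time x w" "t \<in> {0..r}" "w t = x"
 moreover then obtain s where "s \<le> t" "hitting_time x w = ennreal s"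
  using hitting_time_attained[OF assms(1), of t] by (metis atLeastAtMost_iff)
 ultimately show False using assms(2) by (auto simp: ennreal_less_iff)
next
 assume *: "\<forall>t\<in>{0..r}. w t \<noteq> x"
 show "ennreal r < hitting_time x w"
 proof (cases "\<exists>t\<ge>0. w t = x")
  case True
  then obtain s where s: "0 \<le> s" "w s = x" "hitting_time x w = ennreal s"
   using hitting_time_attained[OF assms(1)] by metis
  then show ?thesis using * assms(2) by (auto simp: ennreal_less_iff not_le[symmetric])
 next
  case False
  then have "hitting_time x w = \<infinity>" unfolding hitting_time_def by (simp add: Inf_empty)
  then show ?thesis by simp
 qed
qed

text \<open>By the intermediate value theorem, a path that starts below \<open>x\<close> avoids
  \<open>x\<close> exactly if it stays below it.\<close>

lemma S_lt_iff_hitting_time: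
 assumes "w \<in> Omega" "0 \<le> r" "w 0 < x"
 shows "ennreal r < hitting_time x w \<longleftrightarrow> S r w < x"
proof -
 have "(\<forall>t\<in>{0..r}. w t \<noteq> x) \<longleftrightarrow> S r w < x"
 proof
  assume *: "\<forall>t\<in>{0..r}. w t \<noteq> x"
  show "S r w < x"
  proof (rule ccontr)
   assume "\<not> S r w < x"
   moreover obtain u where u: "0 \<le> u" "u \<le> r" "w u = S r w" using S_attained[OF assms(1,2)] .
   ultimately have "\<exists>t\<ge>0. t \<le> u \<and> w t = x"
    using assms continuous_on_Omega[OF assms(1), of 0 u] by (intro IVT') auto
   with * u show False by force
  qed
 next
  assume "S r w < x" then show "\<forall>t\<in>{0..r}. w t \<noteq> x"
   using S_upper[OF assms(1)] by (metis atLeastAtMost_iff not_le)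
 qed
 then show ?thesis using hitting_time_greater_iff[OF assms(1,2)] by simp
qed

text \<open>By the intermediate value theorem the level is met up to time \<open>r\<close> as soon
  as the path has been both at or above it and at or below it. This form needs no assumption on the
  starting point and gives measurability even when the level is random.\<close>

lemma hitting_time_less_iff:
 assumes w: "W \<in> Omega"
 shows "hitting_time x W < y \<longleftrightarrow> (\<exists>r::rat. 0 \<le> r \<and> ennreal (of_rat r) < y \<and>
   x \<le> S (of_rat r) W \<and> - x \<le> S (of_rat r) (\<lambda>t\<in>{0..}. - W t))" (is "_ \<longleftrightarrow> ?R")
proof
 have w': "(\<lambda>t\<in>{0..}. - W t) \<in> Omega" using w by (rule negated_in_Omega)
 assume "hitting_time x W < y"
 then obtain t where t: "0 \<le> t" "W t = x" "ennreal t < y" unfolding hitting_time_def by (auto simp: INF_less_iff)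
 then obtain r where r: "ennreal t < real_of_rat r" "real_of_rat r < y" using ennreal_rat_dense by blast
 have tr: "t < of_rat r" using r(1) by (metis ennreal_leI linorder_not_le)
 then have r0: "0 \<le> r" using t(1) by (metis le_less_trans of_rat_0 of_rat_less order_less_imp_le)
 have "x \<le> S (of_rat r) W" using S_upper[OF w, of t "of_rat r"] t tr by auto
 moreover have "- x \<le> S (of_rat r) (\<lambda>t\<in>{0..}. - W t)" using S_upper[OF w', of t "of_rat r"] t tr by auto
 ultimately show ?R using r0 r(2) by blast
next
 have w': "(\<lambda>t\<in>{0..}. - W t) \<in> Omega" using w by (rule negated_in_Omega)
 assume ?R
 then obtain r :: rat where r: "0 \<le> r" "ennreal (of_rat r) < y"
  and *: "x \<le> S (of_rat r) W" "- x \<le> S (of_rat r) (\<lambda>t\<in>{0..}. - W t)" by blast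
 have r0: "0 \<le> real_of_rat r" using r(1) by simp
 obtain u where u: "0 \<le> u" "u \<le> of_rat r" "W u = S (of_rat r) W" using S_attained[OF w r0] .
 obtain v where v: "0 \<le> v" "v \<le> of_rat r" "- W v = S (of_rat r) (\<lambda>t\<in>{0..}. - W t)"
  using S_attained[OF w' r0] by auto
 have "\<exists>t\<ge>0. t \<le> of_rat r \<and> W t = x"
 proof (cases "u \<le> v")
  case True
  then have "\<exists>t\<ge>u. t \<le> v \<and> W t = x"
   using u v * continuous_on_Omega[OF w, of u v] by (intro IVT2') auto
  then obtain t where "u \<le> t" "t \<le> v" "W t = x" by blast
  then show ?thesis using u v by (intro exI[of _ t]) auto
 next
  case False
  then have "\<exists>t\<ge>v. t \<le> u \<and> W t = x"
   using u v * continuous_on_Omega[OF w, of v u] by (intro IVT') auto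
  then obtain t where "v \<le> t" "t \<le> u" "W t = x" by blast
  then show ?thesis using u v by (intro exI[of _ t]) auto
 qed
 then obtain t where t: "0 \<le> t" "t \<le> of_rat r" "W t = x" by auto
 have "hitting_time x W \<le> ennreal t" unfolding hitting_time_def using t by (intro INF_lower) auto
 also have "\<dots> \<le> ennreal (of_rat r)" using t by (intro ennreal_leI)
 finally show "hitting_time x W < y" using r(2) by auto
qed

lemma hitting_time_measurable:
 assumes [measurable]: "X \<in> borel_measurable M" and Y: "Y \<in> M \<rightarrow>\<^sub>M F_inf"
 shows "(\<lambda>x. hitting_time (X x) (Y x)) \<in> borel_measurable M"
proof (rule borel_measurableI_less)
 fix y
 have Ys: "Y x \<in> Omega" if "x \<in> space M" for x using measurable_space[OF Y that] by simp
 have Yt: "(\<lambda>x. Y x u) \<in> borel_measurable M" if "0 \<le> u" for u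
  using measurable_compose[OF Y coord_F_inf[OF that]] .
 have "Measurable.pred M (\<lambda>w. \<exists>r::rat. 0 \<le> r \<and> ennreal (of_rat r) < y \<and>
   X w \<le> S (of_rat r) (Y w) \<and> - X w \<le> S (of_rat r) (\<lambda>t\<in>{0..}. - Y w t))"
 proof (intro pred_intros_countable)
  fix r :: rat
  show "Measurable.pred M (\<lambda>w. 0 \<le> r \<and> ennreal (of_rat r) < y \<and>
   X w \<le> S (of_rat r) (Y w) \<and> - X w \<le> S (of_rat r) (\<lambda>t\<in>{0..}. - Y w t))"
  proof (cases "0 \<le> r")
   case True
   then have [measurable]: "(\<lambda>w. S (of_rat r) (Y w)) \<in> borel_measurable M"
    "(\<lambda>w. S (of_rat r) (\<lambda>t\<in>{0..}. - Y w t)) \<in> borel_measurable M"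
    by (auto intro!: S_measurable_comp simp: Ys Yt negated_in_Omega)
   show ?thesis by measurable
  next
   case False
   then have "(\<lambda>w. 0 \<le> r \<and> ennreal (of_rat r) < y \<and>
    X w \<le> S (of_rat r) (Y w) \<and> - X w \<le> S (of_rat r) (\<lambda>t\<in>{0..}. - Y w t)) = (\<lambda>_. False)" by blast
   then show ?thesis by (simp only: measurable_const space_count_space UNIV_I)
  qed
 qed
 moreover have "x \<in> space M ==> hitting_time (X x) (Y x) < y \<longleftrightarrow> (\<exists>r::rat. 0 \<le> r \<and> ennreal (of_rat r) < y \<and>
   X x \<le> S (of_rat r) (Y x) \<and> - X x \<le> S (of_rat r) (\<lambda>t\<in>{0..}. - Y x t))" for x
  by (rule hitting_time_less_iff[OF Ys])
 ultimately have "Measurable.pred M (\<lambda>x. hitting_time (X x) (Y x) < y)"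
  by (rule measurable_cong[THEN iffD2, rotated])
 then show "{x \<in> space M. hitting_time (X x) (Y x) < y} \<in> sets M" unfolding pred_def .
qed

section \<open>Gaussian increments\<close>

definition gauss :: "real => real measure" where
 "gauss \<delta> = density lborel (\<lambda>x. ennreal (normal_density 0 (sqrt \<delta>) x))"

lemma sets_gauss [measurable_cong, simp]: "sets (gauss \<delta>) = sets borel"
 by (simp add: gauss_def)

lemma space_gauss [simp]: "space (gauss \<delta>) = UNIV"
 by (simp add: gauss_def)

lemma measurable_gauss [simp]: "measurable (gauss \<delta>) N = measurable borel N"
 by (rule measurable_cong_sets) simp_all

lemma prob_space_gauss: "0 < \<delta> ==> prob_space (gauss \<delta>)"
 unfolding gauss_def by (rule prob_space_normal_density) simp

lemma gauss_eq_distr: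
 assumes "0 < \<delta>"
 shows "gauss \<delta> = distr std_normal_distribution borel (\<lambda>z. sqrt \<delta> * z)"
proof -
 interpret prob_space std_normal_distribution by (rule prob_space_normal_density) simp
 have "distributed std_normal_distribution lborel (\<lambda>x. x) (\<lambda>x. ennreal (normal_density 0 1 x))"
  unfolding distributed_def by (auto simp: distr_id2)
 from normal_density_affine[OF this, of "sqrt \<delta>" 0] assms
 have "distributed std_normal_distribution lborel (\<lambda>x. sqrt \<delta> * x) (\<lambda>x. ennreal (normal_density 0 (sqrt \<delta>) x))"
  by simp
 then have "distr std_normal_distribution lborel (\<lambda>z. sqrt \<delta> * z) = gauss \<delta>"
  unfolding gauss_def by (rule distributed_distr_eq_density)
 moreover have "distr std_normal_distribution lborel (\<lambda>z. sqrt \<delta> * z) = distr std_normal_distribution borel (\<lambda>z. sqrt \<delta> * z)"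
  by (rule distr_cong) auto
 ultimately show ?thesis by simp
qed

text \<open>Completing the square: the exponential weight shifts the mean from 0 to
  \<open>l * \<delta>\<close>. This is the one-step form of the change of measure to drift
  \<open>l\<close>.\<close>

lemma gauss_tilt:
 assumes [measurable]: "h \<in> borel_measurable borel" and \<delta>: "0 < \<delta>"
 shows "(\<integral>\<^sup>+y. h y * ennreal (exp (l * y - l\<^sup>2 * \<delta> / 2)) \<partial>gauss \<delta>) = (\<integral>\<^sup>+y. h (l * \<delta> + y) \<partial>gauss \<delta>)"
proof -
 have *: "normal_density 0 (sqrt \<delta>) y * exp (l * y - l\<^sup>2 * \<delta> / 2) = normal_density 0 (sqrt \<delta>) (y - l * \<delta>)" for y
 proof -
  have "- (y\<^sup>2) / (2 * \<delta>) + (l * y - l\<^sup>2 * \<delta> / 2) = - ((y - l * \<delta>)\<^sup>2) / (2 * \<delta>)"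
   using \<delta> by (simp add: field_simps power2_eq_square)
  then show ?thesis using \<delta> by (simp add: normal_density_def exp_add[symmetric])
 qed
 have "(\<integral>\<^sup>+y. h y * ennreal (exp (l * y - l\<^sup>2 * \<delta> / 2)) \<partial>gauss \<delta>)
   = (\<integral>\<^sup>+y. ennreal (normal_density 0 (sqrt \<delta>) y) * (h y * ennreal (exp (l * y - l\<^sup>2 * \<delta> / 2))) \<partial>lborel)"
  unfolding gauss_def by (subst nn_integral_density) auto
 also have "\<dots> = (\<integral>\<^sup>+y. ennreal (normal_density 0 (sqrt \<delta>) (y - l * \<delta>)) * h y \<partial>lborel)"
  unfolding *[symmetric] by (intro nn_integral_cong) (simp add: ennreal_mult' mult.left_commute mult.commute)
 also have "\<dots> = (\<integral>\<^sup>+y. ennreal (normal_density 0 (sqrt \<delta>) y) * h (l * \<delta> + y) \<partial>lborel)"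
  by (subst nn_integral_real_affine[where c=1 and t="l * \<delta>"]) auto
 also have "\<dots> = (\<integral>\<^sup>+y. h (l * \<delta> + y) \<partial>gauss \<delta>)"
  unfolding gauss_def by (subst nn_integral_density) auto
 finally show ?thesis .
qed

lemma gauss_exp:
 assumes "0 < \<delta>"
 shows "integrable (gauss \<delta>) (\<lambda>y. exp (l * y))" "(LINT y|gauss \<delta>. exp (l * y)) = exp (l\<^sup>2 * \<delta> / 2)"
proof -
 interpret prob_space "gauss \<delta>" by (rule prob_space_gauss) fact
 have "(\<integral>\<^sup>+y. ennreal (exp (l * y)) \<partial>gauss \<delta>)
   = (\<integral>\<^sup>+y. ennreal (exp (l\<^sup>2 * \<delta> / 2)) * ennreal (exp (l * y - l\<^sup>2 * \<delta> / 2)) \<partial>gauss \<delta>)"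
  by (intro nn_integral_cong) (simp add: ennreal_mult'[symmetric] exp_add[symmetric])
 also have "\<dots> = ennreal (exp (l\<^sup>2 * \<delta> / 2))"
  by (subst gauss_tilt) (use assms emeasure_space_1 in auto)
 finally have *: "(\<integral>\<^sup>+y. ennreal (exp (l * y)) \<partial>gauss \<delta>) = ennreal (exp (l\<^sup>2 * \<delta> / 2))" .
 then show "integrable (gauss \<delta>) (\<lambda>y. exp (l * y))" by (intro integrableI_nn_integral_finite) auto
 show "(LINT y|gauss \<delta>. exp (l * y)) = exp (l\<^sup>2 * \<delta> / 2)"
  by (subst integral_eq_nn_integral) (auto simp: *)
qed

text \<open>\<open>sinh (l * y)\<close> is an eigenfunction of the heat semigroup, being a
  difference of two exponentials with the same rate \<open>l\<^sup>2 / 2\<close>.\<close>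

lemma gauss_sinh_diff:
 assumes "0 < \<delta>"
 shows "(LINT y|gauss \<delta>. sinh (l * (a - y))) = exp (l\<^sup>2 / 2 * \<delta>) * sinh (l * a)"
proof -
 have "(LINT y|gauss \<delta>. sinh (l * (a - y)))
   = (LINT y|gauss \<delta>. exp (l * a) / 2 * exp ((- l) * y) - exp (- l * a) / 2 * exp (l * y))"
  by (intro Bochner_Integration.integral_cong refl)
   (simp add: sinh_field_def algebra_simps exp_add[symmetric] diff_divide_distrib)
 also have "\<dots> = exp (l * a) / 2 * exp (l\<^sup>2 * \<delta> / 2) - exp (- l * a) / 2 * exp (l\<^sup>2 * \<delta> / 2)"
  using gauss_exp[OF assms, of l] gauss_exp[OF assms, of "- l"]
  by (subst Bochner_Integration.integral_diff) auto
 finally show ?thesis by (simp add: sinh_field_def algebra_simps diff_divide_distrib)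
qed

text \<open>The sine analogue, read off from the real and imaginary parts of the Gaussian
  characteristic function; the rate is now negative.\<close>

lemma gauss_sin_diff:
 assumes "0 < \<delta>"
 shows "(LINT y|gauss \<delta>. sin (\<theta> * (a - y))) = exp (- (\<theta>\<^sup>2 / 2) * \<delta>) * sin (\<theta> * a)"
proof -
 interpret N: prob_space std_normal_distribution by (rule prob_space_normal_density) simp
 let ?t = "\<theta> * sqrt \<delta>"
 have i: "integrable std_normal_distribution (\<lambda>z. iexp (?t * z))"
  by (rule N.integrable_const_bound[where B=1]) auto
 have c: "(CLINT z|std_normal_distribution. iexp (?t * z)) = complex_of_real (exp (- (?t\<^sup>2) / 2))"
  using fun_cong[OF char_std_normal_distribution, of ?t] by (simp add: char_def)
 have "(LINT z|std_normal_distribution. Re (iexp (?t * z))) = exp (- (?t\<^sup>2) / 2)"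
  by (subst integral_Re[OF i]) (simp only: c Re_complex_of_real)
 then have ci: "(LINT z|std_normal_distribution. cos (?t * z)) = exp (- (?t\<^sup>2) / 2)"
  by (simp add: Re_exp)
 have "(LINT z|std_normal_distribution. Im (iexp (?t * z))) = 0"
  by (subst integral_Im[OF i]) (simp only: c Im_complex_of_real)
 then have si: "(LINT z|std_normal_distribution. sin (?t * z)) = 0"
  by (simp add: Im_exp)
 have ic: "integrable std_normal_distribution (\<lambda>z. cos (?t * z))" "integrable std_normal_distribution (\<lambda>z. sin (?t * z))"
  by (rule N.integrable_const_bound[where B=1]; simp)+
 have "(LINT y|gauss \<delta>. sin (\<theta> * (a - y))) = (LINT z|std_normal_distribution. sin (\<theta> * (a - sqrt \<delta> * z)))"
  unfolding gauss_eq_distr[OF assms] by (subst integral_distr) auto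
 also have "\<dots> = (LINT z|std_normal_distribution. sin (\<theta> * a) * cos (?t * z) - cos (\<theta> * a) * sin (?t * z))"
  by (intro Bochner_Integration.integral_cong refl) (simp add: right_diff_distrib sin_diff mult.assoc)
 also have "\<dots> = sin (\<theta> * a) * exp (- (?t\<^sup>2) / 2)"
  using ic by (subst Bochner_Integration.integral_diff) (auto simp: ci si)
 finally show ?thesis using assms by (simp add: power_mult_distrib mult_ac)
qed

text \<open>In the expansion of the value in \<open>\<delta>\<close> the constant and the linear
  terms cancel, so it is of order \<open>\<delta>\<^sup>2\<close>. This fourth moment controls the
  overshoot over a killing level.\<close>

lemma gauss_sinh4:
 assumes "0 < \<delta>"
 shows "integrable (gauss \<delta>) (\<lambda>y. sinh (l * y) ^ 4)"
  "(LINT y|gauss \<delta>. sinh (l * y) ^ 4) = (exp (8 * l\<^sup>2 * \<delta>) - 4 * exp (2 * l\<^sup>2 * \<delta>) + 3) / 8"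
proof -
 interpret prob_space "gauss \<delta>" by (rule prob_space_gauss) fact
 have eq: "sinh (l * y) ^ 4 = (exp ((4 * l) * y) + exp ((-4 * l) * y)) / 16
   - (exp ((2 * l) * y) + exp ((-2 * l) * y)) / 4 + 3 / 8" for y :: real
 proof -
  define u v where "u = exp (l * y)" and "v = exp (- (l * y))"
  have uv: "u * v = 1" unfolding u_def v_def by (simp add: exp_minus)
  have e: "exp ((4 * l) * y) = u ^ 4" "exp ((-4 * l) * y) = v ^ 4" "exp ((2 * l) * y) = u ^ 2" "exp ((-2 * l) * y) = v ^ 2"
   by (simp_all add: u_def v_def exp_of_nat_mult[symmetric] mult_ac)
  have "(u - v) ^ 4 = u ^ 4 + v ^ 4 - 4 * (u * v) * (u\<^sup>2 + v\<^sup>2) + 6 * (u * v)\<^sup>2"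
   by (simp add: power4_eq_xxxx power2_eq_square algebra_simps)
  also have "\<dots> = u ^ 4 + v ^ 4 - 4 * (u\<^sup>2 + v\<^sup>2) + 6" using uv by simp
  finally show ?thesis unfolding e by (simp add: sinh_field_def u_def[symmetric] v_def[symmetric] power_divide field_simps)
 qed
 define e where "e c y = exp (c * y)" for c y :: real
 have i [simp]: "integrable (gauss \<delta>) (e c)" for c unfolding e_def by (rule gauss_exp[OF assms])
 have [simp]: "(LINT y|gauss \<delta>. e c y) = exp (c\<^sup>2 * \<delta> / 2)" for c unfolding e_def by (rule gauss_exp[OF assms])
 have eq': "(\<lambda>y. sinh (l * y) ^ 4) = (\<lambda>y. (e (4 * l) y + e (-4 * l) y) / 16 - (e (2 * l) y + e (-2 * l) y) / 4 + 3 / 8)"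
  unfolding eq e_def ..
 show "integrable (gauss \<delta>) (\<lambda>y. sinh (l * y) ^ 4)" unfolding eq' by simp
 have [simp]: "prob UNIV = 1" using prob_space by simp
 show "(LINT y|gauss \<delta>. sinh (l * y) ^ 4) = (exp (8 * l\<^sup>2 * \<delta>) - 4 * exp (2 * l\<^sup>2 * \<delta>) + 3) / 8"
  unfolding eq' by (simp add: power_mult_distrib field_simps)
qed

lemma gauss_moments:
 assumes "0 < \<delta>"
 shows "integrable (gauss \<delta>) (\<lambda>y. y ^ k)" "(LINT y|gauss \<delta>. y) = 0" "(LINT y|gauss \<delta>. y\<^sup>2) = \<delta>"
  "(LINT y|gauss \<delta>. y ^ 4) = 3 * \<delta>\<^sup>2"
proof -
 have eq: "(LINT y|gauss \<delta>. y ^ k) = (LINT z|std_normal_distribution. sqrt \<delta> ^ k * z ^ k)" for k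
  unfolding gauss_eq_distr[OF assms] by (subst integral_distr) (auto simp: power_mult_distrib)
 show "integrable (gauss \<delta>) (\<lambda>y. y ^ k)"
  unfolding gauss_eq_distr[OF assms]
  by (subst integrable_distr_eq) (auto simp: power_mult_distrib intro!: integrable_std_normal_distribution_moment)
 show "(LINT y|gauss \<delta>. y) = 0"
  using eq[of 1] integral_std_normal_distribution_moment_odd[of 1] by simp
 show "(LINT y|gauss \<delta>. y\<^sup>2) = \<delta>"
  using eq[of 2] std_normal_distribution_even_moments(1)[of 1] assms by simp
 have "sqrt \<delta> ^ 4 = \<delta>\<^sup>2" using assms by (simp add: power4_eq_xxxx power2_eq_square)
 then show "(LINT y|gauss \<delta>. y ^ 4) = 3 * \<delta>\<^sup>2"
  using eq[of 4] std_normal_distribution_even_moments(1)[of 2] by (simp add: fact_numeral)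
qed

text \<open>The inequality between geometric and arithmetic mean, with weights chosen so that both
  even moments contribute the same order \<open>\<delta> * sqrt \<delta>\<close>.\<close>

lemma gauss_abs3:
 assumes "0 < \<delta>"
 shows "integrable (gauss \<delta>) (\<lambda>y. \<bar>y\<bar> ^ 3)" "(LINT y|gauss \<delta>. \<bar>y\<bar> ^ 3) \<le> 2 * \<delta> * sqrt \<delta>"
proof -
 let ?b = "\<lambda>y. (sqrt \<delta> * y\<^sup>2 + y ^ 4 / sqrt \<delta>) / 2"
 have i: "integrable (gauss \<delta>) ?b" using gauss_moments(1)[OF assms] by auto
 have b: "\<bar>y\<bar> ^ 3 \<le> ?b y" for y
 proof -
  have "0 \<le> y\<^sup>2 * (sqrt \<delta> - \<bar>y\<bar>)\<^sup>2 / (2 * sqrt \<delta>)" using assms by simp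
  also have "\<dots> = ?b y - \<bar>y\<bar> ^ 3"
   using assms by (simp add: field_simps power2_eq_square power3_eq_cube power4_eq_xxxx abs_if)
  finally show ?thesis by simp
 qed
 have nb: "norm (\<bar>y\<bar> ^ 3) \<le> norm (?b y)" for y
 proof -
  have "norm (\<bar>y\<bar> ^ 3) = \<bar>y\<bar> ^ 3" by simp
  then show ?thesis using b[of y] abs_ge_self[of "?b y"] unfolding real_norm_def by linarith
 qed
 show *: "integrable (gauss \<delta>) (\<lambda>y. \<bar>y\<bar> ^ 3)"
  by (rule Bochner_Integration.integrable_bound[OF i _ AE_I2]) (simp, rule nb)
 have "(LINT y|gauss \<delta>. \<bar>y\<bar> ^ 3) \<le> (LINT y|gauss \<delta>. ?b y)" by (intro integral_mono * i b)
 also have "\<dots> = (sqrt \<delta> * \<delta> + 3 * \<delta>\<^sup>2 / sqrt \<delta>) / 2"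
  using gauss_moments[OF assms] by simp
 also have "3 * \<delta>\<^sup>2 / sqrt \<delta> = 3 * (\<delta> * sqrt \<delta>)"
  using assms by (simp add: power2_eq_square real_div_sqrt field_simps)
 finally show "(LINT y|gauss \<delta>. \<bar>y\<bar> ^ 3) \<le> 2 * \<delta> * sqrt \<delta>" by (simp add: mult_ac)
qed

section \<open>Independence of increments under Wiener measure\<close>

locale wiener =
 fixes P :: "(real => real) measure"
 assumes wiener: "wiener_measure P"
begin

lemma prob_space_P: "prob_space P" and sets_P [measurable_cong]: "sets P = sets F_inf" and AE_start: "AE w in P. w 0 = 0"
 using wiener by (auto simp: wiener_measure_def)

sublocale prob_space P by (rule prob_space_P)

lemma space_P [simp]: "space P = Omega"
 using sets_eq_imp_space_eq[OF sets_P] by simp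

lemma subalgebra_F: "subalgebra P (F s)"
 unfolding subalgebra_def using sets_F_F_inf by (auto simp: sets_P)

lemma F_measurable_P: "f \<in> F s \<rightarrow>\<^sub>M N ==> f \<in> P \<rightarrow>\<^sub>M N"
 by (rule measurable_from_subalg[OF subalgebra_F])

lemma coord_P [measurable]: "0 \<le> s ==> (\<lambda>w. w s) \<in> borel_measurable P"
 by (rule F_measurable_P[OF coord_F[OF _ order_refl]])

text \<open>Independence and the Gaussian law in one statement: the past, as a measure on
  \<open>F s\<close>, and the increment form a product measure. Fubini then turns expectations over
  an increment into Gaussian integrals with the past held fixed.\<close>

lemma increment_distr:
 assumes s: "0 \<le> s" "s < t"
 shows "distr P (F s \<Otimes>\<^sub>M borel) (\<lambda>w. (w, w t - w s)) = restr_to_subalg P (F s) \<Otimes>\<^sub>M gauss (t - s)"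
proof (rule pair_measure_eqI[symmetric])
 have [measurable]: "(\<lambda>w. w t - w s) \<in> borel_measurable P"
  using s by (intro borel_measurable_diff coord_P) auto
 have [measurable]: "(\<lambda>w. w) \<in> P \<rightarrow>\<^sub>M F s" by (rule F_measurable_P[OF measurable_ident_sets[OF refl]])
 interpret R: prob_space "restr_to_subalg P (F s)" by (rule prob_space_restr_to_subalg[OF subalgebra_F prob_space_P])
 interpret G: prob_space "gauss (t - s)" using s by (intro prob_space_gauss) auto
 show "sigma_finite_measure (restr_to_subalg P (F s))" "sigma_finite_measure (gauss (t - s))"
  by unfold_locales
 show "sets (restr_to_subalg P (F s) \<Otimes>\<^sub>M gauss (t - s)) = sets (distr P (F s \<Otimes>\<^sub>M borel) (\<lambda>w. (w, w t - w s)))"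
  by (auto intro!: sets_pair_measure_cong simp: sets_restr_to_subalg[OF subalgebra_F])
 fix A B assume "A \<in> sets (restr_to_subalg P (F s))" and "B \<in> sets (gauss (t - s))"
 then have A: "A \<in> sets (F s)" and B: "B \<in> sets borel" by (auto simp: sets_restr_to_subalg[OF subalgebra_F])
 have W: "distributed P lborel (\<lambda>w. w t - w s) (\<lambda>x. ennreal (normal_density 0 (sqrt (t - s)) x))"
  "indep_set (sets (F s)) (sets (vimage_algebra (space P) (\<lambda>w. w t - w s) borel))"
  using wiener s by (auto simp: wiener_measure_def)
 define C where "C = (\<lambda>w. w t - w s) -` B \<inter> space P"
 have C: "C \<in> sets (vimage_algebra (space P) (\<lambda>w. w t - w s) borel)" unfolding C_def by (rule in_vimage_algebra[OF B])
 have Cs: "C \<in> sets P" unfolding C_def using B by measurable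
 have As: "A \<in> sets P" using A sets_F_F_inf by (auto simp: sets_P)
 have "prob (A \<inter> C) = prob A * prob C"
  using W(2) A C unfolding indep_sets2_eq by blast
 then have "emeasure P (A \<inter> C) = emeasure P A * emeasure P C"
  using As Cs by (simp add: emeasure_eq_measure ennreal_mult')
 moreover have "emeasure P C = emeasure (gauss (t - s)) B"
  using distributed_distr_eq_density[OF W(1)] B unfolding gauss_def C_def
  by (subst emeasure_distr[symmetric, where N=lborel]) auto
 moreover have "(\<lambda>w. (w, w t - w s)) -` (A \<times> B) \<inter> space P = A \<inter> C"
  using sets.sets_into_space[OF As] by (auto simp: C_def)
 ultimately show "emeasure (restr_to_subalg P (F s)) A * emeasure (gauss (t - s)) B
   = emeasure (distr P (F s \<Otimes>\<^sub>M borel) (\<lambda>w. (w, w t - w s))) (A \<times> B)"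
  using A B by (subst emeasure_distr) (auto simp: emeasure_restr_to_subalg[OF subalgebra_F])
qed

lemma nn_integral_increment:
 assumes s: "0 \<le> s" "s < t" and \<Phi>: "case_prod \<Phi> \<in> borel_measurable (F s \<Otimes>\<^sub>M borel)"
 shows "(\<integral>\<^sup>+w. \<Phi> w (w t - w s) \<partial>P) = (\<integral>\<^sup>+w. (\<integral>\<^sup>+y. \<Phi> w y \<partial>gauss (t - s)) \<partial>P)"
proof -
 interpret G: prob_space "gauss (t - s)" using s by (intro prob_space_gauss) auto
 have [measurable]: "(\<lambda>w. w t - w s) \<in> borel_measurable P"
  using s by (intro borel_measurable_diff coord_P) auto
 have [measurable]: "(\<lambda>w. w) \<in> P \<rightarrow>\<^sub>M F s" by (rule F_measurable_P[OF measurable_ident_sets[OF refl]])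
 have \<Phi>' [measurable]: "case_prod \<Phi> \<in> borel_measurable (F s \<Otimes>\<^sub>M gauss (t - s))"
  using \<Phi> by (simp cong: measurable_cong_sets add: sets_pair_measure_cong[OF refl sets_gauss])
 have \<Phi>'': "case_prod \<Phi> \<in> borel_measurable (restr_to_subalg P (F s) \<Otimes>\<^sub>M gauss (t - s))"
  unfolding measurable_cong_sets[OF sets_pair_measure_cong[OF sets_restr_to_subalg[OF subalgebra_F] refl] refl] by (rule \<Phi>')
 have "(\<integral>\<^sup>+w. \<Phi> w (w t - w s) \<partial>P) = (\<integral>\<^sup>+z. case_prod \<Phi> z \<partial>distr P (F s \<Otimes>\<^sub>M borel) (\<lambda>w. (w, w t - w s)))"
  using \<Phi> by (subst nn_integral_distr) auto
 also have "\<dots> = (\<integral>\<^sup>+w. (\<integral>\<^sup>+y. \<Phi> w y \<partial>gauss (t - s)) \<partial>restr_to_subalg P (F s))"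
  unfolding increment_distr[OF s] by (subst G.nn_integral_fst[symmetric]) (use \<Phi>'' in auto)
 also have "\<dots> = (\<integral>\<^sup>+w. (\<integral>\<^sup>+y. \<Phi> w y \<partial>gauss (t - s)) \<partial>P)"
  by (rule nn_integral_subalgebra2[OF subalgebra_F]) measurable
 finally show ?thesis .
qed

lemma integral_increment:
 fixes \<Phi> :: "(real => real) => real => real"
 assumes s: "0 \<le> s" "s < t" and \<Phi>: "case_prod \<Phi> \<in> borel_measurable (F s \<Otimes>\<^sub>M borel)"
  and int: "integrable P (\<lambda>w. \<Phi> w (w t - w s))"
 shows "(LINT w|P. \<Phi> w (w t - w s)) = (\<integral>w. (LINT y|gauss (t - s). \<Phi> w y) \<partial>P)"
proof -
 interpret R: prob_space "restr_to_subalg P (F s)" by (rule prob_space_restr_to_subalg[OF subalgebra_F prob_space_P])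
 interpret G: prob_space "gauss (t - s)" using s by (intro prob_space_gauss) auto
 interpret pair_sigma_finite "restr_to_subalg P (F s)" "gauss (t - s)" ..
 have [measurable]: "(\<lambda>w. w t - w s) \<in> borel_measurable P"
  using s by (intro borel_measurable_diff coord_P) auto
 have [measurable]: "(\<lambda>w. w) \<in> P \<rightarrow>\<^sub>M F s" by (rule F_measurable_P[OF measurable_ident_sets[OF refl]])
 have \<Phi>' [measurable]: "case_prod \<Phi> \<in> borel_measurable (F s \<Otimes>\<^sub>M gauss (t - s))"
  using \<Phi> by (simp cong: measurable_cong_sets add: sets_pair_measure_cong[OF refl sets_gauss])
 have "integrable (distr P (F s \<Otimes>\<^sub>M borel) (\<lambda>w. (w, w t - w s))) (case_prod \<Phi>)"
  using \<Phi> int by (subst integrable_distr_eq) auto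
 then have i: "integrable (restr_to_subalg P (F s) \<Otimes>\<^sub>M gauss (t - s)) (case_prod \<Phi>)"
  by (simp add: increment_distr[OF s])
 have "(LINT w|P. \<Phi> w (w t - w s)) = (LINT z|distr P (F s \<Otimes>\<^sub>M borel) (\<lambda>w. (w, w t - w s)). case_prod \<Phi> z)"
  using \<Phi> by (subst integral_distr) auto
 also have "\<dots> = (\<integral>w. (LINT y|gauss (t - s). \<Phi> w y) \<partial>restr_to_subalg P (F s))"
  unfolding increment_distr[OF s] using integral_fst'[OF i] by simp
 also have "\<dots> = (\<integral>w. (LINT y|gauss (t - s). \<Phi> w y) \<partial>P)"
  by (rule integral_subalgebra2[OF subalgebra_F]) measurable
 finally show ?thesis .
qed

lemma distr_increment:
 assumes "0 \<le> s" "s < t" shows "distr P borel (\<lambda>w. w t - w s) = gauss (t - s)"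
proof -
 have "distributed P lborel (\<lambda>w. w t - w s) (\<lambda>x. ennreal (normal_density 0 (sqrt (t - s)) x))"
  using wiener assms by (auto simp: wiener_measure_def)
 from distributed_distr_eq_density[OF this]
 have "distr P lborel (\<lambda>w. w t - w s) = gauss (t - s)" unfolding gauss_def .
 moreover have "distr P lborel (\<lambda>w. w t - w s) = distr P borel (\<lambda>w. w t - w s)"
  by (rule distr_cong) auto
 ultimately show ?thesis by simp
qed

lemma integrable_increment_iff:
 fixes h :: "real => real"
 assumes "0 \<le> s" "s < t" and [measurable]: "h \<in> borel_measurable borel"
 shows "integrable P (\<lambda>w. h (w t - w s)) \<longleftrightarrow> integrable (gauss (t - s)) h"
  "(LINT w|P. h (w t - w s)) = (LINT y|gauss (t - s). h y)"
proof -
 have [measurable]: "(\<lambda>w. w t - w s) \<in> borel_measurable P"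
  using assms by (intro borel_measurable_diff coord_P) auto
 show "integrable P (\<lambda>w. h (w t - w s)) \<longleftrightarrow> integrable (gauss (t - s)) h"
  "(LINT w|P. h (w t - w s)) = (LINT y|gauss (t - s). h y)"
  unfolding distr_increment[OF assms(1,2), symmetric]
  by (simp_all add: integrable_distr_eq integral_distr)
qed

end

section \<open>Laws on path space\<close>

text \<open>Continuous functions decreasing to the indicator of a closed set. The empty set is
  excluded because \<open>infdist\<close> to it is 0.\<close>

lemma infdist_approx:
 fixes C :: "real set" assumes "closed C" "C \<noteq> {}"
 shows "(\<lambda>n. max 0 (1 - real n * infdist x C)) \<longlonglongrightarrow> indicator C x"
proof (cases "x \<in> C")
 case False
 then have d: "0 < infdist x C" using assms in_closed_iff_infdist_zero[of C x] infdist_nonneg[of x C] by force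
 then have "\<forall>\<^sub>F n in sequentially. 1 / infdist x C < real n"
  using filterlim_real_sequentially by (simp add: filterlim_at_top_dense)
 then have "\<forall>\<^sub>F n in sequentially. max 0 (1 - real n * infdist x C) = indicator C x"
  by eventually_elim (use d False in \<open>auto simp: field_simps max_def\<close>)
 then show ?thesis by (rule tendsto_eventually)
qed simp

lemma prod_indicator_eq:
 "finite U ==> (\<Prod>u\<in>U. indicator (C u) (f u) :: real) = indicator {f. \<forall>u\<in>U. f u \<in> C u} f"
 by (induction U rule: finite_induct) (auto simp: indicator_def)

text \<open>Products of continuous functions of finitely many coordinates approximate indicators of
  closed cylinders, and these form a generator stable under intersection. The times in
  \<open>T\<close> may be forced into every \<open>U\<close>, since an additional coordinate with
  the constraint \<open>UNIV\<close> changes nothing.\<close>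

lemma coord_distr_eqI:
 fixes Y :: "'a => real => real" and Y' :: "'b => real => real"
 assumes fin: "finite_measure M" "finite_measure M'"
  and Y: "Y \<in> M \<rightarrow>\<^sub>M coord_algebra I" and Y': "Y' \<in> M' \<rightarrow>\<^sub>M coord_algebra I"
  and T: "finite T" "T \<subseteq> I"
  and agree: "\<And>U a. finite U ==> U \<subseteq> I ==> T \<subseteq> U ==> (\<And>u. continuous_on UNIV (a u)) ==>
   (\<And>u x. 0 \<le> a u x \<and> a u x \<le> 1) ==>
   (\<integral>\<^sup>+W. ennreal (\<Prod>u\<in>U. a u (Y W u)) \<partial>M) = (\<integral>\<^sup>+W. ennreal (\<Prod>u\<in>U. a u (Y' W u)) \<partial>M')"
 shows "distr M (coord_algebra I) Y = distr M' (coord_algebra I) Y'"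
proof -
 define G where "G = {{W\<in>Omega. \<forall>u\<in>U. W u \<in> C u} |U C. finite U \<and> U \<subseteq> I \<and> T \<subseteq> U \<and> (\<forall>u. closed (C u :: real set))}"
 have GP: "G \<subseteq> Pow Omega" by (auto simp: G_def)
 have G_sets: "G \<subseteq> sets (coord_algebra I)"
 proof
  fix X assume "X \<in> G"
  then obtain U C where X: "X = {W\<in>Omega. \<forall>u\<in>U. W u \<in> C u}" "finite U" "U \<subseteq> I" "\<forall>u. closed (C u :: real set)"
   unfolding G_def by blast
  have "{W \<in> space (coord_algebra I). \<forall>u\<in>U. W u \<in> C u} \<in> sets (coord_algebra I)"
  proof (rule sets.sets_Collect_finite_All[OF _ X(2)])
   fix u assume "u \<in> U"
   then have "(\<lambda>W. W u) -` C u \<inter> space (coord_algebra I) \<in> sets (coord_algebra I)"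
    using X by (intro measurable_sets[OF measurable_coord]) auto
   then show "{W \<in> space (coord_algebra I). W u \<in> C u} \<in> sets (coord_algebra I)"
    by (simp add: vimage_def Int_def conj_commute)
  qed
  then show "X \<in> sets (coord_algebra I)" by (simp add: X(1))
 qed
 have id: "(\<lambda>W. W) \<in> sigma Omega G \<rightarrow>\<^sub>M coord_algebra I"
 proof (rule measurable_into_coord_algebra)
  fix s assume s: "s \<in> I"
  show "(\<lambda>W. W s) \<in> borel_measurable (sigma Omega G)"
   unfolding borel_measurable_iff_le
  proof
   fix a :: real
   have "{w \<in> space (sigma Omega G). w s \<le> a} = {W\<in>Omega. \<forall>u\<in>insert s T. W u \<in> (if u = s then {..a} else UNIV)}"
    using GP by (auto simp: space_measure_of)
   also have "\<dots> \<in> G" unfolding G_def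
    by (rule CollectI, intro exI[of _ "insert s T"] exI[of _ "\<lambda>u. if u = s then {..a} else UNIV"]) (use s T in auto)
   finally show "{w \<in> space (sigma Omega G). w s \<le> a} \<in> sets (sigma Omega G)"
    using GP by (simp add: sets_measure_of sigma_sets.Basic)
  qed
 qed (use GP in \<open>simp add: space_measure_of\<close>)
 have sets_eq: "sets (coord_algebra I) = sigma_sets Omega G"
 proof (rule antisym)
  show "sets (coord_algebra I) \<subseteq> sigma_sets Omega G"
  proof
   fix A assume A: "A \<in> sets (coord_algebra I)"
   from measurable_sets[OF id this] have "A \<inter> Omega \<in> sigma_sets Omega G"
    using GP by (simp add: space_measure_of sets_measure_of)
   moreover have "A \<inter> Omega = A" using sets.sets_into_space[OF A] by auto
   ultimately show "A \<in> sigma_sets Omega G" by simp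
  qed
  show "sigma_sets Omega G \<subseteq> sets (coord_algebra I)"
   using sets.sigma_sets_subset[OF G_sets] by simp
 qed
 have lim: "(\<lambda>n. \<integral>\<^sup>+W. ennreal (\<Prod>u\<in>U. max 0 (1 - real n * infdist (Y W u) (C u))) \<partial>M)
   \<longlonglongrightarrow> emeasure (distr M (coord_algebra I) Y) {W\<in>Omega. \<forall>u\<in>U. W u \<in> C u}"
  if U: "finite U" "U \<subseteq> I" "T \<subseteq> U" and C: "\<forall>u. closed (C u :: real set)" "\<forall>u. C u \<noteq> {}"
   and M: "finite_measure M" and Y: "Y \<in> M \<rightarrow>\<^sub>M coord_algebra I"
  for U C and M :: "'c measure" and Y
 proof -
  have XG: "{W\<in>Omega. \<forall>u\<in>U. W u \<in> C u} \<in> sets (coord_algebra I)"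
   using G_sets U C(1) unfolding G_def by blast
  have m: "(\<lambda>W. Y W u) \<in> borel_measurable M" if "u \<in> U" for u
   using measurable_compose[OF Y measurable_coord] that U by blast
  have "(\<lambda>n. \<integral>\<^sup>+W. ennreal (\<Prod>u\<in>U. max 0 (1 - real n * infdist (Y W u) (C u))) \<partial>M)
   \<longlonglongrightarrow> (\<integral>\<^sup>+W. ennreal (\<Prod>u\<in>U. indicator (C u) (Y W u)) \<partial>M)"
  proof (rule nn_integral_dominated_convergence[where w="\<lambda>_. 1"])
   fix n
   have "(\<lambda>W. \<Prod>u\<in>U. max 0 (1 - real n * infdist (Y W u) (C u))) \<in> borel_measurable M"
   proof (rule borel_measurable_prod)
    fix u assume "u \<in> U"
    have "(\<lambda>x. infdist x (C u)) \<in> borel_measurable borel"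
     by (intro borel_measurable_continuous_onI continuous_on_infdist continuous_on_id)
    from measurable_compose[OF m[OF \<open>u \<in> U\<close>] this]
    show "(\<lambda>W. max 0 (1 - real n * infdist (Y W u) (C u))) \<in> borel_measurable M" by simp
   qed
   then show "(\<lambda>W. ennreal (\<Prod>u\<in>U. max 0 (1 - real n * infdist (Y W u) (C u)))) \<in> borel_measurable M" by simp
   have "(\<Prod>u\<in>U. max 0 (1 - real n * infdist (Y W u) (C u))) \<le> 1" for W
    by (intro prod_le_1) (auto simp: infdist_nonneg)
   then show "AE W in M. ennreal (\<Prod>u\<in>U. max 0 (1 - real n * infdist (Y W u) (C u))) \<le> 1"
    by (simp add: ennreal_le_1)
  next
   have "(\<lambda>W. \<Prod>u\<in>U. indicator (C u) (Y W u) :: real) \<in> borel_measurable M"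
   proof (rule borel_measurable_prod)
    fix u assume "u \<in> U"
    have "indicator (C u) \<in> borel_measurable borel" using C by simp
    from measurable_compose[OF m[OF \<open>u \<in> U\<close>] this]
    show "(\<lambda>W. indicator (C u) (Y W u) :: real) \<in> borel_measurable M" .
   qed
   then show "(\<lambda>W. ennreal (\<Prod>u\<in>U. indicator (C u) (Y W u))) \<in> borel_measurable M" by simp
   show "(\<integral>\<^sup>+W. 1 \<partial>M) < \<infinity>" using finite_measure.emeasure_finite[OF M] by (simp add: less_top)
   show "AE W in M. (\<lambda>n. ennreal (\<Prod>u\<in>U. max 0 (1 - real n * infdist (Y W u) (C u))))
     \<longlonglongrightarrow> ennreal (\<Prod>u\<in>U. indicator (C u) (Y W u))"
    using C by (intro AE_I2 tendsto_ennrealI tendsto_prod infdist_approx) auto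
  qed simp
  also have "(\<integral>\<^sup>+W. ennreal (\<Prod>u\<in>U. indicator (C u) (Y W u)) \<partial>M)
    = (\<integral>\<^sup>+W. indicator (Y -` {W\<in>Omega. \<forall>u\<in>U. W u \<in> C u} \<inter> space M) W \<partial>M)"
   unfolding prod_indicator_eq[OF U(1)]
   using measurable_space[OF Y] by (intro nn_integral_cong) (auto simp: indicator_def)
  also have "\<dots> = emeasure (distr M (coord_algebra I) Y) {W\<in>Omega. \<forall>u\<in>U. W u \<in> C u}"
   unfolding emeasure_distr[OF Y XG] by (rule nn_integral_indicator) (rule measurable_sets[OF Y XG])
  finally show ?thesis .
 qed
 show ?thesis
 proof (rule measure_eqI_generator_eq[where E=G and \<Omega>=Omega and A="\<lambda>_. Omega"])
  show "Int_stable G"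
  proof (rule Int_stableI)
   fix A B assume "A \<in> G" "B \<in> G"
   then obtain U C V D where *: "A = {W\<in>Omega. \<forall>u\<in>U. W u \<in> C u}" "finite U" "U \<subseteq> I" "T \<subseteq> U" "\<forall>u. closed (C u :: real set)"
    "B = {W\<in>Omega. \<forall>u\<in>V. W u \<in> D u}" "finite V" "V \<subseteq> I" "\<forall>u. closed (D u :: real set)"
    unfolding G_def by blast
   show "A \<inter> B \<in> G" unfolding G_def
    by (rule CollectI, intro exI[of _ "U \<union> V"] exI[of _ "\<lambda>u. (if u \<in> U then C u else UNIV) \<inter> (if u \<in> V then D u else UNIV)"])
     (use * in auto)
  qed
  show "range (\<lambda>_. Omega) \<subseteq> G"
  proof -
   have "Omega = {W\<in>Omega. \<forall>u\<in>T. W u \<in> UNIV}" by auto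
   then have "Omega \<in> G" unfolding G_def using T by (intro CollectI exI[of _ T] exI[of _ "\<lambda>_. UNIV"]) auto
   then show ?thesis by auto
  qed
  show "emeasure (distr M (coord_algebra I) Y) Omega \<noteq> \<infinity>" for i :: nat
   using finite_measure.emeasure_finite[OF finite_measure.finite_measure_distr[OF fin(1) Y]] by simp
 next
  fix X assume "X \<in> G"
  then obtain U C where X: "X = {W\<in>Omega. \<forall>u\<in>U. W u \<in> C u}" and U: "finite U" "U \<subseteq> I" "T \<subseteq> U"
   and C: "\<forall>u. closed (C u :: real set)"
   unfolding G_def by blast
  show "emeasure (distr M (coord_algebra I) Y) X = emeasure (distr M' (coord_algebra I) Y') X"
  proof (cases "\<exists>u\<in>U. C u = {}")
   case True
   then have "X = {}" by (auto simp: X)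
   then show ?thesis by simp
  next
   case False
   \<comment> \<open>Indices outside \<open>U\<close> do not matter, but they must carry a nonempty
     closed set for the approximation to apply.\<close>
   define D where "D u = (if u \<in> U then C u else UNIV)" for u
   have D: "\<forall>u. closed (D u)" "\<forall>u. D u \<noteq> {}" using False C by (auto simp: D_def)
   have XD: "X = {W\<in>Omega. \<forall>u\<in>U. W u \<in> D u}" by (auto simp: X D_def)
   have eq: "(\<integral>\<^sup>+W. ennreal (\<Prod>u\<in>U. max 0 (1 - real n * infdist (Y W u) (D u))) \<partial>M)
     = (\<integral>\<^sup>+W. ennreal (\<Prod>u\<in>U. max 0 (1 - real n * infdist (Y' W u) (D u))) \<partial>M')" for n
   proof (rule agree[OF U])
    show "continuous_on UNIV (\<lambda>x. max 0 (1 - real n * infdist x (D u)))" for u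
     by (intro continuous_on_max continuous_on_diff continuous_on_mult continuous_on_const continuous_on_infdist continuous_on_id)
   qed (auto simp: infdist_nonneg)
   show ?thesis
    using LIMSEQ_unique[OF lim[OF U D fin(1) Y, unfolded eq] lim[OF U D fin(2) Y']] by (simp add: XD)
  qed
 qed (use GP sets_eq in simp_all)
qed

text \<open>The parameter \<open>r\<close> is a time that has to be contained in every index set with later times:
 the kernel \<open>K s t\<close> is only required for \<open>s < t\<close> on the same side of \<open>r\<close>.\<close>

lemma markov_fdd_eq:
 fixes X :: "'a => real => real" and X' :: "'b => real => real"
  and K :: "real => real => (real => ennreal) => real => ennreal"
 assumes base: "\<And>b. b \<in> borel_measurable borel ==> (\<integral>\<^sup>+w. b (X w t0) \<partial>M) = (\<integral>\<^sup>+w. b (X' w t0) \<partial>M')"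
  and t0: "\<And>u. u \<in> I ==> t0 \<le> u"
  and K: "\<And>s t b. s \<in> I ==> t \<in> I ==> s < t ==> b \<in> borel_measurable borel ==> K s t b \<in> borel_measurable borel"
  and step: "\<And>U s t a b. finite U ==> U \<subseteq> I ==> (\<And>u. u \<in> U ==> u \<le> s) ==> s \<in> U ==> t \<in> I ==> s < t ==> r \<in> U \<or> t \<le> r ==>
   (\<And>u. a u \<in> borel_measurable borel) ==> b \<in> borel_measurable borel ==>
   (\<integral>\<^sup>+w. (\<Prod>u\<in>U. a u (X w u)) * b (X w t) \<partial>M) = (\<integral>\<^sup>+w. (\<Prod>u\<in>U. a u (X w u)) * K s t b (X w s) \<partial>M)"
  and step': "\<And>U s t a b. finite U ==> U \<subseteq> I ==> (\<And>u. u \<in> U ==> u \<le> s) ==> s \<in> U ==> t \<in> I ==> s < t ==> r \<in> U \<or> t \<le> r ==>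
   (\<And>u. a u \<in> borel_measurable borel) ==> b \<in> borel_measurable borel ==>
   (\<integral>\<^sup>+w. (\<Prod>u\<in>U. a u (X' w u)) * b (X' w t) \<partial>M') = (\<integral>\<^sup>+w. (\<Prod>u\<in>U. a u (X' w u)) * K s t b (X' w s) \<partial>M')"
  and U: "finite U" "U \<subseteq> I" "t0 \<in> U" "r \<in> U \<or> (\<forall>u\<in>U. u \<le> r)"
  and a: "\<And>u. a u \<in> borel_measurable borel"
 shows "(\<integral>\<^sup>+w. (\<Prod>u\<in>U. a u (X w u)) \<partial>M) = (\<integral>\<^sup>+w. (\<Prod>u\<in>U. a u (X' w u)) \<partial>M')"
 using U a
proof (induction U arbitrary: a rule: finite_linorder_max_induct)
 case empty
 then show ?case by simp
next
 case (insert t U)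
 show ?case
 proof (cases "U = {}")
  case True
  then show ?thesis using insert.prems base by auto
 next
  case False
  define s where "s = Max U"
  have s: "s \<in> U" "\<And>u. u \<in> U ==> u \<le> s" using insert.hyps(1) False by (auto simp: s_def)
  have st: "s < t" using insert.hyps(2) s by auto
  have sI: "s \<in> I" and tI: "t \<in> I" using insert.prems s by auto
  have t0U: "t0 \<in> U"
  proof -
   have "t0 \<le> s" using t0 sI by auto
   then have "t0 \<noteq> t" using st by auto
   then show ?thesis using insert.prems by auto
  qed
  have U: "finite U" "U \<subseteq> I" using insert by auto
  have r1: "r \<in> U \<or> t \<le> r" using insert.prems(3) by auto
  have r2: "r \<in> U \<or> (\<forall>u\<in>U. u \<le> r)" using insert.prems(3) insert.hyps(2) by force
  \<comment> \<open>The last step has been integrated out; its kernel is absorbed into the factor at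
    \<open>s\<close>, which leaves a product of the same kind over fewer times.\<close>
  define a' where "a' = a(s := \<lambda>x. a s x * K s t (a t) x)"
  have a': "a' u \<in> borel_measurable borel" for u
   unfolding a'_def using insert.prems(4) K[OF sI tI st insert.prems(4)] by (auto intro: borel_measurable_times_ennreal)
  have absorb: "(\<Prod>u\<in>U. a u (x u)) * K s t (a t) (x s) = (\<Prod>u\<in>U. a' u (x u))" for x
  proof -
   have "(\<Prod>u\<in>U. a' u (x u)) = a' s (x s) * (\<Prod>u\<in>U - {s}. a' u (x u))"
    using U(1) s(1) by (rule prod.remove)
   also have "(\<Prod>u\<in>U - {s}. a' u (x u)) = (\<Prod>u\<in>U - {s}. a u (x u))"
    by (intro prod.cong) (auto simp: a'_def)
   finally show ?thesis using prod.remove[OF U(1) s(1), of "\<lambda>u. a u (x u)"] by (simp add: a'_def mult_ac)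
  qed
  have tU: "t \<notin> U" using insert.hyps(2) by auto
  have ins: "(\<Prod>u\<in>insert t U. a u (x u)) = (\<Prod>u\<in>U. a u (x u)) * a t (x t)" for x
   using U(1) tU by (simp add: mult.commute)
  show ?thesis
   unfolding ins
   by (subst step[OF U s(2) s(1) tI st r1 insert.prems(4,4)], assumption,
     subst step'[OF U s(2) s(1) tI st r1 insert.prems(4,4)], assumption)
    (unfold absorb, rule insert.IH[OF U(2) t0U r2 a'])
 qed
qed

lemma prod_coord_measurable:
 fixes a :: "real => real => ennreal"
 assumes "\<And>u. u \<in> U ==> 0 \<le> u \<and> u \<le> s" "\<And>u. a u \<in> borel_measurable borel"
 shows "(\<lambda>w. \<Prod>u\<in>U. a u (w u)) \<in> borel_measurable (F s)"
 using assms by (intro borel_measurable_prod_ennreal measurable_compose[OF coord_F assms(2)]) auto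

section \<open>Change of drift and resampling of the future\<close>

definition exp_mart :: "real => real => (real => real) => real" where
 "exp_mart l t w = exp (l * w t - l\<^sup>2 * t / 2)"

lemma exp_mart_measurable: "0 \<le> t ==> exp_mart l t \<in> borel_measurable (F t)"
 unfolding exp_mart_def by measurable

lemma drifted_path_F: "drifted_path l \<in> F r \<rightarrow>\<^sub>M F r"
 unfolding F_def
proof (rule measurable_into_coord_algebra)
 fix s assume s: "s \<in> {0..r}"
 then have [measurable]: "(\<lambda>w. w s) \<in> borel_measurable (coord_algebra {0..r})" by (rule measurable_coord)
 show "(\<lambda>x. drifted_path l x s) \<in> borel_measurable (coord_algebra {0..r})"
  using s unfolding drifted_path_def by simp
qed (simp add: drifted_path_in_Omega)

text \<open>Increments, not values, of the second path are attached after \<open>r\<close>: this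
  keeps the result continuous, and makes it a Wiener path when the components are independent Wiener
  paths.\<close>

definition splice :: "real => (real => real) \<times> (real => real) => real => real" where
 "splice r z = (\<lambda>t\<in>{0..}. if t \<le> r then fst z t else fst z r + (snd z t - snd z r))"

lemma splice_in_Omega:
 assumes "fst z \<in> Omega" "snd z \<in> Omega" "0 \<le> r"
 shows "splice r z \<in> Omega"
proof -
 have "continuous_on ({0..r} \<union> {r..}) (\<lambda>t. if t \<le> r then fst z t else fst z r + (snd z t - snd z r))"
  by (rule continuous_on_If)
   (use assms in \<open>auto intro!: continuous_on_add continuous_on_diff continuous_on_const
    intro: continuous_on_subset[OF OmegaD(1)]\<close>)
 moreover have "{0..r} \<union> {r..} = {0..}" using assms by auto
 ultimately show ?thesis unfolding splice_def by (intro restrict_in_Omega) simp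
qed

context wiener
begin

text \<open>Under the weight \<open>exp_mart l t\<close> the step from \<open>s\<close> to
  \<open>t\<close> is Gaussian with mean \<open>l * (t - s)\<close>. Nonnegative functions are used,
  so that integrability never has to be checked.\<close>

lemma exp_mart_tilt:
 assumes s: "0 \<le> s" "s < t" and [measurable]: "H \<in> borel_measurable (F s)" "b \<in> borel_measurable borel"
 shows "(\<integral>\<^sup>+w. H w * b (w t) * ennreal (exp_mart l t w) \<partial>P)
  = (\<integral>\<^sup>+w. H w * (\<integral>\<^sup>+y. b (w s + l * (t - s) + y) \<partial>gauss (t - s)) * ennreal (exp_mart l s w) \<partial>P)"
proof -
 define c where "c = (\<lambda>w::real => real. w s)"
 have [measurable]: "c \<in> borel_measurable (F s)" unfolding c_def using s by measurable
 have [measurable]: "exp_mart l s \<in> borel_measurable (F s)" using s by (intro exp_mart_measurable) auto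
 define \<Phi> where "\<Phi> = (\<lambda>w y. H w * b (c w + y) * ennreal (exp_mart l s w) * ennreal (exp (l * y - l\<^sup>2 * (t - s) / 2)))"
 have "(\<integral>\<^sup>+w. H w * b (w t) * ennreal (exp_mart l t w) \<partial>P) = (\<integral>\<^sup>+w. \<Phi> w (w t - w s) \<partial>P)"
 proof (intro nn_integral_cong)
  fix w
  have "exp_mart l t w = exp_mart l s w * exp (l * (w t - w s) - l\<^sup>2 * (t - s) / 2)"
   unfolding exp_mart_def exp_add[symmetric] by (simp add: algebra_simps diff_divide_distrib)
  then show "H w * b (w t) * ennreal (exp_mart l t w) = \<Phi> w (w t - w s)"
   by (simp add: \<Phi>_def c_def ennreal_mult' exp_mart_def mult_ac)
 qed
 also have "\<dots> = (\<integral>\<^sup>+w. (\<integral>\<^sup>+y. \<Phi> w y \<partial>gauss (t - s)) \<partial>P)"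
  unfolding \<Phi>_def by (rule nn_integral_increment[OF s]) measurable
 also have "\<dots> = (\<integral>\<^sup>+w. H w * (\<integral>\<^sup>+y. b (w s + l * (t - s) + y) \<partial>gauss (t - s)) * ennreal (exp_mart l s w) \<partial>P)"
 proof (intro nn_integral_cong)
  fix w
  have "(\<integral>\<^sup>+y. \<Phi> w y \<partial>gauss (t - s))
    = (\<integral>\<^sup>+y. (H w * ennreal (exp_mart l s w)) * (b (c w + y) * ennreal (exp (l * y - l\<^sup>2 * (t - s) / 2))) \<partial>gauss (t - s))"
   by (intro nn_integral_cong) (simp add: \<Phi>_def mult_ac)
  also have "\<dots> = (H w * ennreal (exp_mart l s w)) * (\<integral>\<^sup>+y. b (c w + (l * (t - s) + y)) \<partial>gauss (t - s))"
   using s gauss_tilt[of "\<lambda>y. b (c w + y)" "t - s" l] by (subst nn_integral_cmult) auto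
  finally show "(\<integral>\<^sup>+y. \<Phi> w y \<partial>gauss (t - s)) = H w * (\<integral>\<^sup>+y. b (w s + l * (t - s) + y) \<partial>gauss (t - s)) * ennreal (exp_mart l s w)"
   by (simp add: c_def mult_ac add_ac)
 qed
 finally show ?thesis .
qed

lemma exp_mart_nn:
 assumes s: "0 \<le> s" "s \<le> t" and H: "H \<in> borel_measurable (F s)"
 shows "(\<integral>\<^sup>+w. H w * ennreal (exp_mart l t w) \<partial>P) = (\<integral>\<^sup>+w. H w * ennreal (exp_mart l s w) \<partial>P)"
proof (cases "s = t")
 case False
 then have st: "s < t" using s by auto
 have "emeasure (gauss (t - s)) UNIV = 1" using prob_space.emeasure_space_1[OF prob_space_gauss[of "t - s"]] st by simp
 then show ?thesis using exp_mart_tilt[OF s(1) st H, of "\<lambda>_. 1" l] by simp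
qed simp

lemma exp_mart_expectation: "0 \<le> t ==> (\<integral>\<^sup>+w. ennreal (exp_mart l t w) \<partial>P) = 1"
proof -
 assume "0 \<le> t"
 from exp_mart_nn[OF order_refl this, of "\<lambda>_. 1" l]
 have "(\<integral>\<^sup>+w. ennreal (exp_mart l t w) \<partial>P) = (\<integral>\<^sup>+w. ennreal (exp_mart l 0 w) \<partial>P)" by simp
 also have "\<dots> = (\<integral>\<^sup>+w. 1 \<partial>P)"
  using AE_start by (intro nn_integral_cong_AE) (auto simp: exp_mart_def)
 finally show ?thesis by (simp add: emeasure_space_1[simplified])
qed

text \<open>The drifted path under \<open>P\<close> and the identity under the density
  \<open>exp_mart l r\<close> both start at 0 and move from \<open>s\<close> to \<open>t\<close> by
  the same kernel, a Gaussian step shifted by \<open>l * (t - s)\<close>. Equal finite-dimensional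
  laws give equality on \<open>F r\<close>.\<close>

lemma cameron_martin:
 assumes r: "0 \<le> r" and \<Gamma>: "\<Gamma> \<in> sets (F r)"
 shows "emeasure P (drifted_path l -` \<Gamma> \<inter> Omega) = (\<integral>\<^sup>+w. indicator \<Gamma> w * ennreal (exp_mart l r w) \<partial>P)"
proof -
 define M' where "M' = density P (\<lambda>w. ennreal (exp_mart l r w))"
 have N [measurable]: "exp_mart l r \<in> borel_measurable P" by (rule F_measurable_P[OF exp_mart_measurable[OF r]])
 have M'int: "(\<integral>\<^sup>+w. f w \<partial>M') = (\<integral>\<^sup>+w. f w * ennreal (exp_mart l r w) \<partial>P)" if "f \<in> borel_measurable (F s)" for f s
  unfolding M'_def using F_measurable_P[OF that] by (subst nn_integral_density) (auto simp: mult.commute)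
 have finM': "finite_measure M'"
  by (rule finite_measureI) (use M'int[of "\<lambda>_. 1" r] exp_mart_expectation[OF r] in simp)
 have DP: "drifted_path l \<in> P \<rightarrow>\<^sub>M F r" by (rule F_measurable_P[OF drifted_path_F])
 have idM': "(\<lambda>w. w) \<in> M' \<rightarrow>\<^sub>M F r" unfolding M'_def using F_measurable_P[OF measurable_ident_sets[OF refl]] by simp
 define K :: "real => real => (real => ennreal) => real => ennreal" where "K = (\<lambda>s t b x. \<integral>\<^sup>+y. b (x + l * (t - s) + y) \<partial>gauss (t - s))"
 have Km: "K s t b \<in> borel_measurable borel" if "s < t" and [measurable]: "b \<in> borel_measurable borel" for s t b
 proof -
  interpret G: prob_space "gauss (t - s)" using that by (intro prob_space_gauss) auto
  show ?thesis unfolding K_def by measurable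
 qed
 have agree: "(\<integral>\<^sup>+w. (\<Prod>u\<in>U. a u (drifted_path l w u)) \<partial>P) = (\<integral>\<^sup>+w. (\<Prod>u\<in>U. a u (w u)) \<partial>M')"
  if U: "finite U" "U \<subseteq> {0..r}" "0 \<in> U" and a: "\<And>u. a u \<in> borel_measurable borel" for U a
 proof (rule markov_fdd_eq[where r=0 and ?t0.0=0 and I="{0..r}" and K=K])
  fix b :: "real => ennreal" assume b [measurable]: "b \<in> borel_measurable borel"
  have bm: "(\<lambda>w. b (w 0)) \<in> borel_measurable (F 0)" by (rule measurable_compose[OF coord_F b]) auto
  have "(\<integral>\<^sup>+w. b (w 0) \<partial>M') = (\<integral>\<^sup>+w. b (w 0) * ennreal (exp_mart l 0 w) \<partial>P)"
   unfolding M'int[OF bm] by (rule exp_mart_nn[OF order_refl r bm])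
  also have "\<dots> = (\<integral>\<^sup>+w. b (w 0) \<partial>P)"
   using AE_start by (intro nn_integral_cong_AE) (auto simp: exp_mart_def)
  finally show "(\<integral>\<^sup>+w. b (drifted_path l w 0) \<partial>P) = (\<integral>\<^sup>+w. b (w 0) \<partial>M')"
   by (simp add: drifted_path_def)
 next
  fix U s t and a :: "real => real => ennreal" and b :: "real => ennreal"
  assume U: "finite U" "U \<subseteq> {0..r}" and us: "\<And>u. u \<in> U ==> u \<le> s" and s: "s \<in> U" and t: "t \<in> {0..r}" "s < t"
   and a: "\<And>u. a u \<in> borel_measurable borel" and b [measurable]: "b \<in> borel_measurable borel"
  have s0: "0 \<le> s" "t \<le> r" "0 \<le> t" using U s t by auto
  have u0: "u \<in> U ==> 0 \<le> u" for u using U by auto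
  define H where "H = (\<lambda>w. \<Prod>u\<in>U. a u (w u))"
  have H [measurable]: "H \<in> borel_measurable (F s)" unfolding H_def using U us a by (intro prod_coord_measurable) auto
  have H' [measurable]: "(\<lambda>w. H (drifted_path l w)) \<in> borel_measurable (F s)"
   by (rule measurable_compose[OF drifted_path_F H])
  define c where "c = (\<lambda>w::real => real. w s)"
  have [measurable]: "c \<in> borel_measurable (F s)" unfolding c_def using s0 by measurable
  have HU: "(\<Prod>u\<in>U. a u (drifted_path l w u)) = H (drifted_path l w)" for w by (simp add: H_def)
  have "(\<integral>\<^sup>+w. H (drifted_path l w) * b (drifted_path l w t) \<partial>P)
   = (\<integral>\<^sup>+w. (\<lambda>w y. H (drifted_path l w) * b (c w + y + l * t)) w (w t - w s) \<partial>P)"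
   using s0 by (intro nn_integral_cong) (simp add: drifted_path_def c_def)
  also have "\<dots> = (\<integral>\<^sup>+w. (\<integral>\<^sup>+y. H (drifted_path l w) * b (c w + y + l * t) \<partial>gauss (t - s)) \<partial>P)"
   by (rule nn_integral_increment[OF s0(1) t(2)]) measurable
  also have "\<dots> = (\<integral>\<^sup>+w. H (drifted_path l w) * K s t b (drifted_path l w s) \<partial>P)"
   using s0 unfolding K_def
   by (intro nn_integral_cong, subst nn_integral_cmult) (auto simp: drifted_path_def c_def algebra_simps)
  finally show "(\<integral>\<^sup>+w. (\<Prod>u\<in>U. a u (drifted_path l w u)) * b (drifted_path l w t) \<partial>P)
   = (\<integral>\<^sup>+w. (\<Prod>u\<in>U. a u (drifted_path l w u)) * K s t b (drifted_path l w s) \<partial>P)"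
   unfolding HU .
  have m1: "(\<lambda>w. H w * b (w t)) \<in> borel_measurable (F t)"
   using s0 t by (intro borel_measurable_times_ennreal F_measurable_mono[OF H] measurable_compose[OF coord_F b]) auto
  have m2: "(\<lambda>w. H w * K s t b (w s)) \<in> borel_measurable (F s)"
   using s0 t by (intro borel_measurable_times_ennreal H measurable_compose[OF coord_F Km[OF t(2) b]]) auto
  have "(\<integral>\<^sup>+w. H w * b (w t) \<partial>M') = (\<integral>\<^sup>+w. H w * b (w t) * ennreal (exp_mart l t w) \<partial>P)"
   unfolding M'int[OF m1] by (rule exp_mart_nn[OF s0(3,2) m1])
  also have "\<dots> = (\<integral>\<^sup>+w. H w * K s t b (w s) * ennreal (exp_mart l s w) \<partial>P)"
   unfolding K_def by (rule exp_mart_tilt[OF s0(1) t(2) H b])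
  also have "\<dots> = (\<integral>\<^sup>+w. H w * K s t b (w s) \<partial>M')"
   unfolding M'int[OF m2] using s0 t by (intro exp_mart_nn[OF s0(1) _ m2, symmetric]) auto
  finally show "(\<integral>\<^sup>+w. (\<Prod>u\<in>U. a u (w u)) * b (w t) \<partial>M') = (\<integral>\<^sup>+w. (\<Prod>u\<in>U. a u (w u)) * K s t b (w s) \<partial>M')"
   unfolding H_def .
 qed (simp_all add: U a Km)
 have "distr P (F r) (drifted_path l) = distr M' (F r) (\<lambda>w. w)"
  unfolding F_def
 proof (rule coord_distr_eqI[where T="{0}"])
  fix U and a :: "real => real => real" assume U: "finite U" "U \<subseteq> {0..r}" "{0} \<subseteq> U" and a: "\<And>u. continuous_on UNIV (a u)" "\<And>u x. 0 \<le> a u x \<and> a u x \<le> 1"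
  have am: "(\<lambda>x. ennreal (a u x)) \<in> borel_measurable borel" for u
   using borel_measurable_continuous_onI[OF a(1)] by simp
  show "(\<integral>\<^sup>+w. ennreal (\<Prod>u\<in>U. a u (drifted_path l w u)) \<partial>P) = (\<integral>\<^sup>+w. ennreal (\<Prod>u\<in>U. a u (w u)) \<partial>M')"
   using agree[of U "\<lambda>u x. ennreal (a u x)", OF _ _ _ am] U a(2) by (simp add: prod_ennreal)
 qed (use r finM' DP idM' in \<open>auto simp: F_def[symmetric] finite_measure_axioms\<close>)
 then have "emeasure (distr P (F r) (drifted_path l)) \<Gamma> = emeasure (distr M' (F r) (\<lambda>w. w)) \<Gamma>" by simp
 also have "emeasure (distr M' (F r) (\<lambda>w. w)) \<Gamma> = emeasure M' \<Gamma>"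
  using sets.sets_into_space[OF \<Gamma>] by (subst emeasure_distr[OF idM' \<Gamma>]) (simp add: M'_def Int_absorb2)
 also have "\<dots> = (\<integral>\<^sup>+w. indicator \<Gamma> w * ennreal (exp_mart l r w) \<partial>P)"
  unfolding M'_def using sets_F_F_inf[OF \<Gamma>] by (subst emeasure_density) (auto simp: sets_P mult.commute)
 finally show ?thesis using emeasure_distr[OF DP \<Gamma>] by simp
qed

lemma splice_measurable: "0 \<le> r ==> splice r \<in> P \<Otimes>\<^sub>M P \<rightarrow>\<^sub>M F_inf"
proof (rule measurable_into_F_inf)
 fix z assume "z \<in> space (P \<Otimes>\<^sub>M P)" "0 \<le> r"
 then show "splice r z \<in> Omega" by (intro splice_in_Omega) (auto simp: space_pair_measure)
next
 fix s :: real assume "0 \<le> s" "0 \<le> r"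
 have [measurable]: "(\<lambda>z. fst z u) \<in> borel_measurable (P \<Otimes>\<^sub>M P)" "(\<lambda>z. snd z u) \<in> borel_measurable (P \<Otimes>\<^sub>M P)" if "0 \<le> u" for u :: real
  using that by (auto intro: measurable_compose[OF measurable_fst coord_P] measurable_compose[OF measurable_snd coord_P])
 show "(\<lambda>z. splice r z s) \<in> borel_measurable (P \<Otimes>\<^sub>M P)"
  using \<open>0 \<le> s\<close> \<open>0 \<le> r\<close> unfolding splice_def by (cases "s \<le> r") simp_all
qed

text \<open>A step of the spliced path before \<open>r\<close> comes from the first path, one after
  \<open>r\<close> from the second, and either way it is a centred Gaussian independent of the past.
  Having \<open>r\<close> among the times ensures that no step straddles it.\<close>

lemma splice_distr:
 assumes r: "0 \<le> r"
 shows "distr (P \<Otimes>\<^sub>M P) P (splice r) = P"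
proof -
 interpret PP: pair_prob_space P P ..
 define K :: "real => real => (real => ennreal) => real => ennreal" where "K = (\<lambda>s t b x. \<integral>\<^sup>+y. b (x + y) \<partial>gauss (t - s))"
 have Km: "K s t b \<in> borel_measurable borel" if "s < t" and [measurable]: "b \<in> borel_measurable borel" for s t b
 proof -
  interpret G: prob_space "gauss (t - s)" using that by (intro prob_space_gauss) auto
  show ?thesis unfolding K_def by measurable
 qed
 have increment: "(\<integral>\<^sup>+w. H w * b (f w + (w t - w s)) \<partial>P) = (\<integral>\<^sup>+w. H w * K s t b (f w) \<partial>P)"
  if s: "0 \<le> s" "s < t" and [measurable]: "H \<in> borel_measurable (F s)" "b \<in> borel_measurable borel" "f \<in> borel_measurable (F s)"
  for s t b H f
 proof -
  have "(\<integral>\<^sup>+w. H w * b (f w + (w t - w s)) \<partial>P) = (\<integral>\<^sup>+w. (\<integral>\<^sup>+y. H w * b (f w + y) \<partial>gauss (t - s)) \<partial>P)"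
   by (rule nn_integral_increment[OF s, of "\<lambda>w y. H w * b (f w + y)"]) measurable
  also have "\<dots> = (\<integral>\<^sup>+w. H w * K s t b (f w) \<partial>P)"
   unfolding K_def by (intro nn_integral_cong, subst nn_integral_cmult) auto
  finally show ?thesis .
 qed
 have [simp]: "emeasure P Omega = 1" using emeasure_space_1 by simp
 have sp: "splice r (w, w') u = (if u \<le> r then w u else w r + (w' u - w' r))" if "0 \<le> u" for w w' u
  using that by (simp add: splice_def)
 have sp': "splice r (w, w') u = w r + (w' u - w' r)" if "r \<le> u" for w w' u
  using that r by (cases "u = r") (simp_all add: splice_def)
 have spm: "(\<lambda>z. b (splice r z u)) \<in> borel_measurable (P \<Otimes>\<^sub>M P)" if "b \<in> borel_measurable borel" "0 \<le> u" for b :: "real => ennreal" and u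
  by (rule measurable_compose[OF measurable_compose[OF splice_measurable[OF r] coord_F_inf] that(1)]) fact
 have spp: "(\<lambda>z. (\<Prod>u\<in>U. a u (splice r z u)) * b (splice r z t)) \<in> borel_measurable (P \<Otimes>\<^sub>M P)"
  if "U \<subseteq> {0..}" "\<And>u. a u \<in> borel_measurable borel" "b \<in> borel_measurable borel" "0 \<le> t" for U t and a :: "real => real => ennreal" and b
  using that by (intro borel_measurable_times_ennreal borel_measurable_prod_ennreal spm) auto
 have agree: "(\<integral>\<^sup>+z. (\<Prod>u\<in>U. a u (splice r z u)) \<partial>(P \<Otimes>\<^sub>M P)) = (\<integral>\<^sup>+w. (\<Prod>u\<in>U. a u (w u)) \<partial>P)"
  if U: "finite U" "U \<subseteq> {0..}" "0 \<in> U" "r \<in> U" and a: "\<And>u. a u \<in> borel_measurable borel" for U a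
 proof (rule markov_fdd_eq[where r=r and ?t0.0=0 and I="{0..}" and K=K])
  fix b :: "real => ennreal" assume b [measurable]: "b \<in> borel_measurable borel"
  have "(\<integral>\<^sup>+z. b (splice r z 0) \<partial>(P \<Otimes>\<^sub>M P)) = (\<integral>\<^sup>+w. \<integral>\<^sup>+w'. b (splice r (w, w') 0) \<partial>P \<partial>P)"
   by (rule nn_integral_fst[symmetric]) (rule spm[OF b order_refl])
  then show "(\<integral>\<^sup>+z. b (splice r z 0) \<partial>(P \<Otimes>\<^sub>M P)) = (\<integral>\<^sup>+w. b (w 0) \<partial>P)"
   using r by (simp add: sp)
 next
  fix U s t and a :: "real => real => ennreal" and b :: "real => ennreal"
  assume U: "finite U" "U \<subseteq> {0..}" and us: "\<And>u. u \<in> U ==> u \<le> s" and s: "s \<in> U" and t: "t \<in> {0..}" "s < t"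
   and rU: "r \<in> U \<or> t \<le> r"
   and a: "\<And>u. a u \<in> borel_measurable borel" and b [measurable]: "b \<in> borel_measurable borel"
  have s0: "0 \<le> s" "0 \<le> t" using U s t by auto
  have u0: "u \<in> U ==> 0 \<le> u" for u using U by auto
  have H: "(\<lambda>w. \<Prod>u\<in>U. a u (w u)) \<in> borel_measurable (F s)" using U us a by (intro prod_coord_measurable) auto
  have cs: "(\<lambda>w. w s) \<in> borel_measurable (F s)" using s0 by measurable
  show "(\<integral>\<^sup>+w. (\<Prod>u\<in>U. a u (w u)) * b (w t) \<partial>P) = (\<integral>\<^sup>+w. (\<Prod>u\<in>U. a u (w u)) * K s t b (w s) \<partial>P)"
   using increment[OF s0(1) t(2) H b cs] by simp
  have *: "(\<integral>\<^sup>+z. (\<Prod>u\<in>U. a u (splice r z u)) * b (splice r z t) \<partial>(P \<Otimes>\<^sub>M P))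
   = (\<integral>\<^sup>+w. \<integral>\<^sup>+w'. (\<Prod>u\<in>U. a u (splice r (w, w') u)) * b (splice r (w, w') t) \<partial>P \<partial>P)"
   if "b \<in> borel_measurable borel" "0 \<le> t" for b t
   by (rule nn_integral_fst[symmetric]) (rule spp[OF U(2) a that])
  show "(\<integral>\<^sup>+z. (\<Prod>u\<in>U. a u (splice r z u)) * b (splice r z t) \<partial>(P \<Otimes>\<^sub>M P))
   = (\<integral>\<^sup>+z. (\<Prod>u\<in>U. a u (splice r z u)) * K s t b (splice r z s) \<partial>(P \<Otimes>\<^sub>M P))"
   unfolding *[OF b s0(2)] *[OF Km[OF t(2) b] s0(1)]
  proof (cases "t \<le> r")
   case True
   then have "(\<Prod>u\<in>U. a u (splice r (w, w') u)) = (\<Prod>u\<in>U. a u (w u))" for w w'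
    using us t(2) u0 by (intro prod.cong refl) (force simp: sp)
   moreover have "splice r (w, w') t = w t" "splice r (w, w') s = w s" for w w'
    using True t(2) s0 by (auto simp: sp)
   ultimately show "(\<integral>\<^sup>+w. \<integral>\<^sup>+w'. (\<Prod>u\<in>U. a u (splice r (w, w') u)) * b (splice r (w, w') t) \<partial>P \<partial>P)
    = (\<integral>\<^sup>+w. \<integral>\<^sup>+w'. (\<Prod>u\<in>U. a u (splice r (w, w') u)) * K s t b (splice r (w, w') s) \<partial>P \<partial>P)"
    using increment[OF s0(1) t(2) H b cs] by simp
  next
   case False
   then have rs: "r \<le> s" "r \<le> t" using rU us by auto
   show "(\<integral>\<^sup>+w. \<integral>\<^sup>+w'. (\<Prod>u\<in>U. a u (splice r (w, w') u)) * b (splice r (w, w') t) \<partial>P \<partial>P)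
    = (\<integral>\<^sup>+w. \<integral>\<^sup>+w'. (\<Prod>u\<in>U. a u (splice r (w, w') u)) * K s t b (splice r (w, w') s) \<partial>P \<partial>P)"
   \<comment> \<open>With the first path fixed, the spliced path up to \<open>s\<close> is a
     function of the second path up to \<open>s\<close>, so the increment formula is applied to the
     second path alone.\<close>
   proof (rule nn_integral_cong)
    fix w :: "real => real"
    have c: "(\<lambda>w'. splice r (w, w') u) \<in> borel_measurable (F s)" if "0 \<le> u" "u \<le> s" for u
     using that r rs unfolding sp[OF that(1)] by (cases "u \<le> r") simp_all
    have H: "(\<lambda>w'. \<Prod>u\<in>U. a u (splice r (w, w') u)) \<in> borel_measurable (F s)"
     by (rule borel_measurable_prod_ennreal, rule measurable_compose[OF c a]) (use us u0 in auto)
    have "splice r (w, w') t = splice r (w, w') s + (w' t - w' s)" for w'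
     using rs by (simp add: sp')
    then show "(\<integral>\<^sup>+w'. (\<Prod>u\<in>U. a u (splice r (w, w') u)) * b (splice r (w, w') t) \<partial>P)
     = (\<integral>\<^sup>+w'. (\<Prod>u\<in>U. a u (splice r (w, w') u)) * K s t b (splice r (w, w') s) \<partial>P)"
     using increment[OF s0(1) t(2) H b c[OF s0(1) order_refl]] by simp
   qed
  qed
 qed (simp_all add: U a Km)
 have "distr (P \<Otimes>\<^sub>M P) F_inf (splice r) = distr P F_inf (\<lambda>w. w)"
  unfolding F_inf_def
 proof (rule coord_distr_eqI[where T="{0, r}"])
  fix U and a :: "real => real => real" assume U: "finite U" "U \<subseteq> {0..}" "{0, r} \<subseteq> U" and a: "\<And>u. continuous_on UNIV (a u)" "\<And>u x. 0 \<le> a u x \<and> a u x \<le> 1"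
  have am: "(\<lambda>x. ennreal (a u x)) \<in> borel_measurable borel" for u
   using borel_measurable_continuous_onI[OF a(1)] by simp
  show "(\<integral>\<^sup>+z. ennreal (\<Prod>u\<in>U. a u (splice r z u)) \<partial>(P \<Otimes>\<^sub>M P)) = (\<integral>\<^sup>+w. ennreal (\<Prod>u\<in>U. a u (w u)) \<partial>P)"
   using agree[of U "\<lambda>u x. ennreal (a u x)", OF _ _ _ _ am] U a(2) by (simp add: prod_ennreal)
 next
  show "splice r \<in> P \<Otimes>\<^sub>M P \<rightarrow>\<^sub>M coord_algebra {0..}" using splice_measurable[OF r] unfolding F_inf_def .
  show "(\<lambda>w. w) \<in> P \<rightarrow>\<^sub>M coord_algebra {0..}" using measurable_ident_sets[OF sets_P] unfolding F_inf_def .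
  show "finite_measure (P \<Otimes>\<^sub>M P)" "finite_measure P" by unfold_locales
 qed (use r in auto)
 moreover have "distr P F_inf (\<lambda>w. w) = P" by (rule distr_id2) (rule sets_P[symmetric])
 moreover have "distr (P \<Otimes>\<^sub>M P) F_inf (splice r) = distr (P \<Otimes>\<^sub>M P) P (splice r)"
  by (rule distr_cong) (simp_all add: sets_P)
 ultimately show ?thesis by simp
qed

end

section \<open>Killing at a level\<close>

declare coord_F [measurable del] coord_F_inf [measurable del]

lemma borel_measurable_of_bool [measurable (raw)]:
 assumes [measurable]: "Measurable.pred M Q"
 shows "(\<lambda>x. of_bool (Q x) :: real) \<in> borel_measurable M"
 unfolding of_bool_def by measurable

lemma borel_measurable_sinh [measurable (raw)]:
 assumes "f \<in> borel_measurable M" shows "(\<lambda>x. sinh (f x) :: real) \<in> borel_measurable M"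
 by (rule measurable_compose[OF assms borel_measurable_continuous_onI]) (intro continuous_intros)

lemma gauss_singleton: "emeasure (gauss \<delta>) {x} = 0"
proof -
 have "AE y in lborel. y \<noteq> x" by (rule AE_lborel_singleton)
 then have "AE y in gauss \<delta>. y \<noteq> x" unfolding gauss_def by (subst AE_density) auto
 then show ?thesis by (subst (asm) AE_iff_measurable[of "{x}"]) auto
qed

lemma abs_sinh_real: "\<bar>sinh x\<bar> = sinh \<bar>x :: real\<bar>"
 by (cases "0 \<le> x") (auto simp: abs_if)

lemma abs_sinh_le_exp: "\<bar>sinh (x::real)\<bar> \<le> exp \<bar>x\<bar>"
proof -
 have "sinh \<bar>x\<bar> \<le> exp \<bar>x\<bar>" unfolding sinh_field_def using exp_ge_zero[of "- \<bar>x\<bar>"] exp_ge_zero[of "\<bar>x\<bar>"]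
  by (simp add: field_simps)
 then show ?thesis unfolding abs_sinh_real .
qed

lemma exp_abs_le: "exp \<bar>x\<bar> \<le> exp x + exp (- x :: real)"
 by (cases "0 \<le> x") (auto simp: abs_if add_nonneg_nonneg)

text \<open>Meant for the overshoot at killing: the term \<open>\<epsilon>\<close> is charged only
  to paths killed in the current step, hence sums to at most \<open>\<epsilon>\<close> over all
  steps, while the expected fourth powers have a small sum over a fine grid.\<close>

lemma le_eps_plus_power4: "0 < \<epsilon> ==> \<bar>x\<bar> \<le> \<epsilon> + x ^ 4 / \<epsilon> ^ 3" for x :: real
proof (cases "\<bar>x\<bar> \<le> \<epsilon>")
 case False
 assume e: "0 < \<epsilon>"
 have "\<epsilon> ^ 3 \<le> \<bar>x\<bar> ^ 3" using False e by (intro power_mono) auto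
 then have "\<bar>x\<bar> * \<epsilon> ^ 3 \<le> \<bar>x\<bar> * \<bar>x\<bar> ^ 3" by (intro mult_left_mono) auto
 also have "\<dots> = x ^ 4" by (simp add: power_Suc[symmetric] power_even_abs del: power_Suc)
 finally have "\<bar>x\<bar> \<le> x ^ 4 / \<epsilon> ^ 3" using e by (simp add: pos_le_divide_eq)
 then show ?thesis using e by simp
qed (auto intro: add_increasing2)

context wiener
begin

declare coord_P [measurable del]

lemma integrable_exp_increment:
 assumes "0 \<le> p" "p \<le> t" shows "integrable P (\<lambda>w. exp (a * (w t - w p)))"
proof (cases "p = t")
 case False
 then show ?thesis using assms integrable_increment_iff(1)[of p t "\<lambda>y. exp (a * y)"] gauss_exp(1)[of "t - p" a] by simp
qed simp

text \<open>By \<open>u_gauss\<close>, \<open>exp (- \<kappa> * t) * u (L W - W t)\<close> is a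
  martingale, and killing above the level \<open>L\<close> does not disturb it because
  \<open>u\<close> vanishes at 0. When killing is tested at \<open>n\<close> grid times only, the
  error comes from the value of \<open>u\<close> at the overshoot and tends to 0 as the grid is
  refined. Both \<open>sinh\<close> and \<open>sin\<close> will be taken for
  \<open>u\<close>.\<close>

lemma killed_martingale:
 assumes l: "0 < l" and pq: "0 \<le> p" "p < q"
  and K [measurable]: "K \<in> borel_measurable (F p)" and K01: "\<And>W. 0 \<le> K W \<and> K W \<le> 1"
  and L [measurable]: "L \<in> borel_measurable (F p)" and c: "\<And>W. K W \<noteq> 0 ==> \<bar>L W - W p\<bar> \<le> c"
  and u [measurable]: "u \<in> borel_measurable borel"
  and u_gauss: "\<And>a \<delta>. 0 < \<delta> ==> (LINT y|gauss \<delta>. u (a - y)) = exp (\<kappa> * \<delta>) * u a"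
  and u_bound: "\<And>x. \<bar>u x\<bar> \<le> C * \<bar>sinh (l * x)\<bar>"
 shows "(LINT W|P. K W * of_bool (\<forall>t\<in>{p..q}. W t \<le> L W) * u (L W - W q))
  = exp (\<kappa> * (q - p)) * (LINT W|P. K W * of_bool (W p \<le> L W) * u (L W - W p))"
proof -
 have C0: "0 \<le> C" using u_bound[of 1] l by (smt (verit, best) mult_neg_pos mult.right_neutral sinh_real_pos_iff)
 \<comment> \<open>One integrable majorant for all grids: where \<open>K W \<noteq> 0\<close> the
   level is within \<open>c\<close> of \<open>W p\<close>, so \<open>sinh\<close> of the distance to
   it is bounded by exponentials of the increment since \<open>p\<close>.\<close>
 define bd where "bd s W = C * exp (l * c) * (exp (l * (W s - W p)) + exp (- l * (W s - W p)))" for s and W :: "real => real"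
 have bd_int: "integrable P (bd s)" if "p \<le> s" for s
  unfolding bd_def using pq(1) that
  by (intro integrable_mult_right Bochner_Integration.integrable_add integrable_exp_increment) auto
 have bd: "\<bar>K W * of_bool b * u (L W - W s)\<bar> \<le> bd s W" for W s b
 proof (cases "K W = 0")
  case True
  then show ?thesis unfolding bd_def using C0 by (auto intro!: mult_nonneg_nonneg add_nonneg_nonneg)
 next
  case False
  have "\<bar>K W * of_bool b * u (L W - W s)\<bar> = \<bar>K W\<bar> * \<bar>of_bool b\<bar> * \<bar>u (L W - W s)\<bar>" by (simp add: abs_mult)
  also have "\<dots> \<le> 1 * \<bar>u (L W - W s)\<bar>" using K01[of W] by (intro mult_right_mono) auto
  also have "\<dots> \<le> C * \<bar>sinh (l * (L W - W s))\<bar>" using u_bound by simp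
  also have "\<dots> \<le> C * exp \<bar>l * (L W - W s)\<bar>" using C0 by (intro mult_left_mono abs_sinh_le_exp)
  also have "\<dots> \<le> C * (exp (l * c) * exp \<bar>l * (W s - W p)\<bar>)"
  proof -
   have "\<bar>L W - W s\<bar> \<le> c + \<bar>W s - W p\<bar>" using c[OF False] by linarith
   then have "l * \<bar>L W - W s\<bar> \<le> l * c + l * \<bar>W s - W p\<bar>" using l by (metis distrib_left mult_le_cancel_left_pos)
   then show ?thesis using C0 l by (intro mult_left_mono) (auto simp: exp_add[symmetric] abs_mult)
  qed
  also have "\<dots> \<le> bd s W" unfolding bd_def mult.assoc
   using C0 exp_abs_le[of "l * (W s - W p)"] by (intro mult_left_mono) auto
  finally show ?thesis .
 qed
 define E0 where "E0 = (LINT W|P. K W * of_bool (W p \<le> L W) * u (L W - W p))"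
 define En where "En n = (LINT W|P. K W * of_bool (\<forall>i\<le>n. W (p + (q - p) * (real i / real n)) \<le> L W) * u (L W - W q))" for n :: nat
 define C' where "C' = C * exp (\<bar>\<kappa>\<bar> * (q - p))"
 have C'0: "0 \<le> C'" using C0 by (simp add: C'_def)
 define s4 where "s4 \<delta> = (exp (8 * l\<^sup>2 * \<delta>) - 4 * exp (2 * l\<^sup>2 * \<delta>) + 3) / 8" for \<delta>
 have key: "\<bar>E0 - exp (- \<kappa> * (q - p)) * En n\<bar> \<le> C' * (\<epsilon> + real n * s4 ((q - p) / real n) / \<epsilon> ^ 3)"
  if n: "0 < n" and \<epsilon>: "0 < \<epsilon>" for n \<epsilon>
 proof -
  define \<delta> where "\<delta> = (q - p) / real n"
  define t where "t j = p + (q - p) * (real j / real n)" for j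
  have \<delta>: "0 < \<delta>" using n pq by (simp add: \<delta>_def)
  have t0: "t 0 = p" and tn: "t n = q" using n by (auto simp: t_def)
  have tS: "t (Suc j) = t j + \<delta>" for j by (simp add: t_def \<delta>_def add_divide_distrib distrib_left)
  have tp: "p \<le> t j" for j unfolding t_def using pq by (intro add_increasing2 mult_nonneg_nonneg) auto
  have tmono: "i \<le> j ==> t i \<le> t j" for i j
   unfolding t_def using pq by (intro add_mono mult_left_mono divide_right_mono) auto
  have tj0: "0 \<le> t j" for j using tp pq by (meson order_trans)
  define B where "B j W \<longleftrightarrow> (\<forall>i\<le>j. W (t i) \<le> L W)" for j and W :: "real => real"
  define b where "b j W = (of_bool (B j W) :: real)" for j W
  define V where "V j W = u (L W - W (t j)) * exp (- \<kappa> * (t j - p))" for j W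
  have KF: "K \<in> borel_measurable (F (t j))" "L \<in> borel_measurable (F (t j))" for j
   using F_measurable_mono[OF K tp] F_measurable_mono[OF L tp] by auto
  have BF: "Measurable.pred (F (t j)) (B j)" for j
   unfolding B_def
  proof (intro pred_intros_countable pred_intros_imp')
   fix i assume "i \<le> j"
   then have [measurable]: "(\<lambda>W. W (t i)) \<in> borel_measurable (F (t j))" using tmono tj0 by (intro coord_F) auto
   have [measurable]: "L \<in> borel_measurable (F (t j))" by (rule KF)
   show "Measurable.pred (F (t j)) (\<lambda>W. W (t i) \<le> L W)"
    unfolding pred_def by (rule borel_measurable_le) fact+
  qed
  have bF: "b j \<in> borel_measurable (F (t j))" for j unfolding b_def by (rule borel_measurable_of_bool[OF BF])
  have [measurable]: "b j \<in> borel_measurable P" "K \<in> borel_measurable P" "L \<in> borel_measurable P" for j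
   using F_measurable_P[OF bF] F_measurable_P[OF K] F_measurable_P[OF L] by auto
  have [measurable]: "(\<lambda>W. W (t j)) \<in> borel_measurable P" for j using tj0 by (intro coord_P)
  have [measurable]: "V j \<in> borel_measurable P" for j unfolding V_def by measurable
  have int: "integrable P (\<lambda>W. K W * b i W * V j W)" for i j
  proof -
   have "integrable P (\<lambda>W. K W * b i W * u (L W - W (t j)))"
    by (rule Bochner_Integration.integrable_bound[OF bd_int[OF tp[of j]]], measurable)
     (intro AE_I2, simp only: b_def real_norm_def, rule order_trans[OF bd abs_ge_self])
   then have "integrable P (\<lambda>W. K W * b i W * u (L W - W (t j)) * exp (- \<kappa> * (t j - p)))" by (rule integrable_mult_left)
   then show ?thesis by (simp add: V_def mult.assoc)
  qed
  define E where "E j = (LINT W|P. K W * b j W * V j W)" for j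
  \<comment> \<open>Survival up to step \<open>j\<close> is known at time \<open>t j\<close>, hence
    moving \<open>V\<close> one step ahead leaves the expectation unchanged; only the change of the
    survival indicator remains to be estimated.\<close>
  have step: "E j = (LINT W|P. K W * b j W * V (Suc j) W)" for j
  proof -
   define x where "x = (\<lambda>W::real => real. W (t j))"
   have [measurable]: "x \<in> borel_measurable (F (t j))" unfolding x_def using tj0 by (intro coord_F) auto
   have [measurable]: "K \<in> borel_measurable (F (t j))" "L \<in> borel_measurable (F (t j))" "b j \<in> borel_measurable (F (t j))"
    using KF bF by auto
   define \<Phi> where "\<Phi> = (\<lambda>W y. K W * b j W * (u (L W - x W - y) * exp (- \<kappa> * (t (Suc j) - p))))"
   have \<Phi>: "K W * b j W * V (Suc j) W = \<Phi> W (W (t (Suc j)) - W (t j))" for W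
    by (simp add: \<Phi>_def V_def x_def)
   have "(LINT W|P. K W * b j W * V (Suc j) W) = (\<integral>W. (LINT y|gauss (t (Suc j) - t j). \<Phi> W y) \<partial>P)"
    unfolding \<Phi>
   proof (rule integral_increment)
    show "case_prod \<Phi> \<in> borel_measurable (F (t j) \<Otimes>\<^sub>M borel)" unfolding \<Phi>_def by measurable
    show "integrable P (\<lambda>W. \<Phi> W (W (t (Suc j)) - W (t j)))" using int[of j "Suc j"] unfolding \<Phi> .
   qed (use tj0 tS \<delta> in auto)
   also have "\<dots> = E j" unfolding E_def
   proof (intro Bochner_Integration.integral_cong refl)
    fix W
    have "(LINT y|gauss (t (Suc j) - t j). \<Phi> W y) = K W * b j W * exp (- \<kappa> * (t (Suc j) - p)) * (LINT y|gauss \<delta>. u ((L W - x W) - y))"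
     unfolding \<Phi>_def tS by (simp add: mult_ac)
    also have "\<dots> = K W * b j W * (u (L W - x W) * (exp (- \<kappa> * (t (Suc j) - p)) * exp (\<kappa> * \<delta>)))"
     unfolding u_gauss[OF \<delta>] by (simp add: mult_ac)
    also have "exp (- \<kappa> * (t (Suc j) - p)) * exp (\<kappa> * \<delta>) = exp (- \<kappa> * (t j - p))"
     by (simp add: exp_add[symmetric] tS algebra_simps)
    finally show "(LINT y|gauss (t (Suc j) - t j). \<Phi> W y) = K W * b j W * V j W" by (simp add: V_def x_def)
   qed
   finally show ?thesis by simp
  qed
  have bdec: "b (Suc j) W \<le> b j W" for j W unfolding b_def B_def by auto
  define \<beta> where "\<beta> j = (LINT W|P. b j W)" for j
  have bint: "integrable P (b j)" for j
   by (rule integrable_const_bound[where B=1]) (auto simp: b_def)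
  have sh: "integrable P (\<lambda>W. sinh (l * (W (t (Suc j)) - W (t j))) ^ 4)"
   "(LINT W|P. sinh (l * (W (t (Suc j)) - W (t j))) ^ 4) = s4 \<delta>" for j
   using integrable_increment_iff[of "t j" "t (Suc j)" "\<lambda>y. sinh (l * y) ^ 4"] gauss_sinh4[OF \<delta>, of l] tj0[of j] \<delta>
   by (auto simp: tS s4_def)
  have diff: "\<bar>E j - E (Suc j)\<bar> \<le> C' * (\<epsilon> * (\<beta> j - \<beta> (Suc j)) + s4 \<delta> / \<epsilon> ^ 3)" if "j < n" for j
  proof -
   have Ediff: "E j - E (Suc j) = (LINT W|P. K W * b j W * V (Suc j) W - K W * b (Suc j) W * V (Suc j) W)"
    unfolding step[of j] unfolding E_def by (rule Bochner_Integration.integral_diff[symmetric]) (rule int)+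
   have "\<bar>E j - E (Suc j)\<bar> \<le> (LINT W|P. C' * (\<epsilon> * (b j W - b (Suc j) W) + sinh (l * (W (t (Suc j)) - W (t j))) ^ 4 / \<epsilon> ^ 3))"
    unfolding Ediff
   proof (rule order_trans[OF integral_abs_bound integral_mono])
    show "integrable P (\<lambda>W. \<bar>K W * b j W * V (Suc j) W - K W * b (Suc j) W * V (Suc j) W\<bar>)"
     by (intro integrable_abs Bochner_Integration.integrable_diff int)
    show "integrable P (\<lambda>W. C' * (\<epsilon> * (b j W - b (Suc j) W) + sinh (l * (W (t (Suc j)) - W (t j))) ^ 4 / \<epsilon> ^ 3))"
     by (intro integrable_mult_right Bochner_Integration.integrable_add Bochner_Integration.integrable_diff integrable_divide bint sh(1))
    fix W :: "real => real"
    let ?\<Delta> = "W (t (Suc j)) - W (t j)"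
    have nn: "0 \<le> sinh (l * ?\<Delta>) ^ 4 / \<epsilon> ^ 3" using \<epsilon> by simp
    show "\<bar>K W * b j W * V (Suc j) W - K W * b (Suc j) W * V (Suc j) W\<bar>
     \<le> C' * (\<epsilon> * (b j W - b (Suc j) W) + sinh (l * ?\<Delta>) ^ 4 / \<epsilon> ^ 3)"
    proof (cases "B j W \<and> \<not> B (Suc j) W")
     case False
     then have "b j W = b (Suc j) W" using bdec[of j W] by (auto simp: b_def)
     then show ?thesis using mult_nonneg_nonneg[OF C'0 nn] by simp
    next
     case True
     then have bb: "b j W = 1" "b (Suc j) W = 0" by (auto simp: b_def)
     \<comment> \<open>Killed exactly in this step: the level lies between two consecutive grid
       values, so its distance to the new value is at most the length of the increment.\<close>
     have L1: "W (t j) \<le> L W" "L W < W (t (Suc j))" using True by (auto simp: B_def le_Suc_eq not_le)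
     have "\<bar>u (L W - W (t (Suc j)))\<bar> \<le> C * \<bar>sinh (l * (L W - W (t (Suc j))))\<bar>" by (rule u_bound)
     also have "\<dots> \<le> C * \<bar>sinh (l * ?\<Delta>)\<bar>"
      unfolding abs_sinh_real abs_mult using L1 l C0 by (intro mult_left_mono) (auto intro!: mult_left_mono)
     finally have 1: "\<bar>u (L W - W (t (Suc j)))\<bar> \<le> C * \<bar>sinh (l * ?\<Delta>)\<bar>" .
     have 2: "exp (- \<kappa> * (t (Suc j) - p)) \<le> exp (\<bar>\<kappa>\<bar> * (q - p))"
     proof -
      have "t (Suc j) \<le> q" using tmono[of "Suc j" n] that tn by auto
      then have "\<bar>\<kappa>\<bar> * (t (Suc j) - p) \<le> \<bar>\<kappa>\<bar> * (q - p)" by (intro mult_left_mono) auto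
      moreover have "- \<kappa> * (t (Suc j) - p) \<le> \<bar>\<kappa>\<bar> * (t (Suc j) - p)" using tp[of "Suc j"] by (intro mult_right_mono) auto
      ultimately show ?thesis by simp
     qed
     have "\<bar>K W * b j W * V (Suc j) W - K W * b (Suc j) W * V (Suc j) W\<bar> = \<bar>K W\<bar> * (\<bar>u (L W - W (t (Suc j)))\<bar> * exp (- \<kappa> * (t (Suc j) - p)))"
      by (simp add: bb V_def abs_mult)
     also have "\<dots> \<le> 1 * ((C * \<bar>sinh (l * ?\<Delta>)\<bar>) * exp (\<bar>\<kappa>\<bar> * (q - p)))"
      using K01[of W] 1 2 by (intro mult_mono) auto
     also have "\<dots> = C' * \<bar>sinh (l * ?\<Delta>)\<bar>" by (simp add: C'_def)
     also have "\<dots> \<le> C' * (\<epsilon> * (b j W - b (Suc j) W) + sinh (l * ?\<Delta>) ^ 4 / \<epsilon> ^ 3)"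
      using le_eps_plus_power4[OF \<epsilon>, of "sinh (l * ?\<Delta>)"] C'0 by (intro mult_left_mono) (auto simp: bb)
     finally show ?thesis .
    qed
   qed
   also have "\<dots> = C' * (\<epsilon> * (\<beta> j - \<beta> (Suc j)) + s4 \<delta> / \<epsilon> ^ 3)"
    using bint sh by (simp add: \<beta>_def)
   finally show ?thesis .
  qed
  have "\<bar>E 0 - E n\<bar> = \<bar>\<Sum>j<n. E j - E (Suc j)\<bar>" by (simp add: sum_lessThan_telescope')
  also have "\<dots> \<le> (\<Sum>j<n. C' * (\<epsilon> * (\<beta> j - \<beta> (Suc j)) + s4 \<delta> / \<epsilon> ^ 3))"
   by (rule order_trans[OF sum_abs sum_mono]) (use diff in auto)
  also have "\<dots> = C' * (\<epsilon> * (\<Sum>j<n. \<beta> j - \<beta> (Suc j)) + real n * s4 \<delta> / \<epsilon> ^ 3)"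
   by (simp add: sum_distrib_left[symmetric] sum.distrib)
  also have "(\<Sum>j<n. \<beta> j - \<beta> (Suc j)) = \<beta> 0 - \<beta> n" by (simp add: sum_lessThan_telescope')
  also have "C' * (\<epsilon> * (\<beta> 0 - \<beta> n) + real n * s4 \<delta> / \<epsilon> ^ 3) \<le> C' * (\<epsilon> * 1 + real n * s4 \<delta> / \<epsilon> ^ 3)"
  proof -
   have "0 \<le> \<beta> n" unfolding \<beta>_def by (rule integral_nonneg_AE) (auto simp: b_def)
   moreover have "\<beta> 0 \<le> (LINT W|P. 1)" unfolding \<beta>_def by (rule integral_mono[OF bint]) (auto simp: b_def)
   ultimately have "\<beta> 0 - \<beta> n \<le> 1" using prob_space by simp
   then show ?thesis using C'0 \<epsilon> by (intro mult_left_mono add_right_mono) auto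
  qed
  finally have "\<bar>E 0 - E n\<bar> \<le> C' * (\<epsilon> + real n * s4 ((q - p) / real n) / \<epsilon> ^ 3)" by (simp add: \<delta>_def)
  moreover have "E 0 = E0" by (simp add: E_def E0_def b_def B_def V_def t0)
  moreover have "E n = exp (- \<kappa> * (q - p)) * En n"
   unfolding E_def En_def b_def B_def V_def tn by (simp add: t_def mult_ac flip: integral_mult_right_zero)
  ultimately show ?thesis by simp
 qed
 \<comment> \<open>With \<open>\<epsilon>\<close> equal to \<open>n\<close> to the power -1/6 the
   second term is of order \<open>n\<close> to the power -1/2: the sum of fourth moments is of order
   \<open>1 / n\<close>, and it is divided by \<open>n\<close> to the power -1/2.\<close>
 have "(\<lambda>n. C' * (real n powr (-1/6) + real n * s4 ((q - p) / real n) / (real n powr (-1/6)) ^ 3)) \<longlonglongrightarrow> C' * 0"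
 proof (rule tendsto_mult_left)
  define d where "d = q - p"
  have "0 < d" "0 < l\<^sup>2" using pq l by (auto simp: d_def)
  then show "(\<lambda>n. real n powr (-1/6) + real n * s4 ((q - p) / real n) / (real n powr (-1/6)) ^ 3) \<longlonglongrightarrow> 0"
   unfolding s4_def d_def[symmetric] by real_asymp
 qed
 then have "(\<lambda>n. E0 - exp (- \<kappa> * (q - p)) * En n) \<longlonglongrightarrow> 0"
 proof (rule Lim_null_comparison[rotated, OF back_subst[of "\<lambda>x. _ \<longlonglongrightarrow> x"]])
  show "\<forall>\<^sub>F n in sequentially. norm (E0 - exp (- \<kappa> * (q - p)) * En n)
   \<le> C' * (real n powr (-1/6) + real n * s4 ((q - p) / real n) / (real n powr (-1/6)) ^ 3)"
   using eventually_gt_at_top[of 0] by eventually_elim (use key in auto)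
 qed simp
 moreover have "En \<longlonglongrightarrow> (LINT W|P. K W * of_bool (\<forall>t\<in>{p..q}. W t \<le> L W) * u (L W - W q))"
  unfolding En_def
 proof (rule integral_dominated_convergence[where w="bd q"])
  have q0: "0 \<le> q" using pq by auto
  have LP [measurable]: "L \<in> borel_measurable P" "K \<in> borel_measurable P" using F_measurable_P[OF K] F_measurable_P[OF L] by auto
  have [measurable]: "(\<lambda>W. W q) \<in> borel_measurable P" using q0 by (rule coord_P)
  have p1: "Measurable.pred P (\<lambda>W. \<forall>t\<in>{p..q}. W t \<le> L W)" using pq by (intro pred_all_le LP) (auto intro: coord_P)
  show "(\<lambda>W. K W * of_bool (\<forall>t\<in>{p..q}. W t \<le> L W) * u (L W - W q)) \<in> borel_measurable P"
   by (intro borel_measurable_times borel_measurable_of_bool[OF p1]) measurable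
  fix n
  have p2': "Measurable.pred P (\<lambda>W. \<forall>i\<le>n. W (p + (q - p) * (real i / real n)) \<le> L W)"
  proof (intro pred_intros_countable pred_intros_imp')
   fix i
   have "0 \<le> p + (q - p) * (real i / real n)" using pq by (intro add_nonneg_nonneg mult_nonneg_nonneg) auto
   then have [measurable]: "(\<lambda>W. W (p + (q - p) * (real i / real n))) \<in> borel_measurable P" by (rule coord_P)
   show "Measurable.pred P (\<lambda>W. W (p + (q - p) * (real i / real n)) \<le> L W)"
    unfolding pred_def by (rule borel_measurable_le) fact+
  qed
  show "(\<lambda>W. K W * of_bool (\<forall>i\<le>n. W (p + (q - p) * (real i / real n)) \<le> L W) * u (L W - W q)) \<in> borel_measurable P"
   by (intro borel_measurable_times borel_measurable_of_bool[OF p2']) measurable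
  show "AE W in P. norm (K W * of_bool (\<forall>i\<le>n. W (p + (q - p) * (real i / real n)) \<le> L W) * u (L W - W q)) \<le> bd q W"
   by (intro AE_I2) (simp only: real_norm_def bd)
 next
  show "integrable P (bd q)" using pq by (intro bd_int) auto
  show "AE W in P. (\<lambda>n. K W * of_bool (\<forall>i\<le>n. W (p + (q - p) * (real i / real n)) \<le> L W) * u (L W - W q))
    \<longlonglongrightarrow> K W * of_bool (\<forall>t\<in>{p..q}. W t \<le> L W) * u (L W - W q)"
  proof (intro AE_I2 tendsto_mult_right tendsto_mult_left)
   fix W assume "W \<in> space P" then have W: "W \<in> Omega" by simp
   show "(\<lambda>n. of_bool (\<forall>i\<le>n. W (p + (q - p) * (real i / real n)) \<le> L W) :: real) \<longlonglongrightarrow> of_bool (\<forall>t\<in>{p..q}. W t \<le> L W)"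
   proof (cases "\<forall>t\<in>{p..q}. W t \<le> L W")
    case True
    then have "\<forall>i\<le>n. W (p + (q - p) * (real i / real n)) \<le> L W" for n
     using all_le_iff_grid[OF W, of p q "L W"] pq by auto
    then show ?thesis using True by simp
   next
    case False
    then obtain t where "p \<le> t" "t \<le> q" "L W < W t" by (auto simp: not_le)
    from eventually_grid_exceeds[OF W pq(1) this]
    have "\<forall>\<^sub>F n in sequentially. (of_bool (\<forall>i\<le>n. W (p + (q - p) * (real i / real n)) \<le> L W) :: real) = 0"
     by eventually_elim (auto simp: not_le)
    moreover have "(of_bool (\<forall>t\<in>{p..q}. W t \<le> L W) :: real) = 0" using False by (simp only: of_bool_eq)
    ultimately show ?thesis by (simp only: tendsto_eventually)
   qed
  qed
 qed
 then have "(\<lambda>n. E0 - exp (- \<kappa> * (q - p)) * En n) \<longlonglongrightarrow>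
   E0 - exp (- \<kappa> * (q - p)) * (LINT W|P. K W * of_bool (\<forall>t\<in>{p..q}. W t \<le> L W) * u (L W - W q))"
  by (intro tendsto_intros)
 ultimately have "E0 = exp (- \<kappa> * (q - p)) * (LINT W|P. K W * of_bool (\<forall>t\<in>{p..q}. W t \<le> L W) * u (L W - W q))"
  using LIMSEQ_unique by fastforce
 then show ?thesis unfolding E0_def[symmetric] by (simp add: mult.assoc[symmetric] exp_add[symmetric])
qed

text \<open>Killing at the level \<open>S p W - h\<close> is compared for
  \<open>h = 1 / real (Suc m)\<close> and for \<open>h = 0\<close>. The starting values in
  \<open>killed_martingale\<close> converge as \<open>m\<close> grows, so the event \<open>A\<close>
  and the union \<open>A'\<close> of the events with positive \<open>h\<close> carry the same
  integral of \<open>sinh (S p W - W q)\<close>. As \<open>A'\<close> lies in \<open>A\<close> and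
  this weight is positive on \<open>A\<close> unless \<open>W q = S p W\<close>, the two agree
  almost surely.\<close>

lemma max_not_reattained:
 assumes pq: "0 \<le> p" "p < q"
 shows "AE W in P. (\<forall>t\<in>{p..q}. W t \<le> S p W) --> (\<exists>m::nat. \<forall>t\<in>{p..q}. W t \<le> S p W - 1 / real (Suc m))"
proof -
 define A where "A W \<longleftrightarrow> (\<forall>t\<in>{p..q}. W t \<le> S p W)" for W
 define Am where "Am m W \<longleftrightarrow> (\<forall>t\<in>{p..q}. W t \<le> S p W - 1 / real (Suc m))" for m :: nat and W
 define A' where "A' W \<longleftrightarrow> (\<exists>m. Am m W)" for W
 have SF [measurable]: "S p \<in> borel_measurable (F p)" using pq by measurable
 have xF [measurable]: "(\<lambda>W. W p) \<in> borel_measurable (F p)" using pq by (intro coord_F) auto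
 have SP [measurable]: "S p \<in> borel_measurable P" by (rule F_measurable_P[OF SF])
 have [measurable]: "(\<lambda>W. W q) \<in> borel_measurable P" "(\<lambda>W. W p) \<in> borel_measurable P" using pq by (intro coord_P; simp)+
 have [measurable]: "Measurable.pred P A" unfolding A_def using pq by (intro pred_all_le SP) (auto intro: coord_P)
 have [measurable]: "Measurable.pred P (Am m)" for m
  unfolding Am_def using pq by (intro pred_all_le borel_measurable_diff SP) (auto intro: coord_P)
 have [measurable]: "Measurable.pred P A'" unfolding A'_def by measurable
 have AmA: "Am m W ==> A W" for m W
 proof -
  have "S p W - 1 / real (Suc m) \<le> S p W" by simp
  then show "Am m W ==> A W" unfolding Am_def A_def using order_trans by blast
 qed
 have Am_mono: "Am m W ==> m \<le> m' ==> Am m' W" for m m' W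
 proof -
  assume *: "Am m W" "m \<le> m'"
  then have "1 / real (Suc m') \<le> 1 / real (Suc m)" by (intro divide_left_mono) auto
  then show "Am m' W" using *(1) unfolding Am_def by (meson diff_left_mono order_trans)
 qed
 have x_le_S: "W \<in> Omega ==> W p \<le> S p W" for W using S_upper[of W p p] pq by auto
 \<comment> \<open>Truncating the gap below the maximum at \<open>N\<close> provides the bound on
   the distance to the level that \<open>killed_martingale\<close> requires; every path satisfies it
   for some \<open>N\<close>.\<close>
 have N: "AE W in P. S p W - W p \<le> real N \<and> A W \<and> \<not> A' W --> W q = S p W" for N :: nat
 proof -
  define K where "K W = (of_bool (0 \<le> S p W - W p \<and> S p W - W p \<le> real N) :: real)" for W
  have KF [measurable]: "K \<in> borel_measurable (F p)" unfolding K_def by measurable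
  have [measurable]: "K \<in> borel_measurable P" by (rule F_measurable_P[OF KF])
  have K01: "0 \<le> K W \<and> K W \<le> 1" for W by (simp add: K_def)
  have km: "(LINT W|P. K W * of_bool (\<forall>t\<in>{p..q}. W t \<le> S p W - h) * sinh (S p W - h - W q))
   = exp (1 / 2 * (q - p)) * (LINT W|P. K W * of_bool (W p \<le> S p W - h) * sinh (S p W - h - W p))"
   if h: "0 \<le> h" "h \<le> 1" for h
  proof (rule killed_martingale[of 1 p q K "\<lambda>W. S p W - h" "real N + 1" sinh "1 / 2" 1])
   fix a \<delta> :: real assume "0 < \<delta>"
   then show "(LINT y|gauss \<delta>. sinh (a - y)) = exp (1 / 2 * \<delta>) * sinh a" using gauss_sinh_diff[of \<delta> 1 a] by simp
  next
   fix W assume "K W \<noteq> 0" then show "\<bar>S p W - h - W p\<bar> \<le> real N + 1" using h by (auto simp: K_def split: if_splits)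
  qed (use pq K01 in \<open>auto intro!: borel_measurable_continuous_onI continuous_intros\<close>)
  define w where "w W = exp (real N + 1) * (exp (1 * (W q - W p)) + exp (- 1 * (W q - W p)))" for W :: "real => real"
  have w_int: "integrable P w" unfolding w_def using pq
   by (intro integrable_mult_right Bochner_Integration.integrable_add integrable_exp_increment) auto
  have w: "norm (K W * of_bool b * sinh (S p W - h - W q)) \<le> w W" if "0 \<le> h" "h \<le> 1" for W b h
  proof (cases "K W = 0")
   case True then show ?thesis by (simp add: w_def add_nonneg_nonneg)
  next
   case False
   then have d: "0 \<le> S p W - W p" "S p W - W p \<le> real N" by (auto simp: K_def split: if_splits)
   have "norm (K W * of_bool b * sinh (S p W - h - W q)) \<le> \<bar>sinh (S p W - h - W q)\<bar>" by (simp add: K_def)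
   also have "\<dots> \<le> exp \<bar>S p W - h - W q\<bar>" by (rule abs_sinh_le_exp)
   also have "\<dots> \<le> exp ((real N + 1) + \<bar>W q - W p\<bar>)" using d that by simp
   also have "\<dots> = exp (real N + 1) * exp \<bar>W q - W p\<bar>" by (rule exp_add)
   also have "\<dots> \<le> w W" unfolding w_def using exp_abs_le[of "W q - W p"] by (intro mult_left_mono) auto
   finally show ?thesis .
  qed
  have h0: "(\<lambda>m. 1 / real (Suc m)) \<longlonglongrightarrow> 0" by real_asymp
  have l1: "(\<lambda>m. \<integral>W. K W * of_bool (Am m W) * sinh (S p W - 1 / real (Suc m) - W q) \<partial>P)
    \<longlonglongrightarrow> (LINT W|P. K W * of_bool (A' W) * sinh (S p W - W q))"
  proof (rule integral_dominated_convergence[where w=w])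
   show "AE W in P. norm (K W * of_bool (Am m W) * sinh (S p W - 1 / real (Suc m) - W q)) \<le> w W" for m
    by (intro AE_I2 w) auto
   show "AE W in P. (\<lambda>m. K W * of_bool (Am m W) * sinh (S p W - 1 / real (Suc m) - W q)) \<longlonglongrightarrow> K W * of_bool (A' W) * sinh (S p W - W q)"
   proof (intro AE_I2 tendsto_mult tendsto_const)
    fix W
    show "(\<lambda>m. of_bool (Am m W) :: real) \<longlonglongrightarrow> of_bool (A' W)"
    proof (cases "A' W")
     case True
     then obtain m where "Am m W" by (auto simp: A'_def)
     then have "\<forall>\<^sub>F m in sequentially. (of_bool (Am m W) :: real) = 1"
      unfolding eventually_sequentially using Am_mono by (intro exI[of _ m]) auto
     then show ?thesis using True by (simp add: tendsto_eventually)
    qed (auto simp: A'_def)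
    have "(\<lambda>m. S p W - 1 / real (Suc m) - W q) \<longlonglongrightarrow> S p W - 0 - W q" by (intro tendsto_diff tendsto_const h0)
    then show "(\<lambda>m. sinh (S p W - 1 / real (Suc m) - W q)) \<longlonglongrightarrow> sinh (S p W - W q)" by (intro tendsto_sinh) simp
   qed
  next
   show "(\<lambda>W. K W * of_bool (A' W) * sinh (S p W - W q)) \<in> borel_measurable P"
    by (intro borel_measurable_times borel_measurable_of_bool borel_measurable_sinh borel_measurable_diff; fact)
   show "(\<lambda>W. K W * of_bool (Am m W) * sinh (S p W - 1 / real (Suc m) - W q)) \<in> borel_measurable P" for m
    by (intro borel_measurable_times borel_measurable_of_bool borel_measurable_sinh borel_measurable_diff borel_measurable_const; fact)
  qed (rule w_int)
  have l2: "(\<lambda>m. \<integral>W. K W * of_bool (W p \<le> S p W - 1 / real (Suc m)) * sinh (S p W - 1 / real (Suc m) - W p) \<partial>P)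
    \<longlonglongrightarrow> (LINT W|P. K W * sinh (S p W - W p))"
  proof (rule integral_dominated_convergence[where w="\<lambda>_. exp (real N + 1)"])
   show "AE W in P. norm (K W * of_bool (W p \<le> S p W - 1 / real (Suc m)) * sinh (S p W - 1 / real (Suc m) - W p)) \<le> exp (real N + 1)" for m
   proof (intro AE_I2)
    fix W
    show "norm (K W * of_bool (W p \<le> S p W - 1 / real (Suc m)) * sinh (S p W - 1 / real (Suc m) - W p)) \<le> exp (real N + 1)"
    proof (cases "K W = 0")
     case False
     then have d: "0 \<le> S p W - W p" "S p W - W p \<le> real N" by (auto simp: K_def split: if_splits)
     have h: "0 \<le> 1 / real (Suc m)" "1 / real (Suc m) \<le> 1" by auto
     have "norm (K W * of_bool (W p \<le> S p W - 1 / real (Suc m)) * sinh (S p W - 1 / real (Suc m) - W p)) \<le> \<bar>sinh (S p W - 1 / real (Suc m) - W p)\<bar>"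
      by (simp add: K_def)
     also have "\<dots> \<le> exp \<bar>S p W - 1 / real (Suc m) - W p\<bar>" by (rule abs_sinh_le_exp)
     also have "\<dots> \<le> exp (real N + 1)" using d h unfolding exp_le_cancel_iff by linarith
     finally show ?thesis .
    qed simp
   qed
   show "AE W in P. (\<lambda>m. K W * of_bool (W p \<le> S p W - 1 / real (Suc m)) * sinh (S p W - 1 / real (Suc m) - W p)) \<longlonglongrightarrow> K W * sinh (S p W - W p)"
   proof (intro AE_I2)
    fix W assume "W \<in> space P"
    then have mx: "max 0 (S p W - 0 - W p) = S p W - W p" using x_le_S[of W] by simp
    have *: "of_bool (W p \<le> S p W - h) * sinh (S p W - h - W p) = sinh (max 0 (S p W - h - W p))" for h
     by (auto simp: max_def)
    have "(\<lambda>m. max 0 (S p W - 1 / real (Suc m) - W p)) \<longlonglongrightarrow> max 0 (S p W - 0 - W p)"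
     by (intro tendsto_max tendsto_diff tendsto_const h0)
    then have "(\<lambda>m. K W * sinh (max 0 (S p W - 1 / real (Suc m) - W p))) \<longlonglongrightarrow> K W * sinh (S p W - W p)"
     unfolding mx by (intro tendsto_mult_left tendsto_sinh)
    then show "(\<lambda>m. K W * of_bool (W p \<le> S p W - 1 / real (Suc m)) * sinh (S p W - 1 / real (Suc m) - W p)) \<longlonglongrightarrow> K W * sinh (S p W - W p)"
     unfolding *[symmetric] by (simp only: mult.assoc)
   qed
  next
   show "(\<lambda>W. K W * sinh (S p W - W p)) \<in> borel_measurable P"
    by (intro borel_measurable_times borel_measurable_sinh borel_measurable_diff; fact)
   have pm: "Measurable.pred P (\<lambda>W. W p \<le> S p W - 1 / real (Suc m))" for m
    unfolding pred_def by (intro borel_measurable_le borel_measurable_diff borel_measurable_const; fact)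
   show "(\<lambda>W. K W * of_bool (W p \<le> S p W - 1 / real (Suc m)) * sinh (S p W - 1 / real (Suc m) - W p)) \<in> borel_measurable P" for m
    by (intro borel_measurable_times borel_measurable_of_bool borel_measurable_sinh borel_measurable_diff borel_measurable_const; (rule pm | fact))
  qed simp
  have "(LINT W|P. K W * of_bool (A' W) * sinh (S p W - W q)) = exp (1 / 2 * (q - p)) * (LINT W|P. K W * sinh (S p W - W p))"
  proof (rule LIMSEQ_unique[OF l1])
   have "(LINT W|P. K W * of_bool (Am m W) * sinh (S p W - 1 / real (Suc m) - W q))
    = exp (1 / 2 * (q - p)) * (LINT W|P. K W * of_bool (W p \<le> S p W - 1 / real (Suc m)) * sinh (S p W - 1 / real (Suc m) - W p))" for m
    unfolding Am_def by (rule km) auto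
   then show "(\<lambda>m. \<integral>W. K W * of_bool (Am m W) * sinh (S p W - 1 / real (Suc m) - W q) \<partial>P)
    \<longlonglongrightarrow> exp (1 / 2 * (q - p)) * (LINT W|P. K W * sinh (S p W - W p))"
    using tendsto_mult_left[OF l2] by simp
  qed
  also have "\<dots> = (LINT W|P. K W * of_bool (A W) * sinh (S p W - W q))"
  proof -
   have "(LINT W|P. K W * of_bool (W p \<le> S p W - 0) * sinh (S p W - 0 - W p)) = (LINT W|P. K W * sinh (S p W - W p))"
    by (intro Bochner_Integration.integral_cong refl) (simp add: x_le_S)
   then show ?thesis using km[of 0] by (simp add: A_def)
  qed
  finally have eq: "(LINT W|P. K W * of_bool (A' W) * sinh (S p W - W q)) = (LINT W|P. K W * of_bool (A W) * sinh (S p W - W q))" .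
  have int: "integrable P (\<lambda>W. K W * of_bool (Q W) * sinh (S p W - W q))" if [measurable]: "Measurable.pred P Q" for Q
  proof (rule Bochner_Integration.integrable_bound[OF w_int])
   show "(\<lambda>W. K W * of_bool (Q W) * sinh (S p W - W q)) \<in> borel_measurable P"
    by (intro borel_measurable_times borel_measurable_of_bool borel_measurable_sinh borel_measurable_diff; fact)
   show "AE W in P. norm (K W * of_bool (Q W) * sinh (S p W - W q)) \<le> norm (w W)"
   proof (rule AE_I2)
    fix W
    have "norm (K W * of_bool (Q W) * sinh (S p W - 0 - W q)) \<le> w W" by (rule w) auto
    then show "norm (K W * of_bool (Q W) * sinh (S p W - W q)) \<le> norm (w W)" by simp
   qed
  qed
  have "(LINT W|P. K W * of_bool (A W) * sinh (S p W - W q) - K W * of_bool (A' W) * sinh (S p W - W q)) = 0"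
   by (subst Bochner_Integration.integral_diff) (auto intro!: int simp: eq)
  moreover have nn: "0 \<le> K W * of_bool (A W) * sinh (S p W - W q) - K W * of_bool (A' W) * sinh (S p W - W q)" for W
   using AmA pq by (auto simp: A'_def A_def K_def)
  ultimately have "AE W in P. K W * of_bool (A W) * sinh (S p W - W q) - K W * of_bool (A' W) * sinh (S p W - W q) = 0"
   by (subst (asm) integral_nonneg_eq_0_iff_AE) (auto intro!: int Bochner_Integration.integrable_diff)
  with AE_space show ?thesis
  proof eventually_elim
   case (elim W)
   then show ?case using x_le_S[of W] by (auto simp: K_def)
  qed
 qed
 \<comment> \<open>The exceptional case is null: given the past, a Gaussian increment would have to
   take one prescribed value.\<close>
 have "AE W in P. W q \<noteq> S p W"
 proof -
  define c where "c = (\<lambda>W. S p W - W p)"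
  have [measurable]: "c \<in> borel_measurable (F p)" unfolding c_def by measurable
  have "(\<integral>\<^sup>+W. (\<lambda>W y. indicator {c W} y) W (W q - W p) \<partial>P) = (\<integral>\<^sup>+W. (\<integral>\<^sup>+y. indicator {c W} y \<partial>gauss (q - p)) \<partial>P)"
   by (rule nn_integral_increment[OF pq]) (measurable, simp add: indicator_def)
  also have "\<dots> = 0" by (simp add: gauss_singleton)
  finally have "(\<integral>\<^sup>+W. indicator {W \<in> space P. W q = S p W} W \<partial>P) = 0"
   by (subst nn_integral_cong[where v="\<lambda>W. indicator {c W} (W q - W p)"]) (auto simp: indicator_def c_def)
  moreover have E: "{W \<in> space P. W q = S p W} \<in> sets P" by measurable
  ultimately have "emeasure P {W \<in> space P. W q = S p W} = 0" by simp
  with E have "{W \<in> space P. W q = S p W} \<in> null_sets P" by auto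
  then show ?thesis by (rule AE_I') auto
 qed
 moreover have "AE W in P. \<forall>N::nat. S p W - W p \<le> real N \<and> A W \<and> \<not> A' W --> W q = S p W"
  unfolding AE_all_countable using N by blast
 ultimately show ?thesis
 proof eventually_elim
  case (elim W)
  obtain N :: nat where "S p W - W p \<le> real N" using real_arch_simple by blast
  then have "A W --> A' W" using elim by blast
  then show ?case unfolding A_def A'_def Am_def .
 qed
qed

end

section \<open>The penalised measure\<close>

text \<open>For a path with a unique maximiser this says \<open>g w \<le> ennreal q\<close>. In this
  form the event is a decreasing limit of events of finite horizon.\<close>

definition maxed :: "real => (real => real) => bool" where
 "maxed q w \<longleftrightarrow> (\<forall>t\<ge>0. w t \<le> S q w)"

text \<open>\<open>1 - Phi l \<psi> y\<close> is \<open>exp (l * y) * tail l \<psi> y\<close>. The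
  bare tail is monotone and, divided by its value at 0, turns out to be the survival function of
  \<open>S_inf\<close> on the half-line.\<close>

definition tail :: "real => (real => real) => real => real" where
 "tail l \<psi> y = (LINT z:{y..}|lborel. \<psi> z * exp (- l * z))"

definition mart_after :: "real => (real => real) => real => (real => real) => real" where
 "mart_after l \<psi> t w = \<psi> (S t w) * (sinh (l * (S t w - w t)) / l) * exp (- l\<^sup>2 * t / 2)"

text \<open>The two summands turn out to be the densities on \<open>F t\<close> of the events \<open>t < g\<close> and \<open>g \<le> t\<close>.\<close>

lemma Mart_split:
 assumes "l \<noteq> 0"
 shows "Mart l \<psi> t w = tail l \<psi> (S t w) * exp_mart l t w + mart_after l \<psi> t w"
proof -
 let ?s = "S t w" and ?d = "l * (S t w - w t)"
 \<comment> \<open>Writing \<open>cosh\<close> as \<open>sinh\<close> plus a decaying exponential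
   makes the tail part of \<open>phi\<close> cancel against the new \<open>sinh\<close> term, so
   that only \<open>\<psi>\<close> remains in front of \<open>sinh\<close>.\<close>
 have "exp (l * ?s) * (cosh ?d - sinh ?d) = exp (l * w t)"
  unfolding cosh_minus_sinh exp_add[symmetric] by (simp add: algebra_simps)
 then have e: "exp (l * ?s) * cosh ?d = exp (l * w t) + exp (l * ?s) * sinh ?d" by (simp add: algebra_simps)
 have "Mart l \<psi> t w = (tail l \<psi> ?s * (exp (l * ?s) * cosh ?d) + (\<psi> ?s - l * exp (l * ?s) * tail l \<psi> ?s) * (sinh ?d / l)) * exp (- l\<^sup>2 * t / 2)"
  by (simp add: Mart_def Phi_def phi_def tail_def mult_ac)
 also have "\<dots> = tail l \<psi> ?s * (exp (l * w t) * exp (- l\<^sup>2 * t / 2)) + mart_after l \<psi> t w"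
  unfolding e mart_after_def using assms by (simp add: algebra_simps)
 also have "exp (l * w t) * exp (- l\<^sup>2 * t / 2) = exp_mart l t w"
  unfolding exp_mart_def exp_add[symmetric] by (simp add: algebra_simps)
 finally show ?thesis .
qed

text \<open>Equality on the sets of \<open>N\<close> passes to \<open>N\<close>-measurable functions
  although both measures live on larger \<sigma>-algebras and their weights need not be
  \<open>N\<close>-measurable.\<close>

lemma nn_integral_transfer:
 assumes M: "(\<lambda>x. x) \<in> M \<rightarrow>\<^sub>M N" "(\<lambda>x. x) \<in> M' \<rightarrow>\<^sub>M N" and sp: "space N = space M" "space N = space M'"
  and [measurable]: "w \<in> borel_measurable M" "h \<in> borel_measurable M'"
  and eq: "\<And>A. A \<in> sets N ==> (\<integral>\<^sup>+x. w x * indicator A x \<partial>M) = (\<integral>\<^sup>+x. h x * indicator A x \<partial>M')"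
  and K: "K \<in> borel_measurable N"
 shows "(\<integral>\<^sup>+x. w x * K x \<partial>M) = (\<integral>\<^sup>+x. h x * K x \<partial>M')"
proof -
 have id: "(\<lambda>x. x) \<in> density M w \<rightarrow>\<^sub>M N" "(\<lambda>x. x) \<in> density M' h \<rightarrow>\<^sub>M N" using M by auto
 have AM: "A \<in> sets M" "A \<in> sets M'" if "A \<in> sets N" for A
  using measurable_sets[OF M(1) that] measurable_sets[OF M(2) that] sets.sets_into_space[OF that] sp
  by (auto simp: Int_absorb2)
 have KM: "K \<in> borel_measurable M" "K \<in> borel_measurable M'" using measurable_compose[OF M(1) K] measurable_compose[OF M(2) K] by auto
 have "distr (density M w) N (\<lambda>x. x) = distr (density M' h) N (\<lambda>x. x)"
 proof (rule measure_eqI)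
  fix A assume "A \<in> sets (distr (density M w) N (\<lambda>x. x))"
  then have A: "A \<in> sets N" by simp
  have "A \<inter> space M = A" "A \<inter> space M' = A" using sets.sets_into_space[OF A] sp by auto
  then show "emeasure (distr (density M w) N (\<lambda>x. x)) A = emeasure (distr (density M' h) N (\<lambda>x. x)) A"
   using eq[OF A] AM[OF A] by (simp add: emeasure_distr[OF id(1) A] emeasure_distr[OF id(2) A] emeasure_density)
 qed simp
 then have "(\<integral>\<^sup>+x. K x \<partial>distr (density M w) N (\<lambda>x. x)) = (\<integral>\<^sup>+x. K x \<partial>distr (density M' h) N (\<lambda>x. x))" by simp
 then show ?thesis
  using K KM by (simp add: nn_integral_distr[OF id(1)] nn_integral_distr[OF id(2)] nn_integral_density)
qed

text \<open>A countable list of properties that already forces a maximiser to exist, to be unique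
  and to be positive. Rational times suffice because two maximisers can be separated by a
  rational.\<close>

definition good_path :: "(real => real) => bool" where
 "good_path w \<longleftrightarrow> w \<in> Omega \<and> w 0 = 0 \<and> (\<exists>n::nat. maxed (real n) w) \<and>
  (\<forall>p q::rat. 0 \<le> p --> p < q --> (\<forall>t\<in>{of_rat p..of_rat q}. w t \<le> S (of_rat p) w) -->
   (\<exists>m::nat. \<forall>t\<in>{of_rat p..of_rat q}. w t \<le> S (of_rat p) w - 1 / real (Suc m)))"

text \<open>If \<open>t1 < t2\<close> were both maximisers, then for rationals \<open>p\<close>
  between them and \<open>q\<close> beyond \<open>t2\<close> the maximum reached before
  \<open>p\<close> would be touched again between \<open>p\<close> and \<open>q\<close> without
  being exceeded, against the last clause of \<open>good_path\<close>. Positivity of the maximiser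
  is the same argument with \<open>p = 0\<close>.\<close>

lemma good_pathE:
 assumes "good_path W"
 obtains G where "0 < G" "g W = ennreal G" "S_inf W = ereal (W G)" "\<And>t. 0 \<le> t ==> W t \<le> W G"
  "\<And>r. 0 \<le> r ==> maxed r W \<longleftrightarrow> G \<le> r"
proof -
 have w: "W \<in> Omega" and no: "\<And>p q::rat. 0 \<le> p ==> p < q ==> (\<And>t. of_rat p \<le> t ==> t \<le> of_rat q ==> W t \<le> S (of_rat p) W) ==>
   (\<exists>m::nat. \<forall>t\<in>{of_rat p..of_rat q}. W t \<le> S (of_rat p) W - 1 / real (Suc m))"
  using assms unfolding good_path_def by auto
 obtain n :: nat where n: "maxed (real n) W" using assms by (auto simp: good_path_def)
 obtain G where G: "0 \<le> G" "W G = S (real n) W" using S_attained[OF w, of "real n"] by auto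
 have le: "W t \<le> W G" if "0 \<le> t" for t using n that by (simp add: maxed_def G)
 have Sinf: "S_inf W = ereal (W G)"
  using S_inf_le_iff[of W "W G"] le S_inf_upper[OF G(1), of W] by (intro antisym) auto
 have no': False if "0 \<le> p" "p < q" "S (of_rat p) W = W G" "of_rat p \<le> t" "t \<le> of_rat q" "W t = W G" for p q :: rat and t
 proof -
  have "W t' \<le> S (of_rat p) W" if "of_rat p \<le> t'" "t' \<le> of_rat q" for t'
  proof -
   have "0 \<le> t'" using that(1) \<open>0 \<le> p\<close> by (meson order_trans zero_le_of_rat_iff)
   then show ?thesis using le \<open>S (of_rat p) W = W G\<close> by simp
  qed
  from no[OF that(1,2) this] obtain m :: nat where "\<forall>t\<in>{of_rat p..of_rat q}. W t \<le> S (of_rat p) W - 1 / real (Suc m)" by auto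
  then have "W t \<le> S (of_rat p) W - 1 / real (Suc m)" using that(4,5) by (meson atLeastAtMost_iff)
  moreover have "0 < 1 / real (Suc m)" by simp
  ultimately show False using that(3,6) by linarith
 qed
 have Seq: "S r W = W G" if "t \<le> r" "0 \<le> t" "W t = W G" for r t
  using S_upper[OF w that(2,1)] S_le_iff[OF w, of r "W G"] le that by force
 have uniq2: False if "0 \<le> t1" and t12: "t1 < t2" and "W t1 = W G" "W t2 = W G" for t1 t2
 proof -
  obtain p :: rat where p: "t1 < of_rat p" "of_rat p < t2" using of_rat_dense[OF t12] by auto
  obtain q :: rat where q: "t2 < of_rat q" using of_rat_dense[of t2 "t2 + 1"] by auto
  have "(0::real) \<le> of_rat p" using p that by linarith
  then have p0: "0 \<le> p" by simp
  have "real_of_rat p < of_rat q" using p q by linarith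
  then have pq: "p < q" by (simp add: of_rat_less)
  show False by (rule no'[OF p0 pq Seq[of t1], of t2]) (use that t12 p q in auto)
 qed
 have uniq: "t = G" if "0 \<le> t" "W t = W G" for t
  using uniq2[of t G] uniq2[of G t] that G(1) by (cases t G rule: linorder_cases) auto
 have G0: "0 < G"
 proof (rule ccontr)
  assume "\<not> 0 < G" then have [simp]: "G = 0" using G by simp
  show False by (rule no'[of 0 1 0]) (use Seq[of 0 0] in auto)
 qed
 have "{t. 0 \<le> t \<and> ereal (W t) = S_inf W} = {G}" using uniq G(1) by (auto simp: Sinf)
 then have g: "g W = ennreal G" by (simp add: g_def)
 have mx: "maxed r W \<longleftrightarrow> G \<le> r" if "0 \<le> r" for r
 proof
  assume "maxed r W"
  then have "W G \<le> S r W" using G(1) by (auto simp: maxed_def)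
  moreover obtain u where u: "0 \<le> u" "u \<le> r" "W u = S r W" using S_attained[OF w \<open>0 \<le> r\<close>] .
  ultimately have "W u = W G" using le[OF u(1)] by simp
  then show "G \<le> r" using uniq u by auto
 next
  assume "G \<le> r"
  then show "maxed r W" using Seq[OF _ G(1)] le by (auto simp: maxed_def)
 qed
 show ?thesis using that[OF G0 g Sinf le mx] by blast
qed

lemma maxed_iff_sets: "{w \<in> Omega. maxed q w} = {w \<in> Omega. S_inf w \<le> ereal (S q w)}"
 by (auto simp: maxed_def S_inf_le_iff)

lemma maxed_measurable: "0 \<le> q ==> {w \<in> Omega. maxed q w} \<in> sets F_inf"
proof -
 assume "0 \<le> q"
 then have "(\<lambda>w. ereal (S q w)) \<in> borel_measurable F_inf" using S_measurable_F_inf by measurable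
 from borel_measurable_le[OF S_inf_measurable this] show ?thesis by (simp add: maxed_iff_sets)
qed

text \<open>The same majorant as in \<open>killed_martingale\<close>, made available for passing
  between nonnegative and signed integrals.\<close>

lemma (in wiener) integrable_killed:
 assumes l: "0 < l" and pq: "0 \<le> p" "p \<le> s"
  and K: "K \<in> borel_measurable P" and K01: "\<And>w. \<bar>K w\<bar> \<le> 1"
  and L: "L \<in> borel_measurable P" and c: "\<And>w. K w \<noteq> 0 ==> \<bar>L w - w p\<bar> \<le> c"
  and u: "u \<in> borel_measurable borel" and u_bound: "\<And>x. \<bar>u x\<bar> \<le> C * \<bar>sinh (l * x)\<bar>"
 shows "integrable P (\<lambda>w. K w * u (L w - w s))"
proof -
 have C0: "0 \<le> C" using u_bound[of 1] l by (smt (verit, best) mult_neg_pos mult.right_neutral sinh_real_pos_iff)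
 define bd where "bd w = C * exp (l * c) * (exp (l * (w s - w p)) + exp (- l * (w s - w p)))" for w :: "real => real"
 have bd_int: "integrable P bd"
  unfolding bd_def using pq
  by (intro integrable_mult_right Bochner_Integration.integrable_add integrable_exp_increment) auto
 have bd: "\<bar>K w * u (L w - w s)\<bar> \<le> bd w" for w
 proof (cases "K w = 0")
  case True
  then show ?thesis unfolding bd_def using C0 by (auto intro!: mult_nonneg_nonneg add_nonneg_nonneg)
 next
  case False
  have "\<bar>K w * u (L w - w s)\<bar> \<le> 1 * \<bar>u (L w - w s)\<bar>" unfolding abs_mult using K01[of w] by (intro mult_right_mono) auto
  also have "\<dots> \<le> C * \<bar>sinh (l * (L w - w s))\<bar>" using u_bound by simp
  also have "\<dots> \<le> C * exp \<bar>l * (L w - w s)\<bar>" using C0 by (intro mult_left_mono abs_sinh_le_exp)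
  also have "\<dots> \<le> C * (exp (l * c) * exp \<bar>l * (w s - w p)\<bar>)"
  proof -
   have "\<bar>L w - w s\<bar> \<le> c + \<bar>w s - w p\<bar>" using c[OF False] by linarith
   then have "l * \<bar>L w - w s\<bar> \<le> l * c + l * \<bar>w s - w p\<bar>" using l by (metis distrib_left mult_le_cancel_left_pos)
   then show ?thesis using C0 l by (intro mult_left_mono) (auto simp: exp_add[symmetric] abs_mult)
  qed
  also have "\<dots> \<le> bd w" unfolding bd_def mult.assoc
   using C0 exp_abs_le[of "l * (w s - w p)"] by (intro mult_left_mono) auto
  finally show ?thesis .
 qed
 have "(\<lambda>w. w s) \<in> borel_measurable P" using pq by (intro coord_P) auto
 then have "(\<lambda>w. u (L w - w s)) \<in> borel_measurable P"
  using L by (intro measurable_compose[OF borel_measurable_diff u])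
 with K show ?thesis
  by (intro Bochner_Integration.integrable_bound[OF bd_int] borel_measurable_times AE_I2)
   (simp_all only: real_norm_def, rule order_trans[OF bd abs_ge_self])
qed

section \<open>Densities under \<open>Q\<close> before and after the maximum\<close>

locale penalised = wiener P for P :: "(real => real) measure" +
 fixes l :: real and \<psi> :: "real => real" and Q :: "(real => real) measure"
 assumes l_pos: "l > 0"
  and \<psi>_borel [measurable]: "\<psi> \<in> borel_measurable borel"
  and \<psi>_pos: "\<And>x. \<psi> x > 0"
  and \<psi>_int: "\<And>x. set_integrable lborel {x..} (\<lambda>z. \<psi> z * exp (- l * z))"
  and Q_prob: "prob_space Q"
  and Q_sets: "sets Q = sets F_inf"
  and Q_eq: "\<And>t \<Gamma>. 0 \<le> t ==> \<Gamma> \<in> sets (F t) ==>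
   measure Q \<Gamma> = 1 / (1 - Phi l \<psi> 0) * (LINT w|P. indicator \<Gamma> w * Mart l \<psi> t w)"
begin

abbreviation "I0 \<equiv> tail l \<psi> 0"

sublocale Q: prob_space Q by (rule Q_prob)

lemma space_Q [simp]: "space Q = Omega"
 using sets_eq_imp_space_eq[OF Q_sets] by simp

lemma Phi_tail: "1 - Phi l \<psi> y = exp (l * y) * tail l \<psi> y"
 by (simp add: Phi_def tail_def)

lemma I0_eq: "1 - Phi l \<psi> 0 = I0"
 by (simp add: Phi_tail)

lemma tail_nn: "ennreal (tail l \<psi> y) = (\<integral>\<^sup>+z. indicator {y..} z * ennreal (\<psi> z * exp (- l * z)) \<partial>lborel)"
proof -
 have "(\<integral>\<^sup>+z. ennreal (indicator {y..} z *\<^sub>R (\<psi> z * exp (- l * z))) \<partial>lborel) = ennreal (tail l \<psi> y)"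
  unfolding tail_def set_lebesgue_integral_def using \<psi>_int[of y] \<psi>_pos[THEN less_imp_le]
  by (intro nn_integral_eq_integral) (auto simp: set_integrable_def)
 moreover have "(\<integral>\<^sup>+z. ennreal (indicator {y..} z *\<^sub>R (\<psi> z * exp (- l * z))) \<partial>lborel)
   = (\<integral>\<^sup>+z. indicator {y..} z * ennreal (\<psi> z * exp (- l * z)) \<partial>lborel)"
  by (intro nn_integral_cong) (simp add: indicator_def)
 ultimately show ?thesis by simp
qed

lemma tail_nonneg: "0 \<le> tail l \<psi> y"
 unfolding tail_def set_lebesgue_integral_def using \<psi>_pos[THEN less_imp_le]
 by (intro integral_nonneg_AE) (auto simp: zero_le_mult_iff)

lemma tail_antimono: "x \<le> y ==> tail l \<psi> y \<le> tail l \<psi> x"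
proof -
 assume "x \<le> y"
 then have "ennreal (tail l \<psi> y) \<le> ennreal (tail l \<psi> x)"
  unfolding tail_nn by (intro nn_integral_mono mult_right_mono) (auto simp: indicator_def)
 then show ?thesis using tail_nonneg by (simp add: ennreal_le_iff)
qed

lemma tail_borel [measurable]: "tail l \<psi> \<in> borel_measurable borel"
proof -
 have "mono (\<lambda>y. - tail l \<psi> y)" using tail_antimono by (intro monoI) auto
 then have "(\<lambda>y. - tail l \<psi> y) \<in> borel_measurable borel" by (rule borel_measurable_mono)
 then have "(\<lambda>y. - (- tail l \<psi> y)) \<in> borel_measurable borel" by (rule borel_measurable_uminus)
 then show ?thesis by simp
qed

text \<open>The level \<open>l * real n / 4\<close> tends to infinity, but at less than half the
  speed \<open>l\<close> of the drift, so that drifted paths below it at time \<open>n\<close> have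
  exponentially small weight. It is the cut in \<open>AE_maxed\<close>.\<close>

lemma tail_tendsto_0: "(\<lambda>n. tail l \<psi> (l * real n / 4)) \<longlonglongrightarrow> 0"
proof -
 have "(\<lambda>n. \<integral>z. indicator {l * real n / 4..} z *\<^sub>R (\<psi> z * exp (- l * z)) \<partial>lborel) \<longlonglongrightarrow> (LINT z|(lborel :: real measure). (0::real))"
 proof (rule integral_dominated_convergence[where w="\<lambda>z. indicator {0..} z *\<^sub>R (\<psi> z * exp (- l * z))"])
  show "integrable lborel (\<lambda>z. indicator {0..} z *\<^sub>R (\<psi> z * exp (- l * z)))"
   using \<psi>_int[of 0] by (simp add: set_integrable_def)
  show "AE z in lborel. (\<lambda>n. indicator {l * real n / 4..} z *\<^sub>R (\<psi> z * exp (- l * z))) \<longlonglongrightarrow> 0"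
  proof (intro AE_I2 tendsto_eventually)
   fix z :: real
   have "\<forall>\<^sub>F n in sequentially. 4 * z / l < real n"
    using filterlim_real_sequentially by (simp add: filterlim_at_top_dense)
   then show "\<forall>\<^sub>F n in sequentially. indicator {l * real n / 4..} z *\<^sub>R (\<psi> z * exp (- l * z)) = 0"
    by eventually_elim (use l_pos in \<open>auto simp: indicator_def field_simps\<close>)
  qed
  show "AE z in lborel. norm (indicator {l * real n / 4..} z *\<^sub>R (\<psi> z * exp (- l * z))) \<le> indicator {0..} z *\<^sub>R (\<psi> z * exp (- l * z))" for n
  proof (intro AE_I2)
   fix z
   have "0 \<le> l * real n / 4" using l_pos by simp
   then show "norm (indicator {l * real n / 4..} z *\<^sub>R (\<psi> z * exp (- l * z))) \<le> indicator {0..} z *\<^sub>R (\<psi> z * exp (- l * z))"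
    using \<psi>_pos[of z] by (auto simp: indicator_def abs_mult)
  qed
 qed auto
 then show ?thesis by (simp add: tail_def set_lebesgue_integral_def)
qed

lemma Mart_measurable: "0 \<le> t ==> Mart l \<psi> t \<in> borel_measurable (F t)"
 and mart_after_measurable: "0 \<le> t ==> mart_after l \<psi> t \<in> borel_measurable (F t)"
 and tail_S_measurable: "0 \<le> t ==> (\<lambda>w. tail l \<psi> (S t w)) \<in> borel_measurable (F t)"
proof -
 assume t: "0 \<le> t"
 have S: "S t \<in> borel_measurable (F t)" and x: "(\<lambda>w. w t) \<in> borel_measurable (F t)" using t by (auto intro: S_measurable coord_F)
 show T: "(\<lambda>w. tail l \<psi> (S t w)) \<in> borel_measurable (F t)" by (rule measurable_compose[OF S tail_borel])
 have "(\<lambda>w. \<psi> (S t w)) \<in> borel_measurable (F t)" by (rule measurable_compose[OF S \<psi>_borel])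
 then show A: "mart_after l \<psi> t \<in> borel_measurable (F t)" unfolding mart_after_def using S x
  by (intro borel_measurable_times borel_measurable_divide borel_measurable_sinh borel_measurable_diff borel_measurable_const)
 show "Mart l \<psi> t \<in> borel_measurable (F t)"
  using l_pos by (subst ext[OF Mart_split]) (auto intro!: borel_measurable_add borel_measurable_times T A exp_mart_measurable t)
qed

lemma mart_after_nonneg: "w \<in> Omega ==> 0 \<le> t ==> 0 \<le> mart_after l \<psi> t w"
 unfolding mart_after_def using \<psi>_pos[of "S t w"] l_pos S_upper[of w t t] by (intro mult_nonneg_nonneg) auto

lemma tail_exp_nonneg: "0 \<le> tail l \<psi> (S t w) * exp_mart l t w"
 unfolding exp_mart_def using tail_nonneg by simp

lemma Mart_nonneg: "w \<in> Omega ==> 0 \<le> t ==> 0 \<le> Mart l \<psi> t w"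
 using l_pos mart_after_nonneg[of w t] tail_exp_nonneg[of t w] by (subst Mart_split) auto

text \<open>The defining identity of \<open>Q\<close> on \<open>Omega\<close> rules out
  \<open>I0 = 0\<close>: the factor \<open>1 / I0\<close> would then be 0 and so would the total
  mass.\<close>

lemma I0_pos: "0 < I0"
proof -
 have "Omega \<in> sets (F 0)" using sets.top[of "F 0"] by simp
 from Q_eq[OF order_refl this] have "I0 \<noteq> 0" using Q.prob_space by (auto simp: I0_eq)
 then show ?thesis using tail_nonneg[of 0] by simp
qed

text \<open>A Bochner integral without integrability has the value 0, which for the event
  \<open>Omega\<close> contradicts the total mass 1 of \<open>Q\<close>.\<close>

lemma integrable_Mart: "0 \<le> t ==> integrable P (Mart l \<psi> t)"
proof (rule ccontr)
 assume t: "0 \<le> t" and n: "\<not> integrable P (Mart l \<psi> t)"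
 have O: "Omega \<in> sets (F t)" using sets.top[of "F t"] by simp
 have "(LINT w|P. indicator Omega w * Mart l \<psi> t w) = (LINT w|P. Mart l \<psi> t w)"
  by (intro Bochner_Integration.integral_cong) auto
 also have "\<dots> = 0" using n by (rule not_integrable_integral_eq)
 finally have "measure Q Omega = 0" using Q_eq[OF t O] by simp
 then show False using Q.prob_space by simp
qed

lemma id_QF: "(\<lambda>x. x) \<in> Q \<rightarrow>\<^sub>M F t"
 using F_measurable_F_inf[OF measurable_ident_sets[OF refl], of t] by (simp cong: measurable_cong_sets add: Q_sets)

lemma id_PF: "(\<lambda>x. x) \<in> P \<rightarrow>\<^sub>M F t"
 by (rule F_measurable_P[OF measurable_ident_sets[OF refl]])

lemma nn_integral_Q:
 assumes t: "0 \<le> t" and K: "K \<in> borel_measurable (F t)"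
 shows "(\<integral>\<^sup>+w. K w \<partial>Q) = (\<integral>\<^sup>+w. ennreal (Mart l \<psi> t w / I0) * K w \<partial>P)"
proof -
 have M: "Mart l \<psi> t \<in> borel_measurable P" by (rule F_measurable_P[OF Mart_measurable[OF t]])
 have "(\<integral>\<^sup>+w. 1 * K w \<partial>Q) = (\<integral>\<^sup>+w. ennreal (Mart l \<psi> t w / I0) * K w \<partial>P)"
 proof (rule nn_integral_transfer[OF id_QF id_PF _ _ _ _ _ K])
  fix A assume A: "A \<in> sets (F t)"
  then have AP: "A \<in> sets P" "A \<in> sets Q" using sets_F_F_inf by (auto simp: sets_P Q_sets)
  have "integrable P (\<lambda>w. indicator A w * Mart l \<psi> t w)"
   using integrable_mult_indicator[OF AP(1) integrable_Mart[OF t]] by simp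
  then have i: "integrable P (\<lambda>w. indicator A w * Mart l \<psi> t w / I0)" by (rule integrable_divide)
  have "(\<integral>\<^sup>+w. ennreal (Mart l \<psi> t w / I0) * indicator A w \<partial>P) = (\<integral>\<^sup>+w. ennreal (indicator A w * Mart l \<psi> t w / I0) \<partial>P)"
   by (intro nn_integral_cong) (auto simp: indicator_def)
  also have "\<dots> = ennreal (LINT w|P. indicator A w * Mart l \<psi> t w / I0)"
   using Mart_nonneg t I0_pos by (intro nn_integral_eq_integral i) (auto intro!: AE_I2)
  also have "(LINT w|P. indicator A w * Mart l \<psi> t w / I0) = measure Q A" using Q_eq[OF t A] by (simp add: I0_eq)
  finally show "(\<integral>\<^sup>+w. 1 * indicator A w \<partial>Q) = (\<integral>\<^sup>+w. ennreal (Mart l \<psi> t w / I0) * indicator A w \<partial>P)"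
   using AP by (simp add: Q.emeasure_eq_measure)
 qed (use M in auto)
 then show ?thesis by simp
qed

text \<open>On each \<open>F t\<close> the measure \<open>Q\<close> has a density, so null events of
  finite horizon carry over. Events of infinite horizon do not: the existence of a maximum has to be
  shown under \<open>Q\<close> itself.\<close>

lemma AE_Q_F:
 assumes t: "0 \<le> t" and A: "{w \<in> Omega. R w} \<in> sets (F t)" and P: "AE w in P. R w"
 shows "AE w in Q. R w"
proof -
 let ?N = "Omega - {w \<in> Omega. R w}"
 have N: "?N \<in> sets (F t)" using sets.compl_sets[OF A] by simp
 then have [measurable]: "indicator ?N \<in> borel_measurable (F t)" by simp
 have "(\<integral>\<^sup>+w. indicator ?N w \<partial>Q) = (\<integral>\<^sup>+w. ennreal (Mart l \<psi> t w / I0) * indicator ?N w \<partial>P)"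
  by (rule nn_integral_Q[OF t]) measurable
 also have "\<dots> = (\<integral>\<^sup>+w. 0 \<partial>P)" using P by (intro nn_integral_cong_AE) (auto elim!: eventually_mono)
 finally have "emeasure Q ?N = 0" using sets_F_F_inf[OF N] by (simp add: Q_sets)
 then have "?N \<in> null_sets Q" using sets_F_F_inf[OF N] by (auto simp: Q_sets)
 then show ?thesis by (rule AE_I') auto
qed

lemma exp_mart_small:
 assumes t: "0 \<le> t" and A: "A \<in> sets P" "\<And>w. w \<in> A ==> w t \<le> y"
 shows "(\<integral>\<^sup>+w. ennreal (exp_mart l t w) * indicator A w \<partial>P) \<le> ennreal (exp (l * y - l\<^sup>2 * t / 2))"
proof -
 have "(\<integral>\<^sup>+w. ennreal (exp_mart l t w) * indicator A w \<partial>P) \<le> (\<integral>\<^sup>+w. ennreal (exp (l * y - l\<^sup>2 * t / 2)) \<partial>P)"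
  using A(2) l_pos by (intro nn_integral_mono) (auto simp: exp_mart_def indicator_def ennreal_leI)
 then show ?thesis using emeasure_space_1 by simp
qed

text \<open>In terms of densities: with drift \<open>l\<close> the path does not stay below its
  early maximum. Either it is below \<open>y n\<close> at the late time, which has exponentially
  small weight, or its maximum up to \<open>q\<close> already exceeds \<open>y n\<close>, an event
  of the fixed \<sigma>-algebra \<open>F q\<close> that shrinks to the empty set.\<close>

lemma exp_mart_killed_tendsto:
 assumes q: "0 \<le> q"
 shows "(\<lambda>n. \<integral>\<^sup>+W. ennreal (exp_mart l (q + real n) W) * indicator {W \<in> Omega. W (q + real n) \<le> S q W} W \<partial>P) \<longlonglongrightarrow> 0"
proof -
 define y where "y n = l * real n / 4" for n
 define C where "C n = {W \<in> Omega. y n < S q W}" for n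
 have C: "C n \<in> sets (F q)" for n
  unfolding C_def using borel_measurable_less[OF borel_measurable_const S_measurable[OF q order_refl], of "y n"] by simp
 have EP: "exp_mart l q \<in> borel_measurable P" by (rule F_measurable_P[OF exp_mart_measurable[OF q]])
 have CP: "C n \<in> sets P" for n using C sets_F_F_inf by (auto simp: sets_P)
 have bound: "(\<integral>\<^sup>+W. ennreal (exp_mart l (q + real n) W) * indicator {W \<in> Omega. W (q + real n) \<le> S q W} W \<partial>P)
   \<le> ennreal (exp (l * y n - l\<^sup>2 * (q + real n) / 2)) + (\<integral>\<^sup>+W. indicator (C n) W * ennreal (exp_mart l q W) \<partial>P)" for n
 proof -
  let ?t = "q + real n"
  define B where "B = {W \<in> Omega. W ?t \<le> y n}"
  have t0: "0 \<le> ?t" using q by simp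
  have B: "B \<in> sets P" unfolding B_def using borel_measurable_le[OF coord_P[OF t0] borel_measurable_const, of "y n"] by simp
  have E: "exp_mart l ?t \<in> borel_measurable P" by (rule F_measurable_P[OF exp_mart_measurable[OF t0]])
  have "(\<integral>\<^sup>+W. ennreal (exp_mart l ?t W) * indicator {W \<in> Omega. W ?t \<le> S q W} W \<partial>P)
    \<le> (\<integral>\<^sup>+W. ennreal (exp_mart l ?t W) * indicator B W + indicator (C n) W * ennreal (exp_mart l ?t W) \<partial>P)"
   by (intro nn_integral_mono) (auto simp: indicator_def B_def C_def not_le)
  also have "\<dots> = (\<integral>\<^sup>+W. ennreal (exp_mart l ?t W) * indicator B W \<partial>P) + (\<integral>\<^sup>+W. indicator (C n) W * ennreal (exp_mart l ?t W) \<partial>P)"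
   using E B CP by (intro nn_integral_add) auto
  also have "\<dots> \<le> ennreal (exp (l * y n - l\<^sup>2 * ?t / 2)) + (\<integral>\<^sup>+W. indicator (C n) W * ennreal (exp_mart l q W) \<partial>P)"
   using exp_mart_small[OF t0 B] exp_mart_nn[OF q, of ?t "indicator (C n)" l] C[of n]
   by (intro add_mono) (auto simp: B_def)
  finally show ?thesis .
 qed
 have 1: "(\<lambda>n. ennreal (exp (l * y n - l\<^sup>2 * (q + real n) / 2))) \<longlonglongrightarrow> ennreal 0"
 proof (rule tendsto_ennrealI)
  have "l * y n - l\<^sup>2 * (q + real n) / 2 = - (l\<^sup>2 * q / 2) - l\<^sup>2 / 4 * real n" for n
   by (simp add: y_def power2_eq_square field_simps)
  moreover have "0 < l\<^sup>2 / 4" using l_pos by simp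
  then have "(\<lambda>n. exp (- (l\<^sup>2 * q / 2) - l\<^sup>2 / 4 * real n)) \<longlonglongrightarrow> 0" by real_asymp
  ultimately show "(\<lambda>n. exp (l * y n - l\<^sup>2 * (q + real n) / 2)) \<longlonglongrightarrow> 0" by simp
 qed
 have 2: "(\<lambda>n. \<integral>\<^sup>+W. indicator (C n) W * ennreal (exp_mart l q W) \<partial>P) \<longlonglongrightarrow> (\<integral>\<^sup>+W. 0 \<partial>P)"
 proof (rule nn_integral_dominated_convergence[where w="\<lambda>W. ennreal (exp_mart l q W)"])
  show "AE W in P. (\<lambda>n. indicator (C n) W * ennreal (exp_mart l q W)) \<longlonglongrightarrow> 0"
  proof (intro AE_I2 tendsto_eventually)
   fix W
   have "\<forall>\<^sub>F n in sequentially. 4 * S q W / l < real n"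
    using filterlim_real_sequentially by (simp add: filterlim_at_top_dense)
   then show "\<forall>\<^sub>F n in sequentially. indicator (C n) W * ennreal (exp_mart l q W) = 0"
    by eventually_elim (use l_pos in \<open>auto simp: indicator_def C_def y_def field_simps\<close>)
  qed
  show "(\<integral>\<^sup>+W. ennreal (exp_mart l q W) \<partial>P) < \<infinity>" by (simp add: exp_mart_expectation[OF q])
 qed (use EP CP in \<open>auto simp: indicator_def\<close>)
 show ?thesis
  by (rule tendsto_sandwich[OF _ _ tendsto_const]) (use bound tendsto_add[OF 1 2] in auto)
qed

text \<open>As long as the maximum of time \<open>q\<close> is not exceeded, \<open>S\<close> stays
  constant, so \<open>mart_after\<close> is a discounted multiple of the \<open>sinh\<close>
  martingale killed at that level, and its expectation is the same at all later times. The other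
  summand of \<open>Mart\<close> is negligible on this event at late times, which leaves the density
  of \<open>maxed q\<close>.\<close>

lemma Q_maxed_set:
 assumes q: "0 \<le> q" and A: "A \<in> sets (F q)"
 shows "(\<integral>\<^sup>+W. indicator {W \<in> Omega. maxed q W} W * indicator A W \<partial>Q)
  = (\<integral>\<^sup>+W. ennreal (mart_after l \<psi> q W / I0) * indicator A W \<partial>P)"
proof -
 have S: "S q \<in> borel_measurable (F q)" and x: "(\<lambda>W. W q) \<in> borel_measurable (F q)" using q by (auto intro: S_measurable coord_F)
 have \<psi>S: "(\<lambda>W. \<psi> (S q W)) \<in> borel_measurable (F q)" by (rule measurable_compose[OF S \<psi>_borel])
 have MA: "mart_after l \<psi> q \<in> borel_measurable P" by (rule F_measurable_P[OF mart_after_measurable[OF q]])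
 have mxP: "{W \<in> Omega. maxed q W} \<in> sets Q" using maxed_measurable[OF q] by (simp add: Q_sets)
 have AP: "A \<in> sets P" "A \<in> sets Q" using A sets_F_F_inf by (auto simp: sets_P Q_sets)
 \<comment> \<open>Truncation in two respects: a bounded gap to the level, as
   \<open>killed_martingale\<close> demands, and a bounded \<open>\<psi> (S q W)\<close>, so that
   division by \<open>N\<close> gives a weight in the unit interval.\<close>
 define T where "T N = {W \<in> Omega. W \<in> A \<and> S q W - W q \<le> real N \<and> \<psi> (S q W) \<le> real N}" for N :: nat
 have T: "T N \<in> sets (F q)" for N
 proof -
  have "{W \<in> space (F q). S q W - W q \<le> real N} \<in> sets (F q)" "{W \<in> space (F q). \<psi> (S q W) \<le> real N} \<in> sets (F q)"
   by (intro borel_measurable_le borel_measurable_diff borel_measurable_const S x \<psi>S)+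
  then have "A \<inter> ({W \<in> space (F q). S q W - W q \<le> real N} \<inter> {W \<in> space (F q). \<psi> (S q W) \<le> real N}) \<in> sets (F q)" using A by auto
  moreover have "A \<inter> ({W \<in> space (F q). S q W - W q \<le> real N} \<inter> {W \<in> space (F q). \<psi> (S q W) \<le> real N}) = T N"
   using sets.sets_into_space[OF A] by (auto simp: T_def)
  ultimately show ?thesis by simp
 qed
 have TP: "T N \<in> sets P" "T N \<in> sets Q" for N using T sets_F_F_inf by (auto simp: sets_P Q_sets)
 have trunc: "(\<integral>\<^sup>+W. indicator {W \<in> Omega. maxed q W} W * indicator (T N) W \<partial>Q)
   = (\<integral>\<^sup>+W. ennreal (mart_after l \<psi> q W / I0) * indicator (T N) W \<partial>P)" if N: "0 < N" for N :: nat
 proof -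
  define D where "D n = {W \<in> Omega. \<forall>t\<in>{q..q + real n}. W t \<le> S q W}" for n :: nat
  have D: "D n \<in> sets (F (q + real n))" for n
  proof -
   have "Measurable.pred (F (q + real n)) (\<lambda>W. \<forall>t\<in>{q..q + real n}. W t \<le> S q W)"
    using q by (intro pred_all_le S_measurable coord_F) auto
   then show ?thesis by (simp add: pred_def D_def)
  qed
  have DP: "D n \<in> sets P" "D n \<in> sets Q" for n using D sets_F_F_inf by (auto simp: sets_P Q_sets)
  have S_D: "S (q + real n) W = S q W" if "W \<in> D n" for n W
  proof (rule antisym)
   have w: "W \<in> Omega" using that by (simp add: D_def)
   show "S q W \<le> S (q + real n) W" using w q by (intro S_mono) auto
   have "W u \<le> S q W" if "0 \<le> u" "u \<le> q + real n" for u
    using \<open>W \<in> D n\<close> that S_upper[OF w, of u q] by (cases "u \<le> q") (auto simp: D_def)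
   then show "S (q + real n) W \<le> S q W" using w q by (subst S_le_iff) auto
  qed
  have part2: "(\<integral>\<^sup>+W. ennreal (mart_after l \<psi> (q + real n) W / I0) * indicator (T N \<inter> D n) W \<partial>P)
   = (\<integral>\<^sup>+W. ennreal (mart_after l \<psi> q W / I0) * indicator (T N) W \<partial>P)" if n: "0 < n" for n
  proof -
   let ?t = "q + real n"
   define K where "K W = indicator (T N) W * (\<psi> (S q W) / real N)" for W
   have KF: "K \<in> borel_measurable (F q)" unfolding K_def
    using \<psi>S T[of N] by (intro borel_measurable_times borel_measurable_divide borel_measurable_const borel_measurable_indicator)
   have K01: "0 \<le> K W \<and> K W \<le> 1" for W
    using N \<psi>_pos[of "S q W"] by (auto simp: K_def indicator_def T_def divide_le_eq)
   have Kc: "K W \<noteq> 0 ==> \<bar>S q W - W q\<bar> \<le> real N" for W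
    using S_upper[of W q q] q by (auto simp: K_def indicator_def T_def split: if_splits)
   have km: "(LINT W|P. K W * of_bool (\<forall>t\<in>{q..?t}. W t \<le> S q W) * sinh (l * (S q W - W ?t)))
    = exp (l\<^sup>2 / 2 * (?t - q)) * (LINT W|P. K W * of_bool (W q \<le> S q W) * sinh (l * (S q W - W q)))"
   proof (rule killed_martingale[OF l_pos q _ KF K01 S Kc, where u="\<lambda>x. sinh (l * x)" and C=1])
    show "(\<lambda>x. sinh (l * x)) \<in> borel_measurable borel" by measurable
   qed (use n gauss_sinh_diff in auto)
   have KP: "K \<in> borel_measurable P" "S q \<in> borel_measurable P" using F_measurable_P[OF KF] F_measurable_P[OF S] by auto
   have sb: "(\<lambda>x. sinh (l * x)) \<in> borel_measurable borel" by measurable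
   have i1: "integrable P (\<lambda>W. (K W * indicator (D n) W) * sinh (l * (S q W - W ?t)))"
   proof (rule integrable_killed[OF l_pos q _ _ _ KP(2) _ sb, where C=1 and c="real N"])
    show "(\<lambda>W. K W * indicator (D n) W) \<in> borel_measurable P" using KP DP by (intro borel_measurable_times borel_measurable_indicator)
    show "\<bar>K W * indicator (D n) W\<bar> \<le> 1" for W using K01[of W] by (auto simp: indicator_def)
   qed (use Kc in auto)
   have i2: "integrable P (\<lambda>W. K W * sinh (l * (S q W - W q)))"
   proof (rule integrable_killed[OF l_pos q _ KP(1) _ KP(2) _ sb, where C=1 and c="real N"])
    show "\<bar>K W\<bar> \<le> 1" for W using K01[of W] by auto
   qed (use Kc in auto)
   \<comment> \<open>The discount in \<open>mart_after\<close> compensates exactly the growth rate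
     \<open>l\<^sup>2 / 2\<close> of the \<open>sinh\<close> martingale.\<close>
   have e: "exp (- l\<^sup>2 * ?t / 2) * exp (l\<^sup>2 / 2 * (?t - q)) = exp (- l\<^sup>2 * q / 2)"
    unfolding exp_add[symmetric] by (simp add: field_simps)
   define c where "c t = real N / l * exp (- l\<^sup>2 * t / 2) / I0" for t
   have c0: "0 \<le> c t" for t using l_pos I0_pos by (simp add: c_def)
   have A1: "(\<integral>\<^sup>+W. ennreal (mart_after l \<psi> ?t W / I0) * indicator (T N \<inter> D n) W \<partial>P)
     = (\<integral>\<^sup>+W. ennreal (c ?t * ((K W * indicator (D n) W) * sinh (l * (S q W - W ?t)))) \<partial>P)"
    using N by (intro nn_integral_cong) (auto simp: indicator_def S_D mart_after_def K_def c_def mult_ac)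
   also have "\<dots> = ennreal (LINT W|P. c ?t * ((K W * indicator (D n) W) * sinh (l * (S q W - W ?t))))"
   proof (rule nn_integral_eq_integral[OF integrable_mult_right[OF i1]], rule AE_I2)
    fix W
    have "W \<in> D n ==> W ?t \<le> S q W" using q by (auto simp: D_def)
    then show "0 \<le> c ?t * ((K W * indicator (D n) W) * sinh (l * (S q W - W ?t)))"
     using c0[of ?t] K01[of W] l_pos by (auto simp: indicator_def intro!: mult_nonneg_nonneg)
   qed
   also have "(LINT W|P. c ?t * ((K W * indicator (D n) W) * sinh (l * (S q W - W ?t))))
     = c ?t * (LINT W|P. K W * of_bool (\<forall>t\<in>{q..?t}. W t \<le> S q W) * sinh (l * (S q W - W ?t)))"
    by (subst integral_mult_right_zero, rule arg_cong[where f="\<lambda>x. c ?t * x"], intro Bochner_Integration.integral_cong refl)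
     (auto simp: indicator_def D_def)
   also have "\<dots> = c q * (LINT W|P. K W * of_bool (W q \<le> S q W) * sinh (l * (S q W - W q)))"
    unfolding km c_def e[symmetric] by simp
   also have "\<dots> = (LINT W|P. c q * (K W * sinh (l * (S q W - W q))))"
    by (subst integral_mult_right_zero, rule arg_cong[where f="\<lambda>x. c q * x"], intro Bochner_Integration.integral_cong refl)
     (use S_upper[of _ q q] q in auto)
   also have "ennreal \<dots> = (\<integral>\<^sup>+W. ennreal (c q * (K W * sinh (l * (S q W - W q)))) \<partial>P)"
   proof (rule nn_integral_eq_integral[symmetric, OF integrable_mult_right[OF i2]], rule AE_I2)
    fix W assume "W \<in> space P"
    then show "0 \<le> c q * (K W * sinh (l * (S q W - W q)))"
     using c0[of q] K01[of W] l_pos S_upper[of W q q] q by (auto intro!: mult_nonneg_nonneg)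
   qed
   also have "\<dots> = (\<integral>\<^sup>+W. ennreal (mart_after l \<psi> q W / I0) * indicator (T N) W \<partial>P)"
    using N by (intro nn_integral_cong) (auto simp: indicator_def mart_after_def K_def c_def mult_ac)
   finally show ?thesis .
  qed
  have QD: "(\<integral>\<^sup>+W. indicator (D n) W * indicator (T N) W \<partial>Q)
   = (\<integral>\<^sup>+W. ennreal (tail l \<psi> (S (q + real n) W) * exp_mart l (q + real n) W / I0) * indicator (T N \<inter> D n) W \<partial>P)
    + (\<integral>\<^sup>+W. ennreal (mart_after l \<psi> q W / I0) * indicator (T N) W \<partial>P)" if n: "0 < n" for n
  proof -
   let ?t = "q + real n"
   have t: "0 \<le> ?t" using q by simp
   have TD: "T N \<inter> D n \<in> sets (F ?t)" using D[of n] sets_F_mono[of q ?t "T N"] T[of N] by auto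
   then have TDP: "T N \<inter> D n \<in> sets P" using sets_F_F_inf by (auto simp: sets_P)
   have "(\<integral>\<^sup>+W. indicator (D n) W * indicator (T N) W \<partial>Q) = (\<integral>\<^sup>+W. indicator (T N \<inter> D n) W \<partial>Q)"
    by (intro nn_integral_cong) (auto simp: indicator_def)
   also have "\<dots> = (\<integral>\<^sup>+W. ennreal (Mart l \<psi> ?t W / I0) * indicator (T N \<inter> D n) W \<partial>P)"
    by (rule nn_integral_Q[OF t]) (use TD in simp)
   also have "\<dots> = (\<integral>\<^sup>+W. ennreal (tail l \<psi> (S ?t W) * exp_mart l ?t W / I0) * indicator (T N \<inter> D n) W
     + ennreal (mart_after l \<psi> ?t W / I0) * indicator (T N \<inter> D n) W \<partial>P)"
   proof (intro nn_integral_cong)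
    fix W assume "W \<in> space P"
    then have "0 \<le> mart_after l \<psi> ?t W / I0" "0 \<le> tail l \<psi> (S ?t W) * exp_mart l ?t W / I0"
     using mart_after_nonneg[of W ?t] t I0_pos tail_exp_nonneg[of ?t W] by auto
    moreover have "Mart l \<psi> ?t W / I0 = tail l \<psi> (S ?t W) * exp_mart l ?t W / I0 + mart_after l \<psi> ?t W / I0"
     using l_pos by (subst Mart_split) (auto simp: add_divide_distrib)
    ultimately show "ennreal (Mart l \<psi> ?t W / I0) * indicator (T N \<inter> D n) W
     = ennreal (tail l \<psi> (S ?t W) * exp_mart l ?t W / I0) * indicator (T N \<inter> D n) W
     + ennreal (mart_after l \<psi> ?t W / I0) * indicator (T N \<inter> D n) W"
     by (simp add: distrib_right)
   qed
   also have "\<dots> = (\<integral>\<^sup>+W. ennreal (tail l \<psi> (S ?t W) * exp_mart l ?t W / I0) * indicator (T N \<inter> D n) W \<partial>P)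
     + (\<integral>\<^sup>+W. ennreal (mart_after l \<psi> ?t W / I0) * indicator (T N \<inter> D n) W \<partial>P)"
    using TDP F_measurable_P[OF tail_S_measurable[OF t]] F_measurable_P[OF exp_mart_measurable[OF t]] F_measurable_P[OF mart_after_measurable[OF t]]
    by (intro nn_integral_add borel_measurable_times_ennreal measurable_compose[OF _ measurable_ennreal] borel_measurable_divide borel_measurable_times borel_measurable_indicator borel_measurable_const)
   finally show ?thesis unfolding part2[OF n] .
  qed
  have small: "(\<lambda>n. \<integral>\<^sup>+W. ennreal (tail l \<psi> (S (q + real n) W) * exp_mart l (q + real n) W / I0) * indicator (T N \<inter> D n) W \<partial>P) \<longlonglongrightarrow> 0"
  proof (rule tendsto_sandwich[OF _ _ tendsto_const exp_mart_killed_tendsto[OF q]])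
   show "\<forall>\<^sub>F n in sequentially. (\<integral>\<^sup>+W. ennreal (tail l \<psi> (S (q + real n) W) * exp_mart l (q + real n) W / I0) * indicator (T N \<inter> D n) W \<partial>P)
    \<le> (\<integral>\<^sup>+W. ennreal (exp_mart l (q + real n) W) * indicator {W \<in> Omega. W (q + real n) \<le> S q W} W \<partial>P)"
   proof (rule always_eventually, rule allI, rule nn_integral_mono_AE)
    fix n
    show "AE W in P. ennreal (tail l \<psi> (S (q + real n) W) * exp_mart l (q + real n) W / I0) * indicator (T N \<inter> D n) W
     \<le> ennreal (exp_mart l (q + real n) W) * indicator {W \<in> Omega. W (q + real n) \<le> S q W} W"
     using AE_start AE_space
    proof eventually_elim
     case (elim W)
     have "0 \<le> S (q + real n) W" using S_upper[of W 0 "q + real n"] elim q by auto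
     then have "tail l \<psi> (S (q + real n) W) / I0 \<le> 1" using tail_antimono[of 0] I0_pos by (simp add: divide_le_eq)
     then have "tail l \<psi> (S (q + real n) W) / I0 * exp_mart l (q + real n) W \<le> 1 * exp_mart l (q + real n) W"
      by (intro mult_right_mono) (auto simp: exp_mart_def)
     then have "ennreal (tail l \<psi> (S (q + real n) W) * exp_mart l (q + real n) W / I0) \<le> ennreal (exp_mart l (q + real n) W)"
      by (intro ennreal_leI) simp
     then show ?case using q by (auto simp: indicator_def D_def)
    qed
   qed
  qed auto
  have "(\<lambda>n. \<integral>\<^sup>+W. indicator (D n) W * indicator (T N) W \<partial>Q) \<longlonglongrightarrow> 0 + (\<integral>\<^sup>+W. ennreal (mart_after l \<psi> q W / I0) * indicator (T N) W \<partial>P)"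
  proof (rule Lim_transform_eventually[OF tendsto_add[OF small tendsto_const]])
   show "\<forall>\<^sub>F n in sequentially. (\<integral>\<^sup>+W. ennreal (tail l \<psi> (S (q + real n) W) * exp_mart l (q + real n) W / I0) * indicator (T N \<inter> D n) W \<partial>P)
    + (\<integral>\<^sup>+W. ennreal (mart_after l \<psi> q W / I0) * indicator (T N) W \<partial>P) = (\<integral>\<^sup>+W. indicator (D n) W * indicator (T N) W \<partial>Q)"
    using eventually_gt_at_top[of 0] by eventually_elim (use QD in simp)
  qed
  moreover have "(\<lambda>n. \<integral>\<^sup>+W. indicator (D n) W * indicator (T N) W \<partial>Q) \<longlonglongrightarrow> (\<integral>\<^sup>+W. indicator {W \<in> Omega. maxed q W} W * indicator (T N) W \<partial>Q)"
  proof (rule nn_integral_dominated_convergence[where w="\<lambda>_. 1"])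
   show "(\<integral>\<^sup>+W. 1 \<partial>Q) < \<infinity>" using Q.emeasure_space_1 by simp
   show "AE W in Q. (\<lambda>n. indicator (D n) W * indicator (T N) W) \<longlonglongrightarrow> indicator {W \<in> Omega. maxed q W} W * (indicator (T N) W :: ennreal)"
   proof (intro AE_I2 tendsto_eventually)
    fix W assume w: "W \<in> space Q"
    have "\<forall>\<^sub>F n in sequentially. W \<in> D n \<longleftrightarrow> maxed q W"
    proof (cases "maxed q W")
     case True
     then have "W \<in> D n" for n using w q by (auto simp: D_def maxed_def)
     then show ?thesis using True by simp
    next
     case False
     then obtain t where t: "0 \<le> t" "S q W < W t" by (auto simp: maxed_def not_le)
     then have "q \<le> t" using S_upper[of W t q] w by (cases "t \<le> q") auto
     moreover have "\<forall>\<^sub>F n in sequentially. t - q < real n"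
      using filterlim_real_sequentially by (simp add: filterlim_at_top_dense)
     ultimately show ?thesis using False t w
      by (auto elim!: eventually_mono simp: D_def intro!: bexI[of _ t])
    qed
    then show "\<forall>\<^sub>F n in sequentially. indicator (D n) W * indicator (T N) W = indicator {W \<in> Omega. maxed q W} W * (indicator (T N) W :: ennreal)"
     by eventually_elim (use w in \<open>auto simp: indicator_def\<close>)
   qed
  next
   show "(\<lambda>W. indicator {W \<in> Omega. maxed q W} W * indicator (T N) W :: ennreal) \<in> borel_measurable Q"
    by (intro borel_measurable_times_ennreal borel_measurable_indicator mxP TP)
   show "(\<lambda>W. indicator (D n) W * indicator (T N) W :: ennreal) \<in> borel_measurable Q" for n
    by (intro borel_measurable_times_ennreal borel_measurable_indicator DP TP)
  qed (auto simp: indicator_def)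
  ultimately show ?thesis using LIMSEQ_unique by fastforce
 qed
 have inc: "W \<in> T (Suc N) ==> N \<le> N' ==> W \<in> T (Suc N')" for N N' W by (auto simp: T_def)
 have lim: "(\<lambda>N. w W * indicator (T (Suc N)) W) \<longlonglongrightarrow> (w W * indicator A W :: ennreal)" for w W
 proof (rule tendsto_eventually)
  have "\<forall>\<^sub>F N in sequentially. max (S q W - W q) (\<psi> (S q W)) < real N"
   using filterlim_real_sequentially unfolding filterlim_at_top_dense by (rule spec)
  then show "\<forall>\<^sub>F N in sequentially. w W * indicator (T (Suc N)) W = w W * indicator A W"
   by eventually_elim (use sets.sets_into_space[OF A] in \<open>auto simp: indicator_def T_def\<close>)
 qed
 have "(\<lambda>N. \<integral>\<^sup>+W. indicator {W \<in> Omega. maxed q W} W * indicator (T (Suc N)) W \<partial>Q) \<longlonglongrightarrow> (\<integral>\<^sup>+W. indicator {W \<in> Omega. maxed q W} W * indicator A W \<partial>Q)"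
 proof (rule nn_integral_LIMSEQ[OF _ _ lim])
  show "incseq (\<lambda>N W. indicator {W \<in> Omega. maxed q W} W * indicator (T (Suc N)) W :: ennreal)"
   by (auto simp: incseq_def le_fun_def split: split_indicator dest: inc)
 qed (intro borel_measurable_times_ennreal borel_measurable_indicator mxP TP)
 moreover have "(\<lambda>N. \<integral>\<^sup>+W. ennreal (mart_after l \<psi> q W / I0) * indicator (T (Suc N)) W \<partial>P) \<longlonglongrightarrow> (\<integral>\<^sup>+W. ennreal (mart_after l \<psi> q W / I0) * indicator A W \<partial>P)"
 proof (rule nn_integral_LIMSEQ[OF _ _ lim])
  show "incseq (\<lambda>N W. ennreal (mart_after l \<psi> q W / I0) * indicator (T (Suc N)) W)"
   by (auto simp: incseq_def le_fun_def split: split_indicator dest: inc)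
 qed (use MA TP in measurable)
 moreover have "(\<integral>\<^sup>+W. indicator {W \<in> Omega. maxed q W} W * indicator (T (Suc N)) W \<partial>Q) = (\<integral>\<^sup>+W. ennreal (mart_after l \<psi> q W / I0) * indicator (T (Suc N)) W \<partial>P)" for N
  by (rule trunc) simp
 ultimately show ?thesis using LIMSEQ_unique by simp
qed

lemma nn_integral_Q_maxed:
 assumes q: "0 \<le> q" and K: "K \<in> borel_measurable (F q)"
 shows "(\<integral>\<^sup>+w. indicator {w \<in> Omega. maxed q w} w * K w \<partial>Q) = (\<integral>\<^sup>+w. ennreal (mart_after l \<psi> q w / I0) * K w \<partial>P)"
proof (rule nn_integral_transfer[OF id_QF id_PF _ _ _ _ Q_maxed_set[OF q] K])
 have "{w \<in> Omega. maxed q w} \<in> sets Q" using maxed_measurable[OF q] by (simp only: Q_sets)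
 then show "indicator {w \<in> Omega. maxed q w} \<in> borel_measurable Q" by (rule borel_measurable_indicator)
qed (use F_measurable_P[OF mart_after_measurable[OF q]] in auto)

text \<open>The total density on \<open>F q\<close> is known and the part carried by
  \<open>maxed q\<close> has been found; what remains is carried by the paths whose maximum is still
  to come.\<close>

lemma emeasure_Q_not_maxed:
 assumes q: "0 \<le> q" and A: "A \<in> sets (F q)"
 shows "emeasure Q (A \<inter> {w \<in> Omega. \<not> maxed q w}) = (\<integral>\<^sup>+w. ennreal (tail l \<psi> (S q w) * exp_mart l q w / I0) * indicator A w \<partial>P)"
proof -
 have AP: "A \<in> sets P" "A \<in> sets Q" using A sets_F_F_inf by (auto simp: sets_P Q_sets)
 have mx: "{w \<in> Omega. maxed q w} \<in> sets Q" using maxed_measurable[OF q] by (simp add: Q_sets)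
 have AO: "A \<subseteq> Omega" using sets.sets_into_space[OF A] by simp
 let ?N = "A \<inter> {w \<in> Omega. \<not> maxed q w}" and ?M = "A \<inter> {w \<in> Omega. maxed q w}"
 have "?N = A - {w \<in> Omega. maxed q w}" using AO by auto
 then have N: "?N \<in> sets Q" using AP mx by auto
 have "emeasure Q ?N + emeasure Q ?M = emeasure Q (?N \<union> ?M)"
  using N mx AP by (intro plus_emeasure) auto
 also have "?N \<union> ?M = A" using AO by auto
 also have "emeasure Q A = (\<integral>\<^sup>+w. ennreal (Mart l \<psi> q w / I0) * indicator A w \<partial>P)"
  using nn_integral_Q[OF q, of "indicator A"] A AP by simp
 also have "\<dots> = (\<integral>\<^sup>+w. ennreal (tail l \<psi> (S q w) * exp_mart l q w / I0) * indicator A w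
   + ennreal (mart_after l \<psi> q w / I0) * indicator A w \<partial>P)"
 proof (intro nn_integral_cong)
  fix w assume "w \<in> space P"
  then have "0 \<le> mart_after l \<psi> q w / I0" "0 \<le> tail l \<psi> (S q w) * exp_mart l q w / I0"
   using mart_after_nonneg[of w q] q I0_pos tail_exp_nonneg[of q w] by auto
  moreover have "Mart l \<psi> q w / I0 = tail l \<psi> (S q w) * exp_mart l q w / I0 + mart_after l \<psi> q w / I0"
   using l_pos by (subst Mart_split) (auto simp: add_divide_distrib)
  ultimately show "ennreal (Mart l \<psi> q w / I0) * indicator A w
   = ennreal (tail l \<psi> (S q w) * exp_mart l q w / I0) * indicator A w + ennreal (mart_after l \<psi> q w / I0) * indicator A w"
   by (simp add: distrib_right)
 qed
 also have "\<dots> = (\<integral>\<^sup>+w. ennreal (tail l \<psi> (S q w) * exp_mart l q w / I0) * indicator A w \<partial>P)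
   + (\<integral>\<^sup>+w. ennreal (mart_after l \<psi> q w / I0) * indicator A w \<partial>P)"
  using AP F_measurable_P[OF tail_S_measurable[OF q]] F_measurable_P[OF exp_mart_measurable[OF q]] F_measurable_P[OF mart_after_measurable[OF q]]
  by (intro nn_integral_add borel_measurable_times_ennreal measurable_compose[OF _ measurable_ennreal] borel_measurable_divide borel_measurable_times borel_measurable_indicator borel_measurable_const)
 also have "(\<integral>\<^sup>+w. ennreal (mart_after l \<psi> q w / I0) * indicator A w \<partial>P) = emeasure Q ?M"
 proof -
  have "emeasure Q ?M = (\<integral>\<^sup>+w. indicator {w \<in> Omega. maxed q w} w * indicator A w \<partial>Q)"
   using AP mx by (subst nn_integral_indicator[symmetric]) (auto intro!: nn_integral_cong simp del: nn_integral_indicator simp: indicator_def)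
  then show ?thesis using Q_maxed_set[OF q A] by simp
 qed
 finally show ?thesis by (simp add: ennreal_add_left_cancel add.commute)
qed

text \<open>At time \<open>n\<close> the density of paths whose maximum is still to come is small
  for one of two reasons: where the running maximum is above \<open>l * real n / 4\<close> the tail
  is small, and elsewhere the drifted path is unlikely to be so low.\<close>

lemma AE_maxed: "AE w in Q. \<exists>n::nat. maxed (real n) w"
proof -
 define N where "N n = {w \<in> Omega. \<not> maxed (real n) w}" for n :: nat
 have "N n = Omega - {w \<in> Omega. maxed (real n) w}" for n by (auto simp: N_def)
 then have NQ: "N n \<in> sets Q" for n using maxed_measurable[of "real n"] sets.compl_sets[of "{w \<in> Omega. maxed (real n) w}" Q] by (simp add: Q_sets)
 have "emeasure Q (N n) \<le> ennreal (tail l \<psi> (l * real n / 4) / I0) + ennreal (exp (- (l\<^sup>2 / 4) * real n))" for n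
 proof -
  let ?q = "real n" and ?y = "l * real n / 4"
  define B where "B = {w \<in> Omega. w ?q \<le> ?y}"
  have B: "B \<in> sets P" unfolding B_def using borel_measurable_le[OF coord_P[of ?q] borel_measurable_const, of ?y] by simp
  have E: "exp_mart l ?q \<in> borel_measurable P" by (rule F_measurable_P[OF exp_mart_measurable]) simp
  have "emeasure Q (N n) = emeasure Q (Omega \<inter> {w \<in> Omega. \<not> maxed ?q w})" by (rule arg_cong[where f="emeasure Q"]) (auto simp: N_def)
  also have "\<dots> = (\<integral>\<^sup>+w. ennreal (tail l \<psi> (S ?q w) * exp_mart l ?q w / I0) * indicator Omega w \<partial>P)"
   by (rule emeasure_Q_not_maxed) (use sets.top[of "F ?q"] in auto)
  also have "\<dots> \<le> (\<integral>\<^sup>+w. ennreal (tail l \<psi> ?y / I0) * ennreal (exp_mart l ?q w) + ennreal (exp_mart l ?q w) * indicator B w \<partial>P)"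
  proof (intro nn_integral_mono_AE)
   show "AE w in P. ennreal (tail l \<psi> (S ?q w) * exp_mart l ?q w / I0) * indicator Omega w
    \<le> ennreal (tail l \<psi> ?y / I0) * ennreal (exp_mart l ?q w) + ennreal (exp_mart l ?q w) * indicator B w"
    using AE_start AE_space
   proof eventually_elim
    case (elim w)
    have e0: "0 \<le> exp_mart l ?q w" by (simp add: exp_mart_def)
    have eq: "tail l \<psi> (S ?q w) * exp_mart l ?q w / I0 = tail l \<psi> (S ?q w) / I0 * exp_mart l ?q w" by simp
    have S0: "0 \<le> S ?q w" "w ?q \<le> S ?q w" using S_upper[of w 0 ?q] S_upper[of w ?q ?q] elim by auto
    show ?case
    proof (cases "?y \<le> S ?q w")
     case True
     then have "tail l \<psi> (S ?q w) / I0 \<le> tail l \<psi> ?y / I0" using tail_antimono I0_pos by (intro divide_right_mono) auto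
     then have "tail l \<psi> (S ?q w) / I0 * exp_mart l ?q w \<le> tail l \<psi> ?y / I0 * exp_mart l ?q w" using e0 by (rule mult_right_mono)
     then have "ennreal (tail l \<psi> (S ?q w) * exp_mart l ?q w / I0) \<le> ennreal (tail l \<psi> ?y / I0) * ennreal (exp_mart l ?q w)"
      unfolding eq using e0 by (subst ennreal_mult''[symmetric]) (auto intro: ennreal_leI)
     then show ?thesis using elim by (auto intro: add_increasing2)
    next
     case False
     then have "w \<in> B" using S0 elim by (auto simp: B_def)
     have "tail l \<psi> (S ?q w) / I0 \<le> 1" using tail_antimono[OF S0(1)] I0_pos by (simp add: divide_le_eq)
     then have "tail l \<psi> (S ?q w) / I0 * exp_mart l ?q w \<le> 1 * exp_mart l ?q w" using e0 by (rule mult_right_mono)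
     then have "ennreal (tail l \<psi> (S ?q w) * exp_mart l ?q w / I0) \<le> ennreal (exp_mart l ?q w)"
      unfolding eq by (intro ennreal_leI) simp
     then show ?thesis using \<open>w \<in> B\<close> elim by (auto intro: add_increasing)
    qed
   qed
  qed
  also have "\<dots> = ennreal (tail l \<psi> ?y / I0) * (\<integral>\<^sup>+w. ennreal (exp_mart l ?q w) \<partial>P) + (\<integral>\<^sup>+w. ennreal (exp_mart l ?q w) * indicator B w \<partial>P)"
   using E B by (subst nn_integral_add) (auto simp: nn_integral_cmult)
  also have "\<dots> \<le> ennreal (tail l \<psi> ?y / I0) * 1 + ennreal (exp (l * ?y - l\<^sup>2 * ?q / 2))"
   using exp_mart_small[OF _ B, of ?q ?y] by (intro add_mono) (auto simp: exp_mart_expectation B_def)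
  also have "l * ?y - l\<^sup>2 * ?q / 2 = - (l\<^sup>2 / 4) * real n" by (simp add: power2_eq_square field_simps)
  finally show ?thesis by simp
 qed
 moreover have "(\<lambda>n. ennreal (tail l \<psi> (l * real n / 4) / I0) + ennreal (exp (- (l\<^sup>2 / 4) * real n))) \<longlonglongrightarrow> ennreal (0 / I0) + ennreal 0"
 proof (intro tendsto_add tendsto_ennrealI tendsto_divide tail_tendsto_0 tendsto_const)
  have "0 < l\<^sup>2 / 4" using l_pos by simp
  then show "(\<lambda>n. exp (- (l\<^sup>2 / 4) * real n)) \<longlonglongrightarrow> 0" by real_asymp
 qed (use I0_pos in simp)
 ultimately have lim: "(\<lambda>n. emeasure Q (N n)) \<longlonglongrightarrow> 0"
  by (intro tendsto_sandwich[of "\<lambda>_. 0" "\<lambda>n. emeasure Q (N n)"]) auto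
 have "emeasure Q (\<Inter>n. N n) \<le> 0"
  by (rule LIMSEQ_le_const[OF lim]) (auto intro!: exI[of _ 0] emeasure_mono NQ)
 then have "(\<Inter>n. N n) \<in> null_sets Q" using NQ by auto
 then show ?thesis by (rule AE_I') (auto simp: N_def)
qed

text \<open>For each pair of rationals the clause about not touching the maximum again is an event
  of finite horizon, so it transfers from \<open>P\<close>.\<close>

lemma AE_good: "AE w in Q. good_path w"
proof -
 have 1: "AE w in Q. w 0 = 0"
 proof (rule AE_Q_F[OF order_refl _ AE_start])
  have "(\<lambda>w. w 0) -` {0} \<inter> space (F 0) \<in> sets (F 0)" by (intro measurable_sets[OF coord_F]) auto
  then show "{w \<in> Omega. w 0 = 0} \<in> sets (F 0)" by (simp add: vimage_def Int_def conj_commute)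
 qed
 have "AE w in Q. 0 \<le> p --> p < q --> (\<forall>t\<in>{of_rat p..of_rat q}. w t \<le> S (of_rat p) w) -->
   (\<exists>m::nat. \<forall>t\<in>{of_rat p..of_rat q}. w t \<le> S (of_rat p) w - 1 / real (Suc m))" for p q :: rat
 proof (cases "0 \<le> p \<and> p < q")
  case True
  then have pq: "0 \<le> real_of_rat p" "real_of_rat p < of_rat q" "0 \<le> real_of_rat q" by (auto simp: of_rat_less)
  let ?R = "\<lambda>w. (\<forall>t\<in>{real_of_rat p..of_rat q}. w t \<le> S (of_rat p) w) -->
   (\<exists>m::nat. \<forall>t\<in>{of_rat p..of_rat q}. w t \<le> S (of_rat p) w - 1 / real (Suc m))"
  have S: "S (of_rat p) \<in> borel_measurable (F (of_rat q))" using pq by (intro S_measurable) auto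
  have "Measurable.pred (F (of_rat q)) ?R"
   using pq by (intro pred_intros_logic pred_intros_countable pred_all_le borel_measurable_diff borel_measurable_const S)
    (auto intro!: coord_F intro: order_trans[of 0 "real_of_rat p"])
  then have "{w \<in> Omega. ?R w} \<in> sets (F (of_rat q))" unfolding pred_def by simp
  from AE_Q_F[OF pq(3) this max_not_reattained[OF pq(1,2)]] show ?thesis by (auto elim: eventually_mono)
 next
  case False
  then show ?thesis by (intro AE_I2) blast
 qed
 then have "AE w in Q. \<forall>p q::rat. 0 \<le> p --> p < q --> (\<forall>t\<in>{of_rat p..of_rat q}. w t \<le> S (of_rat p) w) -->
   (\<exists>m::nat. \<forall>t\<in>{of_rat p..of_rat q}. w t \<le> S (of_rat p) w - 1 / real (Suc m))"
  by (intro AE_all_countable[THEN iffD2] allI)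
 with 1 AE_maxed AE_space show ?thesis
  by eventually_elim (simp add: good_path_def)
qed

end

section \<open>The path up to the time of the maximum\<close>

text \<open>Events that are decided before the lifetime ends. They generate a \<open>\<sigma>\<close>-algebra for which
 \<^const>\<open>stopped_path\<close> is measurable, up to its value at lifetime 0.\<close>

definition alive_events :: "(ennreal \<times> (real => real)) set set" where
 "alive_events = insert (UNIV \<times> Omega) {{z. ennreal r < fst z \<and> snd z \<in> \<Gamma>} | r \<Gamma>. 0 \<le> r \<and> \<Gamma> \<in> sets (F r)}"

definition alive_algebra :: "(ennreal \<times> (real => real)) measure" where
 "alive_algebra = sigma (UNIV \<times> Omega) alive_events"

text \<open>At lifetime 0 no alive event reveals the starting value of the path, so a fixed path is
  substituted. Under \<open>Q\<close> the lifetime \<open>g\<close> is positive almost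
  surely.\<close>

definition stop :: "ennreal \<times> (real => real) => ennreal \<times> (real => real)" where
 "stop z = (if fst z = 0 then (0, \<lambda>t\<in>{0..}. 0) else stopped_path (fst z) (snd z))"

lemma sets_F_into: "\<Gamma> \<in> sets (F r) ==> \<Gamma> \<subseteq> Omega"
 using sets.sets_into_space[of \<Gamma> "F r"] by simp

lemma alive_events_Pow: "alive_events \<subseteq> Pow (UNIV \<times> Omega)"
 using sets_F_into by (fastforce simp: alive_events_def)

lemma space_alive_algebra [simp]: "space alive_algebra = UNIV \<times> Omega"
 using alive_events_Pow by (simp add: alive_algebra_def space_measure_of)

lemma sets_alive_algebra: "sets alive_algebra = sigma_sets (UNIV \<times> Omega) alive_events"
 using alive_events_Pow by (simp add: alive_algebra_def sets_measure_of)

lemma alive_event: "0 \<le> r ==> \<Gamma> \<in> sets (F r) ==> {z. ennreal r < fst z \<and> snd z \<in> \<Gamma>} \<in> sets alive_algebra"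
 unfolding sets_alive_algebra by (rule sigma_sets.Basic) (auto simp: alive_events_def)

lemma Int_stable_alive_events: "Int_stable alive_events"
proof (rule Int_stableI)
 fix A B assume A: "A \<in> alive_events" and B: "B \<in> alive_events"
 show "A \<inter> B \<in> alive_events"
 proof (cases "A = UNIV \<times> Omega \<or> B = UNIV \<times> Omega")
  case True
  then have "A \<inter> B = A \<or> A \<inter> B = B" using A B alive_events_Pow by blast
  then show ?thesis using A B by auto
 next
  case False
  then obtain r \<Gamma> r' \<Gamma>' where r: "0 \<le> r" "\<Gamma> \<in> sets (F r)" "A = {z. ennreal r < fst z \<and> snd z \<in> \<Gamma>}"
   "0 \<le> r'" "\<Gamma>' \<in> sets (F r')" "B = {z. ennreal r' < fst z \<and> snd z \<in> \<Gamma>'}"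
   using A B unfolding alive_events_def by blast
  have G: "\<Gamma> \<inter> \<Gamma>' \<in> sets (F (max r r'))"
   using sets_F_mono[OF max.cobounded1 r(2)] sets_F_mono[OF max.cobounded2 r(5)] by auto
  have "ennreal (max r r') < a \<longleftrightarrow> ennreal r < a \<and> ennreal r' < a" for a
   using linear[of r r'] by (auto simp: max_def dest: order.strict_trans1[OF ennreal_leI])
  then have "A \<inter> B = {z. ennreal (max r r') < fst z \<and> snd z \<in> \<Gamma> \<inter> \<Gamma>'}"
   by (auto simp: r(3,6))
  then show ?thesis unfolding alive_events_def using G r(1) by (intro insertI2 CollectI exI[of _ "max r r'"] exI[of _ "\<Gamma> \<inter> \<Gamma>'"]) auto
 qed
qed

lemma measurable_into_alive_algebra:
 assumes [measurable]: "T \<in> borel_measurable M" and Y: "Y \<in> M \<rightarrow>\<^sub>M F_inf"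
 shows "(\<lambda>x. (T x, Y x)) \<in> M \<rightarrow>\<^sub>M alive_algebra"
 unfolding alive_algebra_def
proof (rule measurable_measure_of[OF alive_events_Pow])
 have YO: "Y x \<in> Omega" if "x \<in> space M" for x using measurable_space[OF Y that] by simp
 then show "(\<lambda>x. (T x, Y x)) \<in> space M \<rightarrow> UNIV \<times> Omega" by auto
 fix A assume "A \<in> alive_events"
 then consider "A = UNIV \<times> Omega" | r \<Gamma> where "\<Gamma> \<in> sets (F r)" "A = {z. ennreal r < fst z \<and> snd z \<in> \<Gamma>}"
  unfolding alive_events_def by blast
 then show "(\<lambda>x. (T x, Y x)) -` A \<inter> space M \<in> sets M"
 proof cases
  case 1
  then have "(\<lambda>x. (T x, Y x)) -` A \<inter> space M = space M" using YO by auto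
  then show ?thesis by simp
 next
  case 2
  have "{x \<in> space M. ennreal r < T x} \<in> sets M" by measurable
  moreover have "Y -` \<Gamma> \<inter> space M \<in> sets M" by (rule measurable_sets[OF Y sets_F_F_inf[OF 2(1)]])
  moreover have "(\<lambda>x. (T x, Y x)) -` A \<inter> space M = {x \<in> space M. ennreal r < T x} \<inter> (Y -` \<Gamma> \<inter> space M)" by (auto simp: 2(2))
  ultimately show ?thesis by auto
 qed
qed

text \<open>The alive events are stable under intersection, so two laws need only be compared on
  them and in total mass.\<close>

lemma alive_distr_eqI:
 assumes fin: "finite_measure M1"
  and m: "\<phi>1 \<in> M1 \<rightarrow>\<^sub>M alive_algebra" "\<phi>2 \<in> M2 \<rightarrow>\<^sub>M alive_algebra"
  and total: "emeasure M1 (space M1) = emeasure M2 (space M2)"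
  and eq: "\<And>r \<Gamma>. 0 \<le> r ==> \<Gamma> \<in> sets (F r) ==>
   emeasure M1 {x \<in> space M1. ennreal r < fst (\<phi>1 x) \<and> snd (\<phi>1 x) \<in> \<Gamma>} = emeasure M2 {x \<in> space M2. ennreal r < fst (\<phi>2 x) \<and> snd (\<phi>2 x) \<in> \<Gamma>}"
 shows "distr M1 alive_algebra \<phi>1 = distr M2 alive_algebra \<phi>2"
proof (rule measure_eqI_generator_eq[OF Int_stable_alive_events alive_events_Pow, where A="\<lambda>_. UNIV \<times> Omega"])
 fix X assume X: "X \<in> alive_events"
 then have XS: "X \<in> sets alive_algebra" unfolding sets_alive_algebra by (rule sigma_sets.Basic)
 from X consider "X = UNIV \<times> Omega" | r \<Gamma> where "0 \<le> r" "\<Gamma> \<in> sets (F r)" "X = {z. ennreal r < fst z \<and> snd z \<in> \<Gamma>}"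
  unfolding alive_events_def by blast
 then show "emeasure (distr M1 alive_algebra \<phi>1) X = emeasure (distr M2 alive_algebra \<phi>2) X"
 proof cases
  case 1
  have "\<phi>1 -` X \<inter> space M1 = space M1" "\<phi>2 -` X \<inter> space M2 = space M2"
   using measurable_space[OF m(1)] measurable_space[OF m(2)] by (auto simp: 1)
  then show ?thesis using total by (simp add: emeasure_distr[OF m(1) XS] emeasure_distr[OF m(2) XS])
 next
  case 2
  have "\<phi>1 -` X \<inter> space M1 = {x \<in> space M1. ennreal r < fst (\<phi>1 x) \<and> snd (\<phi>1 x) \<in> \<Gamma>}"
   "\<phi>2 -` X \<inter> space M2 = {x \<in> space M2. ennreal r < fst (\<phi>2 x) \<and> snd (\<phi>2 x) \<in> \<Gamma>}" by (auto simp: 2(3))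
  then show ?thesis using eq[OF 2(1,2)] by (simp only: emeasure_distr[OF m(1) XS] emeasure_distr[OF m(2) XS])
 qed
next
 show "range (\<lambda>_. UNIV \<times> Omega) \<subseteq> alive_events" by (auto simp: alive_events_def)
 show "emeasure (distr M1 alive_algebra \<phi>1) (UNIV \<times> Omega) \<noteq> \<infinity>" for i :: nat
  using finite_measure.emeasure_finite[OF finite_measure.finite_measure_distr[OF fin m(1)]] by simp
qed (auto simp: sets_alive_algebra)

lemma fst_alive_measurable: "fst \<in> borel_measurable alive_algebra"
proof (rule borel_measurableI_greater)
 fix y :: ennreal
 show "{z \<in> space alive_algebra. y < fst z} \<in> sets alive_algebra"
 proof (cases y)
  case (real r)
  have "Omega \<in> sets (F r)" using sets.top[of "F r"] by simp
  from alive_event[OF real(1) this] show ?thesis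
   by (rule back_subst[of "\<lambda>A. A \<in> sets alive_algebra"]) (auto simp: real)
 next
  case top
  then show ?thesis by simp
 qed
qed

lemma stop_measurable: "stop \<in> alive_algebra \<rightarrow>\<^sub>M stopped_path_space"
proof -
 note [measurable] = fst_alive_measurable
 define p where "p z = snd (stop z)" for z
 have stop: "stop z = (fst z, p z)" for z by (simp add: p_def stop_def stopped_path_def)
 have "p \<in> alive_algebra \<rightarrow>\<^sub>M F_inf"
 proof (rule measurable_into_F_inf)
  fix z :: "ennreal \<times> (real => real)" assume "z \<in> space alive_algebra"
  then have "snd z \<in> Omega" by auto
  then show "p z \<in> Omega" unfolding p_def stop_def
   by (auto intro!: snd_stopped_path_in_Omega restrict_in_Omega)
 next
  fix t :: real assume t: "0 \<le> t"
  define m where "m z = enn2real (min (ennreal t) (fst z))" for z :: "ennreal \<times> (real => real)"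
  have m [measurable]: "m \<in> borel_measurable alive_algebra" unfolding m_def by measurable
  \<comment> \<open>For \<open>m z > 0\<close> the largest index whose grid time is strictly below
    \<open>m z\<close>. For \<open>m z = 0\<close> the conversion to naturals gives the index 0,
    which still lies before a positive lifetime.\<close>
  define k where "k n z = nat (\<lceil>real n * m z\<rceil> - 1)" for n z
  define f where "f n i z = (if ennreal (real i / real n) < fst z then snd z (min t (real i / real n)) else 0)"
   for n i :: nat and z :: "ennreal \<times> (real => real)"
  have f: "f n i \<in> borel_measurable alive_algebra" for n i
  proof (rule borel_measurable_iff_greater[THEN iffD2], rule allI)
   fix a :: real
   let ?r = "real i / real n"
   have r: "0 \<le> ?r" by simp
   have x: "(\<lambda>W. W (min t ?r)) \<in> borel_measurable (F ?r)" using t by (intro coord_F) auto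
   have G: "{W \<in> Omega. a < W (min t ?r)} \<in> sets (F ?r)" "{W \<in> Omega. W (min t ?r) \<le> a} \<in> sets (F ?r)"
    using borel_measurable_less[OF borel_measurable_const x, of a] borel_measurable_le[OF x borel_measurable_const, of a] by auto
   show "{z \<in> space alive_algebra. a < f n i z} \<in> sets alive_algebra"
   \<comment> \<open>For negative \<open>a\<close> the default value 0 taken after the lifetime
     exceeds \<open>a\<close>, so it is the complement that is an alive event.\<close>
   proof (cases "a < 0")
    case False
    have "{z \<in> space alive_algebra. a < f n i z} = {z. ennreal ?r < fst z \<and> snd z \<in> {W \<in> Omega. a < W (min t ?r)}}"
     using False by (auto simp: f_def)
    then show ?thesis using alive_event[OF r G(1)] by simp
   next
    case True
    have "{z \<in> space alive_algebra. a < f n i z} = space alive_algebra - {z. ennreal ?r < fst z \<and> snd z \<in> {W \<in> Omega. W (min t ?r) \<le> a}}"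
     using True by (auto simp: f_def)
    then show ?thesis using sets.compl_sets[OF alive_event[OF r G(2)]] by simp
   qed
  qed
  have h: "(\<lambda>z. f n (k n z) z) \<in> borel_measurable alive_algebra" for n
  proof (rule measurable_compose_countable[where f="f n" and g="k n"])
   show "k n \<in> alive_algebra \<rightarrow>\<^sub>M count_space UNIV" unfolding k_def by measurable
  qed (rule f)
  show "(\<lambda>z. p z t) \<in> borel_measurable alive_algebra"
  proof (rule borel_measurable_LIMSEQ_real[OF _ h])
   fix z :: "ennreal \<times> (real => real)" assume "z \<in> space alive_algebra"
   then have w: "snd z \<in> Omega" by auto
   show "(\<lambda>n. f n (k n z) z) \<longlonglongrightarrow> p z t"
   proof (cases "fst z = 0")
    case True
    then show ?thesis using t by (simp add: f_def p_def stop_def)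
   next
    case False
    have pz: "p z t = snd z (m z)" using False t by (simp add: p_def stop_def stopped_path_def m_def)
    have m0: "0 \<le> m z" "m z \<le> t" "ennreal (m z) \<le> fst z"
    proof -
     have "min (ennreal t) (fst z) < top" by (simp add: min_less_iff_disj)
     then have e: "ennreal (m z) = min (ennreal t) (fst z)" unfolding m_def by simp
     show "0 \<le> m z" by (simp add: m_def)
     show "ennreal (m z) \<le> fst z" unfolding e by simp
     have "ennreal (m z) \<le> ennreal t" unfolding e by simp
     then show "m z \<le> t" using t by (simp add: ennreal_le_iff)
    qed
    have kn: "real (k n z) / real n \<le> m z" "ennreal (real (k n z) / real n) < fst z" "m z - 1 / real n \<le> real (k n z) / real n" if n: "0 < n" for n
    proof -
     have *: "real (k n z) < real n * m z \<or> (m z = 0 \<and> k n z = 0)" "real n * m z - 1 \<le> real (k n z)"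
     proof -
      have "(real (k n z) < real n * m z \<or> (m z = 0 \<and> k n z = 0)) \<and> real n * m z - 1 \<le> real (k n z)"
      proof (cases "m z = 0")
       case True
       then show ?thesis by (simp add: k_def)
      next
       case False
       then have "0 < real n * m z" using n m0(1) by simp
       then have "1 \<le> \<lceil>real n * m z\<rceil>" by linarith
       then have "real (k n z) = real_of_int \<lceil>real n * m z\<rceil> - 1" by (simp add: k_def)
       then show ?thesis by linarith
      qed
      then show "real (k n z) < real n * m z \<or> (m z = 0 \<and> k n z = 0)" "real n * m z - 1 \<le> real (k n z)" by auto
     qed
     show "real (k n z) / real n \<le> m z" using *(1) n by (auto simp: divide_le_eq mult.commute)
     show "ennreal (real (k n z) / real n) < fst z"
     proof (cases "m z = 0 \<and> k n z = 0")
      case True then show ?thesis using False by (simp add: zero_less_iff_neq_zero)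
     next
      case F: False
      then have "real (k n z) / real n < m z" using *(1) n by (auto simp: divide_less_eq mult.commute)
      then have "ennreal (real (k n z) / real n) < ennreal (m z)" by (intro ennreal_lessI) (auto intro: le_less_trans[rotated])
      then show ?thesis using m0(3) by (rule less_le_trans)
     qed
     have "(real n * m z - 1) / real n \<le> real (k n z) / real n" using *(2) by (intro divide_right_mono) auto
     then show "m z - 1 / real n \<le> real (k n z) / real n" using n by (simp add: diff_divide_distrib)
    qed
    have "(\<lambda>n. real (k n z) / real n) \<longlonglongrightarrow> m z"
    proof (rule real_tendsto_sandwich)
     show "\<forall>\<^sub>F n in sequentially. m z - 1 / real n \<le> real (k n z) / real n" "\<forall>\<^sub>F n in sequentially. real (k n z) / real n \<le> m z"
      unfolding eventually_sequentially using kn(1,3) by (intro exI[of _ 1]; simp)+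
     show "(\<lambda>n. m z - 1 / real n) \<longlonglongrightarrow> m z" by real_asymp
    qed simp
    then have "(\<lambda>n. snd z (real (k n z) / real n)) \<longlonglongrightarrow> snd z (m z)"
     using m0 by (intro Omega_tendsto[OF w]) auto
    moreover have "\<forall>\<^sub>F n in sequentially. snd z (real (k n z) / real n) = f n (k n z) z"
     using eventually_gt_at_top[of 0]
    proof eventually_elim
     case (elim n)
     then have "min t (real (k n z) / real n) = real (k n z) / real n" using kn(1)[OF elim] m0 by simp
     then show ?case using kn(2)[OF elim] by (simp add: f_def)
    qed
    ultimately show ?thesis unfolding pz by (rule Lim_transform_eventually)
   qed
  qed
 qed
 then have "(\<lambda>z. (fst z, p z)) \<in> alive_algebra \<rightarrow>\<^sub>M stopped_path_space" unfolding stopped_path_space_def by measurable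
 then show ?thesis by (subst ext[OF stop])
qed

text \<open>Through the value at the end of the lifetime, \<open>S_inf\<close> becomes a function of
  the path stopped at \<open>g\<close>; the joint law of the two then follows from the law of the
  stopped path alone.\<close>

definition end_value :: "ennreal \<times> (real => real) => real" where
 "end_value z = snd z (enn2real (fst z))"

lemma end_value_measurable: "end_value \<in> borel_measurable stopped_path_space"
 unfolding end_value_def stopped_path_space_def by (rule eval_measurable) measurable

lemma end_value_stopped_path: "0 \<le> G ==> end_value (stopped_path (ennreal G) w) = w G"
 by (simp add: end_value_def stopped_path_def)

lemma (in wiener) drifted_start: "AE w in P. drifted_path l w 0 = 0"
 using AE_start by eventually_elim (simp add: drifted_path_def)

lemma (in wiener) drifted_F_inf: "drifted_path l \<in> P \<rightarrow>\<^sub>M F_inf"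
 using drifted_path_measurable by (simp cong: measurable_cong_sets add: sets_P)

text \<open>By \<open>cameron_martin\<close> the drifted path stays below \<open>x\<close> up to
  time \<open>n\<close> with probability at most
  \<open>exp (l * x - l\<^sup>2 * real n / 2)\<close>, which tends to 0.\<close>

lemma (in wiener) drifted_hits:
 assumes l: "0 < l" and x: "0 < x"
 shows "AE w in P. \<exists>G. 0 < G \<and> hitting_time x (drifted_path l w) = ennreal G \<and> drifted_path l w G = x"
proof -
 define N where "N n = {w \<in> Omega. S (real n) w < x}" for n :: nat
 have N: "N n \<in> sets (F (real n))" for n
  unfolding N_def using borel_measurable_less[OF S_measurable[of "real n"] borel_measurable_const, of "real n" x] by simp
 have NP: "N n \<in> sets P" for n using N sets_F_F_inf by (auto simp: sets_P)
 have DN: "drifted_path l -` N n \<inter> Omega \<in> sets P" for n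
  using measurable_sets[OF drifted_F_inf sets_F_F_inf[OF N]] by simp
 have bound: "emeasure P (drifted_path l -` N n \<inter> Omega) \<le> ennreal (exp (l * x - l\<^sup>2 * real n / 2))" for n
 proof -
  have "emeasure P (drifted_path l -` N n \<inter> Omega) = (\<integral>\<^sup>+w. indicator (N n) w * ennreal (exp_mart l (real n) w) \<partial>P)"
   by (rule cameron_martin[OF _ N]) simp
  also have "\<dots> \<le> (\<integral>\<^sup>+w. ennreal (exp (l * x - l\<^sup>2 * real n / 2)) \<partial>P)"
  proof (rule nn_integral_mono)
   fix w assume "w \<in> space P"
   then have "w (real n) \<le> S (real n) w" using S_upper[of w "real n" "real n"] by simp
   then show "indicator (N n) w * ennreal (exp_mart l (real n) w) \<le> ennreal (exp (l * x - l\<^sup>2 * real n / 2))"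
    using l by (auto simp: N_def exp_mart_def indicator_def intro!: ennreal_leI)
  qed
  also have "\<dots> = ennreal (exp (l * x - l\<^sup>2 * real n / 2))" using emeasure_space_1 by simp
  finally show ?thesis .
 qed
 have "(\<lambda>n. ennreal (exp (l * x - l\<^sup>2 * real n / 2))) \<longlonglongrightarrow> ennreal 0"
 proof (rule tendsto_ennrealI)
  have "0 < l\<^sup>2" using l by simp
  then show "(\<lambda>n. exp (l * x - l\<^sup>2 * real n / 2)) \<longlonglongrightarrow> 0" by real_asymp
 qed
 then have lim: "(\<lambda>n. emeasure P (drifted_path l -` N n \<inter> Omega)) \<longlonglongrightarrow> 0"
  using bound by (intro tendsto_sandwich[of "\<lambda>_. 0" "\<lambda>n. emeasure P (drifted_path l -` N n \<inter> Omega)"]) auto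
 have "emeasure P (\<Inter>n. drifted_path l -` N n \<inter> Omega) \<le> 0"
  by (rule LIMSEQ_le_const[OF lim]) (use DN in \<open>auto intro!: exI[of _ 0] emeasure_mono\<close>)
 moreover have "(\<Inter>n. drifted_path l -` N n \<inter> Omega) \<in> sets P" by (rule sets.countable_INT) (use DN in auto)
 ultimately have "(\<Inter>n. drifted_path l -` N n \<inter> Omega) \<in> null_sets P" by (intro null_setsI) simp_all
 then have "AE w in P. w \<notin> (\<Inter>n. drifted_path l -` N n \<inter> Omega)" by (rule AE_not_in)
 with AE_space drifted_start[of l] show ?thesis
 proof eventually_elim
  case (elim w)
  have D: "drifted_path l w \<in> Omega" using elim(1) by (simp add: drifted_path_in_Omega)
  obtain n :: nat where "drifted_path l w \<notin> N n" using elim(1,3) by auto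
  then have "\<not> S (real n) (drifted_path l w) < x" using D by (simp add: N_def)
  then have "\<not> ennreal (real n) < hitting_time x (drifted_path l w)"
   using S_lt_iff_hitting_time[OF D, of "real n" x] x elim(2) by simp
  then obtain t where t: "0 \<le> t" "t \<le> real n" "drifted_path l w t = x"
   using hitting_time_greater_iff[OF D, of "real n" x] by auto
  obtain s where s: "0 \<le> s" "drifted_path l w s = x" "hitting_time x (drifted_path l w) = ennreal s"
   using hitting_time_attained[OF D t(1,3)] by metis
  moreover have "s \<noteq> 0" using s(2) elim(2) x by auto
  ultimately show ?case by (intro exI[of _ s]) auto
 qed
qed

context penalised
begin

section \<open>Joint law of the maximum and of the path before it\<close>

definition max_density :: "real => ennreal" where
 "max_density x = ennreal (indicator {0<..} x * (exp (- l * x) * \<psi> x / I0))"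

lemma max_density_borel [measurable]: "max_density \<in> borel_measurable borel"
 unfolding max_density_def by measurable

text \<open>Reads the factor \<open>tail l \<psi> (S r w) / I0\<close> of the density before
  \<open>g\<close> as the probability that a level drawn from \<open>max_density\<close> lies above
  \<open>S r w\<close>. This is what produces the mixture.\<close>

lemma max_density_tail:
 assumes "0 \<le> y" shows "(\<integral>\<^sup>+x. max_density x * indicator {y<..} x \<partial>lborel) = ennreal (tail l \<psi> y / I0)"
proof -
 have "(\<integral>\<^sup>+x. max_density x * indicator {y<..} x \<partial>lborel) = (\<integral>\<^sup>+x. ennreal (1 / I0) * (indicator {y..} x * ennreal (\<psi> x * exp (- l * x))) \<partial>lborel)"
 proof (rule nn_integral_cong_AE)
  show "AE x in lborel. max_density x * indicator {y<..} x = ennreal (1 / I0) * (indicator {y..} x * ennreal (\<psi> x * exp (- l * x)))"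
   using AE_lborel_singleton[of y]
  proof eventually_elim
   case (elim x)
   have "ennreal (exp (- l * x) * \<psi> x / I0) = ennreal (1 / I0) * ennreal (\<psi> x * exp (- l * x))"
    using I0_pos \<psi>_pos[of x] by (subst ennreal_mult'[symmetric]) (auto simp: mult.commute)
   then show ?case using elim assms by (auto simp: max_density_def indicator_def)
  qed
 qed
 also have "\<dots> = ennreal (1 / I0) * ennreal (tail l \<psi> y)"
  unfolding tail_nn by (rule nn_integral_cmult) measurable
 also have "\<dots> = ennreal (tail l \<psi> y / I0)"
  using I0_pos tail_nonneg[of y] by (subst ennreal_mult'[symmetric]) auto
 finally show ?thesis .
qed

lemma max_density_total: "(\<integral>\<^sup>+x. max_density x \<partial>lborel) = 1"
proof -
 have "(\<integral>\<^sup>+x. max_density x \<partial>lborel) = (\<integral>\<^sup>+x. max_density x * indicator {0<..} x \<partial>lborel)"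
  by (intro nn_integral_cong) (auto simp: max_density_def indicator_def)
 then show ?thesis using max_density_tail[of 0] I0_pos by simp
qed

abbreviation "mixture \<equiv> density lborel max_density \<Otimes>\<^sub>M P"

lemma prob_space_max_density: "prob_space (density lborel max_density)"
 by (rule prob_spaceI) (simp add: emeasure_density max_density_total)

lemma g_borel_Q: "g \<in> borel_measurable Q"
 using g_measurable by (simp cong: measurable_cong_sets add: Q_sets)

lemma id_Q_F_inf: "(\<lambda>w. w) \<in> Q \<rightarrow>\<^sub>M F_inf"
 by (rule measurable_ident_sets[OF Q_sets])

lemma mixture_measurable:
 "(\<lambda>z. hitting_time (fst z) (drifted_path l (snd z))) \<in> borel_measurable mixture" (is ?A)
 "(\<lambda>z. drifted_path l (snd z)) \<in> mixture \<rightarrow>\<^sub>M F_inf" (is ?B)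
proof -
 show B: ?B by (rule measurable_compose[OF measurable_snd drifted_F_inf])
 have "fst \<in> borel_measurable mixture"
  using measurable_fst[of "density lborel max_density" P] by (simp cong: measurable_cong_sets)
 from hitting_time_measurable[OF this B] show ?A .
qed

text \<open>The tail factor is written as an integral over levels \<open>x > S r W\<close>. After
  Fubini, \<open>cameron_martin\<close> turns the exponential density on \<open>S r W < x\<close>
  into the law of the drifted path, for which this event says that \<open>x\<close> has not been hit
  by time \<open>r\<close>.\<close>

lemma alive_law:
 "distr Q alive_algebra (\<lambda>W. (g W, W))
  = distr mixture alive_algebra (\<lambda>z. (hitting_time (fst z) (drifted_path l (snd z)), drifted_path l (snd z)))"
proof (rule alive_distr_eqI)
 interpret D: prob_space "density lborel max_density" by (rule prob_space_max_density)
 interpret DP: pair_prob_space "density lborel max_density" P ..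
 show "finite_measure Q" by (rule Q.finite_measure_axioms)
 show "(\<lambda>W. (g W, W)) \<in> Q \<rightarrow>\<^sub>M alive_algebra"
  by (rule measurable_into_alive_algebra[OF g_borel_Q id_Q_F_inf])
 show "(\<lambda>z. (hitting_time (fst z) (drifted_path l (snd z)), drifted_path l (snd z))) \<in> mixture \<rightarrow>\<^sub>M alive_algebra"
  by (rule measurable_into_alive_algebra[OF mixture_measurable])
 show "emeasure Q (space Q) = emeasure mixture (space mixture)"
  using Q.emeasure_space_1 DP.emeasure_space_1 by simp
 fix r \<Gamma> assume r: "0 \<le> r" and \<Gamma>: "\<Gamma> \<in> sets (F r)"
 have \<Gamma>P: "\<Gamma> \<in> sets P" "\<Gamma> \<in> sets Q" using sets_F_F_inf[OF \<Gamma>] by (auto simp: sets_P Q_sets)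
 have SF: "S r \<in> borel_measurable (F r)" using r by (intro S_measurable) auto
 have SP [measurable]: "S r \<in> borel_measurable P" by (rule F_measurable_P[OF SF])
 have EP [measurable]: "exp_mart l r \<in> borel_measurable P" by (rule F_measurable_P[OF exp_mart_measurable[OF r]])
 have "emeasure Q {x \<in> space Q. ennreal r < fst (g x, x) \<and> snd (g x, x) \<in> \<Gamma>} = emeasure Q (\<Gamma> \<inter> {W \<in> Omega. \<not> maxed r W})"
 proof (rule emeasure_eq_AE)
  show "AE x in Q. (x \<in> {x \<in> space Q. ennreal r < fst (g x, x) \<and> snd (g x, x) \<in> \<Gamma>}) = (x \<in> \<Gamma> \<inter> {W \<in> Omega. \<not> maxed r W})"
   using AE_good
  proof eventually_elim
   case (elim W)
   then have w: "W \<in> Omega" by (simp add: good_path_def)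
   from elim obtain G where G: "0 < G" "g W = ennreal G" "maxed r W \<longleftrightarrow> G \<le> r"
    using good_pathE[of W] r by metis
   have "ennreal r < g W \<longleftrightarrow> \<not> maxed r W" using G r by (simp add: ennreal_less_iff not_le)
   then show ?case using w by auto
  qed
  have "{x \<in> space Q. ennreal r < g x} \<in> sets Q" using g_borel_Q by measurable
  then have "\<Gamma> \<inter> {x \<in> space Q. ennreal r < g x} \<in> sets Q" using \<Gamma>P by auto
  also have "\<Gamma> \<inter> {x \<in> space Q. ennreal r < g x} = {x \<in> space Q. ennreal r < fst (g x, x) \<and> snd (g x, x) \<in> \<Gamma>}" by auto
  finally show "{x \<in> space Q. ennreal r < fst (g x, x) \<and> snd (g x, x) \<in> \<Gamma>} \<in> sets Q" .
  have "\<Gamma> - {W \<in> Omega. maxed r W} \<in> sets Q" using \<Gamma>P maxed_measurable[OF r] by (auto simp: Q_sets)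
  also have "\<Gamma> - {W \<in> Omega. maxed r W} = \<Gamma> \<inter> {W \<in> Omega. \<not> maxed r W}" using sets_F_into[OF \<Gamma>] by auto
  finally show "\<Gamma> \<inter> {W \<in> Omega. \<not> maxed r W} \<in> sets Q" .
 qed
 also have "\<dots> = (\<integral>\<^sup>+W. ennreal (tail l \<psi> (S r W) * exp_mart l r W / I0) * indicator \<Gamma> W \<partial>P)"
  by (rule emeasure_Q_not_maxed[OF r \<Gamma>])
 also have "\<dots> = (\<integral>\<^sup>+W. (\<integral>\<^sup>+x. max_density x * indicator {S r W<..} x \<partial>lborel) * (ennreal (exp_mart l r W) * indicator \<Gamma> W) \<partial>P)"
 proof (rule nn_integral_cong_AE)
  show "AE W in P. ennreal (tail l \<psi> (S r W) * exp_mart l r W / I0) * indicator \<Gamma> W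
   = (\<integral>\<^sup>+x. max_density x * indicator {S r W<..} x \<partial>lborel) * (ennreal (exp_mart l r W) * indicator \<Gamma> W)"
   using AE_start AE_space
  proof eventually_elim
   case (elim W)
   have "0 \<le> S r W" using S_upper[of W 0 r] elim r by auto
   moreover have "ennreal (tail l \<psi> (S r W) * exp_mart l r W / I0) = ennreal (tail l \<psi> (S r W) / I0) * ennreal (exp_mart l r W)"
    using tail_nonneg[of "S r W"] I0_pos by (subst ennreal_mult'[symmetric]) (auto simp: exp_mart_def)
   ultimately show ?case by (simp add: max_density_tail mult.assoc)
  qed
 qed
 also have "\<dots> = (\<integral>\<^sup>+W. (\<integral>\<^sup>+x. max_density x * indicator {S r W<..} x * (ennreal (exp_mart l r W) * indicator \<Gamma> W) \<partial>lborel) \<partial>P)"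
  by (intro nn_integral_cong nn_integral_multc[symmetric]) measurable
 also have "\<dots> = (\<integral>\<^sup>+x. (\<integral>\<^sup>+W. max_density x * indicator {S r W<..} x * (ennreal (exp_mart l r W) * indicator \<Gamma> W) \<partial>P) \<partial>lborel)"
 proof -
  interpret LP: pair_sigma_finite lborel P ..
  have "(\<lambda>(x, W). max_density x * indicator {W. S r W < x} W * (ennreal (exp_mart l r W) * indicator \<Gamma> W)) \<in> borel_measurable (lborel \<Otimes>\<^sub>M P)"
   using \<Gamma>P unfolding indicator_def by measurable
  moreover have "(\<lambda>(x, W). max_density x * indicator {W. S r W < x} W * (ennreal (exp_mart l r W) * indicator \<Gamma> W))
    = (\<lambda>(x, W). max_density x * indicator {S r W<..} x * (ennreal (exp_mart l r W) * indicator \<Gamma> W))"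
   by (auto simp: indicator_def)
  ultimately show ?thesis by (intro LP.Fubini') simp
 qed
 also have "\<dots> = (\<integral>\<^sup>+x. max_density x * emeasure P (drifted_path l -` (\<Gamma> \<inter> {W \<in> Omega. S r W < x}) \<inter> Omega) \<partial>lborel)"
 proof (rule nn_integral_cong)
  fix x
  have G: "\<Gamma> \<inter> {W \<in> Omega. S r W < x} \<in> sets (F r)"
   using \<Gamma> borel_measurable_less[OF SF borel_measurable_const, of x] by auto
  have "(\<integral>\<^sup>+W. max_density x * indicator {S r W<..} x * (ennreal (exp_mart l r W) * indicator \<Gamma> W) \<partial>P)
   = (\<integral>\<^sup>+W. max_density x * (indicator (\<Gamma> \<inter> {W \<in> Omega. S r W < x}) W * ennreal (exp_mart l r W)) \<partial>P)"
   by (intro nn_integral_cong) (auto simp: indicator_def)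
  also have "\<dots> = max_density x * (\<integral>\<^sup>+W. indicator (\<Gamma> \<inter> {W \<in> Omega. S r W < x}) W * ennreal (exp_mart l r W) \<partial>P)"
   using sets_F_F_inf[OF G] by (intro nn_integral_cmult) (auto simp: sets_P)
  finally show "(\<integral>\<^sup>+W. max_density x * indicator {S r W<..} x * (ennreal (exp_mart l r W) * indicator \<Gamma> W) \<partial>P)
   = max_density x * emeasure P (drifted_path l -` (\<Gamma> \<inter> {W \<in> Omega. S r W < x}) \<inter> Omega)"
   unfolding cameron_martin[OF r G] .
 qed
 also have "\<dots> = (\<integral>\<^sup>+x. max_density x * emeasure P {W \<in> Omega. ennreal r < hitting_time x (drifted_path l W) \<and> drifted_path l W \<in> \<Gamma>} \<partial>lborel)"
 proof (rule nn_integral_cong)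
  fix x
  show "max_density x * emeasure P (drifted_path l -` (\<Gamma> \<inter> {W \<in> Omega. S r W < x}) \<inter> Omega)
   = max_density x * emeasure P {W \<in> Omega. ennreal r < hitting_time x (drifted_path l W) \<and> drifted_path l W \<in> \<Gamma>}"
  proof (cases "0 < x")
   case False
   then show ?thesis by (simp add: max_density_def)
  next
   case True
   have "emeasure P (drifted_path l -` (\<Gamma> \<inter> {W \<in> Omega. S r W < x}) \<inter> Omega)
    = emeasure P {W \<in> Omega. ennreal r < hitting_time x (drifted_path l W) \<and> drifted_path l W \<in> \<Gamma>}"
   proof (rule emeasure_eq_AE)
    show "AE W in P. (W \<in> drifted_path l -` (\<Gamma> \<inter> {W \<in> Omega. S r W < x}) \<inter> Omega)
      = (W \<in> {W \<in> Omega. ennreal r < hitting_time x (drifted_path l W) \<and> drifted_path l W \<in> \<Gamma>})"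
     using drifted_start[of l] AE_space
    proof eventually_elim
     case (elim W)
     then show ?case using S_lt_iff_hitting_time[OF drifted_path_in_Omega r, of W l x] True
      by (auto simp: drifted_path_in_Omega)
    qed
    have G: "\<Gamma> \<inter> {W \<in> Omega. S r W < x} \<in> sets (F r)"
     using \<Gamma> borel_measurable_less[OF SF borel_measurable_const, of x] by auto
    show "drifted_path l -` (\<Gamma> \<inter> {W \<in> Omega. S r W < x}) \<inter> Omega \<in> sets P"
     using measurable_sets[OF drifted_F_inf sets_F_F_inf[OF G]] by simp
    have h: "(\<lambda>W. hitting_time x (drifted_path l W)) \<in> borel_measurable P"
     by (rule hitting_time_measurable[OF _ drifted_F_inf]) simp
    have "{W \<in> space P. ennreal r < hitting_time x (drifted_path l W)} \<in> sets P"
     using h by measurable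
    moreover have "drifted_path l -` \<Gamma> \<inter> space P \<in> sets P" by (rule measurable_sets[OF drifted_F_inf sets_F_F_inf[OF \<Gamma>]])
    ultimately have "{W \<in> space P. ennreal r < hitting_time x (drifted_path l W)} \<inter> (drifted_path l -` \<Gamma> \<inter> space P) \<in> sets P" by (rule sets.Int)
    moreover have "{W \<in> space P. ennreal r < hitting_time x (drifted_path l W)} \<inter> (drifted_path l -` \<Gamma> \<inter> space P)
     = {W \<in> Omega. ennreal r < hitting_time x (drifted_path l W) \<and> drifted_path l W \<in> \<Gamma>}" by auto
    ultimately show "{W \<in> Omega. ennreal r < hitting_time x (drifted_path l W) \<and> drifted_path l W \<in> \<Gamma>} \<in> sets P" by simp
   qed
   then show ?thesis by simp
  qed
 qed
 also have "\<dots> = emeasure mixture {z \<in> space mixture. ennreal r < hitting_time (fst z) (drifted_path l (snd z)) \<and> drifted_path l (snd z) \<in> \<Gamma>}"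
 proof -
  let ?A = "{z \<in> space mixture. ennreal r < hitting_time (fst z) (drifted_path l (snd z)) \<and> drifted_path l (snd z) \<in> \<Gamma>}"
  have "{z \<in> space mixture. ennreal r < hitting_time (fst z) (drifted_path l (snd z))} \<in> sets mixture"
   using mixture_measurable(1) by measurable
  moreover have "(\<lambda>z. drifted_path l (snd z)) -` \<Gamma> \<inter> space mixture \<in> sets mixture"
   by (rule measurable_sets[OF mixture_measurable(2) sets_F_F_inf[OF \<Gamma>]])
  ultimately have "{z \<in> space mixture. ennreal r < hitting_time (fst z) (drifted_path l (snd z))} \<inter> ((\<lambda>z. drifted_path l (snd z)) -` \<Gamma> \<inter> space mixture) \<in> sets mixture" by (rule sets.Int)
  moreover have "{z \<in> space mixture. ennreal r < hitting_time (fst z) (drifted_path l (snd z))} \<inter> ((\<lambda>z. drifted_path l (snd z)) -` \<Gamma> \<inter> space mixture) = ?A" by auto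
  ultimately have A: "?A \<in> sets mixture" by simp
  have "emeasure mixture ?A = (\<integral>\<^sup>+x. emeasure P (Pair x -` ?A) \<partial>density lborel max_density)"
   by (rule emeasure_pair_measure_alt[OF A])
  also have "\<dots> = (\<integral>\<^sup>+x. max_density x * emeasure P (Pair x -` ?A) \<partial>lborel)"
  proof (rule nn_integral_density)
   have "(\<lambda>x. emeasure P (Pair x -` ?A)) \<in> borel_measurable (density lborel max_density)"
    by (rule measurable_emeasure_Pair[OF A])
   then show "(\<lambda>x. emeasure P (Pair x -` ?A)) \<in> borel_measurable lborel" by simp
  qed simp
  also have "(\<lambda>x. Pair x -` ?A) = (\<lambda>x. {W \<in> Omega. ennreal r < hitting_time x (drifted_path l W) \<and> drifted_path l W \<in> \<Gamma>})"
   by (auto simp: space_pair_measure fun_eq_iff)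
  finally show ?thesis by simp
 qed
 finally show "emeasure Q {x \<in> space Q. ennreal r < fst (g x, x) \<and> snd (g x, x) \<in> \<Gamma>}
  = emeasure mixture {z \<in> space mixture. ennreal r < fst (hitting_time (fst z) (drifted_path l (snd z)), drifted_path l (snd z))
    \<and> snd (hitting_time (fst z) (drifted_path l (snd z)), drifted_path l (snd z)) \<in> \<Gamma>}" by simp
qed

definition drift_kernel :: "real => (ennreal \<times> (real => real)) measure" where
 "drift_kernel x = distr P stopped_path_space
  (\<lambda>w. stopped_path (hitting_time x (drifted_path l w)) (drifted_path l w))"

lemma stopped_g_measurable: "(\<lambda>w. stopped_path (g w) w) \<in> Q \<rightarrow>\<^sub>M stopped_path_space"
 by (rule stopped_path_measurable[OF g_borel_Q id_Q_F_inf])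

lemma S_inf_borel_Q: "(\<lambda>w. real_of_ereal (S_inf w)) \<in> borel_measurable Q"
proof -
 have "S_inf \<in> borel_measurable Q" using S_inf_measurable by (simp cong: measurable_cong_sets add: Q_sets)
 then show ?thesis by measurable
qed

lemma drift_stopped_measurable:
 "(\<lambda>w. stopped_path (hitting_time x (drifted_path l w)) (drifted_path l w)) \<in> P \<rightarrow>\<^sub>M stopped_path_space"
 by (rule stopped_path_measurable[OF hitting_time_measurable drifted_F_inf]) (auto intro: drifted_F_inf)

text \<open>The condition on \<open>S_inf\<close> is moved into the set \<open>B'\<close> by means
  of \<open>end_value\<close>, and \<open>alive_law\<close> is applied to the preimage under
  \<open>stop\<close>. On the mixture side the end value is the level \<open>x\<close> itself, so
  the condition becomes \<open>indicator A x\<close>.\<close>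

lemma joint_law:
 assumes A: "A \<in> sets borel" and B: "B \<in> sets stopped_path_space"
 shows "emeasure Q {W \<in> Omega. real_of_ereal (S_inf W) \<in> A \<and> stopped_path (g W) W \<in> B}
  = (\<integral>\<^sup>+x. max_density x * indicator A x * emeasure (drift_kernel x) B \<partial>lborel)"
proof -
 define B' where "B' = B \<inter> {z \<in> space stopped_path_space. end_value z \<in> A}"
 have B': "B' \<in> sets stopped_path_space"
 proof -
  have "B' = B \<inter> (end_value -` A \<inter> space stopped_path_space)" by (auto simp: B'_def)
  then show ?thesis using sets.Int[OF B measurable_sets[OF end_value_measurable A]] by simp
 qed
 have BS: "z \<in> B ==> z \<in> space stopped_path_space" for z using sets.sets_into_space[OF B] by auto
 have C: "stop -` B' \<inter> space alive_algebra \<in> sets alive_algebra" by (rule measurable_sets[OF stop_measurable B'])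
 let ?C = "stop -` B' \<inter> space alive_algebra"
 have m1: "(\<lambda>W. (g W, W)) \<in> Q \<rightarrow>\<^sub>M alive_algebra"
  by (rule measurable_into_alive_algebra[OF g_borel_Q id_Q_F_inf])
 have m2: "(\<lambda>z. (hitting_time (fst z) (drifted_path l (snd z)), drifted_path l (snd z))) \<in> mixture \<rightarrow>\<^sub>M alive_algebra" (is "?\<phi> \<in> _")
  by (rule measurable_into_alive_algebra[OF mixture_measurable])
 have "emeasure Q {W \<in> Omega. real_of_ereal (S_inf W) \<in> A \<and> stopped_path (g W) W \<in> B} = emeasure Q ((\<lambda>W. (g W, W)) -` ?C \<inter> space Q)"
 proof (rule emeasure_eq_AE)
  show "AE W in Q. (W \<in> {W \<in> Omega. real_of_ereal (S_inf W) \<in> A \<and> stopped_path (g W) W \<in> B}) = (W \<in> (\<lambda>W. (g W, W)) -` ?C \<inter> space Q)"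
   using AE_good
  proof eventually_elim
   case (elim W)
   then have w: "W \<in> Omega" by (simp add: good_path_def)
   from elim obtain G where G: "0 < G" "g W = ennreal G" "S_inf W = ereal (W G)"
    using good_pathE[of W] by metis
   then have "stop (g W, W) = stopped_path (g W) W" by (simp add: stop_def)
   moreover have "end_value (stopped_path (g W) W) = real_of_ereal (S_inf W)" using G by (simp add: end_value_stopped_path)
   ultimately show ?case using w BS[of "stopped_path (g W) W"] by (auto simp: B'_def)
  qed
  have "{W \<in> space Q. real_of_ereal (S_inf W) \<in> A} \<in> sets Q"
   using measurable_sets[OF S_inf_borel_Q A] by (simp add: vimage_def Int_def conj_commute)
  moreover have "(\<lambda>W. stopped_path (g W) W) -` B \<inter> space Q \<in> sets Q" by (rule measurable_sets[OF stopped_g_measurable B])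
  ultimately have "{W \<in> space Q. real_of_ereal (S_inf W) \<in> A} \<inter> ((\<lambda>W. stopped_path (g W) W) -` B \<inter> space Q) \<in> sets Q" by (rule sets.Int)
  moreover have "{W \<in> space Q. real_of_ereal (S_inf W) \<in> A} \<inter> ((\<lambda>W. stopped_path (g W) W) -` B \<inter> space Q)
   = {W \<in> Omega. real_of_ereal (S_inf W) \<in> A \<and> stopped_path (g W) W \<in> B}" by auto
  ultimately show "{W \<in> Omega. real_of_ereal (S_inf W) \<in> A \<and> stopped_path (g W) W \<in> B} \<in> sets Q" by simp
  show "(\<lambda>W. (g W, W)) -` ?C \<inter> space Q \<in> sets Q" by (rule measurable_sets[OF m1 C])
 qed
 also have "\<dots> = emeasure mixture (?\<phi> -` ?C \<inter> space mixture)"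
  using alive_law by (simp only: emeasure_distr[OF m1 C, symmetric] emeasure_distr[OF m2 C, symmetric])
 also have "\<dots> = (\<integral>\<^sup>+x. emeasure P (Pair x -` (?\<phi> -` ?C \<inter> space mixture)) \<partial>density lborel max_density)"
  by (rule emeasure_pair_measure_alt[OF measurable_sets[OF m2 C]])
 also have "\<dots> = (\<integral>\<^sup>+x. max_density x * emeasure P (Pair x -` (?\<phi> -` ?C \<inter> space mixture)) \<partial>lborel)"
 proof (rule nn_integral_density)
  show "(\<lambda>x. emeasure P (Pair x -` (?\<phi> -` ?C \<inter> space mixture))) \<in> borel_measurable lborel"
   using measurable_emeasure_Pair[OF measurable_sets[OF m2 C]] by simp
 qed simp
 also have "\<dots> = (\<integral>\<^sup>+x. max_density x * indicator A x * emeasure (drift_kernel x) B \<partial>lborel)"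
 proof (rule nn_integral_cong)
  fix x
  show "max_density x * emeasure P (Pair x -` (?\<phi> -` ?C \<inter> space mixture)) = max_density x * indicator A x * emeasure (drift_kernel x) B"
  proof (cases "0 < x")
   case False
   then show ?thesis by (simp add: max_density_def)
  next
   case True
   let ?s = "\<lambda>W. stopped_path (hitting_time x (drifted_path l W)) (drifted_path l W)"
   have sB: "?s -` B \<inter> space P \<in> sets P" by (rule measurable_sets[OF drift_stopped_measurable B])
   have "emeasure P (Pair x -` (?\<phi> -` ?C \<inter> space mixture)) = emeasure P (if x \<in> A then ?s -` B \<inter> space P else {})"
   proof (rule emeasure_eq_AE)
    show "AE W in P. (W \<in> Pair x -` (?\<phi> -` ?C \<inter> space mixture)) = (W \<in> (if x \<in> A then ?s -` B \<inter> space P else {}))"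
     using drifted_hits[OF l_pos True] AE_space
    proof eventually_elim
     case (elim W)
     then obtain G where G: "0 < G" "hitting_time x (drifted_path l W) = ennreal G" "drifted_path l W G = x" by blast
     then have "stop (?\<phi> (x, W)) = ?s W" by (simp add: stop_def)
     moreover have "end_value (?s W) = x" using G by (simp add: end_value_stopped_path)
     ultimately show ?case using elim(2) BS[of "?s W"] by (auto simp: B'_def space_pair_measure drifted_path_in_Omega)
    qed
    show "Pair x -` (?\<phi> -` ?C \<inter> space mixture) \<in> sets P" by (rule sets_Pair1[OF measurable_sets[OF m2 C]])
   qed (use sB in auto)
   also have "\<dots> = indicator A x * emeasure (drift_kernel x) B"
    unfolding drift_kernel_def using emeasure_distr[OF drift_stopped_measurable B] by (simp add: indicator_def)
   finally show ?thesis by (simp add: mult.assoc)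
  qed
 qed
 finally show ?thesis .
qed

end

section \<open>Sine eigenfunctions\<close>

text \<open>At 0 the continuous extension is taken, which makes the function smooth and bounded by
  \<open>\<bar>\<theta>\<bar> / l\<close>.\<close>

definition sfun :: "real => real => real => real" where
 "sfun l \<theta> z = (if z = 0 then \<theta> / l else sin (\<theta> * z) / sinh (l * z))"

lemma abs_le_abs_sinh: "\<bar>x\<bar> \<le> \<bar>sinh (x :: real)\<bar>"
proof -
 have "y \<le> sinh y" if "0 \<le> y" for y :: real
 proof -
  have "sinh 0 - 0 \<le> sinh y - y"
  proof (rule DERIV_nonneg_imp_nondecreasing[OF that])
   fix x :: real
   show "\<exists>d. ((\<lambda>x. sinh x - x) has_real_derivative d) (at x) \<and> 0 \<le> d"
    by (intro exI[of _ "cosh x - 1"] conjI) (auto intro!: derivative_eq_intros simp: cosh_real_ge_1)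
  qed
  then show ?thesis by simp
 qed
 from this[of "\<bar>x\<bar>"] show ?thesis unfolding abs_sinh_real by simp
qed

lemma abs_sin_le_sinh: "0 < l ==> \<bar>sin (\<theta> * x)\<bar> \<le> \<bar>\<theta>\<bar> / l * \<bar>sinh (l * x)\<bar>" for l x :: real
proof -
 assume l: "0 < l"
 have "\<bar>sin (\<theta> * x)\<bar> \<le> \<bar>\<theta> * x\<bar>" by (rule abs_sin_x_le_abs_x)
 also have "\<dots> = \<bar>\<theta>\<bar> / l * \<bar>l * x\<bar>" using l by (simp add: abs_mult)
 also have "\<dots> \<le> \<bar>\<theta>\<bar> / l * \<bar>sinh (l * x)\<bar>" using l by (intro mult_left_mono abs_le_abs_sinh) auto
 finally show ?thesis .
qed

lemma sfun_times_sinh: "0 < l ==> sfun l \<theta> z * sinh (l * z) = sin (\<theta> * z)"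
 by (simp add: sfun_def)

lemma sfun_bound: "0 < l ==> \<bar>sfun l \<theta> z\<bar> \<le> \<bar>\<theta>\<bar> / l"
 using abs_sin_le_sinh[of l \<theta> z] by (auto simp: sfun_def abs_divide divide_le_eq)

lemma norm_sin_le_exp: "norm (sin z) \<le> exp \<bar>Im z\<bar>"
proof -
 have "norm (sin z) \<le> (norm (exp (\<i> * z)) + norm (exp (- (\<i> * z)))) / 2"
 proof -
  have "norm (sin z) = norm (exp (\<i> * z) - exp (- (\<i> * z))) / 2"
   unfolding sin_exp_eq by (simp only: norm_divide norm_mult) simp
  also have "\<dots> \<le> (norm (exp (\<i> * z)) + norm (exp (- (\<i> * z)))) / 2"
   by (intro divide_right_mono norm_triangle_ineq4) simp
  finally show ?thesis .
 qed
 also have "\<dots> \<le> (exp \<bar>Im z\<bar> + exp \<bar>Im z\<bar>) / 2"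
  by (intro divide_right_mono add_mono) (auto simp: norm_exp_eq_Re)
 finally show ?thesis by simp
qed

lemma norm_sinh_ge: "sinh \<bar>Re z\<bar> \<le> norm (sinh z)"
proof -
 have "sinh \<bar>Re z\<bar> = \<bar>norm (exp z) - norm (exp (- z))\<bar> / 2"
  by (cases "0 \<le> Re z") (auto simp: norm_exp_eq_Re sinh_field_def abs_if)
 also have "\<dots> \<le> norm (exp z - exp (- z)) / 2" by (intro divide_right_mono norm_triangle_ineq3) auto
 also have "\<dots> = norm (sinh z)" by (simp add: sinh_field_def norm_divide)
 finally show ?thesis .
qed

lemma sinh_complex_zero:
 assumes "sinh z = 0" "\<bar>Im z\<bar> < pi" shows "z = 0"
proof -
 have "exp z * exp z = 1" using assms(1) unfolding sinh_zero_iff by auto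
 then have "exp (2 * z) = 1" by (simp only: mult_2 exp_add)
 then have "Re (2 * z) = 0 \<and> (\<exists>n::int. Im (2 * z) = of_int (2 * n) * pi)" unfolding exp_eq_1 .
 then obtain n :: int where "Re (2 * z) = 0" and n2: "Im (2 * z) = of_int (2 * n) * pi" by blast
 then have n: "Re z = 0" by simp
 note n2
 then have Imz: "Im z = of_int n * pi" by simp
 with assms(2) have "\<bar>real_of_int n\<bar> * pi < 1 * pi" by (simp add: abs_mult)
 then have "\<bar>real_of_int n\<bar> < 1" using mult_less_cancel_right_pos[OF pi_gt_zero] by blast
 then have "n = 0" by linarith
 with n Imz show ?thesis by (simp add: complex_eq_iff)
qed

text \<open>\<^const>\<open>sfun\<close> extends to a bounded holomorphic function on a strip, so Cauchy's
 inequalities bound all its derivatives on the real line.\<close>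

lemma sfun_smooth:
 assumes l: "0 < l"
 obtains D :: "nat => real => real" and B :: real where "D 0 = sfun l \<theta>"
  "\<And>n x. (D n has_real_derivative D (Suc n) x) (at x)" "\<And>n x. \<bar>D n x\<bar> \<le> fact n * B * l ^ n"
proof -
 \<comment> \<open>Apart from 0, the zeros of \<open>sinh (l * z)\<close> have imaginary part at
   least \<open>pi / l\<close> in modulus. So the strip of half-width \<open>2 / l\<close> is free
   of them, and it contains the closed discs of radius \<open>1 / l\<close> about real
   points.\<close>
 define U where "U = {z. \<bar>Im z\<bar> < 2 / l}"
 define f where "f z = (if z = 0 then of_real (\<theta> / l) else sin (of_real \<theta> * z) / sinh (of_real l * z))" for z :: complex
 have "U = Im -` {-(2/l)<..<2/l}" by (auto simp: U_def)
 then have oU: "open U" by (simp add: open_vimage continuous_on_Im)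
 have nz: "sinh (of_real l * z) \<noteq> 0" if "z \<in> U" "z \<noteq> 0" for z
 proof
  assume "sinh (of_real l * z) = 0"
  moreover have "\<bar>Im (of_real l * z)\<bar> < pi"
  proof -
   have "\<bar>Im (of_real l * z)\<bar> = l * \<bar>Im z\<bar>" using l by (simp add: abs_mult)
   also have "\<dots> < l * (2 / l)" using that l by (intro mult_strict_left_mono) (auto simp: U_def)
   also have "\<dots> < pi" using l pi_gt3 by simp
   finally show ?thesis .
  qed
  ultimately have "of_real l * z = 0" by (rule sinh_complex_zero)
  then show False using l that by simp
 qed
 have hol: "f holomorphic_on U"
 proof (rule no_isolated_singularity'[OF _ _ oU])
  show "f holomorphic_on U - {0}"
  proof (rule holomorphic_transform)
   have "(\<lambda>z. sinh (of_real l * z)) holomorphic_on U - {0}" unfolding sinh_field_def by (intro holomorphic_intros) auto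
   then show "(\<lambda>z. sin (of_real \<theta> * z) / sinh (of_real l * z)) holomorphic_on U - {0}"
    using nz by (intro holomorphic_intros) auto
  qed (auto simp: f_def)
  fix z :: complex assume "z \<in> {0}"
  then have z: "z = 0" by simp
  have "((\<lambda>z. sin (of_real \<theta> * z)) has_field_derivative of_real \<theta>) (at (0::complex))" by (auto intro!: derivative_eq_intros)
  then have 1: "((\<lambda>z. sin (of_real \<theta> * z) / z) \<longlongrightarrow> of_real \<theta>) (at (0::complex))" by (simp add: DERIV_def)
  have "((\<lambda>z. sinh (of_real l * z)) has_field_derivative of_real l) (at (0::complex))" by (auto intro!: derivative_eq_intros)
  then have 2: "((\<lambda>z. sinh (of_real l * z) / z) \<longlongrightarrow> of_real l) (at (0::complex))" by (simp add: DERIV_def)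
  have "((\<lambda>z. (sin (of_real \<theta> * z) / z) / (sinh (of_real l * z) / z)) \<longlongrightarrow> of_real \<theta> / of_real l) (at (0::complex))"
   using l by (intro tendsto_divide 1 2) auto
  moreover have "\<forall>\<^sub>F z in at 0. (sin (of_real \<theta> * z) / z) / (sinh (of_real l * z) / z) = f z"
   unfolding eventually_at by (intro exI[of _ 1]) (auto simp: f_def)
  ultimately have "(f \<longlongrightarrow> of_real \<theta> / of_real l) (at 0)" by (rule Lim_transform_eventually)
  then show "(f \<longlongrightarrow> f z) (at z within U)" unfolding z by (auto simp: f_def intro: tendsto_within_subset[of _ _ _ UNIV])
 qed simp
 obtain B where B: "\<And>z. \<bar>Im z\<bar> \<le> 1 / l ==> norm (f z) \<le> B"
 proof -
  define R where "R = cbox (Complex (- (1/l)) (- (1/l))) (Complex (1/l) (1/l))"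
  have "R \<subseteq> U"
  proof
   fix z assume "z \<in> R"
   then have "\<bar>Im z\<bar> \<le> 1 / l" by (auto simp: R_def in_cbox_complex_iff)
   also have "1 / l < 2 / l" using l by (simp add: divide_strict_right_mono)
   finally show "z \<in> U" by (simp add: U_def)
  qed
  then have "continuous_on R f" using holomorphic_on_imp_continuous_on[OF hol] continuous_on_subset by blast
  then have "compact (f ` R)" by (intro compact_continuous_image) (auto simp: R_def)
  then have "bounded (f ` R)" by (rule compact_imp_bounded)
  then obtain B1 where "\<forall>w\<in>f ` R. norm w \<le> B1" unfolding bounded_iff by blast
  then have B1: "\<And>z. z \<in> R ==> norm (f z) \<le> B1" by blast
  \<comment> \<open>Near 0 the bound comes from compactness. Farther out \<open>sinh\<close> is
    bounded below in terms of the real part, while \<open>sin\<close> grows only with the imaginary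
    part, which is bounded here.\<close>
  have "norm (f z) \<le> max B1 (exp (\<bar>\<theta>\<bar> / l) / sinh 1)" if z: "\<bar>Im z\<bar> \<le> 1 / l" for z
  proof (cases "\<bar>Re z\<bar> \<le> 1 / l")
   case True
   then have "z \<in> R" using z by (auto simp: R_def in_cbox_complex_iff)
   then show ?thesis using B1 by (simp add: max.coboundedI1)
  next
   case False
   then have "z \<noteq> 0" using l by auto
   have "1 \<le> l * \<bar>Re z\<bar>" using False l by (simp add: field_simps not_le)
   then have "sinh 1 \<le> sinh \<bar>Re (of_real l * z)\<bar>" using l by (simp add: abs_mult)
   also have "\<dots> \<le> norm (sinh (of_real l * z))" by (rule norm_sinh_ge)
   finally have d: "sinh 1 \<le> norm (sinh (of_real l * z))" .
   have "norm (sin (of_real \<theta> * z)) \<le> exp \<bar>Im (of_real \<theta> * z)\<bar>" by (rule norm_sin_le_exp)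
   also have "\<dots> \<le> exp (\<bar>\<theta>\<bar> / l)" using z mult_left_mono[OF z, of "\<bar>\<theta>\<bar>"] by (simp add: abs_mult)
   finally have "norm (f z) \<le> exp (\<bar>\<theta>\<bar> / l) / sinh 1"
    using \<open>z \<noteq> 0\<close> d by (simp add: f_def norm_divide) (intro frac_le, auto)
   then show ?thesis by (simp add: max.coboundedI2)
  qed
  then show ?thesis using that by blast
 qed
 define D where "D n x = Re ((deriv ^^ n) f (of_real x))" for n x
 have real_in: "of_real x \<in> U" for x using l by (simp add: U_def)
 have cb: "cball (of_real x) (1 / l) \<subseteq> {z. \<bar>Im z\<bar> \<le> 1 / l}" for x
 proof
  fix z :: complex assume "z \<in> cball (of_real x) (1 / l)"
  then have "norm (z - of_real x) \<le> 1 / l" by (simp add: dist_norm norm_minus_commute)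
  then show "z \<in> {z. \<bar>Im z\<bar> \<le> 1 / l}" using abs_Im_le_cmod[of "z - of_real x"] by simp
 qed
 have cbU: "cball (of_real x) (1 / l) \<subseteq> U" for x
 proof -
  have "1 / l < 2 / l" using l by (simp add: divide_strict_right_mono)
  then show ?thesis using cb[of x] by (force simp: U_def)
 qed
 have bound: "\<bar>D n x\<bar> \<le> fact n * B * l ^ n" for n x
 proof -
  have "norm ((deriv ^^ n) f (of_real x)) \<le> fact n * B / (1 / l) ^ n"
  proof (rule Cauchy_inequality)
   show "f holomorphic_on ball (of_real x) (1 / l)"
    using cbU[of x] ball_subset_cball by (intro holomorphic_on_subset[OF hol]) blast
   show "continuous_on (cball (of_real x) (1 / l)) f"
    by (rule continuous_on_subset[OF holomorphic_on_imp_continuous_on[OF hol] cbU])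
   show "0 < 1 / l" using l by simp
   fix z :: complex assume "norm (of_real x - z) = 1 / l"
   then have "z \<in> cball (of_real x) (1 / l)" by (simp add: dist_norm)
   then show "norm (f z) \<le> B" using cb[of x] B by blast
  qed
  also have "fact n * B / (1 / l) ^ n = fact n * B * l ^ n" by (simp add: power_divide)
  finally show ?thesis unfolding D_def using abs_Re_le_cmod order_trans by blast
 qed
 have der: "(D n has_real_derivative D (Suc n) x) (at x)" for n x
 proof -
  have "((deriv ^^ n) f has_field_derivative deriv ((deriv ^^ n) f) (of_real x)) (at (of_real x))"
   using holomorphic_higher_deriv[OF hol oU, of n] oU real_in by (rule holomorphic_derivI)
  then have "((\<lambda>x. (deriv ^^ n) f (of_real x)) has_vector_derivative (deriv ^^ Suc n) f (of_real x)) (at x)"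
   by (intro has_vector_derivative_real_field) simp
  from bounded_linear.has_vector_derivative[OF bounded_linear_Re this]
  show ?thesis unfolding D_def has_real_derivative_iff_has_vector_derivative .
 qed
 have "D 0 = sfun l \<theta>"
 proof
  fix x
  have "sinh (complex_of_real y) = of_real (sinh y)" for y
   by (simp add: sinh_field_def exp_of_real flip: of_real_minus)
  then have "f (of_real x) = of_real (sfun l \<theta> x)"
   by (simp add: f_def sfun_def sin_of_real flip: of_real_mult)
  then show "D 0 x = sfun l \<theta> x" by (simp add: D_def)
 qed
 from that[OF this der bound] show ?thesis .
qed

lemma continuous_sfun: "0 < l ==> continuous_on UNIV (sfun l \<theta>)"
proof -
 assume "0 < l"
 then obtain D :: "nat => real => real" and B :: real where D0: "D 0 = sfun l \<theta>"
  and D: "\<And>n x. (D n has_real_derivative D (Suc n) x) (at x)" "\<And>n x. \<bar>D n x\<bar> \<le> fact n * B * l ^ n"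
  by (rule sfun_smooth[where \<theta>=\<theta>]) (rule that)
 have "isCont (sfun l \<theta>) x" for x using DERIV_isCont[OF D(1)[of 0 x]] unfolding D0 .
 then show ?thesis by (intro continuous_at_imp_continuous_on ballI)
qed

lemma sfun_borel: "0 < l ==> sfun l \<theta> \<in> borel_measurable borel"
 by (intro borel_measurable_continuous_onI continuous_sfun)

text \<open>Multiplication by an independent fair sign symmetrises the measure, so that its
  characteristic function is the cosine transform; the absolute value then recovers the original
  measure.\<close>

lemma cosine_transform_unique:
 fixes \<nu>1 \<nu>2 :: "real measure"
 assumes prob: "prob_space \<nu>1" "prob_space \<nu>2" and sets: "sets \<nu>1 = sets borel" "sets \<nu>2 = sets borel"
  and nonneg: "AE x in \<nu>1. 0 \<le> x" "AE x in \<nu>2. 0 \<le> x"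
  and eq: "\<And>\<theta>. (LINT x|\<nu>1. cos (\<theta> * x)) = (LINT x|\<nu>2. cos (\<theta> * x))"
 shows "\<nu>1 = \<nu>2"
proof -
 define coin where "coin = measure_pmf (pmf_of_set {-1, 1 :: real})"
 define sym where "sym \<nu> = distr (\<nu> \<Otimes>\<^sub>M coin) borel (\<lambda>(x, s). s * x)" for \<nu> :: "real measure"
 interpret coin: prob_space coin unfolding coin_def by (rule measure_pmf.prob_space_axioms)
 have *: "real_distribution (sym \<nu>) \<and> char (sym \<nu>) = (\<lambda>\<theta>. of_real (LINT x|\<nu>. cos (\<theta> * x))) \<and> distr (sym \<nu>) borel abs = \<nu>"
  if \<nu>: "prob_space \<nu>" and s: "sets \<nu> = sets borel" and nn: "AE x in \<nu>. 0 \<le> x" for \<nu>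
 proof -
  interpret \<nu>: prob_space \<nu> by fact
  interpret pair_prob_space \<nu> coin ..
  have m [measurable]: "(\<lambda>(x, s). s * x) \<in> borel_measurable (\<nu> \<Otimes>\<^sub>M coin)"
  proof -
   have "fst \<in> borel_measurable (\<nu> \<Otimes>\<^sub>M coin)" using measurable_fst[of \<nu> coin] s by (simp cong: measurable_cong_sets)
   moreover have "snd \<in> borel_measurable (\<nu> \<Otimes>\<^sub>M coin)"
    by (rule measurable_compose[OF measurable_snd]) (simp add: coin_def)
   ultimately show ?thesis unfolding case_prod_beta by measurable
  qed
  have rd: "real_distribution (sym \<nu>)" unfolding sym_def
   by (simp add: real_distribution_def real_distribution_axioms_def prob_space_distr)
  have ch: "char (sym \<nu>) \<theta> = of_real (LINT x|\<nu>. cos (\<theta> * x))" for \<theta>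
  proof -
   have i: "integrable (\<nu> \<Otimes>\<^sub>M coin) (\<lambda>(x, s). iexp (\<theta> * (s * x)))"
   proof (rule integrable_const_bound[where B=1])
    have "(\<lambda>z. iexp (\<theta> * (case z of (x, s) => s * x))) \<in> borel_measurable (\<nu> \<Otimes>\<^sub>M coin)" by measurable
    then show "(\<lambda>(x, s). iexp (\<theta> * (s * x))) \<in> borel_measurable (\<nu> \<Otimes>\<^sub>M coin)" by (simp add: case_prod_beta)
   qed auto
   have "char (sym \<nu>) \<theta> = (CLINT z|\<nu> \<Otimes>\<^sub>M coin. iexp (\<theta> * (case z of (x, s) => s * x)))"
    unfolding char_def sym_def by (subst integral_distr) auto
   also have "\<dots> = (CLINT z|\<nu> \<Otimes>\<^sub>M coin. (case z of (x, s) => iexp (\<theta> * (s * x))))"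
    by (intro Bochner_Integration.integral_cong) auto
   also have "\<dots> = (CLINT x|\<nu>. CLINT s|coin. iexp (\<theta> * (s * x)))"
    using integral_fst'[OF i] by simp
   also have "\<dots> = (CLINT x|\<nu>. of_real (cos (\<theta> * x)))"
   proof (intro Bochner_Integration.integral_cong refl)
    fix x
    have "(CLINT s|coin. iexp (\<theta> * (s * x))) = (iexp (\<theta> * ((-1) * x)) + iexp (\<theta> * (1 * x))) / 2"
     unfolding coin_def by (subst integral_measure_pmf[of "{-1, 1}"]) (auto simp: scaleR_conv_of_real field_simps)
    also have "\<dots> = of_real (cos (\<theta> * x))"
     unfolding cos_of_real[symmetric] cos_exp_eq by (simp add: add.commute)
    finally show "(CLINT s|coin. iexp (\<theta> * (s * x))) = of_real (cos (\<theta> * x))" .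
   qed
   finally show ?thesis by simp
  qed
  have "distr (sym \<nu>) borel abs = distr (\<nu> \<Otimes>\<^sub>M coin) borel (\<lambda>z. \<bar>case z of (x, s) => s * x\<bar>)"
   unfolding sym_def by (subst distr_distr) (auto simp: comp_def)
  also have "\<dots> = distr (\<nu> \<Otimes>\<^sub>M coin) borel fst"
  proof (rule distr_cong_AE)
   have c: "AE s in coin. \<bar>s\<bar> = 1" unfolding coin_def by (simp add: AE_measure_pmf_iff)
   have "AE x in \<nu>. AE s in coin. \<bar>s * x\<bar> = x"
    using nn by eventually_elim (use c in \<open>auto elim!: eventually_mono simp: abs_mult\<close>)
   then show "AE z in \<nu> \<Otimes>\<^sub>M coin. \<bar>case z of (x, s) => s * x\<bar> = fst z"
   proof (intro AE_pair_measure)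
    have f: "fst \<in> borel_measurable (\<nu> \<Otimes>\<^sub>M coin)" using measurable_fst[of \<nu> coin] s by (simp cong: measurable_cong_sets)
    have a: "(\<lambda>z. \<bar>case z of (x, s) => s * x\<bar>) \<in> borel_measurable (\<nu> \<Otimes>\<^sub>M coin)" by measurable
    show "{x \<in> space (\<nu> \<Otimes>\<^sub>M coin). \<bar>case x of (x, s) => s * x\<bar> = fst x} \<in> sets (\<nu> \<Otimes>\<^sub>M coin)"
     by (rule borel_measurable_eq[OF a f])
   qed simp
  qed (use measurable_fst[of \<nu> coin] s in \<open>simp_all cong: measurable_cong_sets\<close>)
  also have "\<dots> = distr (\<nu> \<Otimes>\<^sub>M coin) \<nu> fst" by (rule distr_cong) (simp_all add: s)
  also have "\<dots> = \<nu>" by (rule coin.distr_pair_fst)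
  finally show ?thesis using rd ch by auto
 qed
 note 1 = *[OF prob(1) sets(1) nonneg(1)] and 2 = *[OF prob(2) sets(2) nonneg(2)]
 have "sym \<nu>1 = sym \<nu>2"
  using 1 2 eq by (intro Levy_uniqueness) auto
 then show ?thesis using 1 2 by metis
qed

text \<open>Central differences in \<open>\<theta>\<close> converge to
  \<open>cos (\<theta> * x) * k x\<close>, where \<open>k x\<close> is
  \<open>x / sinh (l * x)\<close>, extended to 0. Since \<open>k\<close> is bounded and strictly
  positive, the measure with density \<open>k\<close> is determined by its cosine transform, and
  \<open>k\<close> can be divided out again.\<close>

lemma sfun_transform_unique:
 fixes \<mu>1 \<mu>2 :: "real measure"
 assumes l: "0 < l" and fin: "finite_measure \<mu>1" "finite_measure \<mu>2" and sets: "sets \<mu>1 = sets borel" "sets \<mu>2 = sets borel"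
  and nonneg: "AE x in \<mu>1. 0 \<le> x" "AE x in \<mu>2. 0 \<le> x"
  and eq: "\<And>\<theta>. (LINT x|\<mu>1. sfun l \<theta> x) = (LINT x|\<mu>2. sfun l \<theta> x)"
 shows "\<mu>1 = \<mu>2"
proof -
 define k where "k z = (if z = 0 then 1 / l else z / sinh (l * z))" for z :: real
 have kpos: "0 < k z" for z using l by (auto simp: k_def zero_less_divide_iff zero_less_mult_iff mult_less_0_iff)
 have kle: "k z \<le> 1 / l" for z
 proof (cases "z = 0")
  case False
  have "k z = \<bar>z\<bar> / \<bar>sinh (l * z)\<bar>" using False kpos[of z] by (simp add: k_def flip: abs_divide)
  moreover have "\<bar>z\<bar> * l \<le> \<bar>sinh (l * z)\<bar>" using abs_le_abs_sinh[of "l * z"] l by (simp add: abs_mult mult.commute)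
  moreover have "0 < \<bar>sinh (l * z)\<bar>" using False l by simp
  ultimately have "(l * k z) * \<bar>sinh (l * z)\<bar> \<le> 1 * \<bar>sinh (l * z)\<bar>" by (simp add: mult.commute)
  then have "l * k z \<le> 1" using \<open>0 < \<bar>sinh (l * z)\<bar>\<close> by (simp only: mult_le_cancel_right_pos)
  then show ?thesis using l by (simp add: field_simps)
 qed (simp add: k_def)
 have km: "k \<in> borel_measurable borel" unfolding k_def by measurable
 have lim: "(\<lambda>n. ((LINT x|\<mu>. sfun l (\<theta> + 1 / real (Suc n)) x) - (LINT x|\<mu>. sfun l (\<theta> - 1 / real (Suc n)) x)) / (2 / real (Suc n)))
   \<longlonglongrightarrow> (LINT x|\<mu>. cos (\<theta> * x) * k x)" if \<mu>: "finite_measure \<mu>" and s: "sets \<mu> = sets borel" for \<mu> \<theta>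
 proof -
  interpret finite_measure \<mu> by fact
  have mb: "f \<in> borel_measurable borel ==> f \<in> borel_measurable \<mu>" for f :: "real => real"
   using s by (simp cong: measurable_cong_sets)
  have i: "integrable \<mu> (sfun l \<theta>)" for \<theta>
   using sfun_bound[OF l] sfun_borel[OF l] by (intro integrable_const_bound[where B="\<bar>\<theta>\<bar> / l"] mb) auto
  let ?d = "\<lambda>n x. (sfun l (\<theta> + 1 / real (Suc n)) x - sfun l (\<theta> - 1 / real (Suc n)) x) / (2 / real (Suc n))"
  have d: "?d n x = cos (\<theta> * x) * sfun l (1 / real (Suc n)) x * real (Suc n)" for n x
  proof -
   define e where "e = 1 / real (Suc n)"
   have e: "0 < e" "real (Suc n) = 1 / e" by (auto simp: e_def)
   have sd: "sin ((\<theta> + e) * x) - sin ((\<theta> - e) * x) = 2 * (cos (\<theta> * x) * sin (e * x))"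
    by (simp add: algebra_simps sin_add sin_diff)
   have "(sfun l (\<theta> + e) x - sfun l (\<theta> - e) x) / (2 * e) = cos (\<theta> * x) * sfun l e x * (1 / e)"
   proof (cases "x = 0")
    case False
    then have "sfun l (\<theta> + e) x - sfun l (\<theta> - e) x = 2 * (cos (\<theta> * x) * sin (e * x)) / sinh (l * x)"
     by (simp add: sfun_def sd[symmetric] diff_divide_distrib)
    then show ?thesis using False e(1) by (simp add: sfun_def)
   qed (use e(1) l in \<open>simp add: sfun_def field_simps\<close>)
   then show ?thesis using e(1) unfolding e_def[symmetric] e(2) by simp
  qed
  have "(\<lambda>n. \<integral>x. ?d n x \<partial>\<mu>) \<longlonglongrightarrow> (LINT x|\<mu>. cos (\<theta> * x) * k x)"
  proof (rule integral_dominated_convergence[where w="\<lambda>_. 1 / l"])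
   show "(\<lambda>x. cos (\<theta> * x) * k x) \<in> borel_measurable \<mu>" using km by (intro mb) measurable
   show "?d n \<in> borel_measurable \<mu>" for n
    by (intro mb borel_measurable_divide borel_measurable_diff borel_measurable_const sfun_borel[OF l])
   show "AE x in \<mu>. (\<lambda>n. ?d n x) \<longlonglongrightarrow> cos (\<theta> * x) * k x"
   proof (intro AE_I2)
    fix x
    have "(\<lambda>n. sfun l (1 / real (Suc n)) x * real (Suc n)) \<longlonglongrightarrow> k x"
    proof (cases "x = 0")
     case False
     have "(\<lambda>n. sin (1 / real (Suc n) * x) * real (Suc n)) \<longlonglongrightarrow> x" by real_asymp
     then have "(\<lambda>n. sin (1 / real (Suc n) * x) * real (Suc n) / sinh (l * x)) \<longlonglongrightarrow> x / sinh (l * x)"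
      using False l by (intro tendsto_divide tendsto_const) auto
     then show ?thesis using False by (simp add: sfun_def k_def)
    qed (simp add: sfun_def k_def)
    then have "(\<lambda>n. cos (\<theta> * x) * (sfun l (1 / real (Suc n)) x * real (Suc n))) \<longlonglongrightarrow> cos (\<theta> * x) * k x" by (rule tendsto_mult_left)
    then show "(\<lambda>n. ?d n x) \<longlonglongrightarrow> cos (\<theta> * x) * k x" unfolding d by (simp only: mult.assoc)
   qed
   show "AE x in \<mu>. norm (?d n x) \<le> 1 / l" for n
   proof (intro AE_I2)
    fix x
    have "norm (?d n x) = \<bar>cos (\<theta> * x)\<bar> * (\<bar>sfun l (1 / real (Suc n)) x\<bar> * real (Suc n))" unfolding d by (simp add: abs_mult)
    also have "\<dots> \<le> 1 * ((\<bar>1 / real (Suc n)\<bar> / l) * real (Suc n))"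
     using l by (intro mult_mono sfun_bound) auto
    also have "\<dots> = 1 / l" by simp
    finally show "norm (?d n x) \<le> 1 / l" .
   qed
  qed simp
  moreover have "(LINT x|\<mu>. ?d n x) = ((LINT x|\<mu>. sfun l (\<theta> + 1 / real (Suc n)) x) - (LINT x|\<mu>. sfun l (\<theta> - 1 / real (Suc n)) x)) / (2 / real (Suc n))" for n
   using i by (simp only: integral_divide_zero Bochner_Integration.integral_diff)
  ultimately show ?thesis by simp
 qed
 have cos_eq: "(LINT x|\<mu>1. cos (\<theta> * x) * k x) = (LINT x|\<mu>2. cos (\<theta> * x) * k x)" for \<theta>
  using LIMSEQ_unique[OF lim[OF fin(1) sets(1), unfolded eq] lim[OF fin(2) sets(2)]] .
 define c where "c = (LINT x|\<mu>1. k x)"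
 have c': "c = (LINT x|\<mu>2. k x)" using cos_eq[of 0] by (simp add: c_def)
 have mb: "f \<in> borel_measurable borel ==> f \<in> borel_measurable \<mu>1" "f \<in> borel_measurable borel ==> f \<in> borel_measurable \<mu>2" for f :: "real => real"
  using sets by (simp_all cong: measurable_cong_sets)
 have ki: "integrable \<mu>1 k" "integrable \<mu>2 k"
  using kpos kle less_imp_le[OF kpos] km
  by (auto intro!: finite_measure.integrable_const_bound[OF fin(1), where B="1/l"] finite_measure.integrable_const_bound[OF fin(2), where B="1/l"] mb simp: abs_of_pos)
 show ?thesis
 \<comment> \<open>Normalisation to probability measures needs positive mass; \<open>c = 0\<close>
   means that both measures vanish.\<close>
 proof (cases "c = 0")
  case True
  have z: "emeasure \<mu> (space \<mu>) = 0" if "integrable \<mu> k" "(LINT x|\<mu>. k x) = 0" for \<mu>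
  proof -
   have "AE x in \<mu>. k x = 0" using that less_imp_le[OF kpos] by (subst (asm) integral_nonneg_eq_0_iff_AE) auto
   then have "AE x in \<mu>. False" by eventually_elim (use kpos in \<open>auto simp: less_le\<close>)
   then show ?thesis by (simp add: AE_iff_measurable[OF _ refl])
  qed
  have z1: "emeasure \<mu>1 (space \<mu>1) = 0" "emeasure \<mu>2 (space \<mu>2) = 0"
   using z[OF ki(1)] z[OF ki(2)] True c' by (simp_all add: c_def)
  show ?thesis
  proof (rule measure_eqI)
   fix A assume "A \<in> sets \<mu>1"
   then have "emeasure \<mu>1 A = 0" "emeasure \<mu>2 A = 0"
    using z1 emeasure_space[of \<mu>1 A] emeasure_space[of \<mu>2 A] by simp_all
   then show "emeasure \<mu>1 A = emeasure \<mu>2 A" by simp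
  qed (simp add: sets)
 next
  case False
  have "0 \<le> c" unfolding c_def using less_imp_le[OF kpos] by (intro integral_nonneg_AE) auto
  with False have c: "0 < c" by simp
  define n where "n \<mu> = density \<mu> (\<lambda>x. ennreal (k x / c))" for \<mu>
  have n: "prob_space (n \<mu>) \<and> sets (n \<mu>) = sets borel \<and> (AE x in n \<mu>. 0 \<le> x) \<and> (\<forall>\<theta>. (LINT x|n \<mu>. cos (\<theta> * x)) = (LINT x|\<mu>. cos (\<theta> * x) * k x) / c)
    \<and> density (n \<mu>) (\<lambda>x. ennreal (c / k x)) = \<mu>"
   if s: "sets \<mu> = sets borel" and i: "integrable \<mu> k" and ck: "c = (LINT x|\<mu>. k x)" and nn: "AE x in \<mu>. 0 \<le> x" for \<mu>
  proof -
   have mb: "f \<in> borel_measurable borel ==> f \<in> borel_measurable \<mu>" for f :: "real => real"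
    using s by (simp cong: measurable_cong_sets)
   have k' [measurable]: "k \<in> borel_measurable \<mu>" using km by (rule mb)
   have "(\<integral>\<^sup>+x. ennreal (k x / c) \<partial>\<mu>) = ennreal (LINT x|\<mu>. k x / c)"
    using i c less_imp_le[OF kpos] by (intro nn_integral_eq_integral) auto
   then have 1: "prob_space (n \<mu>)" unfolding n_def using c ck by (intro prob_spaceI) (simp add: emeasure_density)
   have 2: "AE x in n \<mu>. 0 \<le> x" unfolding n_def using nn by (subst AE_density) auto
   have 3: "(LINT x|n \<mu>. cos (\<theta> * x)) = (LINT x|\<mu>. cos (\<theta> * x) * k x) / c" for \<theta>
   proof -
    have "(LINT x|n \<mu>. cos (\<theta> * x)) = (LINT x|\<mu>. (k x / c) *\<^sub>R cos (\<theta> * x))"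
     unfolding n_def using c less_imp_le[OF kpos] km by (intro integral_density mb borel_measurable_divide) auto
    also have "\<dots> = (LINT x|\<mu>. cos (\<theta> * x) * k x / c)" by (intro Bochner_Integration.integral_cong) auto
    finally show ?thesis by simp
   qed
   have "density (n \<mu>) (\<lambda>x. ennreal (c / k x)) = density \<mu> (\<lambda>x. ennreal (k x / c) * ennreal (c / k x))"
    unfolding n_def by (rule density_density_eq) auto
   also have "\<dots> = density \<mu> (\<lambda>_. 1)"
   proof -
    have "ennreal (k x / c) * ennreal (c / k x) = 1" for x
     using kpos[of x] c by (subst ennreal_mult'[symmetric]) auto
    then show ?thesis by simp
   qed
   also have "\<dots> = \<mu>" by (rule density_1)
   finally show ?thesis using 1 2 3 s by (simp add: n_def)
  qed
  have n1: "prob_space (n \<mu>1) \<and> sets (n \<mu>1) = sets borel \<and> (AE x in n \<mu>1. 0 \<le> x) \<and> (\<forall>\<theta>. (LINT x|n \<mu>1. cos (\<theta> * x)) = (LINT x|\<mu>1. cos (\<theta> * x) * k x) / c)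
    \<and> density (n \<mu>1) (\<lambda>x. ennreal (c / k x)) = \<mu>1" by (rule n[OF sets(1) ki(1) c_def nonneg(1)])
  have n2: "prob_space (n \<mu>2) \<and> sets (n \<mu>2) = sets borel \<and> (AE x in n \<mu>2. 0 \<le> x) \<and> (\<forall>\<theta>. (LINT x|n \<mu>2. cos (\<theta> * x)) = (LINT x|\<mu>2. cos (\<theta> * x) * k x) / c)
    \<and> density (n \<mu>2) (\<lambda>x. ennreal (c / k x)) = \<mu>2" by (rule n[OF sets(2) ki(2) c' nonneg(2)])
  have "n \<mu>1 = n \<mu>2"
   by (rule cosine_transform_unique) (use n1 n2 cos_eq in auto)
  then show ?thesis using n1 n2 by metis
 qed
qed

definition sine_mart :: "real => 'a measure => ('a => real => real) => bool" where
 "sine_mart l M Y \<longleftrightarrow> (\<forall>\<theta> U s t (a :: real => real => real). finite U --> U \<subseteq> {0..s} --> 0 \<le> s --> s < t -->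
  (\<forall>u. continuous_on UNIV (a u)) --> (\<forall>u x. 0 \<le> a u x \<and> a u x \<le> 1) -->
  (LINT w|M. (\<Prod>u\<in>U. a u (Y w u)) * sfun l \<theta> (Y w t))
   = exp (- ((\<theta>\<^sup>2 + l\<^sup>2) / 2) * (t - s)) * (LINT w|M. (\<Prod>u\<in>U. a u (Y w u)) * sfun l \<theta> (Y w s)))"

lemma prod_path_measurable:
 fixes a :: "real => real => real"
 assumes Y: "Y \<in> M \<rightarrow>\<^sub>M F_inf" and U: "U \<subseteq> {0..}" and a: "\<And>u. continuous_on UNIV (a u)"
 shows "(\<lambda>w. \<Prod>u\<in>U. a u (Y w u)) \<in> borel_measurable M"
proof (rule borel_measurable_prod)
 fix u assume "u \<in> U"
 then have "0 \<le> u" using U by auto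
 show "(\<lambda>w. a u (Y w u)) \<in> borel_measurable M"
  by (rule measurable_compose[OF measurable_compose[OF Y coord_F_inf[OF \<open>0 \<le> u\<close>]] borel_measurable_continuous_onI[OF a]])
qed

lemma prod_01:
 fixes a :: "real => real => real"
 assumes "\<And>u x. 0 \<le> a u x \<and> a u x \<le> 1"
 shows "0 \<le> (\<Prod>u\<in>U. a u (x u)) \<and> (\<Prod>u\<in>U. a u (x u)) \<le> 1"
 using assms by (auto intro!: prod_nonneg prod_le_1)

text \<open>Induction on the latest time \<open>t\<close>. Weighted with the past, the law of
  \<open>Y w t\<close> is determined by the integrals of \<open>sfun\<close>, and the martingale
  property expresses these at the preceding time \<open>s\<close>, where the induction hypothesis
  applies. The eigenfunctions thus replace a transition kernel.\<close>

lemma sine_mart_unique: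
 fixes Y :: "'a => real => real" and Y' :: "'b => real => real"
 assumes l: "0 < l" and fin: "finite_measure M" "finite_measure M'"
  and Y: "Y \<in> M \<rightarrow>\<^sub>M F_inf" and Y': "Y' \<in> M' \<rightarrow>\<^sub>M F_inf"
  and pos: "AE w in M. Y w 0 = 0 \<and> (\<forall>t\<ge>0. 0 \<le> Y w t)" "AE w in M'. Y' w 0 = 0 \<and> (\<forall>t\<ge>0. 0 \<le> Y' w t)"
  and total: "measure M (space M) = measure M' (space M')"
  and sm: "sine_mart l M Y" "sine_mart l M' Y'"
 shows "distr M F_inf Y = distr M' F_inf Y'"
proof -
 interpret M: finite_measure M by fact
 interpret M': finite_measure M' by fact
 have agree: "(LINT w|M. (\<Prod>u\<in>U. a u (Y w u))) = (LINT w|M'. (\<Prod>u\<in>U. a u (Y' w u)))"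
  if "finite U" "U \<subseteq> {0..}" "0 \<in> U" "\<And>u. continuous_on UNIV (a u)" "\<And>u x. 0 \<le> a u x \<and> a u x \<le> 1"
  for U and a :: "real => real => real"
  using that
 proof (induction U arbitrary: a rule: finite_linorder_max_induct)
  case empty
  then show ?case by simp
 next
  case (insert t U)
  note a = insert.prems(3,4)
  show ?case
  proof (cases "U = {}")
   case True
   then have t: "t = 0" using insert.prems by auto
   have "(LINT w|M. a 0 (Y w 0)) = (LINT w|M. a 0 0)"
    using pos(1) measurable_compose[OF measurable_compose[OF Y coord_F_inf[of 0]] borel_measurable_continuous_onI[OF a(1)]]
    by (intro integral_cong_AE) (auto elim!: eventually_mono)
   moreover have "(LINT w|M'. a 0 (Y' w 0)) = (LINT w|M'. a 0 0)"
    using pos(2) measurable_compose[OF measurable_compose[OF Y' coord_F_inf[of 0]] borel_measurable_continuous_onI[OF a(1)]]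
    by (intro integral_cong_AE) (auto elim!: eventually_mono)
   ultimately show ?thesis using total by (simp add: True t)
  next
   case False
   define s where "s = Max U"
   have s: "s \<in> U" "\<And>u. u \<in> U ==> u \<le> s" using insert.hyps(1) False by (auto simp: s_def)
   have U0: "U \<subseteq> {0..}" using insert.prems by auto
   have s0: "0 \<le> s" using s(1) U0 by auto
   have st: "s < t" using insert.hyps(2) s by auto
   have t0: "0 \<le> t" "0 < t" using s0 st by auto
   have zU: "0 \<in> U" using insert.prems t0 by auto
   have Us: "U \<subseteq> {0..s}" using s U0 by auto
   define H where "H w = (\<Prod>u\<in>U. a u (Y w u))" for w
   define H' where "H' w = (\<Prod>u\<in>U. a u (Y' w u))" for w
   have Hm [measurable]: "H \<in> borel_measurable M" "H' \<in> borel_measurable M'"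
    unfolding H_def H'_def by (rule prod_path_measurable[OF Y U0 a(1)] prod_path_measurable[OF Y' U0 a(1)])+
   have H01: "0 \<le> H w \<and> H w \<le> 1" "0 \<le> H' w' \<and> H' w' \<le> 1" for w w'
    unfolding H_def H'_def by (rule prod_01[OF a(2)])+
   have Yt [measurable]: "(\<lambda>w. Y w t) \<in> borel_measurable M" "(\<lambda>w. Y' w t) \<in> borel_measurable M'"
    using measurable_compose[OF Y coord_F_inf[OF t0(1)]] measurable_compose[OF Y' coord_F_inf[OF t0(1)]] by auto
   have Ys [measurable]: "(\<lambda>w. Y w s) \<in> borel_measurable M" "(\<lambda>w. Y' w s) \<in> borel_measurable M'"
    using measurable_compose[OF Y coord_F_inf[OF s0]] measurable_compose[OF Y' coord_F_inf[OF s0]] by auto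
   define \<mu> where "\<mu> = distr (density M (\<lambda>w. ennreal (H w))) borel (\<lambda>w. Y w t)"
   define \<mu>' where "\<mu>' = distr (density M' (\<lambda>w. ennreal (H' w))) borel (\<lambda>w. Y' w t)"
   have int: "(LINT x|\<mu>. f x) = (LINT w|M. H w * f (Y w t))" "(LINT x|\<mu>'. f x) = (LINT w|M'. H' w * f (Y' w t))"
    if [measurable]: "f \<in> borel_measurable borel" for f :: "real => real"
    unfolding \<mu>_def \<mu>'_def using H01 by (simp_all add: integral_distr integral_density)
   have HL: "(LINT w|M. H w * sfun l \<theta> (Y w s)) = (LINT w|M'. H' w * sfun l \<theta> (Y' w s))" for \<theta>
   proof -
    \<comment> \<open>\<open>sfun\<close> may be negative, so it is mapped affinely into the unit
      interval before it is absorbed as a weight at time \<open>s\<close>; linearity undoes this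
      afterwards.\<close>
    define C where "C = \<bar>\<theta>\<bar> / l + 1"
    have C: "0 < C" using l by (simp add: C_def add_nonneg_pos)
    define a' where "a' = a(s := \<lambda>x. a s x * ((sfun l \<theta> x + C) / (2 * C)))"
    have sb: "0 \<le> (sfun l \<theta> x + C) / (2 * C) \<and> (sfun l \<theta> x + C) / (2 * C) \<le> 1" for x
     using sfun_bound[OF l, of \<theta> x] C by (auto simp: C_def divide_le_eq abs_le_iff)
    have a'1: "continuous_on UNIV (a' u)" for u
     unfolding a'_def using a(1) continuous_sfun[OF l] C by (auto intro!: continuous_intros)
    have a'2: "0 \<le> a' u x \<and> a' u x \<le> 1" for u x
    proof (cases "u = s")
     case True
     then have "a' u x = a s x * ((sfun l \<theta> x + C) / (2 * C))" by (simp add: a'_def)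
     then show ?thesis using sb[of x] a(2)[of s x] by (simp only: mult_nonneg_nonneg mult_le_one simp_thms)
    qed (use a(2) in \<open>simp add: a'_def\<close>)
    have absorb: "(\<Prod>u\<in>U. a' u (x u)) = (\<Prod>u\<in>U. a u (x u)) * ((sfun l \<theta> (x s) + C) / (2 * C))" for x
    proof -
     have "(\<Prod>u\<in>U. a' u (x u)) = a' s (x s) * (\<Prod>u\<in>U - {s}. a' u (x u))"
      using insert.hyps(1) s(1) by (rule prod.remove)
     also have "(\<Prod>u\<in>U - {s}. a' u (x u)) = (\<Prod>u\<in>U - {s}. a u (x u))"
      by (intro prod.cong) (auto simp: a'_def)
     finally show ?thesis using prod.remove[OF insert.hyps(1) s(1), of "\<lambda>u. a u (x u)"] by (simp add: a'_def)
    qed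
    have i: "integrable M H" "integrable M' H'"
     using H01 by (auto intro!: M.integrable_const_bound[where B=1] M'.integrable_const_bound[where B=1])
    have i2: "integrable M (\<lambda>w. H w * sfun l \<theta> (Y w s))" "integrable M' (\<lambda>w. H' w * sfun l \<theta> (Y' w s))"
    proof -
     have "norm (h * sfun l \<theta> y) \<le> \<bar>\<theta>\<bar> / l" if "0 \<le> h \<and> h \<le> 1" for h y :: real
      using that sfun_bound[OF l, of \<theta> y] mult_mono[of h 1 "\<bar>sfun l \<theta> y\<bar>" "\<bar>\<theta>\<bar> / l"] by (simp add: abs_mult)
     then show "integrable M (\<lambda>w. H w * sfun l \<theta> (Y w s))" "integrable M' (\<lambda>w. H' w * sfun l \<theta> (Y' w s))"
      using H01 measurable_compose[OF Ys(1) sfun_borel[OF l]] measurable_compose[OF Ys(2) sfun_borel[OF l]]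
      by (auto intro!: M.integrable_const_bound[where B="\<bar>\<theta>\<bar> / l"] M'.integrable_const_bound[where B="\<bar>\<theta>\<bar> / l"] borel_measurable_times)
    qed
    have "(LINT w|M. H w * ((sfun l \<theta> (Y w s) + C) / (2 * C))) = (LINT w|M'. H' w * ((sfun l \<theta> (Y' w s) + C) / (2 * C)))"
     using insert.IH[where a=a', OF U0 zU a'1 a'2] unfolding absorb H_def H'_def .
    moreover have "(LINT w|M. H w * ((sfun l \<theta> (Y w s) + C) / (2 * C))) = ((LINT w|M. H w * sfun l \<theta> (Y w s)) + (LINT w|M. H w) * C) / (2 * C)"
     using i i2 by (simp add: distrib_left)
    moreover have "(LINT w|M'. H' w * ((sfun l \<theta> (Y' w s) + C) / (2 * C))) = ((LINT w|M'. H' w * sfun l \<theta> (Y' w s)) + (LINT w|M'. H' w) * C) / (2 * C)"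
     using i i2 by (simp add: distrib_left)
    moreover have "(LINT w|M. H w) = (LINT w|M'. H' w)"
     using insert.IH[where a=a, OF U0 zU a] unfolding H_def H'_def .
    ultimately show ?thesis using C by simp
   qed
   have "\<mu> = \<mu>'"
   proof (rule sfun_transform_unique[OF l])
    have "(\<integral>\<^sup>+w. ennreal (H w) \<partial>M) \<le> (\<integral>\<^sup>+w. 1 \<partial>M)" "(\<integral>\<^sup>+w. ennreal (H' w) \<partial>M') \<le> (\<integral>\<^sup>+w. 1 \<partial>M')"
     by (rule nn_integral_mono, use H01 in \<open>simp add: ennreal_le_1\<close>)+
    then have d: "finite_measure (density M (\<lambda>w. ennreal (H w)))" "finite_measure (density M' (\<lambda>w. ennreal (H' w)))"
     by (auto intro!: finite_measureI simp: emeasure_density M.emeasure_finite M'.emeasure_finite top_unique)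
    show "finite_measure \<mu>" "finite_measure \<mu>'"
     unfolding \<mu>_def \<mu>'_def using d by (auto intro!: finite_measure.finite_measure_distr)
    show "AE x in \<mu>. 0 \<le> x" "AE x in \<mu>'. 0 \<le> x"
    proof -
     have "AE w in M. 0 < ennreal (H w) --> 0 \<le> Y w t" using pos(1) by eventually_elim (use t0 in auto)
     then show "AE x in \<mu>. 0 \<le> x" unfolding \<mu>_def by (simp add: AE_distr_iff AE_density)
     have "AE w in M'. 0 < ennreal (H' w) --> 0 \<le> Y' w t" using pos(2) by eventually_elim (use t0 in auto)
     then show "AE x in \<mu>'. 0 \<le> x" unfolding \<mu>'_def by (simp add: AE_distr_iff AE_density)
    qed
    fix \<theta>
    have "(LINT x|\<mu>. sfun l \<theta> x) = exp (- ((\<theta>\<^sup>2 + l\<^sup>2) / 2) * (t - s)) * (LINT w|M. H w * sfun l \<theta> (Y w s))"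
     unfolding int(1)[OF sfun_borel[OF l]] H_def
     using sm(1) insert.hyps(1) Us s0 st a unfolding sine_mart_def by blast
    moreover have "(LINT x|\<mu>'. sfun l \<theta> x) = exp (- ((\<theta>\<^sup>2 + l\<^sup>2) / 2) * (t - s)) * (LINT w|M'. H' w * sfun l \<theta> (Y' w s))"
     unfolding int(2)[OF sfun_borel[OF l]] H'_def
     using sm(2) insert.hyps(1) Us s0 st a unfolding sine_mart_def by blast
    ultimately show "(LINT x|\<mu>. sfun l \<theta> x) = (LINT x|\<mu>'. sfun l \<theta> x)" using HL by simp
   qed (simp_all add: \<mu>_def \<mu>'_def)
   then have "(LINT w|M. H w * a t (Y w t)) = (LINT w|M'. H' w * a t (Y' w t))"
    using int[OF borel_measurable_continuous_onI[OF a(1)[of t]]] by simp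
   moreover have "t \<notin> U" using insert.hyps(2) by auto
   ultimately show ?thesis using insert.hyps(1) by (simp add: H_def H'_def mult.commute)
  qed
 qed
 show ?thesis unfolding F_inf_def
 proof (rule coord_distr_eqI[where T="{0}"])
  fix U :: "real set" and a :: "real => real => real" assume U: "finite U" "U \<subseteq> {0..}" "{0} \<subseteq> U" and a: "\<And>u. continuous_on UNIV (a u)" "\<And>u x. 0 \<le> a u x \<and> a u x \<le> 1"
  have m: "(\<lambda>w. \<Prod>u\<in>U. a u (Y w u)) \<in> borel_measurable M" "(\<lambda>w. \<Prod>u\<in>U. a u (Y' w u)) \<in> borel_measurable M'"
   by (rule prod_path_measurable[OF Y U(2) a(1)] prod_path_measurable[OF Y' U(2) a(1)])+
  have b: "0 \<le> (\<Prod>u\<in>U. a u (x u)) \<and> (\<Prod>u\<in>U. a u (x u)) \<le> 1" for x by (rule prod_01[OF a(2)])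
  have "(\<integral>\<^sup>+w. ennreal (\<Prod>u\<in>U. a u (Y w u)) \<partial>M) = ennreal (LINT w|M. (\<Prod>u\<in>U. a u (Y w u)))"
   using b m by (intro nn_integral_eq_integral M.integrable_const_bound[where B=1]) auto
  moreover have "(\<integral>\<^sup>+w. ennreal (\<Prod>u\<in>U. a u (Y' w u)) \<partial>M') = ennreal (LINT w|M'. (\<Prod>u\<in>U. a u (Y' w u)))"
   using b m by (intro nn_integral_eq_integral M'.integrable_const_bound[where B=1]) auto
  ultimately show "(\<integral>\<^sup>+w. ennreal (\<Prod>u\<in>U. a u (Y w u)) \<partial>M) = (\<integral>\<^sup>+w. ennreal (\<Prod>u\<in>U. a u (Y' w u)) \<partial>M')"
   using agree[OF U(1,2) _ a] U(3) by simp
 qed (use fin Y Y' in \<open>simp_all add: F_inf_def\<close>)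
qed

section \<open>The path after the time of the maximum\<close>

context penalised
begin

text \<open>The constant \<open>B\<close> is added to make the integrand nonnegative, and removed
  again by applying the same identity to the zero function.\<close>

lemma integral_Q_maxed:
 fixes K :: "(real => real) => real"
 assumes q: "0 \<le> q" and K: "K \<in> borel_measurable (F q)" and B: "\<And>w. \<bar>K w\<bar> \<le> B"
 shows "(LINT w|Q. indicator {w \<in> Omega. maxed q w} w * K w) = (LINT w|P. mart_after l \<psi> q w / I0 * K w)"
proof -
 let ?X = "{w \<in> Omega. maxed q w}" and ?m = "\<lambda>w. mart_after l \<psi> q w / I0"
 have B0: "0 \<le> B" using B[of undefined] by linarith
 have XQ: "?X \<in> sets Q" using maxed_measurable[OF q] by (simp only: Q_sets)
 have KP: "K \<in> borel_measurable P" by (rule F_measurable_P[OF K])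
 have KQ: "K \<in> borel_measurable Q" by (rule measurable_compose[OF id_QF K])
 have mP: "?m \<in> borel_measurable P" using F_measurable_P[OF mart_after_measurable[OF q]] by simp
 have m0: "w \<in> Omega ==> 0 \<le> ?m w" for w using mart_after_nonneg[of w q] q I0_pos by simp
 have XB: "indicator ?X \<in> borel_measurable Q" using XQ by (rule borel_measurable_indicator)
 have eq: "(LINT w|Q. indicator ?X w * (K' w + B)) = (LINT w|P. ?m w * (K' w + B))"
  if K': "K' \<in> borel_measurable (F q)" "\<And>w. \<bar>K' w\<bar> \<le> B" for K'
 proof -
  have pos: "0 \<le> K' w + B" for w using K'(2)[of w] by linarith
  have KP': "K' \<in> borel_measurable P" by (rule F_measurable_P[OF K'(1)])
  have KQ': "K' \<in> borel_measurable Q" by (rule measurable_compose[OF id_QF K'(1)])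
  have "(LINT w|Q. indicator ?X w * (K' w + B)) = enn2real (\<integral>\<^sup>+w. ennreal (indicator ?X w * (K' w + B)) \<partial>Q)"
   using pos XB KQ' by (intro integral_eq_nn_integral borel_measurable_times borel_measurable_add) auto
  also have "(\<integral>\<^sup>+w. ennreal (indicator ?X w * (K' w + B)) \<partial>Q) = (\<integral>\<^sup>+w. indicator ?X w * ennreal (K' w + B) \<partial>Q)"
   by (intro nn_integral_cong) (auto simp: indicator_def)
  also have "\<dots> = (\<integral>\<^sup>+w. ennreal (?m w) * ennreal (K' w + B) \<partial>P)"
   using K'(1) by (intro nn_integral_Q_maxed[OF q]) auto
  also have "\<dots> = (\<integral>\<^sup>+w. ennreal (?m w * (K' w + B)) \<partial>P)"
   using pos m0 by (intro nn_integral_cong ennreal_mult[symmetric]) auto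
  also have "enn2real \<dots> = (LINT w|P. ?m w * (K' w + B))"
   using mP KP' by (intro integral_eq_nn_integral[symmetric] borel_measurable_times borel_measurable_add AE_I2 mult_nonneg_nonneg pos m0) auto
  finally show ?thesis .
 qed
 have mi: "integrable P ?m"
 proof (rule integrableI_nonneg[OF mP])
  have "(\<integral>\<^sup>+w. ennreal (?m w) \<partial>P) = (\<integral>\<^sup>+w. indicator ?X w * 1 \<partial>Q)"
   using nn_integral_Q_maxed[OF q, of "\<lambda>_. 1"] by simp
  also have "\<dots> \<le> (\<integral>\<^sup>+w. 1 \<partial>Q)" by (intro nn_integral_mono) (auto simp: indicator_def)
  finally show "(\<integral>\<^sup>+w. ennreal (?m w) \<partial>P) < \<infinity>" using Q.emeasure_space_1 by (simp add: order.strict_trans1)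
 qed (use m0 in auto)
 have mKi: "integrable P (\<lambda>w. ?m w * K w)"
 proof (rule Bochner_Integration.integrable_bound[OF integrable_mult_right[OF mi, of B]])
  show "AE w in P. norm (?m w * K w) \<le> norm (B * ?m w)"
  proof (rule AE_I2)
   fix w assume "w \<in> space P"
   then have "\<bar>?m w\<bar> * \<bar>K w\<bar> \<le> \<bar>?m w\<bar> * B" using B[of w] by (intro mult_left_mono) auto
   then show "norm (?m w * K w) \<le> norm (B * ?m w)" using B0 by (simp only: real_norm_def abs_mult abs_of_nonneg mult.commute)
  qed
 qed (use mP KP in \<open>rule borel_measurable_times\<close>)
 have Xi: "integrable Q (\<lambda>w. indicator ?X w * K w)" "integrable Q (\<lambda>w. indicator ?X w :: real)"
  by (rule Q.integrable_const_bound[where B=B], use B B0 in \<open>simp add: indicator_def\<close>, rule borel_measurable_times[OF XB KQ])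
   (rule Q.integrable_const_bound[where B=1, OF _ XB], simp add: indicator_def)
 have "(LINT w|Q. indicator ?X w * K w) + (LINT w|Q. indicator ?X w * B) = (LINT w|P. ?m w * K w) + (LINT w|P. ?m w * B)"
  using eq[OF K B] Xi integrable_mult_left[OF Xi(2), of B] mKi integrable_mult_left[OF mi, of B]
  by (simp only: distrib_left Bochner_Integration.integral_add)
 moreover have "(LINT w|Q. indicator ?X w * B) = (LINT w|P. ?m w * B)"
  using eq[of "\<lambda>_. 0"] B0 by simp
 ultimately show ?thesis by simp
qed

lemma maxed_shift:
 assumes w: "W \<in> Omega" and p: "0 \<le> p" "p \<le> q"
 shows "maxed p W \<longleftrightarrow> maxed q W \<and> S q W \<le> S p W"
proof
 assume *: "maxed p W"
 then have "S q W \<le> S p W" using w p by (subst S_le_iff) (auto simp: maxed_def)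
 moreover have "maxed q W" using * S_mono[OF w p] unfolding maxed_def by (meson order_trans)
 ultimately show "maxed q W \<and> S q W \<le> S p W" by simp
next
 assume "maxed q W \<and> S q W \<le> S p W"
 then show "maxed p W" unfolding maxed_def by (meson order_trans)
qed

text \<open>On \<open>maxed p\<close> the density at time \<open>q\<close> contains
  \<open>sinh (l * (S p W - W q))\<close>, which cancels the denominator of \<open>sfun\<close>.
  What remains is \<open>sin\<close> with killing at the level \<open>S p W\<close>:
  \<open>killed_martingale\<close> gives the rate \<open>- (\<theta>\<^sup>2 / 2)\<close>, and the
  discount in \<open>mart_after\<close> contributes \<open>- (l\<^sup>2 / 2)\<close>.\<close>

lemma sine_step_at_max:
 assumes p: "0 \<le> p" "p < q" and K: "K \<in> borel_measurable (F p)" and K01: "\<And>W. 0 \<le> K W \<and> K W \<le> 1"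
 shows "(LINT W|Q. indicator {W \<in> Omega. maxed p W} W * (K W * sfun l \<theta> (S p W - W q)))
  = exp (- ((\<theta>\<^sup>2 + l\<^sup>2) / 2) * (q - p)) * (LINT W|Q. indicator {W \<in> Omega. maxed p W} W * (K W * sfun l \<theta> (S p W - W p)))"
proof -
 let ?X = "\<lambda>p. {W \<in> Omega. maxed p W}"
 define T where "T N W = (of_bool (S p W - W p \<le> real N \<and> \<psi> (S p W) \<le> real N) :: real)" for N :: nat and W
 define D where "D W \<longleftrightarrow> (\<forall>t\<in>{p..q}. W t \<le> S p W)" for W
 have q0: "0 \<le> q" using p by simp
 have S: "S p \<in> borel_measurable (F p)" and x: "(\<lambda>W. W p) \<in> borel_measurable (F p)" using p by (auto intro: S_measurable coord_F)
 have Sq: "S p \<in> borel_measurable (F q)" and xq: "(\<lambda>W. W q) \<in> borel_measurable (F q)" using p by (auto intro: S_measurable coord_F)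
 have \<psi>S: "(\<lambda>W. \<psi> (S p W)) \<in> borel_measurable (F p)" by (rule measurable_compose[OF S \<psi>_borel])
 have TF: "T N \<in> borel_measurable (F p)" for N
 proof -
  have "Measurable.pred (F p) (\<lambda>W. S p W - W p \<le> real N)" "Measurable.pred (F p) (\<lambda>W. \<psi> (S p W) \<le> real N)"
   unfolding pred_def by (intro borel_measurable_le borel_measurable_diff borel_measurable_const S x \<psi>S)+
  then show ?thesis unfolding T_def by (intro borel_measurable_of_bool pred_intros_logic)
 qed
 have T01: "0 \<le> T N W \<and> T N W \<le> 1" for N W by (simp add: T_def)
 have Dm: "Measurable.pred (F q) D" unfolding D_def using p by (intro pred_all_le S_measurable) (auto intro: coord_F)
 have sf: "(\<lambda>W. sfun l \<theta> (S p W - W q)) \<in> borel_measurable (F q)" "(\<lambda>W. sfun l \<theta> (S p W - W p)) \<in> borel_measurable (F p)"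
  by (rule measurable_compose[OF borel_measurable_diff[OF Sq xq] sfun_borel[OF l_pos]] measurable_compose[OF borel_measurable_diff[OF S x] sfun_borel[OF l_pos]])+
 have KTb: "\<bar>K W * T N W * of_bool b * sfun l \<theta> y\<bar> \<le> \<bar>\<theta>\<bar> / l" for W N b y
 proof -
  have "\<bar>K W * T N W * of_bool b\<bar> \<le> 1" using K01[of W] T01[of N W] mult_le_one[of "K W" "T N W"] by (cases b) (auto simp: abs_mult)
  then have "\<bar>K W * T N W * of_bool b\<bar> * \<bar>sfun l \<theta> y\<bar> \<le> 1 * (\<bar>\<theta>\<bar> / l)" using sfun_bound[OF l_pos, of \<theta> y] by (intro mult_mono) auto
  then show ?thesis by (simp only: abs_mult mult_1)
 qed
 have S_D: "S q W = S p W" if "W \<in> Omega" "D W" for W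
 proof (rule antisym)
  have "W u \<le> S p W" if "0 \<le> u" "u \<le> q" for u
   using \<open>D W\<close> that S_upper[OF \<open>W \<in> Omega\<close>, of u p] by (cases "u \<le> p") (auto simp: D_def)
  then show "S q W \<le> S p W" using that q0 by (subst S_le_iff) auto
  show "S p W \<le> S q W" using that p by (intro S_mono) auto
 qed
 \<comment> \<open>Having the overall maximum by time \<open>p\<close> means having it by time
   \<open>q\<close> and not exceeding the level in between. This brings in the density of
   \<open>maxed q\<close> on \<open>F q\<close>, which the integrand needs because it looks at
   \<open>W q\<close>.\<close>
 have XD: "indicator (?X p) W = indicator (?X q) W * (of_bool (D W) :: real)" for W
 proof (cases "W \<in> Omega")
  case True
  have "maxed p W \<longleftrightarrow> maxed q W \<and> D W"
   using maxed_shift[OF True p(1), of q] p S_D[OF True] by (auto simp: D_def maxed_def)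
  then show ?thesis using True by (auto simp: indicator_def)
 qed (simp add: indicator_def)
 have trunc: "(LINT W|Q. indicator (?X p) W * (K W * T N W * sfun l \<theta> (S p W - W q)))
  = exp (- ((\<theta>\<^sup>2 + l\<^sup>2) / 2) * (q - p)) * (LINT W|Q. indicator (?X p) W * (K W * T N W * sfun l \<theta> (S p W - W p)))"
  if N: "0 < N" for N
 proof -
  define K' where "K' W = K W * T N W * (\<psi> (S p W) / real N)" for W
  define c where "c t = real N / l * exp (- l\<^sup>2 * t / 2) / I0" for t
  have K'F: "K' \<in> borel_measurable (F p)" unfolding K'_def
   by (intro borel_measurable_times borel_measurable_divide borel_measurable_const K TF \<psi>S)
  have K'01: "0 \<le> K' W \<and> K' W \<le> 1" for W
  proof (cases "T N W = 0")
   case False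
   then have "\<psi> (S p W) \<le> real N" "T N W = 1" by (auto simp: T_def split: if_splits)
   then have "0 \<le> \<psi> (S p W) / real N" "\<psi> (S p W) / real N \<le> 1" using \<psi>_pos[of "S p W"] N by (auto simp: divide_le_eq)
   moreover have "K' W = K W * (\<psi> (S p W) / real N)" using \<open>T N W = 1\<close> by (simp only: K'_def mult_1_right)
   ultimately show ?thesis using K01[of W] mult_le_one[of "K W" "\<psi> (S p W) / real N"] mult_nonneg_nonneg[of "K W" "\<psi> (S p W) / real N"] by presburger
  qed (simp add: K'_def)
  \<comment> \<open>The factor \<open>of_bool (0 \<le> S p W - W p)\<close> is 1 on
    \<open>Omega\<close>. It secures the bound on the distance to the level for functions outside
    \<open>Omega\<close> as well, over which the premises of \<open>killed_martingale\<close>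
    range.\<close>
  have km: "(LINT W|P. K' W * of_bool (0 \<le> S p W - W p) * of_bool (\<forall>t\<in>{p..q}. W t \<le> S p W) * sin (\<theta> * (S p W - W q)))
   = exp (- (\<theta>\<^sup>2 / 2) * (q - p)) * (LINT W|P. K' W * of_bool (0 \<le> S p W - W p) * of_bool (W p \<le> S p W) * sin (\<theta> * (S p W - W p)))"
  proof (rule killed_martingale[OF l_pos p _ _ S, where u="\<lambda>x. sin (\<theta> * x)" and C="\<bar>\<theta>\<bar> / l" and c="real N"])
   have "Measurable.pred (F p) (\<lambda>W. 0 \<le> S p W - W p)"
    unfolding pred_def by (intro borel_measurable_le borel_measurable_diff borel_measurable_const S x)
   then show "(\<lambda>W. K' W * of_bool (0 \<le> S p W - W p)) \<in> borel_measurable (F p)"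
    by (intro borel_measurable_times borel_measurable_of_bool K'F)
   show "0 \<le> K' W * of_bool (0 \<le> S p W - W p) \<and> K' W * of_bool (0 \<le> S p W - W p) \<le> 1" for W
    using K'01[of W] by simp
   show "\<bar>S p W - W p\<bar> \<le> real N" if "K' W * of_bool (0 \<le> S p W - W p) \<noteq> 0" for W
    using that by (auto simp: K'_def T_def split: if_splits)
   show "(\<lambda>x. sin (\<theta> * x)) \<in> borel_measurable borel" by measurable
   show "\<bar>sin (\<theta> * x)\<bar> \<le> \<bar>\<theta>\<bar> / l * \<bar>sinh (l * x)\<bar>" for x by (rule abs_sin_le_sinh[OF l_pos])
  qed (rule gauss_sin_diff)
  have Sx: "W \<in> Omega ==> W p \<le> S p W" for W using S_upper[of W p p] p by auto
  have "(LINT W|Q. indicator (?X p) W * (K W * T N W * sfun l \<theta> (S p W - W q)))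
   = (LINT W|Q. indicator (?X q) W * (K W * T N W * of_bool (D W) * sfun l \<theta> (S p W - W q)))"
   unfolding XD by (intro Bochner_Integration.integral_cong refl) (simp add: mult_ac)
  also have "\<dots> = (LINT W|P. mart_after l \<psi> q W / I0 * (K W * T N W * of_bool (D W) * sfun l \<theta> (S p W - W q)))"
   by (rule integral_Q_maxed[OF q0 _ KTb])
    (intro borel_measurable_times borel_measurable_of_bool Dm sf(1) F_measurable_mono[OF K less_imp_le[OF p(2)]] F_measurable_mono[OF TF less_imp_le[OF p(2)]])
  also have "\<dots> = (LINT W|P. c q * (K' W * of_bool (0 \<le> S p W - W p) * of_bool (\<forall>t\<in>{p..q}. W t \<le> S p W) * sin (\<theta> * (S p W - W q))))"
  proof (intro Bochner_Integration.integral_cong refl)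
   fix W assume "W \<in> space P"
   then have w: "W \<in> Omega" by simp
   show "mart_after l \<psi> q W / I0 * (K W * T N W * of_bool (D W) * sfun l \<theta> (S p W - W q))
    = c q * (K' W * of_bool (0 \<le> S p W - W p) * of_bool (\<forall>t\<in>{p..q}. W t \<le> S p W) * sin (\<theta> * (S p W - W q)))"
   proof (cases "D W")
    case True
    have "mart_after l \<psi> q W = \<psi> (S p W) / l * exp (- l\<^sup>2 * q / 2) * sinh (l * (S p W - W q))"
     by (simp add: mart_after_def S_D[OF w True])
    then show ?thesis using True Sx[OF w] N unfolding sfun_times_sinh[OF l_pos, symmetric] D_def
     by (simp add: K'_def c_def)
   qed (auto simp: D_def)
  qed
  also have "\<dots> = c q * (exp (- (\<theta>\<^sup>2 / 2) * (q - p)) * (LINT W|P. K' W * of_bool (0 \<le> S p W - W p) * of_bool (W p \<le> S p W) * sin (\<theta> * (S p W - W p))))"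
   by (simp only: integral_mult_right_zero km)
  also have "(LINT W|P. K' W * of_bool (0 \<le> S p W - W p) * of_bool (W p \<le> S p W) * sin (\<theta> * (S p W - W p)))
   = (LINT W|P. K' W * sin (\<theta> * (S p W - W p)))"
   using Sx by (intro Bochner_Integration.integral_cong refl) simp
  also have "c q * (exp (- (\<theta>\<^sup>2 / 2) * (q - p)) * (LINT W|P. K' W * sin (\<theta> * (S p W - W p))))
   = exp (- ((\<theta>\<^sup>2 + l\<^sup>2) / 2) * (q - p)) * (c p * (LINT W|P. K' W * sin (\<theta> * (S p W - W p))))"
  proof -
   have "exp (- l\<^sup>2 * q / 2) * exp (- (\<theta>\<^sup>2 / 2) * (q - p)) = exp (- ((\<theta>\<^sup>2 + l\<^sup>2) / 2) * (q - p)) * exp (- l\<^sup>2 * p / 2)"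
    unfolding exp_add[symmetric] by (simp add: field_simps)
   then have "c q * exp (- (\<theta>\<^sup>2 / 2) * (q - p)) = exp (- ((\<theta>\<^sup>2 + l\<^sup>2) / 2) * (q - p)) * c p"
    unfolding c_def by (simp add: field_simps)
   then show ?thesis by (simp only: mult.assoc[symmetric])
  qed
  also have "c p * (LINT W|P. K' W * sin (\<theta> * (S p W - W p))) = (LINT W|P. mart_after l \<psi> p W / I0 * (K W * T N W * of_bool True * sfun l \<theta> (S p W - W p)))"
   unfolding integral_mult_right_zero[symmetric] sfun_times_sinh[OF l_pos, symmetric] using N
   by (intro Bochner_Integration.integral_cong refl) (simp add: K'_def c_def mart_after_def)
  also have "\<dots> = (LINT W|Q. indicator (?X p) W * (K W * T N W * of_bool True * sfun l \<theta> (S p W - W p)))"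
   by (rule integral_Q_maxed[symmetric, OF p(1) _ KTb]) (intro borel_measurable_times K TF sf(2) borel_measurable_const)
  finally show ?thesis by simp
 qed
 have XQ: "?X p \<in> sets Q" using maxed_measurable[OF p(1)] by (simp only: Q_sets)
 have lim: "(\<lambda>N. \<integral>W. indicator (?X p) W * (K W * T (Suc N) W * f W) \<partial>Q) \<longlonglongrightarrow> (LINT W|Q. indicator (?X p) W * (K W * f W))"
  if f: "f \<in> borel_measurable (F q)" "\<And>W. \<bar>f W\<bar> \<le> \<bar>\<theta>\<bar> / l" for f
 proof (rule integral_dominated_convergence[where w="\<lambda>_. \<bar>\<theta>\<bar> / l"])
  have m: "f \<in> borel_measurable Q" "K \<in> borel_measurable Q" "T N \<in> borel_measurable Q" for N
   by (rule measurable_compose[OF id_QF f(1)] measurable_compose[OF id_QF K] measurable_compose[OF id_QF TF])+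
  show "(\<lambda>W. indicator (?X p) W * (K W * f W)) \<in> borel_measurable Q"
   by (intro borel_measurable_times borel_measurable_indicator XQ m)
  show "(\<lambda>W. indicator (?X p) W * (K W * T (Suc N) W * f W)) \<in> borel_measurable Q" for N
   by (intro borel_measurable_times borel_measurable_indicator XQ m)
  show "AE W in Q. (\<lambda>N. indicator (?X p) W * (K W * T (Suc N) W * f W)) \<longlonglongrightarrow> indicator (?X p) W * (K W * f W)"
  proof (intro AE_I2 tendsto_eventually)
   fix W
   have "\<forall>\<^sub>F N in sequentially. max (S p W - W p) (\<psi> (S p W)) < real N"
    using filterlim_real_sequentially unfolding filterlim_at_top_dense by (rule spec)
   then show "\<forall>\<^sub>F N in sequentially. indicator (?X p) W * (K W * T (Suc N) W * f W) = indicator (?X p) W * (K W * f W)"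
    by eventually_elim (simp add: T_def)
  qed
  show "AE W in Q. norm (indicator (?X p) W * (K W * T (Suc N) W * f W)) \<le> \<bar>\<theta>\<bar> / l" for N
  proof (rule AE_I2)
   fix W
   have "\<bar>indicator (?X p) W * (K W * T (Suc N) W)\<bar> \<le> 1" using K01[of W] T01[of "Suc N" W] mult_le_one[of "K W" "T (Suc N) W"]
    by (auto simp: abs_mult indicator_def)
   then have "\<bar>indicator (?X p) W * (K W * T (Suc N) W)\<bar> * \<bar>f W\<bar> \<le> 1 * (\<bar>\<theta>\<bar> / l)" using f(2)[of W] by (intro mult_mono) auto
   then show "norm (indicator (?X p) W * (K W * T (Suc N) W * f W)) \<le> \<bar>\<theta>\<bar> / l" by (simp only: real_norm_def abs_mult mult_1 mult.assoc)
  qed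
 qed simp
 note l1 = lim[OF sf(1) sfun_bound[OF l_pos]]
  and l2 = lim[OF F_measurable_mono[OF sf(2) less_imp_le[OF p(2)]] sfun_bound[OF l_pos]]
 have "(\<lambda>N. exp (- ((\<theta>\<^sup>2 + l\<^sup>2) / 2) * (q - p)) * (LINT W|Q. indicator (?X p) W * (K W * T (Suc N) W * sfun l \<theta> (S p W - W p))))
   \<longlonglongrightarrow> (LINT W|Q. indicator (?X p) W * (K W * sfun l \<theta> (S p W - W q)))"
  using l1 by (subst (asm) trunc) auto
 from LIMSEQ_unique[OF this tendsto_mult_left[OF l2]] show ?thesis .
qed

text \<open>To admit weights depending on the path up to \<open>r + s\<close>, the step is started
  there: \<open>maxed r\<close> is \<open>maxed (r + s)\<close> together with
  \<open>S (r + s) w \<le> S r w\<close>, and the second condition joins the weight.\<close>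

lemma sine_step_after_max:
 assumes r: "0 \<le> r" "0 \<le> s" "s < t" and K: "K \<in> borel_measurable (F (r + s))" and K01: "\<And>w. 0 \<le> K w \<and> K w \<le> 1"
 shows "(LINT w|Q. indicator {w \<in> Omega. maxed r w} w * (K w * sfun l \<theta> (S r w - w (r + t))))
  = exp (- ((\<theta>\<^sup>2 + l\<^sup>2) / 2) * (t - s)) * (LINT w|Q. indicator {w \<in> Omega. maxed r w} w * (K w * sfun l \<theta> (S r w - w (r + s))))"
proof -
 let ?p = "r + s" and ?q = "r + t"
 have b: "Measurable.pred (F ?p) (\<lambda>w. S ?p w \<le> S r w)"
  unfolding pred_def using r by (intro borel_measurable_le S_measurable) auto
 have eq: "indicator {w \<in> Omega. maxed ?p w} w * ((K w * of_bool (S ?p w \<le> S r w)) * sfun l \<theta> (S ?p w - y))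
   = indicator {w \<in> Omega. maxed r w} w * (K w * sfun l \<theta> (S r w - y))" for w y
 proof (cases "w \<in> Omega")
  case True
  show ?thesis
  proof (cases "S ?p w \<le> S r w")
   case T: True
   moreover have "S r w \<le> S ?p w" using True r by (intro S_mono) auto
   ultimately show ?thesis using maxed_shift[OF True r(1), of ?p] r by (auto simp: indicator_def)
  qed (use maxed_shift[OF True r(1), of ?p] r in \<open>auto simp: indicator_def\<close>)
 qed (simp add: indicator_def)
 have "(LINT w|Q. indicator {w \<in> Omega. maxed ?p w} w * ((K w * of_bool (S ?p w \<le> S r w)) * sfun l \<theta> (S ?p w - w ?q)))
  = exp (- ((\<theta>\<^sup>2 + l\<^sup>2) / 2) * (?q - ?p)) * (LINT w|Q. indicator {w \<in> Omega. maxed ?p w} w * ((K w * of_bool (S ?p w \<le> S r w)) * sfun l \<theta> (S ?p w - w ?p)))"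
  using r K01 by (intro sine_step_at_max borel_measurable_times borel_measurable_of_bool K b) auto
 then show ?thesis unfolding eq by simp
qed

lemma post_g_Q: "post_g_path \<in> Q \<rightarrow>\<^sub>M F_inf"
 using post_g_path_measurable by (simp cong: measurable_cong_sets add: Q_sets)

lemma alive_sets_Q:
 assumes "\<Gamma> \<in> sets (F r)" shows "{w \<in> Omega. ennreal r < g w \<and> w \<in> \<Gamma>} \<in> sets Q"
proof -
 have "{w \<in> space Q. ennreal r < g w} \<in> sets Q" using g_borel_Q by measurable
 moreover have "\<Gamma> \<in> sets Q" using sets_F_F_inf[OF assms] by (simp add: Q_sets)
 moreover have "{w \<in> space Q. ennreal r < g w} \<inter> \<Gamma> = {w \<in> Omega. ennreal r < g w \<and> w \<in> \<Gamma>}" by auto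
 ultimately show ?thesis using sets.Int by metis
qed

text \<open>The time \<open>g\<close> is approximated from above by the grid times \<open>r0 + k / n\<close>.\<close>

lemma post_g_sine_mart:
 assumes r0: "0 \<le> r0" and \<Gamma>: "\<Gamma> \<in> sets (F r0)"
 shows "sine_mart l (density Q (indicator {W \<in> Omega. ennreal r0 < g W \<and> W \<in> \<Gamma>})) post_g_path"
 unfolding sine_mart_def
proof (intro allI impI)
 fix \<theta> s t :: real and U :: "real set" and a :: "real => real => real"
 assume U: "finite U" "U \<subseteq> {0..s}" and s: "0 \<le> s" "s < t" and a1: "\<forall>u. continuous_on UNIV (a u)" and a2: "\<forall>u x. 0 \<le> a u x \<and> a u x \<le> 1"
 define G where "G = {W \<in> Omega. ennreal r0 < g W \<and> W \<in> \<Gamma>}"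
 define e where "e = exp (- ((\<theta>\<^sup>2 + l\<^sup>2) / 2) * (t - s))"
 define w where "w v W = (\<Prod>u\<in>U. a u (post_g_path W u)) * sfun l \<theta> (post_g_path W v)" for v W
 have GQ: "G \<in> sets Q" unfolding G_def by (rule alive_sets_Q[OF \<Gamma>])
 have U0: "U \<subseteq> {0..}" using U(2) by auto
 have ab: "a u \<in> borel_measurable borel" for u using a1 by (intro borel_measurable_continuous_onI) auto
 have a2': "0 \<le> a u x \<and> a u x \<le> 1" for u x using a2 by blast
 have wm: "w v \<in> borel_measurable Q" if "0 \<le> v" for v
  unfolding w_def using a1 that
  by (intro borel_measurable_times prod_path_measurable[OF post_g_Q U0] measurable_compose[OF measurable_compose[OF post_g_Q coord_F_inf] sfun_borel[OF l_pos]]) auto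
 have pb: "\<bar>(\<Prod>u\<in>U. a u (x u)) * sfun l \<theta> y\<bar> \<le> \<bar>\<theta>\<bar> / l" for x y
 proof -
  have "0 \<le> (\<Prod>u\<in>U. a u (x u)) \<and> (\<Prod>u\<in>U. a u (x u)) \<le> 1" by (rule prod_01) (rule a2')
  then have "\<bar>\<Prod>u\<in>U. a u (x u)\<bar> * \<bar>sfun l \<theta> y\<bar> \<le> 1 * (\<bar>\<theta>\<bar> / l)" using sfun_bound[OF l_pos, of \<theta> y] by (intro mult_mono) auto
  then show ?thesis by (simp only: abs_mult mult_1)
 qed
 define \<Gamma>' where "\<Gamma>' = (indicator \<Gamma> :: _ => real)"
 \<comment> \<open>A bound on \<open>g\<close> makes the sum over grid cells finite; it is removed
   by letting \<open>m\<close> grow.\<close>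
 have trunc: "(LINT W|Q. indicator G W * of_bool (g W \<le> ennreal (r0 + real m)) * w t W)
   = e * (LINT W|Q. indicator G W * of_bool (g W \<le> ennreal (r0 + real m)) * w s W)" for m
 proof -
  define r where "r n k = r0 + real k / real n" for n k :: nat
  \<comment> \<open>The contribution of the event that \<open>g\<close> lies in the cell ending at
    \<open>r n k\<close>, with \<open>g\<close> replaced by that end point.\<close>
  define h where "h n k v W = \<Gamma>' W * of_bool (maxed (r n k) W \<and> \<not> maxed (r n (k - 1)) W) *
    ((\<Prod>u\<in>U. a u (S (r n k) W - W (r n k + u))) * sfun l \<theta> (S (r n k) W - W (r n k + v)))" for n k v W
  have rk0: "0 \<le> r n k" for n k using r0 by (simp add: r_def)
  have rmono: "r n (k - 1) \<le> r n k" for n k by (auto simp: r_def intro!: divide_right_mono)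
  have r0r: "r0 \<le> r n k" for n k by (simp add: r_def)
  \<comment> \<open>Given \<open>maxed (r n k)\<close>, the maximum has not been reached at the
    previous grid point exactly if \<open>S\<close> still increases in between. This replaces a
    condition on the whole future by one in \<open>F (r n k)\<close>, so that
    \<open>sine_step_after_max\<close> applies.\<close>
  define H where "H n k W = \<Gamma>' W * of_bool (S (r n (k - 1)) W < S (r n k) W) * (\<Prod>u\<in>U. a u (S (r n k) W - W (r n k + u)))" for n k W
  have HF: "H n k \<in> borel_measurable (F (r n k + s))" for n k
  proof -
   have "\<Gamma>' \<in> borel_measurable (F (r n k + s))" unfolding \<Gamma>'_def using sets_F_mono[OF _ \<Gamma>, of "r n k + s"] r0r[of n k] s
    by (intro borel_measurable_indicator) auto
   moreover have "Measurable.pred (F (r n k + s)) (\<lambda>W. S (r n (k - 1)) W < S (r n k) W)"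
    unfolding pred_def using rk0 rmono[of n k] s by (intro borel_measurable_less S_measurable) (auto intro: order_trans[OF rmono])
   moreover have "(\<lambda>W. \<Prod>u\<in>U. a u (S (r n k) W - W (r n k + u))) \<in> borel_measurable (F (r n k + s))"
    using U(2) s rk0[of n k] by (intro borel_measurable_prod measurable_compose[OF borel_measurable_diff[OF S_measurable coord_F] ab]) auto
   ultimately show ?thesis unfolding H_def by (intro borel_measurable_times borel_measurable_of_bool)
  qed
  have H01: "0 \<le> H n k W \<and> H n k W \<le> 1" for n k W
  proof -
   have "0 \<le> (\<Prod>u\<in>U. a u (S (r n k) W - W (r n k + u))) \<and> (\<Prod>u\<in>U. a u (S (r n k) W - W (r n k + u))) \<le> 1"
    by (intro conjI prod_nonneg prod_le_1) (use a2' in auto)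
   then show ?thesis by (auto simp: H_def \<Gamma>'_def indicator_def)
  qed
  have hH: "h n k v W = indicator {W \<in> Omega. maxed (r n k) W} W * (H n k W * sfun l \<theta> (S (r n k) W - W (r n k + v)))" if "W \<in> Omega" for n k v W
   using maxed_shift[OF that rk0 rmono, of n k] that unfolding h_def H_def
   by (auto simp: indicator_def not_le split: if_splits)
  have Xk: "{W \<in> Omega. maxed (r n k) W} \<in> sets Q" for n k using maxed_measurable[OF rk0] by (simp only: Q_sets)
  have hm: "h n k v \<in> borel_measurable Q" if v: "0 \<le> v" for n k v
  proof -
   have "(\<lambda>W. sfun l \<theta> (S (r n k) W - W (r n k + v))) \<in> borel_measurable Q"
    by (rule measurable_compose[OF id_QF[of "r n k + v"] measurable_compose[OF borel_measurable_diff[OF S_measurable coord_F] sfun_borel[OF l_pos]]])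
     (use rk0[of n k] v in auto)
   then have "(\<lambda>W. indicator {W \<in> Omega. maxed (r n k) W} W * (H n k W * sfun l \<theta> (S (r n k) W - W (r n k + v)))) \<in> borel_measurable Q"
    by (intro borel_measurable_times borel_measurable_indicator Xk measurable_compose[OF id_QF HF])
   then show ?thesis by (rule measurable_cong[THEN iffD1, rotated]) (simp add: hH)
  qed
  have h_step: "(LINT W|Q. h n k t W) = e * (LINT W|Q. h n k s W)" for n k
  proof -
   have "(LINT W|Q. h n k v W) = (LINT W|Q. indicator {W \<in> Omega. maxed (r n k) W} W * (H n k W * sfun l \<theta> (S (r n k) W - W (r n k + v))))" for v
    by (intro Bochner_Integration.integral_cong refl) (simp add: hH)
   then show ?thesis using sine_step_after_max[OF rk0 s HF H01, of n k \<theta>] by (simp add: e_def)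
  qed
  have hb: "\<bar>h n k v W\<bar> \<le> \<bar>\<theta>\<bar> / l" for n k v W
  proof -
   have "\<bar>\<Gamma>' W * of_bool (maxed (r n k) W \<and> \<not> maxed (r n (k - 1)) W)\<bar> \<le> 1" by (auto simp: \<Gamma>'_def indicator_def)
   then have "\<bar>\<Gamma>' W * of_bool (maxed (r n k) W \<and> \<not> maxed (r n (k - 1)) W)\<bar> * \<bar>(\<Prod>u\<in>U. a u (S (r n k) W - W (r n k + u))) * sfun l \<theta> (S (r n k) W - W (r n k + v))\<bar> \<le> 1 * (\<bar>\<theta>\<bar> / l)"
    using pb[of "\<lambda>u. S (r n k) W - W (r n k + u)"] by (intro mult_mono) auto
   then show ?thesis unfolding h_def by (simp only: abs_mult mult_1)
  qed
  have hi: "integrable Q (h n k v)" if "0 \<le> v" for n k v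
   by (rule Q.integrable_const_bound[where B="\<bar>\<theta>\<bar> / l"]) (use hb hm[OF that] in auto)
  define \<Phi> where "\<Phi> n v W = (\<Sum>k\<in>{1..n * m}. h n k v W)" for n v W
  have \<Phi>_step: "(LINT W|Q. \<Phi> n t W) = e * (LINT W|Q. \<Phi> n s W)" for n
   unfolding \<Phi>_def using hi s by (simp add: h_step sum_distrib_left)
  define tgt where "tgt v W = indicator G W * of_bool (g W \<le> ennreal (r0 + real m)) * w v W" for v W
  have good: "(\<lambda>n. \<Phi> (Suc n) v W) \<longlonglongrightarrow> tgt v W" "\<bar>\<Phi> (Suc n) v W\<bar> \<le> \<bar>\<theta>\<bar> / l"
   if W: "good_path W" and v: "0 \<le> v" for v W n
  proof -
   have WO: "W \<in> Omega" using W by (simp add: good_path_def)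
   obtain g' where g': "0 < g'" "g W = ennreal g'" "S_inf W = ereal (W g')" "\<And>t. 0 \<le> t ==> W t \<le> W g'"
    "\<And>r. 0 \<le> r ==> maxed r W \<longleftrightarrow> g' \<le> r" using good_pathE[OF W] by blast
   have post: "post_g_path W u = W g' - W (g' + u)" if "0 \<le> u" for u
    using that g' by (simp add: post_g_path_def add.commute)
   have mk: "maxed (r n k) W \<and> \<not> maxed (r n (k - 1)) W \<longleftrightarrow> r n (k - 1) < g' \<and> g' \<le> r n k" for n k
    using g'(5) rk0 by (auto simp: not_le)
   have "g W \<le> ennreal (r0 + real m) \<longleftrightarrow> g' \<le> r0 + real m" unfolding g'(2) using r0 by (intro ennreal_le_iff) auto
   then have tgt: "tgt v W = \<Gamma>' W * of_bool (r0 < g' \<and> g' \<le> r0 + real m) * w v W"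
    using g'(2) r0 WO by (simp add: tgt_def G_def \<Gamma>'_def indicator_def ennreal_less_iff)
   have "(\<lambda>n. \<Phi> (Suc n) v W) \<longlonglongrightarrow> tgt v W \<and> (\<forall>n. \<bar>\<Phi> (Suc n) v W\<bar> \<le> \<bar>\<theta>\<bar> / l)"
   proof (cases "r0 < g'")
    case False
    then have "\<not> (r n (k - 1) < g' \<and> g' \<le> r n k)" for n k using r0r[of n "k - 1"] by auto
    then have "h n k v W = 0" for n k unfolding h_def mk by simp
    then have "\<Phi> n v W = 0" for n by (simp add: \<Phi>_def)
    moreover have "tgt v W = 0" using False by (simp add: tgt)
    moreover have "0 \<le> \<bar>\<theta>\<bar> / l" using l_pos by simp
    ultimately show ?thesis by simp
   next
    case True
    \<comment> \<open>The only cell that contributes: the smallest \<open>k\<close> with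
      \<open>g' \<le> r n k\<close>. It is positive because \<open>r0 < g'\<close>.\<close>
    define \<kappa> where "\<kappa> n = nat \<lceil>real n * (g' - r0)\<rceil>" for n
    have \<kappa>: "real n * (g' - r0) \<le> real (\<kappa> n)" "real (\<kappa> n) < real n * (g' - r0) + 1" "1 \<le> \<kappa> n" if n: "0 < n" for n
    proof -
     have p: "0 < real n * (g' - r0)" using n True by simp
     have k: "real (\<kappa> n) = real_of_int \<lceil>real n * (g' - r0)\<rceil>" using p by (simp add: \<kappa>_def)
     show "real n * (g' - r0) \<le> real (\<kappa> n)" "real (\<kappa> n) < real n * (g' - r0) + 1" unfolding k by linarith+
     then show "1 \<le> \<kappa> n" using p by (cases "\<kappa> n") auto
    qed
    have cell: "(r n (k - 1) < g' \<and> g' \<le> r n k) \<longleftrightarrow> k = \<kappa> n" if n: "0 < n" and k: "1 \<le> k" for n k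
    proof -
     have "g' \<le> r n k \<longleftrightarrow> real n * (g' - r0) \<le> real k" using n by (simp add: r_def field_simps)
     moreover have "r n (k - 1) < g' \<longleftrightarrow> real k - 1 < real n * (g' - r0)" using n k by (simp add: r_def field_simps of_nat_diff)
     ultimately have "(r n (k - 1) < g' \<and> g' \<le> r n k) \<longleftrightarrow> real k - 1 < real n * (g' - r0) \<and> real n * (g' - r0) \<le> real k" by auto
     also have "\<dots> \<longleftrightarrow> k = \<kappa> n"
     proof
      assume *: "real k - 1 < real n * (g' - r0) \<and> real n * (g' - r0) \<le> real k"
      then have "real k < real (\<kappa> n) + 1" "real (\<kappa> n) < real k + 1" using \<kappa>[OF n] by linarith+
      then show "k = \<kappa> n" by linarith
     qed (use \<kappa>[OF n] in linarith)
     finally show ?thesis .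
    qed
    have range: "\<kappa> n \<le> n * m \<longleftrightarrow> g' \<le> r0 + real m" if n: "0 < n" for n
    proof
     assume "\<kappa> n \<le> n * m"
     then have "real (\<kappa> n) \<le> real n * real m" by (metis of_nat_le_iff of_nat_mult)
     then have "real n * (g' - r0) \<le> real n * real m" using \<kappa>(1)[OF n] by linarith
     then show "g' \<le> r0 + real m" using n by simp
    next
     assume "g' \<le> r0 + real m"
     then have "real n * (g' - r0) \<le> real n * real m" by (intro mult_left_mono) auto
     then have "real (\<kappa> n) < real (n * m) + 1" using \<kappa>(2)[OF n] by simp
     then show "\<kappa> n \<le> n * m" by linarith
    qed
    have S_r: "S (r n (\<kappa> n)) W = W g'" if n: "0 < n" for n
    proof -
     have "g' \<le> r n (\<kappa> n)" using cell[OF n \<kappa>(3)[OF n]] by simp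
     then have "W g' \<le> S (r n (\<kappa> n)) W" using g'(1) by (intro S_upper[OF WO]) auto
     moreover have "S (r n (\<kappa> n)) W \<le> W g'" using g'(4) rk0 by (subst S_le_iff[OF WO]) auto
     ultimately show ?thesis by simp
    qed
    define b where "b n = (\<Prod>u\<in>U. a u (W g' - W (r n (\<kappa> n) + u))) * sfun l \<theta> (W g' - W (r n (\<kappa> n) + v))" for n
    have \<Phi>eq: "\<Phi> n v W = \<Gamma>' W * of_bool (g' \<le> r0 + real m) * b n" if n: "0 < n" for n
    proof -
     have "h n k v W = (if k = \<kappa> n then \<Gamma>' W * b n else 0)" if "k \<in> {1..n * m}" for k
      using that cell[OF n, of k] S_r[OF n] unfolding h_def mk b_def by auto
     then have "\<Phi> n v W = (\<Sum>k\<in>{1..n * m}. if k = \<kappa> n then \<Gamma>' W * b n else 0)" by (simp add: \<Phi>_def)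
     also have "\<dots> = (if \<kappa> n \<in> {1..n * m} then \<Gamma>' W * b n else 0)" by (subst sum.delta) auto
     finally show ?thesis using range[OF n] \<kappa>(3)[OF n] by auto
    qed
    have rlim: "(\<lambda>n. r (Suc n) (\<kappa> (Suc n)) + u) \<longlonglongrightarrow> g' + u" for u
    proof (intro tendsto_add tendsto_const)
     show "(\<lambda>n. r (Suc n) (\<kappa> (Suc n))) \<longlonglongrightarrow> g'"
     proof (rule real_tendsto_sandwich)
      show "\<forall>\<^sub>F n in sequentially. g' \<le> r (Suc n) (\<kappa> (Suc n))"
       using cell[OF _ \<kappa>(3)] by (intro always_eventually allI) blast
      show "\<forall>\<^sub>F n in sequentially. r (Suc n) (\<kappa> (Suc n)) \<le> g' + 1 / real (Suc n)"
      proof (intro always_eventually allI)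
       fix n
       have "real (\<kappa> (Suc n)) / real (Suc n) \<le> (real (Suc n) * (g' - r0) + 1) / real (Suc n)"
        using \<kappa>(2)[of "Suc n"] by (intro divide_right_mono) auto
       also have "\<dots> = (g' - r0) + 1 / real (Suc n)" by (simp add: add_divide_distrib)
       finally show "r (Suc n) (\<kappa> (Suc n)) \<le> g' + 1 / real (Suc n)" by (simp add: r_def)
      qed
      show "(\<lambda>n. g' + 1 / real (Suc n)) \<longlonglongrightarrow> g'" by real_asymp
     qed simp
    qed
    have Wlim: "(\<lambda>n. W g' - W (r (Suc n) (\<kappa> (Suc n)) + u)) \<longlonglongrightarrow> post_g_path W u" if "0 \<le> u" for u
     unfolding post[OF that] using that rk0 g'(1)
     by (intro tendsto_diff tendsto_const Omega_tendsto[OF WO rlim]) (auto intro: add_nonneg_nonneg)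
    have "(\<lambda>n. b (Suc n)) \<longlonglongrightarrow> w v W" unfolding b_def w_def
    proof (intro tendsto_mult tendsto_prod)
     fix u assume "u \<in> U"
     then have "0 \<le> u" using U0 by auto
     moreover have "isCont (a u) (post_g_path W u)" using a1 continuous_on_eq_continuous_at[OF open_UNIV] by blast
     ultimately show "(\<lambda>n. a u (W g' - W (r (Suc n) (\<kappa> (Suc n)) + u))) \<longlonglongrightarrow> a u (post_g_path W u)"
      by (intro isCont_tendsto_compose[OF _ Wlim])
    next
     have "isCont (sfun l \<theta>) (post_g_path W v)" using continuous_sfun[OF l_pos] continuous_on_eq_continuous_at[OF open_UNIV] by blast
     then show "(\<lambda>n. sfun l \<theta> (W g' - W (r (Suc n) (\<kappa> (Suc n)) + v))) \<longlonglongrightarrow> sfun l \<theta> (post_g_path W v)"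
      by (rule isCont_tendsto_compose[OF _ Wlim[OF v]])
    qed
    then have "(\<lambda>n. \<Gamma>' W * of_bool (g' \<le> r0 + real m) * b (Suc n)) \<longlonglongrightarrow> \<Gamma>' W * of_bool (g' \<le> r0 + real m) * w v W"
     by (rule tendsto_mult_left)
    moreover have "\<bar>\<Gamma>' W * of_bool (g' \<le> r0 + real m) * b n\<bar> \<le> \<bar>\<theta>\<bar> / l" for n
    proof -
     have "\<bar>\<Gamma>' W * of_bool (g' \<le> r0 + real m)\<bar> * \<bar>b n\<bar> \<le> 1 * (\<bar>\<theta>\<bar> / l)"
      using pb[of "\<lambda>u. W g' - W (r n (\<kappa> n) + u)"] unfolding b_def by (intro mult_mono) (auto simp: \<Gamma>'_def indicator_def)
     then show ?thesis by (simp only: abs_mult mult_1)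
    qed
    ultimately show ?thesis using True by (simp add: \<Phi>eq tgt)
   qed
   then show "(\<lambda>n. \<Phi> (Suc n) v W) \<longlonglongrightarrow> tgt v W" "\<bar>\<Phi> (Suc n) v W\<bar> \<le> \<bar>\<theta>\<bar> / l" by auto
  qed
  have gm: "Measurable.pred Q (\<lambda>W. g W \<le> ennreal (r0 + real m))" using g_borel_Q by measurable
  have lim: "(\<lambda>n. \<integral>W. \<Phi> (Suc n) v W \<partial>Q) \<longlonglongrightarrow> (LINT W|Q. tgt v W)" if v: "0 \<le> v" for v
  proof (rule integral_dominated_convergence[where w="\<lambda>_. \<bar>\<theta>\<bar> / l"])
   show "tgt v \<in> borel_measurable Q" unfolding tgt_def
    by (intro borel_measurable_times borel_measurable_indicator borel_measurable_of_bool GQ gm wm[OF v])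
   show "\<Phi> (Suc n) v \<in> borel_measurable Q" for n unfolding \<Phi>_def by (intro borel_measurable_sum hm[OF v])
   show "AE W in Q. (\<lambda>n. \<Phi> (Suc n) v W) \<longlonglongrightarrow> tgt v W" using AE_good by eventually_elim (rule good(1)[OF _ v])
   show "AE W in Q. norm (\<Phi> (Suc n) v W) \<le> \<bar>\<theta>\<bar> / l" for n
    using AE_good by eventually_elim (simp only: real_norm_def, rule good(2)[OF _ v])
  qed simp
  have "0 \<le> t" using s by simp
  from lim[OF this, unfolded \<Phi>_step] have "(LINT W|Q. tgt t W) = e * (LINT W|Q. tgt s W)"
   by (rule LIMSEQ_unique[OF _ tendsto_mult_left[OF lim[OF s(1)]]])
  then show ?thesis unfolding tgt_def .
 qed
 have lim: "(\<lambda>m. \<integral>W. indicator G W * of_bool (g W \<le> ennreal (r0 + real m)) * w v W \<partial>Q) \<longlonglongrightarrow> (LINT W|Q. indicator G W * w v W)" if v: "0 \<le> v" for v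
 proof (rule integral_dominated_convergence[where w="\<lambda>_. \<bar>\<theta>\<bar> / l"])
  show "(\<lambda>W. indicator G W * w v W) \<in> borel_measurable Q" by (intro borel_measurable_times borel_measurable_indicator GQ wm[OF v])
  have gm: "Measurable.pred Q (\<lambda>W. g W \<le> ennreal (r0 + real m))" for m using g_borel_Q by measurable
  show "(\<lambda>W. indicator G W * of_bool (g W \<le> ennreal (r0 + real m)) * w v W) \<in> borel_measurable Q" for m
   by (intro borel_measurable_times borel_measurable_indicator borel_measurable_of_bool GQ gm wm[OF v])
  show "AE W in Q. (\<lambda>m. indicator G W * of_bool (g W \<le> ennreal (r0 + real m)) * w v W) \<longlonglongrightarrow> indicator G W * w v W"
   using AE_good
  proof eventually_elim
   case (elim W)
   obtain g' where g': "0 < g'" "g W = ennreal g'" using good_pathE[OF elim] by metis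
   have "\<forall>\<^sub>F m in sequentially. g' < real m" using filterlim_real_sequentially unfolding filterlim_at_top_dense by (rule spec)
   then have "\<forall>\<^sub>F m in sequentially. indicator G W * of_bool (g W \<le> ennreal (r0 + real m)) * w v W = indicator G W * w v W"
   proof eventually_elim
    case (elim m)
    then have "g W \<le> ennreal (r0 + real m)" unfolding g'(2) using r0 by (intro ennreal_leI) auto
    then show ?case by (simp only: of_bool_eq mult_1_right)
   qed
   then show ?case by (rule tendsto_eventually)
  qed
  show "AE W in Q. norm (indicator G W * of_bool (g W \<le> ennreal (r0 + real m)) * w v W) \<le> \<bar>\<theta>\<bar> / l" for m
  proof (rule AE_I2)
   fix W
   have "\<bar>indicator G W * of_bool (g W \<le> ennreal (r0 + real m))\<bar> * \<bar>w v W\<bar> \<le> 1 * (\<bar>\<theta>\<bar> / l)"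
    using pb[of "post_g_path W"] unfolding w_def by (intro mult_mono) (auto simp: indicator_def)
   then show "norm (indicator G W * of_bool (g W \<le> ennreal (r0 + real m)) * w v W) \<le> \<bar>\<theta>\<bar> / l"
    by (simp only: real_norm_def abs_mult mult_1)
  qed
 qed simp
 have t0: "0 \<le> t" using s by simp
 have eq: "(LINT W|Q. indicator G W * w t W) = e * (LINT W|Q. indicator G W * w s W)"
  using lim[OF t0, unfolded trunc] by (rule LIMSEQ_unique[OF _ tendsto_mult_left[OF lim[OF s(1)]]])
 have dens: "(LINT W|density Q (indicator G). w v W) = (LINT W|Q. indicator G W * w v W)" if v: "0 \<le> v" for v
 proof -
  have "(LINT W|density Q (\<lambda>W. ennreal (indicator G W)). w v W) = (LINT W|Q. indicator G W *\<^sub>R w v W)"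
   by (rule integral_density[OF wm[OF v]]) (use GQ in auto)
  moreover have "(\<lambda>W. ennreal (indicator G W)) = indicator G" by (auto simp: indicator_def)
  ultimately show ?thesis by simp
 qed
 show "(LINT W|density Q (indicator {W \<in> Omega. ennreal r0 < g W \<and> W \<in> \<Gamma>}). (\<Prod>u\<in>U. a u (post_g_path W u)) * sfun l \<theta> (post_g_path W t))
  = exp (- ((\<theta>\<^sup>2 + l\<^sup>2) / 2) * (t - s)) * (LINT W|density Q (indicator {W \<in> Omega. ennreal r0 < g W \<and> W \<in> \<Gamma>}). (\<Prod>u\<in>U. a u (post_g_path W u)) * sfun l \<theta> (post_g_path W s))"
  using eq dens[OF t0] dens[OF s(1)] unfolding G_def[symmetric] e_def[symmetric] w_def by simp
qed

section \<open>Independence of the paths before and after \<open>g\<close>\<close>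

lemma AE_g_pos: "AE w in Q. 0 < g w \<and> g w < \<infinity>"
 using AE_good
proof eventually_elim
 case (elim w)
 then obtain G where "0 < G" "g w = ennreal G" using good_pathE by metis
 then show ?case by simp
qed

lemma AE_post_g_pos: "AE w in Q. post_g_path w 0 = 0 \<and> (\<forall>t\<ge>0. 0 \<le> post_g_path w t)"
 using AE_good
proof eventually_elim
 case (elim w)
 then obtain G where "0 < G" "g w = ennreal G" "S_inf w = ereal (w G)" "\<And>t. 0 \<le> t ==> w t \<le> w G"
  using good_pathE by metis
 then show ?case by (simp add: post_g_path_def)
qed

lemma post_g_sine_mart_Q: "sine_mart l Q post_g_path"
proof -
 have O: "Omega \<in> sets (F 0)" using sets.top[of "F 0"] by simp
 have "density Q (indicator {w \<in> Omega. ennreal 0 < g w \<and> w \<in> Omega}) = density Q (\<lambda>_. 1)"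
 proof (rule density_cong)
  show "AE w in Q. indicator {w \<in> Omega. ennreal 0 < g w \<and> w \<in> Omega} w = (1::ennreal)"
   using AE_g_pos AE_space by eventually_elim (auto simp: indicator_def)
  show "indicator {w \<in> Omega. ennreal 0 < g w \<and> w \<in> Omega} \<in> borel_measurable Q"
   by (rule borel_measurable_indicator[OF alive_sets_Q[OF O]])
 qed simp
 also have "\<dots> = Q" by (rule density_1)
 finally show ?thesis using post_g_sine_mart[OF order_refl O] by simp
qed

lemma sine_mart_scale:
 assumes "sine_mart l M Y" "0 \<le> c" "Y \<in> M \<rightarrow>\<^sub>M F_inf"
 shows "sine_mart l (density M (\<lambda>_. ennreal c)) Y"
 unfolding sine_mart_def
proof (intro allI impI)
 fix \<theta> s t :: real and U :: "real set" and a :: "real => real => real"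
 assume U: "finite U" "U \<subseteq> {0..s}" and s: "0 \<le> s" "s < t" and a1: "\<forall>u. continuous_on UNIV (a u)" and a2: "\<forall>u x. 0 \<le> a u x \<and> a u x \<le> 1"
 have m: "(\<lambda>w. (\<Prod>u\<in>U. a u (Y w u)) * sfun l \<theta> (Y w v)) \<in> borel_measurable M" if "0 \<le> v" for v
  using a1 U that
  by (intro borel_measurable_times prod_path_measurable[OF assms(3)] measurable_compose[OF measurable_compose[OF assms(3) coord_F_inf] sfun_borel[OF l_pos]]) auto
 have d: "(LINT w|density M (\<lambda>_. ennreal c). (\<Prod>u\<in>U. a u (Y w u)) * sfun l \<theta> (Y w v)) = c * (LINT w|M. (\<Prod>u\<in>U. a u (Y w u)) * sfun l \<theta> (Y w v))" if "0 \<le> v" for v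
  using assms(2) by (subst integral_density[OF m[OF that]]) auto
 have t0: "0 \<le> t" using s by simp
 have "(LINT w|M. (\<Prod>u\<in>U. a u (Y w u)) * sfun l \<theta> (Y w t))
  = exp (- ((\<theta>\<^sup>2 + l\<^sup>2) / 2) * (t - s)) * (LINT w|M. (\<Prod>u\<in>U. a u (Y w u)) * sfun l \<theta> (Y w s))"
  using assms(1) U s a1 a2 unfolding sine_mart_def by blast
 then show "(LINT w|density M (\<lambda>_. ennreal c). (\<Prod>u\<in>U. a u (Y w u)) * sfun l \<theta> (Y w t))
  = exp (- ((\<theta>\<^sup>2 + l\<^sup>2) / 2) * (t - s)) * (LINT w|density M (\<lambda>_. ennreal c). (\<Prod>u\<in>U. a u (Y w u)) * sfun l \<theta> (Y w s))"
  unfolding d[OF t0] d[OF s(1)] by simp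
qed

text \<open>\<open>Q\<close> restricted to the alive event and \<open>Q\<close> multiplied by the
  probability of that event have the same mass, and \<open>post_g_path\<close> satisfies
  \<open>sine_mart\<close> under both. By uniqueness it has the same law under both, which is the
  product formula.\<close>

lemma post_g_indep_alive:
 assumes r: "0 \<le> r" and \<Gamma>: "\<Gamma> \<in> sets (F r)" and C: "C \<in> sets F_inf"
 shows "emeasure Q ({w \<in> Omega. ennreal r < g w \<and> w \<in> \<Gamma>} \<inter> (post_g_path -` C \<inter> Omega))
  = emeasure Q {w \<in> Omega. ennreal r < g w \<and> w \<in> \<Gamma>} * emeasure Q (post_g_path -` C \<inter> Omega)"
proof -
 define G where "G = {w \<in> Omega. ennreal r < g w \<and> w \<in> \<Gamma>}"
 have GQ: "G \<in> sets Q" unfolding G_def by (rule alive_sets_Q[OF \<Gamma>])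
 define M1 where "M1 = density Q (indicator G)"
 define M2 where "M2 = density Q (\<lambda>_. ennreal (measure Q G))"
 have em: "emeasure M1 A = emeasure Q (G \<inter> A)" "emeasure M2 A = ennreal (measure Q G) * emeasure Q A" if "A \<in> sets Q" for A
  using that GQ unfolding M1_def M2_def
  by (simp_all add: emeasure_density nn_integral_cmult Int_commute flip: indicator_inter_arith)
 have sp: "space M1 = Omega" "space M2 = Omega" by (simp_all add: M1_def M2_def)
 have OQ: "Omega \<in> sets Q" using sets.top[of Q] by simp
 have GO: "G \<inter> Omega = G" by (auto simp: G_def)
 have fin: "finite_measure M1" "finite_measure M2"
  using em[OF OQ] Q.emeasure_space_1 by (auto intro!: finite_measureI simp: sp GO Q.emeasure_eq_measure)
 have Y: "post_g_path \<in> M1 \<rightarrow>\<^sub>M F_inf" "post_g_path \<in> M2 \<rightarrow>\<^sub>M F_inf" using post_g_Q by (auto simp: M1_def M2_def)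
 have "distr M1 F_inf post_g_path = distr M2 F_inf post_g_path"
 proof (rule sine_mart_unique[OF l_pos fin Y])
  have pp: "AE w in Q. post_g_path w 0 = 0 \<and> (\<forall>t\<ge>0. 0 \<le> post_g_path w t)"
   using AE_post_g_pos by eventually_elim auto
  have "AE w in Q. 0 < (indicator G w :: ennreal) --> post_g_path w 0 = 0 \<and> (\<forall>t\<ge>0. 0 \<le> post_g_path w t)"
   using pp by eventually_elim blast
  then show "AE w in M1. post_g_path w 0 = 0 \<and> (\<forall>t\<ge>0. 0 \<le> post_g_path w t)"
   unfolding M1_def using GQ by (subst AE_density) (rule borel_measurable_indicator)
  have "AE w in Q. 0 < ennreal (measure Q G) --> post_g_path w 0 = 0 \<and> (\<forall>t\<ge>0. 0 \<le> post_g_path w t)"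
   using pp by eventually_elim blast
  then show "AE w in M2. post_g_path w 0 = 0 \<and> (\<forall>t\<ge>0. 0 \<le> post_g_path w t)"
   unfolding M2_def by (subst AE_density) (rule borel_measurable_const)
  have "emeasure Q Omega = 1" using Q.emeasure_space_1 by (simp only: space_Q)
  then have "emeasure M1 (space M1) = emeasure M2 (space M2)"
   unfolding sp em[OF OQ] GO by (simp only: Q.emeasure_eq_measure[of G] mult_1_right)
  then show "measure M1 (space M1) = measure M2 (space M2)" by (simp only: measure_def)
  show "sine_mart l M1 post_g_path" unfolding M1_def G_def by (rule post_g_sine_mart[OF r \<Gamma>])
  show "sine_mart l M2 post_g_path" unfolding M2_def by (rule sine_mart_scale[OF post_g_sine_mart_Q _ post_g_Q]) simp
 qed
 then have "emeasure (distr M1 F_inf post_g_path) C = emeasure (distr M2 F_inf post_g_path) C" by simp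
 moreover have CQ: "post_g_path -` C \<inter> Omega \<in> sets Q" using measurable_sets[OF post_g_Q C] by simp
 ultimately show ?thesis
  using em[OF CQ] by (simp add: emeasure_distr[OF Y(1) C] emeasure_distr[OF Y(2) C] sp G_def Q.emeasure_eq_measure)
qed

text \<open>The same comparison with the roles exchanged: now \<open>C\<close> is fixed, and the
  laws of \<open>(g w, w)\<close> under the restricted and the scaled measure agree on alive events,
  hence on \<open>alive_algebra\<close>, for which \<open>stop\<close> is measurable.\<close>

lemma post_g_indep:
 assumes B: "B \<in> sets stopped_path_space" and C: "C \<in> sets F_inf"
 shows "emeasure Q ((post_g_path -` C \<inter> Omega) \<inter> ((\<lambda>w. stopped_path (g w) w) -` B \<inter> Omega))
  = emeasure Q (post_g_path -` C \<inter> Omega) * emeasure Q ((\<lambda>w. stopped_path (g w) w) -` B \<inter> Omega)"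
proof -
 define A where "A = post_g_path -` C \<inter> Omega"
 have AQ: "A \<in> sets Q" using measurable_sets[OF post_g_Q C] by (simp add: A_def)
 define M1 where "M1 = density Q (indicator A)"
 define M2 where "M2 = density Q (\<lambda>_. ennreal (measure Q A))"
 have em: "emeasure M1 X = emeasure Q (A \<inter> X)" "emeasure M2 X = emeasure Q A * emeasure Q X" if "X \<in> sets Q" for X
  using that AQ unfolding M1_def M2_def
  by (simp_all add: emeasure_density nn_integral_cmult Int_commute Q.emeasure_eq_measure flip: indicator_inter_arith)
 have sp: "space M1 = Omega" "space M2 = Omega" by (simp_all add: M1_def M2_def)
 have OQ: "Omega \<in> sets Q" using sets.top[of Q] by simp
 have AO: "A \<inter> Omega = A" by (auto simp: A_def)
 have m0: "(\<lambda>w. (g w, w)) \<in> Q \<rightarrow>\<^sub>M alive_algebra"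
  by (rule measurable_into_alive_algebra[OF g_borel_Q id_Q_F_inf])
 have m: "(\<lambda>w. (g w, w)) \<in> M1 \<rightarrow>\<^sub>M alive_algebra" "(\<lambda>w. (g w, w)) \<in> M2 \<rightarrow>\<^sub>M alive_algebra"
  using m0 by (auto simp: M1_def M2_def)
 have "distr M1 alive_algebra (\<lambda>w. (g w, w)) = distr M2 alive_algebra (\<lambda>w. (g w, w))"
 proof (rule alive_distr_eqI[OF _ m])
  show "finite_measure M1" using em(1)[OF OQ] by (auto intro!: finite_measureI simp: sp AO Q.emeasure_eq_measure)
  show "emeasure M1 (space M1) = emeasure M2 (space M2)" using em[OF OQ] Q.emeasure_space_1 by (simp add: sp AO)
  fix r \<Gamma> assume r: "0 \<le> r" "\<Gamma> \<in> sets (F r)"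
  have "{w \<in> Omega. ennreal r < fst (g w, w) \<and> snd (g w, w) \<in> \<Gamma>} = {w \<in> Omega. ennreal r < g w \<and> w \<in> \<Gamma>}" by simp
  then show "emeasure M1 {w \<in> space M1. ennreal r < fst (g w, w) \<and> snd (g w, w) \<in> \<Gamma>} = emeasure M2 {w \<in> space M2. ennreal r < fst (g w, w) \<and> snd (g w, w) \<in> \<Gamma>}"
   using em[OF alive_sets_Q[OF r(2)]] post_g_indep_alive[OF r C] by (simp add: sp A_def Int_commute mult.commute)
 qed
 then have eq: "emeasure (distr M1 alive_algebra (\<lambda>w. (g w, w))) (stop -` B \<inter> space alive_algebra)
  = emeasure (distr M2 alive_algebra (\<lambda>w. (g w, w))) (stop -` B \<inter> space alive_algebra)" by simp
 define D where "D = (\<lambda>w. (g w, w)) -` (stop -` B \<inter> space alive_algebra) \<inter> Omega"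
 have sB: "stop -` B \<inter> space alive_algebra \<in> sets alive_algebra" by (rule measurable_sets[OF stop_measurable B])
 have DQ: "D \<in> sets Q" using measurable_sets[OF m0 sB] by (simp add: D_def)
 have "emeasure M1 D = emeasure M2 D"
  using eq unfolding emeasure_distr[OF m(1) sB] emeasure_distr[OF m(2) sB] by (simp add: sp D_def)
 then have prod: "emeasure Q (A \<inter> D) = emeasure Q A * emeasure Q D" using em[OF DQ] by simp
 define E where "E = (\<lambda>w. stopped_path (g w) w) -` B \<inter> Omega"
 have EQ: "E \<in> sets Q" using measurable_sets[OF stopped_g_measurable B] by (simp add: E_def)
 have ED: "AE w in Q. w \<in> E \<longleftrightarrow> w \<in> D"
  using AE_g_pos AE_space by eventually_elim (auto simp: E_def D_def stop_def)
 have "emeasure Q E = emeasure Q D" by (rule emeasure_eq_AE[OF ED EQ DQ])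
 moreover have "emeasure Q (A \<inter> E) = emeasure Q (A \<inter> D)"
  by (rule emeasure_eq_AE) (use ED AQ EQ DQ in \<open>auto elim!: eventually_mono\<close>)
 ultimately show ?thesis using prod unfolding A_def[symmetric] E_def[symmetric] by simp
qed

end

section \<open>Solutions of the radial equation\<close>

lemma coth_mono: "0 < x ==> x \<le> y ==> coth y \<le> coth x" for x y :: real
proof -
 assume x: "0 < x" "x \<le> y"
 then have "0 \<le> sinh (y - x)" by simp
 then have "cosh y * sinh x \<le> cosh x * sinh y" by (simp add: sinh_diff mult.commute)
 then show ?thesis using x by (simp add: coth_def divide_le_eq le_divide_eq mult.commute)
qed

lemma coth_nonneg: "0 \<le> x ==> 0 \<le> coth x"
 by (simp add: coth_def)

lemma coth_borel: "coth \<in> borel_measurable borel"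
 unfolding coth_def[abs_def] by (intro borel_measurable_divide borel_measurable_continuous_onI continuous_intros)

text \<open>One path of a \<open>nonneg_solution\<close> together with its driving path, so that
  comparison and the expansion of test functions become statements without probability.\<close>

definition solves :: "real => (real => real) => (real => real) => bool" where
 "solves l w z \<longleftrightarrow> w \<in> Omega \<and> z \<in> Omega \<and> (\<forall>t\<ge>0. 0 \<le> z t) \<and> (AE u in lborel. 0 \<le> u --> 0 < z u) \<and>
  (\<forall>t\<ge>0. set_integrable lborel {0..t} (\<lambda>u. coth (l * z u)) \<and> z t = w t + l * (LINT u:{0..t}|lborel. coth (l * z u)))"

lemma solvesD:
 assumes "solves l w z"
 shows "w \<in> Omega" "z \<in> Omega" "0 \<le> t ==> 0 \<le> z t" "AE u in lborel. 0 \<le> u --> 0 < z u"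
  "0 \<le> t ==> set_integrable lborel {0..t} (\<lambda>u. coth (l * z u))"
  "0 \<le> t ==> z t = w t + l * (LINT u:{0..t}|lborel. coth (l * z u))"
 using assms unfolding solves_def by blast+

lemma set_integrable_Icc_const: "set_integrable lborel {s..t} (\<lambda>_. c)" for s t c :: real
 by (intro borel_integrable_atLeastAtMost' continuous_intros)

lemma set_integral_Icc_diff:
 fixes f :: "real => real"
 assumes "set_integrable lborel {0..t} f" "0 \<le> s" "s \<le> t"
 shows "set_integrable lborel {s<..t} f" "(LINT u:{0..t}|lborel. f u) - (LINT u:{0..s}|lborel. f u) = (LINT u:{s<..t}|lborel. f u)"
proof -
 show 1: "set_integrable lborel {s<..t} f" by (rule set_integrable_subset[OF assms(1)]) (use assms in auto)
 have 2: "set_integrable lborel {0..s} f" by (rule set_integrable_subset[OF assms(1)]) (use assms in auto)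
 have "{0..t} = {0..s} \<union> {s<..t}" using assms by auto
 then show "(LINT u:{0..t}|lborel. f u) - (LINT u:{0..s}|lborel. f u) = (LINT u:{s<..t}|lborel. f u)"
  using set_integral_Un[OF _ 2 1] by force
qed

lemma solves_increment:
 assumes "solves l w z" "0 \<le> s" "s \<le> t"
 shows "set_integrable lborel {s<..t} (\<lambda>u. coth (l * z u))" "(z t - w t) - (z s - w s) = l * (LINT u:{s<..t}|lborel. coth (l * z u))"
proof -
 have i: "set_integrable lborel {0..t} (\<lambda>u. coth (l * z u))" using assms unfolding solves_def by auto
 show "set_integrable lborel {s<..t} (\<lambda>u. coth (l * z u))" by (rule set_integral_Icc_diff[OF i assms(2,3)])
 have "z t = w t + l * (LINT u:{0..t}|lborel. coth (l * z u))" "z s = w s + l * (LINT u:{0..s}|lborel. coth (l * z u))"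
  using assms unfolding solves_def by auto
 then show "(z t - w t) - (z s - w s) = l * (LINT u:{s<..t}|lborel. coth (l * z u))"
  by (simp only: set_integral_Icc_diff(2)[OF i assms(2,3), symmetric]) (simp add: algebra_simps)
qed

lemma solves_drift_nonneg:
 assumes "0 < l" "solves l w z" "0 \<le> s" "s \<le> t"
 shows "0 \<le> (z t - w t) - (z s - w s)"
proof -
 have "0 \<le> indicat_real {s<..t} u *\<^sub>R coth (l * z u)" for u
  using assms(1,3) solvesD(3)[OF assms(2), of u] by (cases "u \<in> {s<..t}") (simp_all add: coth_nonneg)
 then show ?thesis unfolding solves_increment(2)[OF assms(2-4)] set_lebesgue_integral_def
  using assms(1) by (intro mult_nonneg_nonneg Bochner_Integration.integral_nonneg) simp_all
qed

lemma solves_start: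
 assumes "solves l w z" shows "z 0 = w 0"
proof -
 have "z 0 = w 0 + l * (LINT u:{0..0}|lborel. coth (l * z u))" using assms unfolding solves_def by auto
 also have "(LINT u:{0..0::real}|lborel. coth (l * z u)) = 0"
  unfolding set_lebesgue_integral_def
  by (rule integral_eq_zero_AE) (use AE_lborel_singleton[of "0::real"] in \<open>eventually_elim, auto simp: indicator_def\<close>)
 finally show ?thesis by simp
qed

text \<open>After the last time before \<open>t\<close> at which \<open>z \<le> z'\<close>, the drift of \<open>z\<close> is the smaller one because \<^const>\<open>coth\<close> decreases.\<close>

lemma solves_le:
 assumes l: "0 < l" and z: "solves l w z" and z': "solves l w' z'"
  and w: "\<And>u. 0 \<le> u ==> u \<le> r ==> w u = w' u" and t: "0 \<le> t" "t \<le> r"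
 shows "z t \<le> z' t"
proof (rule ccontr)
 assume n: "\<not> z t \<le> z' t"
 have zO: "z \<in> Omega" "z' \<in> Omega" by (rule solvesD(2)[OF z], rule solvesD(2)[OF z'])
 define E where "E = {u \<in> {0..t}. z u - z' u \<le> 0}"
 have c: "continuous_on {0..t} (\<lambda>u. z u - z' u)" using zO by (intro continuous_on_diff continuous_on_Omega) auto
 have "closed E" unfolding E_def by (rule continuous_on_closed_Collect_le[OF c]) auto
 moreover have "E \<subseteq> {0..t}" by (auto simp: E_def)
 ultimately have "compact E" using compact_Int_closed[of "{0..t}" E] by (simp add: Int_absorb1)
 moreover have "0 \<in> E" using solves_start[OF z] solves_start[OF z'] w[of 0] t by (simp add: E_def)
 ultimately obtain s where s: "s \<in> E" "\<And>u. u \<in> E ==> u \<le> s" using compact_attains_sup[of E] by blast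
 have st: "0 \<le> s" "s \<le> t" "z s \<le> z' s" using s(1) by (auto simp: E_def)
 have gt: "z' u < z u" if "u \<in> {s<..t}" for u using s(2)[of u] that st by (force simp: E_def)
 note i = solves_increment[OF z st(1,2)] and i' = solves_increment[OF z' st(1,2)]
 have "(LINT u:{s<..t}|lborel. coth (l * z u)) \<le> (LINT u:{s<..t}|lborel. coth (l * z' u))"
 proof (rule set_integral_mono_AE[OF i(1) i'(1)])
  have "AE u in lborel. 0 \<le> u --> 0 < z' u" by (rule solvesD(4)[OF z'])
  then show "AE u\<in>{s<..t} in lborel. coth (l * z u) \<le> coth (l * z' u)"
  proof eventually_elim
   case (elim u)
   show ?case
   proof
    assume u: "u \<in> {s<..t}"
    have "0 < z' u" using elim u st by auto
    then show "coth (l * z u) \<le> coth (l * z' u)" using less_imp_le[OF gt[OF u]] l by (intro coth_mono mult_pos_pos mult_left_mono) simp_all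
   qed
  qed
 qed
 then have "l * (LINT u:{s<..t}|lborel. coth (l * z u)) \<le> l * (LINT u:{s<..t}|lborel. coth (l * z' u))" using l by (intro mult_left_mono) auto
 then show False using i(2) i'(2) w[of t] w[of s] st t n by simp
qed

lemma solves_unique:
 assumes "0 < l" "solves l w z" "solves l w' z'" "\<And>u. 0 \<le> u ==> u \<le> r ==> w u = w' u" "0 \<le> t" "t \<le> r"
 shows "z t = z' t"
 by (intro antisym solves_le[OF assms] solves_le[OF assms(1,3,2) assms(4)[symmetric] assms(5,6)])

section \<open>Test functions along a solution\<close>

lemma derivative_bound:
 fixes f :: "real => real"
 assumes d: "\<And>x. (f has_real_derivative f' x) (at x)" and B: "\<And>x. \<bar>f' x\<bar> \<le> B"
 shows "\<bar>f x - f y\<bar> \<le> B * \<bar>x - y\<bar>"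
proof -
 have *: "\<bar>f b - f a\<bar> \<le> B * \<bar>b - a\<bar>" if "a < b" for a b
 proof -
  from MVT2[OF that d] obtain c where "f b - f a = (b - a) * f' c" by blast
  then have "\<bar>f b - f a\<bar> = \<bar>f' c\<bar> * \<bar>b - a\<bar>" by (simp add: abs_mult)
  also have "\<dots> \<le> B * \<bar>b - a\<bar>" by (intro mult_right_mono B) auto
  finally show ?thesis .
 qed
 show ?thesis using *[of x y] *[of y x] by (cases x y rule: linorder_cases) (auto simp: abs_minus_commute)
qed

text \<open>The bound on the third derivative serves twice: for the Taylor remainder over a Brownian
  increment and as a Lipschitz constant of \<open>f2\<close>.\<close>

locale test_function =
 fixes l :: real and f f1 f2 f3 :: "real => real" and B :: real
 assumes l_pos: "0 < l"
  and d: "\<And>x. (f has_real_derivative f1 x) (at x)" "\<And>x. (f1 has_real_derivative f2 x) (at x)" "\<And>x. (f2 has_real_derivative f3 x) (at x)"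
  and b: "\<And>x. \<bar>f x\<bar> \<le> B" "\<And>x. \<bar>f1 x\<bar> \<le> B" "\<And>x. \<bar>f2 x\<bar> \<le> B" "\<And>x. \<bar>f3 x\<bar> \<le> B"
begin

definition gen :: "real => real" where
 "gen z = f2 z / 2 + l * coth (l * z) * f1 z"

lemma B_nonneg: "0 \<le> B" using b(1)[of 0] by linarith

lemma f_borel: "f \<in> borel_measurable borel" "f1 \<in> borel_measurable borel" "f2 \<in> borel_measurable borel"
 using d by (auto intro!: borel_measurable_continuous_onI continuous_at_imp_continuous_on intro: DERIV_isCont)

lemma gen_borel: "gen \<in> borel_measurable borel"
proof -
 have "(\<lambda>z. coth (l * z)) \<in> borel_measurable borel" by (rule measurable_compose[OF _ coth_borel]) measurable
 then show ?thesis unfolding gen_def[abs_def]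
  by (intro borel_measurable_add borel_measurable_times borel_measurable_divide borel_measurable_const f_borel)
qed

text \<open>\<open>gen\<close> need not be bounded near 0, but it grows no faster than
  \<open>coth\<close>, which is integrable along a solution.\<close>

lemma gen_bound: "0 \<le> z ==> \<bar>gen z\<bar> \<le> B * (l * coth (l * z)) + B / 2"
proof -
 assume z: "0 \<le> z"
 have c: "0 \<le> l * coth (l * z)" using z l_pos by (simp add: coth_nonneg)
 have "\<bar>gen z\<bar> \<le> \<bar>f2 z / 2\<bar> + \<bar>l * coth (l * z) * f1 z\<bar>" unfolding gen_def by (rule abs_triangle_ineq)
 also have "\<bar>f2 z / 2\<bar> \<le> B / 2" using b(3)[of z] by simp
 also have "\<bar>l * coth (l * z) * f1 z\<bar> = l * coth (l * z) * \<bar>f1 z\<bar>" unfolding abs_mult[of "l * coth (l * z)"] abs_of_nonneg[OF c] ..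
 also have "\<dots> \<le> l * coth (l * z) * B" by (intro mult_left_mono b c)
 finally show ?thesis by (simp add: mult_ac)
qed

lemma gen_integrable:
 assumes z: "solves l w z" and t: "0 \<le> t"
 shows "set_integrable lborel {0..t} (\<lambda>u. gen (z u))"
 unfolding set_integrable_def
proof (rule Bochner_Integration.integrable_bound)
 note zO = solvesD(2)[OF z] and z0 = solvesD(3)[OF z]
 have "set_integrable lborel {0..t} (\<lambda>u. B * (l * coth (l * z u)) + B / 2)"
  by (intro set_integral_add(1) set_integrable_mult_right solvesD(5)[OF z t] set_integrable_Icc_const)
 then show "integrable lborel (\<lambda>u. indicat_real {0..t} u *\<^sub>R (B * (l * coth (l * z u)) + B / 2))" by (simp only: set_integrable_def)
 have "(\<lambda>u. indicat_real {0..t} u *\<^sub>R z u) \<in> borel_measurable borel"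
  by (intro borel_measurable_continuous_on_indicator continuous_on_Omega zO) auto
 from borel_measurable_scaleR[OF borel_measurable_indicator measurable_compose[OF this gen_borel]]
 have "(\<lambda>u. indicat_real {0..t} u *\<^sub>R gen (indicat_real {0..t} u *\<^sub>R z u)) \<in> borel_measurable borel" by simp
 moreover have "(\<lambda>u. indicat_real {0..t} u *\<^sub>R gen (indicat_real {0..t} u *\<^sub>R z u)) = (\<lambda>u. indicat_real {0..t} u *\<^sub>R gen (z u))"
  by (auto simp: indicator_def)
 ultimately show "(\<lambda>u. indicat_real {0..t} u *\<^sub>R gen (z u)) \<in> borel_measurable lborel" by simp
 show "AE u in lborel. norm (indicat_real {0..t} u *\<^sub>R gen (z u)) \<le> norm (indicat_real {0..t} u *\<^sub>R (B * (l * coth (l * z u)) + B / 2))"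
  using gen_bound[OF z0] by (intro AE_I2) (force simp: indicator_def)
qed

text \<open>Only the drift part is expanded: \<open>z p + (w q - w p)\<close> is \<open>z q\<close>
  minus the drift increment, so the mean value theorem yields that increment times \<open>f1\<close>
  at an intermediate point. The drift increment is kept as an integral of \<open>l * coth\<close>,
  and the error is proportional to it, so no bound on \<open>coth\<close> enters.\<close>

lemma generator_cell:
 assumes z: "solves l w z" and pq: "0 \<le> p" "p \<le> q"
  and osc: "\<And>u. u \<in> {p..q} ==> \<bar>z u - z q\<bar> \<le> \<epsilon>" "(z q - w q) - (z p - w p) \<le> \<epsilon>"
 shows "\<bar>f (z q) - f (z p + (w q - w p)) + (q - p) * (f2 (z p) / 2) - (LINT u:{p<..q}|lborel. gen (z u))\<bar>
  \<le> 2 * B * \<epsilon> * ((z q - w q) - (z p - w p)) + B * \<epsilon> * (q - p)"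
proof -
 define a where "a = (z q - w q) - (z p - w p)"
 note z0 = solvesD(3)[OF z]
 note I = solves_increment[OF z pq]
 have c0: "0 \<le> coth (l * z u)" if "u \<in> {p<..q}" for u using z0[of u] that pq l_pos by (intro coth_nonneg mult_nonneg_nonneg) auto
 have a0: "0 \<le> a" unfolding a_def by (rule solves_drift_nonneg[OF l_pos z pq])
 obtain \<xi> where \<xi>: "z q - a \<le> \<xi>" "\<xi> \<le> z q" "f (z q) - f (z q - a) = a * f1 \<xi>"
 proof (cases "a = 0")
  case False
  then have "z q - a < z q" using a0 by simp
  from MVT2[OF this, of f f1] d(1) obtain \<xi> where "z q - a < \<xi>" "\<xi> < z q" "f (z q) - f (z q - a) = (z q - (z q - a)) * f1 \<xi>" by blast
  then show ?thesis by (intro that[of \<xi>]) auto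
 qed (use that[of "z q"] in auto)
 have ae: "a \<le> \<epsilon>" using osc(2) by (simp add: a_def)
 have Gi: "set_integrable lborel {p<..q} (\<lambda>u. gen (z u))"
  by (rule set_integral_Icc_diff(1)[OF gen_integrable[OF z, of q]]) (use pq in auto)
 have Ci: "set_integrable lborel {p<..q} (\<lambda>u. c)" for c :: real
  unfolding set_integrable_def using pq by (intro integrable_scaleR_left) simp
 have Cv: "(LINT u:{p<..q}|lborel. c) = (q - p) * c" for c :: real
  using pq by (simp add: set_lebesgue_integral_def)
 have Li: "set_integrable lborel {p<..q} (\<lambda>u. l * coth (l * z u) * c + k)" for c k
  by (intro set_integral_add(1) set_integrable_mult_left set_integrable_mult_right I(1) Ci)
 have Lv: "(LINT u:{p<..q}|lborel. l * coth (l * z u) * c + k) = a * c + (q - p) * k" for c k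
  by (subst set_integral_add(2)) (auto intro!: set_integrable_mult_left set_integrable_mult_right I(1) Ci simp: Cv a_def I(2))
 have "f (z q) - f (z p + (w q - w p)) + (q - p) * (f2 (z p) / 2) = a * f1 \<xi> + (q - p) * (f2 (z p) / 2)"
  using \<xi>(3) by (simp add: a_def algebra_simps)
 moreover have "a * f1 \<xi> + (q - p) * (f2 (z p) / 2) = (LINT u:{p<..q}|lborel. l * coth (l * z u) * f1 \<xi> + f2 (z p) / 2)" by (rule Lv[symmetric])
 moreover have "(LINT u:{p<..q}|lborel. l * coth (l * z u) * f1 \<xi> + f2 (z p) / 2) - (LINT u:{p<..q}|lborel. gen (z u)) = (LINT u:{p<..q}|lborel. l * coth (l * z u) * f1 \<xi> + f2 (z p) / 2 - gen (z u))"
  by (rule set_integral_diff(2)[OF Li Gi, symmetric])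
 ultimately have eq: "f (z q) - f (z p + (w q - w p)) + (q - p) * (f2 (z p) / 2) - (LINT u:{p<..q}|lborel. gen (z u))
  = (LINT u:{p<..q}|lborel. l * coth (l * z u) * f1 \<xi> + f2 (z p) / 2 - gen (z u))" by (simp only:)
 have "\<bar>LINT u:{p<..q}|lborel. l * coth (l * z u) * f1 \<xi> + f2 (z p) / 2 - gen (z u)\<bar>
  \<le> (LINT u:{p<..q}|lborel. \<bar>l * coth (l * z u) * f1 \<xi> + f2 (z p) / 2 - gen (z u)\<bar>)"
  using set_integral_norm_bound[OF set_integral_diff(1)[OF Li[of "f1 \<xi>" "f2 (z p) / 2"] Gi]] by simp
 also have "\<dots> \<le> (LINT u:{p<..q}|lborel. l * coth (l * z u) * (2 * B * \<epsilon>) + B * \<epsilon>)"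
 proof (rule set_integral_mono[OF set_integrable_abs[OF set_integral_diff(1)[OF Li Gi]] Li])
  fix u assume u: "u \<in> {p<..q}"
  have zu: "\<bar>z u - z q\<bar> \<le> \<epsilon>" "\<bar>z p - z q\<bar> \<le> \<epsilon>" using osc(1)[of u] osc(1)[of p] u pq by auto
  have "\<bar>f1 \<xi> - f1 (z u)\<bar> \<le> B * \<bar>\<xi> - z u\<bar>" by (rule derivative_bound[OF d(2) b(3)])
  also have "\<dots> \<le> B * (2 * \<epsilon>)" using zu \<xi> ae by (intro mult_left_mono B_nonneg) auto
  finally have 1: "\<bar>f1 \<xi> - f1 (z u)\<bar> \<le> 2 * B * \<epsilon>" by simp
  have "\<bar>f2 (z p) - f2 (z u)\<bar> \<le> B * \<bar>z p - z u\<bar>" by (rule derivative_bound[OF d(3) b(4)])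
  also have "\<dots> \<le> B * (2 * \<epsilon>)" using zu by (intro mult_left_mono B_nonneg) auto
  finally have 2: "\<bar>(f2 (z p) - f2 (z u)) / 2\<bar> \<le> B * \<epsilon>" by simp
  have c: "0 \<le> l * coth (l * z u)" using c0[OF u] l_pos by simp
  have "l * coth (l * z u) * f1 \<xi> + f2 (z p) / 2 - gen (z u) = l * coth (l * z u) * (f1 \<xi> - f1 (z u)) + (f2 (z p) - f2 (z u)) / 2"
   by (simp add: gen_def algebra_simps diff_divide_distrib)
  also have "\<bar>\<dots>\<bar> \<le> \<bar>l * coth (l * z u) * (f1 \<xi> - f1 (z u))\<bar> + \<bar>(f2 (z p) - f2 (z u)) / 2\<bar>" by (rule abs_triangle_ineq)
  also have "\<bar>l * coth (l * z u) * (f1 \<xi> - f1 (z u))\<bar> = l * coth (l * z u) * \<bar>f1 \<xi> - f1 (z u)\<bar>"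
   unfolding abs_mult[of "l * coth (l * z u)"] abs_of_nonneg[OF c] ..
  also have "\<dots> \<le> l * coth (l * z u) * (2 * B * \<epsilon>)" by (intro mult_left_mono 1 c)
  finally show "\<bar>l * coth (l * z u) * f1 \<xi> + f2 (z p) / 2 - gen (z u)\<bar> \<le> l * coth (l * z u) * (2 * B * \<epsilon>) + B * \<epsilon>" using 2 by linarith
 qed
 also have "\<dots> = 2 * B * \<epsilon> * a + B * \<epsilon> * (q - p)" unfolding Lv by (simp add: mult_ac)
 finally show ?thesis unfolding eq a_def .
qed

definition mesh :: "real => real => nat => nat => real" where
 "mesh s t n k = s + real k * ((t - s) / real n)"

lemma mesh_simps: "0 < n ==> mesh s t n 0 = s" "0 < n ==> mesh s t n n = t" "mesh s t n (Suc k) - mesh s t n k = (t - s) / real n"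
 by (simp_all add: mesh_def) (simp add: add_divide_distrib distrib_right)

lemma mesh_mono: "s \<le> t ==> j \<le> k ==> mesh s t n j \<le> mesh s t n k"
 unfolding mesh_def by (intro add_left_mono mult_right_mono divide_nonneg_nonneg) auto

text \<open>For each cell, the increment of \<open>f\<close> without the part caused by the Brownian
  increment, plus the expected second-order contribution of the latter. These sums converge along
  each single path, without a stochastic integral.\<close>

definition cell_sum :: "real => real => nat => (real => real) => (real => real) => real" where
 "cell_sum s t n w z = (\<Sum>k<n. f (z (mesh s t n (Suc k))) - f (z (mesh s t n k) + (w (mesh s t n (Suc k)) - w (mesh s t n k)))
   + (t - s) / real n * (f2 (z (mesh s t n k)) / 2))"

text \<open>The error in a cell is a multiple of \<open>\<epsilon>\<close> times the increments of
  drift and time over that cell. These increments telescope, so the total error does not depend on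
  the number of cells.\<close>

lemma generator_limit:
 assumes z: "solves l w z" and st: "0 \<le> s" "s \<le> t"
 shows "(\<lambda>n. cell_sum s t (Suc n) w z) \<longlonglongrightarrow> (LINT u:{s<..t}|lborel. gen (z u))"
proof (rule LIMSEQ_I)
 fix e :: real assume e: "0 < e"
 define A where "A u = z u - w u" for u
 define J where "J u = (LINT v:{0..u}|lborel. gen (z v))" for u
 define C where "C = 2 * B * (A t - A s) + B * (t - s)"
 note zw = solvesD(2,1)[OF z] and z0 = solvesD(3)[OF z]
 have "0 \<le> A t - A s" unfolding A_def by (rule solves_drift_nonneg[OF l_pos z st])
 then have C0: "0 \<le> C" using st B_nonneg by (simp add: C_def)
 define \<epsilon> where "\<epsilon> = e / (C + 1)"
 have \<epsilon>: "0 < \<epsilon>" "\<epsilon> * C < e" using e C0 by (auto simp: \<epsilon>_def field_simps)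
 have "uniformly_continuous_on {s..t} z" "uniformly_continuous_on {s..t} A"
  unfolding A_def by (intro compact_uniformly_continuous continuous_on_diff continuous_on_Omega zw st compact_Icc)+
 then obtain d1 d2 where d1: "0 < d1" "\<And>x y. x \<in> {s..t} ==> y \<in> {s..t} ==> \<bar>x - y\<bar> < d1 ==> \<bar>z x - z y\<bar> < \<epsilon>"
  and d2: "0 < d2" "\<And>x y. x \<in> {s..t} ==> y \<in> {s..t} ==> \<bar>x - y\<bar> < d2 ==> \<bar>A x - A y\<bar> < \<epsilon>"
  unfolding uniformly_continuous_on_def dist_real_def using \<epsilon>(1) by metis
 have "(\<lambda>n. (t - s) / real (Suc n)) \<longlonglongrightarrow> 0" by real_asymp
 then have "\<forall>\<^sub>F n in sequentially. (t - s) / real (Suc n) < min d1 d2" using d1(1) d2(1) by (intro order_tendstoD) auto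
 then obtain N where N: "\<And>n. N \<le> n ==> (t - s) / real (Suc n) < min d1 d2" unfolding eventually_sequentially by blast
 show "\<exists>N. \<forall>n\<ge>N. norm (cell_sum s t (Suc n) w z - (LINT u:{s<..t}|lborel. gen (z u))) < e"
 proof (intro exI allI impI)
  fix n assume n: "N \<le> n"
  let ?m = "mesh s t (Suc n)" and ?\<delta> = "(t - s) / real (Suc n)"
  let ?c = "\<lambda>k. f (z (?m (Suc k))) - f (z (?m k) + (w (?m (Suc k)) - w (?m k))) + ?\<delta> * (f2 (z (?m k)) / 2)"
  have cell: "\<bar>?c k - (J (?m (Suc k)) - J (?m k))\<bar> \<le> 2 * B * \<epsilon> * (A (?m (Suc k)) - A (?m k)) + B * \<epsilon> * ?\<delta>" if k: "k < Suc n" for k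
  proof -
   have mm: "s \<le> ?m k" "?m k \<le> ?m (Suc k)" "?m (Suc k) \<le> t"
    using mesh_mono[OF st(2), of 0 k "Suc n"] mesh_mono[OF st(2), of k "Suc k" "Suc n"] mesh_mono[OF st(2), of "Suc k" "Suc n" "Suc n"] k by (simp_all add: mesh_simps)
   have sm: "?m (Suc k) - ?m k < min d1 d2" unfolding mesh_simps(3) by (rule N[OF n])
   have "\<bar>f (z (?m (Suc k))) - f (z (?m k) + (w (?m (Suc k)) - w (?m k))) + (?m (Suc k) - ?m k) * (f2 (z (?m k)) / 2) - (LINT u:{?m k<..?m (Suc k)}|lborel. gen (z u))\<bar>
    \<le> 2 * B * \<epsilon> * ((z (?m (Suc k)) - w (?m (Suc k))) - (z (?m k) - w (?m k))) + B * \<epsilon> * (?m (Suc k) - ?m k)"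
   proof (rule generator_cell[OF z])
    show "\<bar>z u - z (?m (Suc k))\<bar> \<le> \<epsilon>" if "u \<in> {?m k..?m (Suc k)}" for u
     using d1(2)[of u "?m (Suc k)"] that mm sm by auto
    show "z (?m (Suc k)) - w (?m (Suc k)) - (z (?m k) - w (?m k)) \<le> \<epsilon>"
     using d2(2)[of "?m (Suc k)" "?m k"] mm sm by (auto simp: A_def)
   qed (use mm st in auto)
   moreover have "J (?m (Suc k)) - J (?m k) = (LINT u:{?m k<..?m (Suc k)}|lborel. gen (z u))"
    unfolding J_def by (rule set_integral_Icc_diff(2)[OF gen_integrable[OF z]]) (use mm st in auto)
   ultimately show ?thesis unfolding mesh_simps(3) A_def by simp
  qed
  have tot: "J t - J s = (\<Sum>k<Suc n. J (?m (Suc k)) - J (?m k))" "A t - A s = (\<Sum>k<Suc n. A (?m (Suc k)) - A (?m k))"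
   using sum_lessThan_telescope[of "\<lambda>k. J (?m k)" "Suc n"] sum_lessThan_telescope[of "\<lambda>k. A (?m k)" "Suc n"] by (simp_all only: mesh_simps zero_less_Suc)
  have sp: "(\<Sum>k<Suc n. ?c k - (J (?m (Suc k)) - J (?m k))) = (\<Sum>k<Suc n. ?c k) - (J t - J s)"
   unfolding tot(1) by (rule sum_subtractf)
  have lc: "(LINT u:{s<..t}|lborel. gen (z u)) = J t - J s"
   unfolding J_def by (rule set_integral_Icc_diff(2)[OF gen_integrable[OF z order_trans[OF st]] st, symmetric])
  have "norm (cell_sum s t (Suc n) w z - (LINT u:{s<..t}|lborel. gen (z u))) = \<bar>\<Sum>k<Suc n. ?c k - (J (?m (Suc k)) - J (?m k))\<bar>"
   unfolding sp lc cell_sum_def real_norm_def ..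
  also have "\<dots> \<le> (\<Sum>k<Suc n. \<bar>?c k - (J (?m (Suc k)) - J (?m k))\<bar>)" by (rule sum_abs)
  also have "\<dots> \<le> (\<Sum>k<Suc n. 2 * B * \<epsilon> * (A (?m (Suc k)) - A (?m k)) + B * \<epsilon> * ?\<delta>)" by (intro sum_mono cell) auto
  also have "\<dots> = 2 * B * \<epsilon> * (A t - A s) + real (Suc n) * (B * \<epsilon> * ?\<delta>)"
   unfolding sum.distrib tot(2) sum_distrib_left by simp
  also have "\<dots> = \<epsilon> * C" by (simp add: C_def field_simps)
  also have "\<dots> < e" by (rule \<epsilon>)
  finally show "norm (cell_sum s t (Suc n) w z - (LINT u:{s<..t}|lborel. gen (z u))) < e" by simp
 qed
qed

text \<open>A majorant uniform in the mesh, integrable as soon as the drift is.\<close>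

lemma cell_sum_bound:
 assumes z: "solves l w z" and st: "0 \<le> s" "s \<le> t"
 shows "\<bar>cell_sum s t (Suc n) w z\<bar> \<le> B * (z t - w t) + (t - s) * B"
proof -
 let ?m = "mesh s t (Suc n)" and ?\<delta> = "(t - s) / real (Suc n)"
 define A where "A u = z u - w u" for u
 have m0: "0 \<le> ?m k" for k using mesh_mono[OF st(2), of 0 k "Suc n"] st(1) by (simp add: mesh_simps)
 have "\<bar>f (z (?m (Suc k))) - f (z (?m k) + (w (?m (Suc k)) - w (?m k))) + ?\<delta> * (f2 (z (?m k)) / 2)\<bar> \<le> B * (A (?m (Suc k)) - A (?m k)) + ?\<delta> * B" for k
 proof -
  have "\<bar>f (z (?m (Suc k))) - f (z (?m k) + (w (?m (Suc k)) - w (?m k)))\<bar> \<le> B * \<bar>z (?m (Suc k)) - (z (?m k) + (w (?m (Suc k)) - w (?m k)))\<bar>"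
   by (rule derivative_bound[OF d(1) b(2)])
  also have "z (?m (Suc k)) - (z (?m k) + (w (?m (Suc k)) - w (?m k))) = A (?m (Suc k)) - A (?m k)" by (simp add: A_def)
  also have "\<bar>A (?m (Suc k)) - A (?m k)\<bar> = A (?m (Suc k)) - A (?m k)"
   using solves_drift_nonneg[OF l_pos z m0 mesh_mono[OF st(2)], of k "Suc k"] by (simp add: A_def)
  moreover have "\<bar>?\<delta> * (f2 (z (?m k)) / 2)\<bar> \<le> ?\<delta> * B"
   unfolding abs_mult using b(3)[of "z (?m k)"] B_nonneg st by (intro mult_mono) auto
  ultimately show ?thesis by linarith
 qed
 then have "\<bar>cell_sum s t (Suc n) w z\<bar> \<le> (\<Sum>k<Suc n. B * (A (?m (Suc k)) - A (?m k)) + ?\<delta> * B)"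
  unfolding cell_sum_def by (intro order_trans[OF sum_abs] sum_mono)
 also have "\<dots> = B * (\<Sum>k<Suc n. A (?m (Suc k)) - A (?m k)) + real (Suc n) * (?\<delta> * B)"
  unfolding sum.distrib sum_distrib_left by simp
 also have "(\<Sum>k<Suc n. A (?m (Suc k)) - A (?m k)) = A t - A s"
  using sum_lessThan_telescope[of "\<lambda>k. A (?m k)" "Suc n"] by (simp only: mesh_simps zero_less_Suc)
 also have "B * (A t - A s) \<le> B * A t"
  using solves_drift_nonneg[OF l_pos z order_refl st(1)] solves_start[OF z] B_nonneg by (intro mult_left_mono) (auto simp: A_def)
 finally show ?thesis by (simp add: A_def)
qed

text \<open>Third-order Taylor expansion: the first-order term has mean 0 and the second moment is
  \<open>\<delta>\<close>. A remainder of order \<open>\<delta> * sqrt \<delta>\<close> stays small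
  after summation over about \<open>1 / \<delta>\<close> cells.\<close>

lemma gauss_taylor:
 assumes \<delta>: "0 < \<delta>"
 shows "\<bar>(LINT y|gauss \<delta>. f (x + y) - f x) - \<delta> * (f2 x / 2)\<bar> \<le> B * \<delta> * sqrt \<delta>"
proof -
 interpret G: prob_space "gauss \<delta>" by (rule prob_space_gauss[OF \<delta>])
 have T: "\<bar>f (x + y) - f x - y * f1 x - y\<^sup>2 * (f2 x / 2)\<bar> \<le> B * \<bar>y\<bar> ^ 3 / 6" for y
 proof (cases "y = 0")
  case False
  define D where "D m = (if m = 0 then f else if m = 1 then f1 else if m = 2 then f2 else f3)" for m :: nat
  obtain \<xi> where "f (x + y) = (\<Sum>m<3. D m x / fact m * (x + y - x) ^ m) + D 3 \<xi> / fact 3 * (x + y - x) ^ 3"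
  proof -
   have "\<forall>m t. m < 3 \<and> min x (x + y) \<le> t \<and> t \<le> max x (x + y) --> (D m has_real_derivative D (Suc m) t) (at t)"
    using d by (auto simp: D_def less_Suc_eq numeral_eq_Suc)
   from Taylor[OF _ _ this, of f x "x + y"] False obtain \<zeta>
    where "f (x + y) = (\<Sum>m<3. D m x / fact m * (x + y - x) ^ m) + D 3 \<zeta> / fact 3 * (x + y - x) ^ 3" by (auto simp: D_def)
   then show thesis by (rule that)
  qed
  then have "f (x + y) - f x - y * f1 x - y\<^sup>2 * (f2 x / 2) = f3 \<xi> * y ^ 3 / 6"
   by (simp add: D_def numeral_eq_Suc algebra_simps)
  then have "\<bar>f (x + y) - f x - y * f1 x - y\<^sup>2 * (f2 x / 2)\<bar> = \<bar>f3 \<xi> * y ^ 3 / 6\<bar>" by (simp only:)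
  then show ?thesis using mult_right_mono[OF b(4)[of \<xi>], of "\<bar>y\<bar> ^ 3"] by (simp add: abs_mult power_abs)
 qed simp
 have fm: "(\<lambda>y. f (x + y)) \<in> borel_measurable borel" by (rule measurable_compose[OF _ f_borel(1)]) measurable
 have i1: "integrable (gauss \<delta>) (\<lambda>y. f (x + y))" by (rule G.integrable_const_bound[where B=B]) (use b fm in auto)
 have i2: "integrable (gauss \<delta>) (\<lambda>y. y * f1 x)" "integrable (gauss \<delta>) (\<lambda>y. y\<^sup>2 * (f2 x / 2))"
  using gauss_moments(1)[OF \<delta>, of 1] gauss_moments(1)[OF \<delta>, of 2] by auto
 have "(LINT y|gauss \<delta>. f (x + y) - f x - y * f1 x - y\<^sup>2 * (f2 x / 2)) = (LINT y|gauss \<delta>. f (x + y) - f x) - \<delta> * (f2 x / 2)"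
  using i1 i2 gauss_moments(2,3)[OF \<delta>] by simp
 then have "\<bar>(LINT y|gauss \<delta>. f (x + y) - f x) - \<delta> * (f2 x / 2)\<bar> = \<bar>\<integral>y. f (x + y) - f x - y * f1 x - y\<^sup>2 * (f2 x / 2) \<partial>gauss \<delta>\<bar>" by simp
 also have "\<dots> \<le> (LINT y|gauss \<delta>. \<bar>f (x + y) - f x - y * f1 x - y\<^sup>2 * (f2 x / 2)\<bar>)" by (rule integral_abs_bound)
 also have "\<dots> \<le> (LINT y|gauss \<delta>. B * \<bar>y\<bar> ^ 3 / 6)"
  using i1 i2 gauss_abs3(1)[OF \<delta>] T by (intro integral_mono) auto
 also have "\<dots> = B / 6 * (LINT y|gauss \<delta>. \<bar>y\<bar> ^ 3)" by simp
 also have "\<dots> \<le> B / 6 * (2 * \<delta> * sqrt \<delta>)" using B_nonneg by (intro mult_left_mono gauss_abs3(2)[OF \<delta>]) auto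
 also have "\<dots> \<le> B * \<delta> * sqrt \<delta>" using B_nonneg \<delta> by (simp add: field_simps)
 finally show ?thesis .
qed

end

section \<open>The law of the radial process\<close>

locale radial = wiener P + test_function l f f1 f2 f3 B
 for P l f f1 f2 f3 B +
 fixes Z :: "(real => real) => real => real"
 assumes sol: "nonneg_solution P l Z"

text \<open>No measurability is asked for: a function that is not integrable has integral 0, and
  \<open>C\<close> is nonnegative.\<close>

lemma (in prob_space) abs_integral_le:
 fixes f :: "'a => real" and C :: real
 assumes "\<And>x. \<bar>f x\<bar> \<le> C" shows "\<bar>\<integral>x. f x \<partial>M\<bar> \<le> C"
proof (cases "integrable M f")
 case True
 have "\<bar>\<integral>x. f x \<partial>M\<bar> \<le> (LINT x|M. \<bar>f x\<bar>)" by (rule integral_abs_bound)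
 also have "\<dots> \<le> C" using True assms by (intro integral_le_const) auto
 finally show ?thesis .
qed (use order_trans[OF abs_ge_zero assms] in \<open>simp add: not_integrable_integral_eq\<close>)

context wiener
begin

lemma AE_solves:
 assumes "nonneg_solution P l Z" shows "AE w in P. solves l w (Z w)"
proof -
 have Z: "Z \<in> P \<rightarrow>\<^sub>M F_inf" using assms by (simp add: nonneg_solution_def)
 have "AE w in P. (\<forall>t\<ge>0. 0 \<le> Z w t) \<and> (AE u in lborel. 0 \<le> u --> 0 < Z w u) \<and>
    (\<forall>t\<ge>0. set_integrable lborel {0..t} (\<lambda>u. coth (l * Z w u)) \<and>
        Z w t = w t + l * (LINT u:{0..t}|lborel. coth (l * Z w u)))"
  using assms unfolding nonneg_solution_def by blast
 then show ?thesis using AE_space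
 proof eventually_elim
  case (elim w)
  moreover have "Z w \<in> Omega" using measurable_space[OF Z elim(2)] by simp
  ultimately show ?case unfolding solves_def space_P by blast
 qed
qed

text \<open>By pathwise uniqueness the solution up to time \<open>r\<close> does not change when the driving path is replaced by an
 independent one after time \<open>r\<close>; this is how adaptedness of \<open>Z\<close> is exploited.\<close>

lemma solution_splice:
 assumes l: "0 < l" and sol: "nonneg_solution P l Z" and r: "0 \<le> r"
 shows "AE z in P \<Otimes>\<^sub>M P. \<forall>u. 0 \<le> u --> u \<le> r --> Z (splice r z) u = Z (fst z) u"
proof -
 interpret PP: pair_prob_space P P ..
 have "AE w in distr (P \<Otimes>\<^sub>M P) P fst. solves l w (Z w)" unfolding distr_pair_fst by (rule AE_solves[OF sol])
 then have 1: "AE z in P \<Otimes>\<^sub>M P. solves l (fst z) (Z (fst z))" by (rule AE_distrD[rotated]) simp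
 have sm: "splice r \<in> P \<Otimes>\<^sub>M P \<rightarrow>\<^sub>M P" using splice_measurable[OF r] by (simp add: measurable_cong_sets[OF refl sets_P])
 have "AE w in distr (P \<Otimes>\<^sub>M P) P (splice r). solves l w (Z w)" unfolding splice_distr[OF r] by (rule AE_solves[OF sol])
 then have 2: "AE z in P \<Otimes>\<^sub>M P. solves l (splice r z) (Z (splice r z))" by (rule AE_distrD[OF sm])
 show ?thesis using 1 2
 proof eventually_elim
  case (elim z)
  show ?case
  proof (intro allI impI)
   fix u assume "0 \<le> u" "u \<le> r"
   then show "Z (splice r z) u = Z (fst z) u"
    by (intro solves_unique[OF l elim(2,1)]) (auto simp: splice_def)
  qed
 qed
qed

text \<open>\<open>\<Phi>\<close> reads the solution only up to \<open>r\<close>, so by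
  \<open>solution_splice\<close> the driving increment after \<open>r\<close> may be drawn from an
  independent second path. Fubini and the Gaussian law of increments then apply.\<close>

lemma solution_increment:
 fixes \<Phi> :: "(real => real) => real => real"
 assumes l: "0 < l" and sol: "nonneg_solution P l Z" and r: "0 \<le> r" "r < q"
  and \<Phi>: "case_prod \<Phi> \<in> borel_measurable (F_inf \<Otimes>\<^sub>M borel)" and C: "\<And>z y. \<bar>\<Phi> z y\<bar> \<le> C"
  and loc: "\<And>z z' y. z \<in> Omega ==> z' \<in> Omega ==> (\<And>u. 0 \<le> u ==> u \<le> r ==> z u = z' u) ==> \<Phi> z y = \<Phi> z' y"
 shows "(LINT w|P. \<Phi> (Z w) (w q - w r)) = (\<integral>w. (LINT y|gauss (q - r). \<Phi> (Z w) y) \<partial>P)"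
proof -
 interpret PP: pair_prob_space P P ..
 have Z: "Z \<in> P \<rightarrow>\<^sub>M F_inf" using sol by (simp add: nonneg_solution_def)
 have sm: "splice r \<in> P \<Otimes>\<^sub>M P \<rightarrow>\<^sub>M P" using splice_measurable[OF r(1)] by (simp add: measurable_cong_sets[OF refl sets_P])
 have inc: "(\<lambda>w. w q - w r) \<in> borel_measurable P" using r by (intro borel_measurable_diff coord_P) auto
 have m1: "(\<lambda>w. \<Phi> (Z w) (w q - w r)) \<in> borel_measurable P"
  using measurable_compose[OF measurable_Pair[OF Z inc] \<Phi>] by simp
 have m2: "(\<lambda>z. \<Phi> (Z (fst z)) (snd z q - snd z r)) \<in> borel_measurable (P \<Otimes>\<^sub>M P)"
  using measurable_compose[OF measurable_Pair[OF measurable_compose[OF measurable_fst Z] measurable_compose[OF measurable_snd inc]] \<Phi>] by simp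
 have i: "integrable (P \<Otimes>\<^sub>M P) (\<lambda>z. \<Phi> (Z (fst z)) (snd z q - snd z r))"
  by (rule PP.integrable_const_bound[where B=C, OF _ m2]) (simp add: C)
 have "(LINT w|P. \<Phi> (Z w) (w q - w r)) = (LINT w|distr (P \<Otimes>\<^sub>M P) P (splice r). \<Phi> (Z w) (w q - w r))"
  unfolding splice_distr[OF r(1)] ..
 also have "\<dots> = (LINT z|(P \<Otimes>\<^sub>M P). \<Phi> (Z (splice r z)) (splice r z q - splice r z r))"
  by (rule integral_distr[OF sm m1])
 also have "\<dots> = (LINT z|(P \<Otimes>\<^sub>M P). \<Phi> (Z (fst z)) (snd z q - snd z r))"
 proof (rule integral_cong_AE)
  show "(\<lambda>z. \<Phi> (Z (splice r z)) (splice r z q - splice r z r)) \<in> borel_measurable (P \<Otimes>\<^sub>M P)"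
   by (rule measurable_compose[OF sm m1])
  show "AE z in P \<Otimes>\<^sub>M P. \<Phi> (Z (splice r z)) (splice r z q - splice r z r) = \<Phi> (Z (fst z)) (snd z q - snd z r)"
   using solution_splice[OF l sol r(1)] AE_space
  proof eventually_elim
   case (elim z)
   have "splice r z \<in> space P" by (rule measurable_space[OF sm elim(2)])
   then have 1: "Z (splice r z) \<in> space F_inf" by (rule measurable_space[OF Z])
   have "fst z \<in> space P" using elim(2) by (auto simp: space_pair_measure)
   then have "Z (fst z) \<in> space F_inf" by (rule measurable_space[OF Z])
   with 1
   have "\<Phi> (Z (splice r z)) y = \<Phi> (Z (fst z)) y" for y using elim(1) by (intro loc) simp_all
   moreover have "splice r z q - splice r z r = snd z q - snd z r" using r by (simp add: splice_def)
   ultimately show ?case by simp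
  qed
 qed (rule m2)
 also have "\<dots> = (\<integral>w. (LINT w'|P. \<Phi> (Z w) (w' q - w' r)) \<partial>P)"
  using PP.integral_fst'[OF i] by simp
 also have "\<dots> = (\<integral>w. (LINT y|gauss (q - r). \<Phi> (Z w) y) \<partial>P)"
 proof (rule Bochner_Integration.integral_cong[OF refl])
  fix w assume "w \<in> space P"
  then have "Z w \<in> space F_inf" by (rule measurable_space[OF Z])
  then have mz: "\<Phi> (Z w) \<in> borel_measurable borel" using measurable_Pair2[OF \<Phi>, of "Z w"] by simp
  have "(LINT w'|P. \<Phi> (Z w) (w' q - w' r)) = (\<integral>w'. (LINT y|gauss (q - r). \<Phi> (Z w) y) \<partial>P)"
  proof (rule integral_increment[OF r])
   show "(\<lambda>(w'::real => real, y). \<Phi> (Z w) y) \<in> borel_measurable (F r \<Otimes>\<^sub>M borel)"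
    using measurable_compose[OF measurable_snd mz] by (simp add: case_prod_beta')
   show "integrable P (\<lambda>w'. \<Phi> (Z w) (w' q - w' r))"
    by (rule integrable_const_bound[where B=C]) (auto intro: measurable_compose[OF inc mz] simp: C)
  qed
  then show "(LINT w'|P. \<Phi> (Z w) (w' q - w' r)) = (LINT y|gauss (q - r). \<Phi> (Z w) y)" using prob_space by simp
 qed
 finally show ?thesis .
qed

end

text \<open>Stands for a bounded random variable known at time \<open>s\<close>; dependence on the
  past is stated pointwise, as \<open>solution_increment\<close> needs it.\<close>

definition past_weight :: "real => ((real => real) => real) => bool" where
 "past_weight s h \<longleftrightarrow> h \<in> borel_measurable F_inf \<and> (\<forall>z. 0 \<le> h z \<and> h z \<le> 1) \<and>
  (\<forall>z z'. (\<forall>u. 0 \<le> u --> u \<le> s --> z u = z' u) --> h z = h z')"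

lemma past_weightD:
 assumes "past_weight s h"
 shows "h \<in> borel_measurable F_inf" "0 \<le> h z" "h z \<le> 1" "\<bar>h z\<bar> \<le> 1" "(\<And>u. 0 \<le> u ==> u \<le> s ==> z u = z' u) ==> h z = h z'"
 using assms unfolding past_weight_def by (auto simp: abs_le_iff intro: order_trans[of _ 0])

context radial
begin

lemma Z: "Z \<in> P \<rightarrow>\<^sub>M F_inf" using sol by (simp add: nonneg_solution_def)

lemma Z_at: "0 \<le> t ==> (\<lambda>w. Z w t) \<in> borel_measurable P"
 by (rule measurable_compose[OF Z coord_F_inf])

lemma AE_sol: "AE w in P. solves l w (Z w)" by (rule AE_solves[OF sol])

lemma f_integrable:
 assumes h: "past_weight s h" and t: "0 \<le> t"
 shows "integrable P (\<lambda>w. h (Z w) * f (Z w t))"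
proof (rule integrable_const_bound[where B=B])
 show "AE w in P. norm (h (Z w) * f (Z w t)) \<le> B"
  using mult_mono[OF past_weightD(4)[OF h] b(1)] by (auto simp: abs_mult)
 show "(\<lambda>w. h (Z w) * f (Z w t)) \<in> borel_measurable P"
  by (intro borel_measurable_times measurable_compose[OF Z past_weightD(1)[OF h]] measurable_compose[OF Z_at[OF t] f_borel(1)])
qed

text \<open>The change of \<open>f\<close> caused by the Brownian increment of one cell, minus its
  compensator. Weighted with the past, its expectation is only of order
  \<open>(q - r) * sqrt (q - r)\<close>.\<close>

definition err :: "real => real => (real => real) => real" where
 "err r q w = f (Z w r + (w q - w r)) - f (Z w r) - (q - r) * (f2 (Z w r) / 2)"

lemma err_measurable: "0 \<le> r ==> 0 \<le> q ==> err r q \<in> borel_measurable P"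
 unfolding err_def[abs_def]
 by (intro borel_measurable_diff borel_measurable_times borel_measurable_divide borel_measurable_const
  measurable_compose[OF _ f_borel(1)] measurable_compose[OF _ f_borel(3)] borel_measurable_add Z_at coord_P)

lemma taylor_bound: "0 \<le> \<delta> ==> \<bar>f (x + y) - f x - \<delta> * (f2 x / 2)\<bar> \<le> 2 * B + \<delta> * B"
proof -
 assume "0 \<le> \<delta>"
 then have "\<bar>\<delta> * (f2 x / 2)\<bar> \<le> \<delta> * B" unfolding abs_mult using b(3)[of x] B_nonneg by (intro mult_mono) auto
 then show ?thesis using b(1)[of "x + y"] b(1)[of x] by linarith
qed

lemma err_integrable:
 assumes h: "past_weight s h" and r: "0 \<le> r" "r \<le> q"
 shows "integrable P (\<lambda>w. h (Z w) * err r q w)"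
proof (rule integrable_const_bound[where B="2 * B + (q - r) * B"])
 show "AE w in P. norm (h (Z w) * err r q w) \<le> 2 * B + (q - r) * B"
 proof (rule AE_I2)
  fix w
  have "\<bar>h (Z w)\<bar> * \<bar>err r q w\<bar> \<le> 1 * (2 * B + (q - r) * B)"
   using r unfolding err_def by (intro mult_mono past_weightD(4)[OF h] taylor_bound) auto
  then show "norm (h (Z w) * err r q w) \<le> 2 * B + (q - r) * B" by (simp add: abs_mult)
 qed
 show "(\<lambda>w. h (Z w) * err r q w) \<in> borel_measurable P"
  using r by (intro borel_measurable_times measurable_compose[OF Z past_weightD(1)[OF h]] err_measurable) auto
qed

lemma err_expectation:
 assumes h: "past_weight s h" and r: "0 \<le> s" "s \<le> r" "r < q"
 shows "\<bar>\<integral>w. h (Z w) * err r q w \<partial>P\<bar> \<le> B * (q - r) * sqrt (q - r)"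
proof -
 define \<Phi> where "\<Phi> z y = h z * (f (z r + y) - f (z r) - (q - r) * (f2 (z r) / 2))" for z y
 have r0: "0 \<le> r" using r by simp
 interpret G: prob_space "gauss (q - r)" using r by (intro prob_space_gauss) simp
 have \<Phi>m: "case_prod \<Phi> \<in> borel_measurable (F_inf \<Otimes>\<^sub>M borel)"
  unfolding \<Phi>_def case_prod_beta'
  by (intro borel_measurable_diff borel_measurable_times borel_measurable_divide borel_measurable_const borel_measurable_add
   measurable_compose[OF _ f_borel(1)] measurable_compose[OF _ f_borel(3)] measurable_compose[OF measurable_fst past_weightD(1)[OF h]]
   measurable_compose[OF measurable_fst coord_F_inf[OF r0]] measurable_snd)
 have \<Phi>b: "\<bar>\<Phi> z y\<bar> \<le> 2 * B + (q - r) * B" for z y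
 proof -
  have "\<bar>h z\<bar> * \<bar>f (z r + y) - f (z r) - (q - r) * (f2 (z r) / 2)\<bar> \<le> 1 * (2 * B + (q - r) * B)"
   using r by (intro mult_mono past_weightD(4)[OF h] taylor_bound) auto
  then show ?thesis by (simp add: \<Phi>_def abs_mult)
 qed
 have "(LINT w|P. h (Z w) * err r q w) = (LINT w|P. \<Phi> (Z w) (w q - w r))" by (simp only: \<Phi>_def err_def)
 also have "\<dots> = (\<integral>w. (LINT y|gauss (q - r). \<Phi> (Z w) y) \<partial>P)"
 proof (rule solution_increment[OF l_pos sol r0 r(3) \<Phi>m \<Phi>b])
  fix z z' :: "real => real" and y assume e: "\<And>u. 0 \<le> u ==> u \<le> r ==> z u = z' u"
  have "h z = h z'" using e r by (intro past_weightD(5)[OF h]) auto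
  then show "\<Phi> z y = \<Phi> z' y" using e[OF r0 order_refl] by (simp add: \<Phi>_def)
 qed
 finally have eq: "(LINT w|P. h (Z w) * err r q w) = (\<integral>w. (LINT y|gauss (q - r). \<Phi> (Z w) y) \<partial>P)" .
 have "\<bar>\<integral>y. \<Phi> z y \<partial>gauss (q - r)\<bar> \<le> B * (q - r) * sqrt (q - r)" for z
 proof -
  have fm: "(\<lambda>y. f (z r + y)) \<in> borel_measurable borel" by (rule measurable_compose[OF _ f_borel(1)]) measurable
  have i: "integrable (gauss (q - r)) (\<lambda>y. f (z r + y))" by (rule G.integrable_const_bound[where B=B]) (use b fm in auto)
  have "(LINT y|gauss (q - r). \<Phi> z y) = h z * ((LINT y|gauss (q - r). f (z r + y) - f (z r)) - (q - r) * (f2 (z r) / 2))"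
   unfolding \<Phi>_def using i G.prob_space by simp
  also have "\<bar>\<dots>\<bar> \<le> 1 * (B * (q - r) * sqrt (q - r))"
   unfolding abs_mult[of "h z"] using r by (intro mult_mono past_weightD(4)[OF h] gauss_taylor) auto
  finally show ?thesis by simp
 qed
 then show ?thesis unfolding eq by (rule abs_integral_le)
qed

lemma cell_sum_eq:
 assumes "0 < n"
 shows "cell_sum s t n w (Z w) = f (Z w t) - f (Z w s) - (\<Sum>k<n. err (mesh s t n k) (mesh s t n (Suc k)) w)"
proof -
 have "cell_sum s t n w (Z w) = (\<Sum>k<n. (f (Z w (mesh s t n (Suc k))) - f (Z w (mesh s t n k))) - err (mesh s t n k) (mesh s t n (Suc k)) w)"
  unfolding cell_sum_def err_def mesh_simps(3) by (intro sum.cong refl) simp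
 also have "\<dots> = (\<Sum>k<n. f (Z w (mesh s t n (Suc k))) - f (Z w (mesh s t n k))) - (\<Sum>k<n. err (mesh s t n k) (mesh s t n (Suc k)) w)"
  by (rule sum_subtractf)
 also have "(\<Sum>k<n. f (Z w (mesh s t n (Suc k))) - f (Z w (mesh s t n k))) = f (Z w t) - f (Z w s)"
  using sum_lessThan_telescope[of "\<lambda>k. f (Z w (mesh s t n k))" n] by (simp only: mesh_simps assms)
 finally show ?thesis .
qed

text \<open>Each of the \<open>n\<close> cells contributes an error of order \<open>n\<close> to the
  power -3/2, so the total is of order \<open>n\<close> to the power -1/2.\<close>

lemma cell_sum_expectation:
 assumes h: "past_weight s h" and st: "0 \<le> s" "s < t" and n: "0 < n"
 shows "integrable P (\<lambda>w. h (Z w) * cell_sum s t n w (Z w))"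
  "\<bar>(LINT w|P. h (Z w) * cell_sum s t n w (Z w)) - ((LINT w|P. h (Z w) * f (Z w t)) - (LINT w|P. h (Z w) * f (Z w s)))\<bar>
   \<le> B * (t - s) * sqrt ((t - s) / real n)"
proof -
 let ?m = "mesh s t n" and ?\<delta> = "(t - s) / real n"
 have \<delta>0: "0 < ?\<delta>" using st n by simp
 have m: "s \<le> ?m k" "?m k < ?m (Suc k)" for k
  using mesh_mono[of s t 0 k n] mesh_simps(1)[OF n, of s t] mesh_simps(3)[of s t n k] \<delta>0 st by linarith+
 have m0: "0 \<le> ?m k" for k using m(1)[of k] st by linarith
 have ei: "integrable P (\<lambda>w. h (Z w) * err (?m k) (?m (Suc k)) w)" for k
  by (rule err_integrable[OF h m0 less_imp_le[OF m(2)]])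
 have eq: "h (Z w) * cell_sum s t n w (Z w)
  = (h (Z w) * f (Z w t) - h (Z w) * f (Z w s)) - (\<Sum>k<n. h (Z w) * err (?m k) (?m (Suc k)) w)" for w
  unfolding cell_sum_eq[OF n] sum_distrib_left[symmetric] by (simp only: right_diff_distrib)
 have fi: "integrable P (\<lambda>w. h (Z w) * f (Z w t))" "integrable P (\<lambda>w. h (Z w) * f (Z w s))"
  using st by (auto intro: f_integrable[OF h])
 note di = Bochner_Integration.integrable_diff[OF fi]
 have si: "integrable P (\<lambda>w. \<Sum>k<n. h (Z w) * err (?m k) (?m (Suc k)) w)" by (rule Bochner_Integration.integrable_sum[OF ei])
 show "integrable P (\<lambda>w. h (Z w) * cell_sum s t n w (Z w))"
  unfolding eq by (rule Bochner_Integration.integrable_diff[OF di si])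
 have de: "(LINT w|P. h (Z w) * cell_sum s t n w (Z w)) - ((LINT w|P. h (Z w) * f (Z w t)) - (LINT w|P. h (Z w) * f (Z w s)))
  = - (\<Sum>k<n. \<integral>w. h (Z w) * err (?m k) (?m (Suc k)) w \<partial>P)"
  unfolding eq Bochner_Integration.integral_diff[OF di si] Bochner_Integration.integral_diff[OF fi] Bochner_Integration.integral_sum[OF ei] by simp
 have "\<bar>- (\<Sum>k<n. \<integral>w. h (Z w) * err (?m k) (?m (Suc k)) w \<partial>P)\<bar> \<le> (\<Sum>k<n. \<bar>\<integral>w. h (Z w) * err (?m k) (?m (Suc k)) w \<partial>P\<bar>)"
  unfolding abs_minus_cancel by (rule sum_abs)
 also have "\<dots> \<le> (\<Sum>k<n. B * ?\<delta> * sqrt ?\<delta>)"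
  using err_expectation[OF h st(1) m] unfolding mesh_simps(3) by (intro sum_mono)
 also have "\<dots> = B * (t - s) * sqrt ?\<delta>" using n by simp
 finally show "\<bar>(LINT w|P. h (Z w) * cell_sum s t n w (Z w)) - ((LINT w|P. h (Z w) * f (Z w t)) - (LINT w|P. h (Z w) * f (Z w s)))\<bar>
   \<le> B * (t - s) * sqrt ?\<delta>" unfolding de .
qed

lemma Z_joint: "k \<in> borel_measurable borel ==> 0 \<le> s ==>
 (\<lambda>z. indicat_real {s<..t} (snd z) *\<^sub>R (k (Z (fst z) (snd z)) :: real)) \<in> borel_measurable (P \<Otimes>\<^sub>M lborel)"
proof -
 assume k: "k \<in> borel_measurable borel" and s: "0 \<le> s"
 \<comment> \<open>Evaluation is measurable only at nonnegative times; the indicator hides the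
   truncation at 0.\<close>
 have "(\<lambda>z. Z (fst z) (max 0 (snd z))) \<in> borel_measurable (P \<Otimes>\<^sub>M lborel)"
 proof (rule eval_measurable[OF _ measurable_compose[OF measurable_fst Z]])
  show "(\<lambda>z. max 0 (snd z) :: real) \<in> borel_measurable (P \<Otimes>\<^sub>M lborel)"
   by (intro borel_measurable_max borel_measurable_const measurable_compose[OF measurable_snd, where g="\<lambda>x. x"]) simp
 qed simp
 then have 1: "(\<lambda>z. k (Z (fst z) (max 0 (snd z)))) \<in> borel_measurable (P \<Otimes>\<^sub>M lborel)" by (rule measurable_compose[OF _ k])
 have 2: "(\<lambda>z. indicat_real {s<..t} (snd z)) \<in> borel_measurable (P \<Otimes>\<^sub>M lborel)"
  by (rule measurable_compose[OF measurable_snd]) simp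
 have "(\<lambda>z. indicat_real {s<..t} (snd z) *\<^sub>R k (Z (fst z) (max 0 (snd z)))) \<in> borel_measurable (P \<Otimes>\<^sub>M lborel)"
  by (rule borel_measurable_scaleR[OF 2 1])
 also have "(\<lambda>z. indicat_real {s<..t} (snd z) *\<^sub>R k (Z (fst z) (max 0 (snd z)))) = (\<lambda>z. indicat_real {s<..t} (snd z) *\<^sub>R k (Z (fst z) (snd z)))"
  using s by (auto simp: indicator_def max_def fun_eq_iff)
 finally show ?thesis .
qed

lemma Z_LINT_measurable: "k \<in> borel_measurable borel ==> 0 \<le> s ==> (\<lambda>w. LINT u:{s<..t}|lborel. k (Z w u) :: real) \<in> borel_measurable P"
 unfolding set_lebesgue_integral_def
 using lborel.borel_measurable_lebesgue_integral[of "\<lambda>w u. indicat_real {s<..t} u *\<^sub>R k (Z w u)" P] Z_joint[of k s t]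
 by (simp add: case_prod_beta')

lemma drift_measurable: "0 \<le> t ==> (\<lambda>w. Z w t - w t) \<in> borel_measurable P"
 by (intro borel_measurable_diff Z_at coord_P)

text \<open>Dynkin's formula, from two limits of the expected cell sums: pathwise they approach the
  integral of the generator, and in expectation they approach the increment of \<open>f\<close>.
  Integrability of the drift provides the majorant.\<close>

lemma generator_formula:
 assumes h: "past_weight s h" and st: "0 \<le> s" "s < t" and D: "integrable P (\<lambda>W. Z W t - W t)"
 shows "(LINT W|P. h (Z W) * f (Z W t)) - (LINT W|P. h (Z W) * f (Z W s)) = (LINT W|P. h (Z W) * (LINT u:{s<..t}|lborel. gen (Z W u)))"
proof (rule LIMSEQ_unique)
 let ?V = "\<lambda>n. \<integral>W. h (Z W) * cell_sum s t (Suc n) W (Z W) \<partial>P" and ?L = "(LINT W|P. h (Z W) * f (Z W t)) - (LINT W|P. h (Z W) * f (Z W s))"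
 have hm: "(\<lambda>W. h (Z W)) \<in> borel_measurable P" by (rule measurable_compose[OF Z past_weightD(1)[OF h]])
 have "(\<lambda>n. B * (t - s) * sqrt ((t - s) / real (Suc n))) \<longlonglongrightarrow> B * (t - s) * sqrt 0"
  by (intro tendsto_intros) real_asymp
 then have z: "(\<lambda>n. B * (t - s) * sqrt ((t - s) / real (Suc n))) \<longlonglongrightarrow> 0" by simp
 have "norm (?V n - ?L) \<le> B * (t - s) * sqrt ((t - s) / real (Suc n))" for n
  using cell_sum_expectation(2)[OF h st, of "Suc n"] by (simp only: real_norm_def zero_less_Suc)
 then have "(\<lambda>n. ?V n - ?L) \<longlonglongrightarrow> 0" by (intro Lim_null_comparison[OF always_eventually z] allI)
 then show "?V \<longlonglongrightarrow> ?L" by (simp only: LIM_zero_iff)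
 show "?V \<longlonglongrightarrow> (LINT W|P. h (Z W) * (LINT u:{s<..t}|lborel. gen (Z W u)))"
 proof (rule integral_dominated_convergence[where w="\<lambda>W. B * (Z W t - W t) + (t - s) * B"])
  show "(\<lambda>W. h (Z W) * (LINT u:{s<..t}|lborel. gen (Z W u))) \<in> borel_measurable P"
   by (intro borel_measurable_times hm Z_LINT_measurable gen_borel st)
  show "(\<lambda>W. h (Z W) * cell_sum s t (Suc n) W (Z W)) \<in> borel_measurable P" for n
   using cell_sum_expectation(1)[OF h st, of "Suc n"] by (intro borel_measurable_integrable) simp
  show "integrable P (\<lambda>W. B * (Z W t - W t) + (t - s) * B)" using D by simp
  show "AE W in P. (\<lambda>n. h (Z W) * cell_sum s t (Suc n) W (Z W)) \<longlonglongrightarrow> h (Z W) * (LINT u:{s<..t}|lborel. gen (Z W u))"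
   using AE_sol by eventually_elim (intro tendsto_mult_left generator_limit, use st in auto)
  show "AE W in P. norm (h (Z W) * cell_sum s t (Suc n) W (Z W)) \<le> B * (Z W t - W t) + (t - s) * B" for n
   using AE_sol
  proof eventually_elim
   case (elim W)
   have "\<bar>h (Z W)\<bar> * \<bar>cell_sum s t (Suc n) W (Z W)\<bar> \<le> 1 * (B * (Z W t - W t) + (t - s) * B)"
    using st by (intro mult_mono past_weightD(4)[OF h] cell_sum_bound[OF elim]) auto
   then show ?case by (simp add: abs_mult)
  qed
 qed
qed

text \<open>Increasing test functions only: for these the drift part of \<^const>\<open>cell_sum\<close> is nonnegative, so that Fatou's lemma applies.\<close>

lemma drift_integrable_aux:
 assumes f1: "\<And>x. 0 \<le> f1 x" "\<And>x. 0 \<le> x ==> x \<le> 1 ==> c \<le> f1 x" and c: "0 < c" and t: "0 < t"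
 shows "integrable P (\<lambda>w. Z w t - w t)"
proof -
 let ?V = "\<lambda>n w. cell_sum 0 t (Suc n) w (Z w) + t * B" and ?L = "\<lambda>w. (LINT u:{0<..t}|lborel. gen (Z w u)) + t * B"
 have h: "past_weight 0 (\<lambda>_. 1)" by (simp add: past_weight_def)
 have Vi: "integrable P (?V n)" for n using cell_sum_expectation(1)[OF h order_refl t, of "Suc n"] by simp
 have V0: "AE w in P. 0 \<le> ?V n w" for n
  using AE_sol
 proof eventually_elim
  case (elim w)
  let ?m = "mesh 0 t (Suc n)"
  have "- (t / real (Suc n) * B) \<le> f (Z w (?m (Suc k))) - f (Z w (?m k) + (w (?m (Suc k)) - w (?m k))) + (t - 0) / real (Suc n) * (f2 (Z w (?m k)) / 2)" for k
  proof -
   have "0 \<le> ?m k" "?m k \<le> ?m (Suc k)" using mesh_mono[of 0 t 0 k "Suc n"] mesh_mono[of 0 t k "Suc k" "Suc n"] t by (simp_all add: mesh_simps)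
   then have "Z w (?m k) + (w (?m (Suc k)) - w (?m k)) \<le> Z w (?m (Suc k))" using solves_drift_nonneg[OF l_pos elim] by force
   then have "f (Z w (?m k) + (w (?m (Suc k)) - w (?m k))) \<le> f (Z w (?m (Suc k)))"
    by (rule DERIV_nonneg_imp_nondecreasing) (use d(1) f1(1) in blast)
   moreover have "- B \<le> f2 (Z w (?m k)) / 2" using b(3)[of "Z w (?m k)"] B_nonneg by (simp add: abs_le_iff)
   then have "t / real (Suc n) * - B \<le> t / real (Suc n) * (f2 (Z w (?m k)) / 2)" using t by (intro mult_left_mono) auto
   ultimately show ?thesis by simp
  qed
  then have "(\<Sum>k<Suc n. - (t / real (Suc n) * B)) \<le> cell_sum 0 t (Suc n) w (Z w)" unfolding cell_sum_def by (intro sum_mono)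
  also have "(\<Sum>k<Suc n. - (t / real (Suc n) * B)) = - (t * B)" by simp
  finally show ?case by simp
 qed
 \<comment> \<open>A bound for the expected shifted cell sum that is uniform in \<open>n\<close>:
   \<open>2 * B\<close> from \<open>f\<close> at both ends, \<open>B * t * sqrt t\<close> from the
   Taylor errors, and \<open>t * B\<close> from the shift.\<close>
 define C where "C = 2 * B + B * t * sqrt t + t * B"
 have C0: "0 \<le> C" using t B_nonneg by (simp add: C_def)
 have EV: "(\<integral>\<^sup>+w. ennreal (?V n w) \<partial>P) \<le> ennreal C" for n
 proof -
  have "(\<integral>\<^sup>+w. ennreal (?V n w) \<partial>P) = ennreal (LINT w|P. ?V n w)" by (rule nn_integral_eq_integral[OF Vi V0])
  also have "(LINT w|P. ?V n w) = (LINT w|P. cell_sum 0 t (Suc n) w (Z w)) + t * B"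
   using cell_sum_expectation(1)[OF h order_refl t, of "Suc n"] prob_space by simp
  also have "\<dots> \<le> C"
  proof -
   have "sqrt (t / real (Suc n)) \<le> sqrt t" using t by (simp add: divide_le_eq mult_left_le)
   then have "B * t * sqrt (t / real (Suc n)) \<le> B * t * sqrt t" using t B_nonneg by (intro mult_left_mono) auto
   moreover have "\<bar>\<integral>w. f (Z w t) \<partial>P\<bar> \<le> B" "\<bar>\<integral>w. f (Z w 0) \<partial>P\<bar> \<le> B" by (intro abs_integral_le b)+
   ultimately show ?thesis using cell_sum_expectation(2)[OF h order_refl t, of "Suc n"] unfolding C_def by simp
  qed
  finally show ?thesis using ennreal_leI by auto
 qed
 have Lm: "?L \<in> borel_measurable P" by (intro borel_measurable_add borel_measurable_const Z_LINT_measurable gen_borel) simp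
 have lim: "AE w in P. (\<lambda>n. ?V n w) \<longlonglongrightarrow> ?L w"
  using AE_sol by eventually_elim (intro tendsto_add tendsto_const generator_limit, use t in auto)
 have "(\<integral>\<^sup>+w. ennreal (?L w) \<partial>P) = (\<integral>\<^sup>+w. liminf (\<lambda>n. ennreal (?V n w)) \<partial>P)"
 proof (rule nn_integral_cong_AE)
  show "AE w in P. ennreal (?L w) = liminf (\<lambda>n. ennreal (?V n w))"
   using lim by eventually_elim (rule lim_imp_Liminf[symmetric], simp, rule tendsto_ennrealI)
 qed
 also have "\<dots> \<le> liminf (\<lambda>n. \<integral>\<^sup>+w. ennreal (?V n w) \<partial>P)"
  by (rule nn_integral_liminf) (use borel_measurable_integrable[OF Vi] in \<open>rule measurable_compose[OF _ measurable_ennreal]\<close>)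
 also have "\<dots> \<le> ennreal C"
  using EV by (intro Liminf_le) auto
 finally have fin: "(\<integral>\<^sup>+w. ennreal (?L w) \<partial>P) \<le> ennreal C" .
 have L0: "AE w in P. 0 \<le> ?L w"
 proof -
  have "AE w in P. \<forall>n. 0 \<le> ?V n w" unfolding AE_all_countable using V0 by (rule allI)
  with lim show ?thesis by eventually_elim (rule LIMSEQ_le_const, auto)
 qed
 have Li: "integrable P ?L"
  by (rule integrableI_nonneg[OF Lm L0]) (use fin in \<open>simp add: order_le_less_trans\<close>)
 \<comment> \<open>Where \<open>Z w u \<le> 1\<close> the derivative \<open>f1\<close> is at least
   \<open>c\<close>, so the drift term of the generator dominates \<open>c * l * coth\<close>;
   elsewhere \<open>coth\<close> is at most \<open>coth l\<close>. Hence the integrated generator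
   controls the drift up to constants.\<close>
 have bound: "0 \<le> Z w t - w t \<and> Z w t - w t \<le> l * coth l * t + ?L w / c" if w: "solves l w (Z w)" for w
 proof
  show "0 \<le> Z w t - w t" using solves_drift_nonneg[OF l_pos w order_refl, of t] t solves_start[OF w] by simp
  note I = solves_increment[OF w order_refl less_imp_le[OF t]]
  have Gi: "set_integrable lborel {0<..t} (\<lambda>u. gen (Z w u))"
   by (rule set_integral_Icc_diff(1)[OF gen_integrable[OF w, of t]]) (use t in auto)
  have Ci: "set_integrable lborel {0<..t} (\<lambda>u. k)" for k :: real by (rule set_integrable_subset[OF set_integrable_Icc_const[of 0 t]]) auto
  have "c * (Z w t - w t) = (LINT u:{0<..t}|lborel. c * (l * coth (l * Z w u)))"
   using I(2) solves_start[OF w] by simp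
  also have "\<dots> \<le> (LINT u:{0<..t}|lborel. gen (Z w u) + (c * (l * coth l) + B))"
  proof (rule set_integral_mono)
   fix u assume "u \<in> {0<..t}"
   then have z: "0 \<le> Z w u" using solvesD(3)[OF w] by simp
   have k0: "0 \<le> l * coth (l * Z w u)" "0 \<le> l * coth l" using z l_pos by (simp_all add: coth_nonneg)
   have "- B \<le> f2 (Z w u) / 2" using b(3)[of "Z w u"] B_nonneg by (simp add: abs_le_iff)
   moreover have "0 \<le> l * coth (l * Z w u) * f1 (Z w u)" by (intro mult_nonneg_nonneg k0 f1)
   moreover have "c * (l * coth (l * Z w u)) \<le> l * coth (l * Z w u) * f1 (Z w u) + c * (l * coth l)"
   proof (cases "Z w u \<le> 1")
    case True
    then have "l * coth (l * Z w u) * c \<le> l * coth (l * Z w u) * f1 (Z w u)" by (intro mult_left_mono f1(2) z k0)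
    moreover have "0 \<le> c * (l * coth l)" using c k0 by simp
    ultimately show ?thesis by (simp add: mult.commute)
   next
    case False
    then have "coth (l * Z w u) \<le> coth l" using l_pos by (intro coth_mono) auto
    then have "c * (l * coth (l * Z w u)) \<le> c * (l * coth l)" using c l_pos by simp
    then show ?thesis using \<open>0 \<le> l * coth (l * Z w u) * f1 (Z w u)\<close> by linarith
   qed
   ultimately show "c * (l * coth (l * Z w u)) \<le> gen (Z w u) + (c * (l * coth l) + B)" unfolding gen_def by linarith
  qed (intro set_integral_add(1) set_integrable_mult_right I(1) Gi Ci)+
  also have "\<dots> = (LINT u:{0<..t}|lborel. gen (Z w u)) + (c * (l * coth l) + B) * t"
   using t by (subst set_integral_add(2)[OF Gi Ci]) (simp add: set_lebesgue_integral_def)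
  finally show "Z w t - w t \<le> l * coth l * t + ?L w / c" using c by (simp add: field_simps)
 qed
 show ?thesis
 proof (rule Bochner_Integration.integrable_bound)
  show "integrable P (\<lambda>w. l * coth l * t + ?L w / c)" by (intro Bochner_Integration.integrable_add integrable_const integrable_divide Li)
  show "AE w in P. norm (Z w t - w t) \<le> norm (l * coth l * t + ?L w / c)"
   using AE_sol by eventually_elim (use bound in force)
 qed (rule drift_measurable, use t in simp)
qed

end

text \<open>A bounded increasing function whose derivative stays away from 0 on the unit interval,
  as \<open>drift_integrable_aux\<close> asks. The constant 6 is \<open>2 + 4\<close>, from the
  coefficients of the third derivative.\<close>

lemma test_function_tanh:
 "0 < l ==> test_function l tanh (\<lambda>x. 1 - (tanh x)\<^sup>2) (\<lambda>x. - 2 * tanh x * (1 - (tanh x)\<^sup>2))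
  (\<lambda>x. - 2 * (1 - (tanh x)\<^sup>2)\<^sup>2 + 4 * (tanh x)\<^sup>2 * (1 - (tanh x)\<^sup>2)) 6"
proof
 have c: "cosh x \<noteq> 0" for x :: real using cosh_real_pos[of x] by simp
 show "(tanh has_real_derivative 1 - (tanh x)\<^sup>2) (at x)" for x :: real
  by (auto intro!: derivative_eq_intros simp: c)
 show "((\<lambda>x. 1 - (tanh x)\<^sup>2) has_real_derivative - 2 * tanh x * (1 - (tanh x)\<^sup>2)) (at x)" for x :: real
  by (auto intro!: derivative_eq_intros simp: c)
 show "((\<lambda>x. - 2 * tanh x * (1 - (tanh x)\<^sup>2)) has_real_derivative - 2 * (1 - (tanh x)\<^sup>2)\<^sup>2 + 4 * (tanh x)\<^sup>2 * (1 - (tanh x)\<^sup>2)) (at x)" for x :: real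
  by (auto intro!: derivative_eq_intros simp: c) (simp add: algebra_simps power2_eq_square)
 have a: "\<bar>tanh x\<bar> \<le> 1" for x :: real using tanh_real_bounds[of x] by auto
 have s: "0 \<le> (tanh x)\<^sup>2" "(tanh x)\<^sup>2 \<le> 1" for x :: real using a[of x] by (simp_all add: abs_square_le_1)
 show "\<bar>tanh x\<bar> \<le> 6" for x :: real using a[of x] by linarith
 show "\<bar>1 - (tanh x)\<^sup>2\<bar> \<le> 6" for x :: real using s[of x] by linarith
 have p: "\<bar>1 - (tanh x)\<^sup>2\<bar> \<le> 1" for x :: real using s[of x] by linarith
 show "\<bar>- 2 * tanh x * (1 - (tanh x)\<^sup>2)\<bar> \<le> 6" for x :: real
 proof -
  have "\<bar>tanh x\<bar> * \<bar>1 - (tanh x)\<^sup>2\<bar> \<le> 1 * 1" using a p by (intro mult_mono) auto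
  moreover have "\<bar>- 2 * tanh x * (1 - (tanh x)\<^sup>2)\<bar> = 2 * (\<bar>tanh x\<bar> * \<bar>1 - (tanh x)\<^sup>2\<bar>)" by (simp add: abs_mult)
  ultimately show ?thesis by linarith
 qed
 show "\<bar>- 2 * (1 - (tanh x)\<^sup>2)\<^sup>2 + 4 * (tanh x)\<^sup>2 * (1 - (tanh x)\<^sup>2)\<bar> \<le> 6" for x :: real
 proof -
  have "0 \<le> (1 - (tanh x)\<^sup>2)\<^sup>2" "(1 - (tanh x)\<^sup>2)\<^sup>2 \<le> 1" using p[of x] by (simp_all add: abs_square_le_1)
  moreover have "0 \<le> (tanh x)\<^sup>2 * (1 - (tanh x)\<^sup>2)" "(tanh x)\<^sup>2 * (1 - (tanh x)\<^sup>2) \<le> 1"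
   using s[of x] by (auto intro: mult_le_one)
  ultimately show ?thesis unfolding mult.assoc by linarith
 qed
qed

text \<open>Obtained from one particular test function, but the statement no longer mentions it and
  so serves \<open>generator_formula\<close> for all of them.\<close>

lemma (in wiener) drift_integrable:
 assumes l: "0 < l" and sol: "nonneg_solution P l Z" and t: "0 < t"
 shows "integrable P (\<lambda>w. Z w t - w t)"
proof -
 interpret T: test_function l tanh "\<lambda>x. 1 - (tanh x)\<^sup>2" "\<lambda>x. - 2 * tanh x * (1 - (tanh x)\<^sup>2)"
  "\<lambda>x. - 2 * (1 - (tanh x)\<^sup>2)\<^sup>2 + 4 * (tanh x)\<^sup>2 * (1 - (tanh x)\<^sup>2)" 6 by (rule test_function_tanh[OF l])
 interpret R: radial P l tanh "\<lambda>x. 1 - (tanh x)\<^sup>2" "\<lambda>x. - 2 * tanh x * (1 - (tanh x)\<^sup>2)"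
  "\<lambda>x. - 2 * (1 - (tanh x)\<^sup>2)\<^sup>2 + 4 * (tanh x)\<^sup>2 * (1 - (tanh x)\<^sup>2)" 6 Z by unfold_locales (rule sol)
 show ?thesis
 proof (rule R.drift_integrable_aux[OF _ _ _ t, where c="1 - (tanh 1)\<^sup>2"])
  have "\<bar>tanh x\<bar> < 1" for x :: real using tanh_real_bounds[of x] by auto
  then have lt: "(tanh x)\<^sup>2 < 1" for x :: real by (simp add: abs_square_less_1)
  show "0 \<le> 1 - (tanh x)\<^sup>2" for x :: real using lt[of x] by linarith
  show "0 < 1 - (tanh (1 :: real))\<^sup>2" using lt[of 1] by linarith
  show "1 - (tanh 1)\<^sup>2 \<le> 1 - (tanh x)\<^sup>2" if "0 \<le> x" "x \<le> 1" for x :: real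
   using that power_mono[of "tanh x" "tanh 1" 2] by simp
 qed
qed

text \<open>Differentiating \<open>sfun l \<theta> z * sinh (l * z) = sin (\<theta> * z)\<close>
  twice and dividing by \<open>2 * sinh (l * z)\<close> gives the eigenvalue relation without
  derivatives of a quotient.\<close>

lemma sfun_generator:
 assumes l: "0 < l" and D0: "D 0 = sfun l \<theta>" and D: "\<And>n x. (D n has_real_derivative D (Suc n) x) (at x)" and z: "0 < z"
 shows "D 2 z / 2 + l * coth (l * z) * D 1 z = - ((\<theta>\<^sup>2 + l\<^sup>2) / 2) * sfun l \<theta> z"
proof -
 have d0: "(D 0 has_real_derivative D 1 x) (at x)" "(D 1 has_real_derivative D 2 x) (at x)" for x
  using D[of 0 x] D[of 1 x] by (simp_all add: numeral_2_eq_2)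
 have e0: "(\<lambda>x. D 0 x * sinh (l * x)) = (\<lambda>x. sin (\<theta> * x))" unfolding D0 using sfun_times_sinh[OF l] by (intro ext)
 have "((\<lambda>x. D 0 x * sinh (l * x)) has_real_derivative D 1 x * sinh (l * x) + D 0 x * (l * cosh (l * x))) (at x)" for x
  by (rule derivative_eq_intros d0 refl | simp)+
 moreover have "((\<lambda>x. sin (\<theta> * x)) has_real_derivative \<theta> * cos (\<theta> * x)) (at x)" for x
  by (rule derivative_eq_intros refl | simp)+
 ultimately have e1: "D 1 x * sinh (l * x) + D 0 x * (l * cosh (l * x)) = \<theta> * cos (\<theta> * x)" for x
  unfolding e0 by (rule DERIV_unique)
 have "((\<lambda>x. D 1 x * sinh (l * x) + D 0 x * (l * cosh (l * x))) has_real_derivative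
   D 2 z * sinh (l * z) + D 1 z * (l * cosh (l * z)) + (D 1 z * (l * cosh (l * z)) + D 0 z * (l * (l * sinh (l * z))))) (at z)"
  by (rule derivative_eq_intros d0 refl | simp)+
 moreover have "((\<lambda>x. \<theta> * cos (\<theta> * x)) has_real_derivative \<theta> * (\<theta> * - sin (\<theta> * z))) (at z)"
  by (rule derivative_eq_intros refl | simp)+
 ultimately have "D 2 z * sinh (l * z) + D 1 z * (l * cosh (l * z)) + (D 1 z * (l * cosh (l * z)) + D 0 z * (l * (l * sinh (l * z)))) = \<theta> * (\<theta> * - sin (\<theta> * z))"
  unfolding e1 by (rule DERIV_unique)
 also have "\<dots> = - \<theta>\<^sup>2 * (D 0 z * sinh (l * z))" unfolding fun_cong[OF e0] by (simp add: power2_eq_square)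
 finally have E: "D 2 z * sinh (l * z) + D 1 z * (l * cosh (l * z)) + (D 1 z * (l * cosh (l * z)) + D 0 z * (l * (l * sinh (l * z)))) = - \<theta>\<^sup>2 * (D 0 z * sinh (l * z))" .
 have "(D 2 z / 2 + l * coth (l * z) * D 1 z) * sinh (l * z) = D 2 z * sinh (l * z) / 2 + D 1 z * (l * (coth (l * z) * sinh (l * z)))"
  by (simp add: algebra_simps)
 also have "coth (l * z) * sinh (l * z) = cosh (l * z)" using l z by (simp add: coth_def)
 also have "D 2 z * sinh (l * z) / 2 + D 1 z * (l * cosh (l * z)) = (- ((\<theta>\<^sup>2 + l\<^sup>2) / 2) * D 0 z) * sinh (l * z)"
  using E by (simp add: field_simps power2_eq_square)
 finally have "(D 2 z / 2 + l * coth (l * z) * D 1 z) * sinh (l * z) = (- ((\<theta>\<^sup>2 + l\<^sup>2) / 2) * D 0 z) * sinh (l * z)" .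
 moreover have "sinh (l * z) \<noteq> 0" using l z by simp
 ultimately show ?thesis unfolding D0 using mult_right_cancel[THEN iffD1] by blast
qed

text \<open>The integral equation makes \<open>v\<close> differentiable, and then
  \<open>exp (c * r) * v r\<close> has derivative 0.\<close>

lemma exponential_decay:
 fixes v :: "real => real"
 assumes st: "s < t" and v: "continuous_on {s..t} v" and eq: "\<And>r. r \<in> {s..t} ==> v r = v s - c * integral {s..r} v"
 shows "v t = exp (- c * (t - s)) * v s"
proof -
 have d: "(v has_real_derivative - c * v r) (at r within {s..t})" if r: "r \<in> {s..t}" for r
 proof (rule has_field_derivative_transform_within[OF _ zero_less_one r])
  show "((\<lambda>r. v s - c * integral {s..r} v) has_real_derivative - c * v r) (at r within {s..t})"
   by (rule derivative_eq_intros integral_has_real_derivative[OF v r] refl | simp)+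
 qed (rule eq[symmetric])
 have "\<exists>k. \<forall>r\<in>{s..t}. exp (c * r) * v r = k"
 proof (rule has_field_derivative_zero_constant)
  fix r assume r: "r \<in> {s..t}"
  show "((\<lambda>r. exp (c * r) * v r) has_real_derivative 0) (at r within {s..t})"
   by (rule derivative_eq_intros d[OF r] refl | simp add: algebra_simps)+
 qed simp
 then have "exp (c * t) * v t = exp (c * s) * v s" using st by force
 then have "exp (- (c * t)) * (exp (c * t) * v t) = exp (- (c * t)) * (exp (c * s) * v s)" by simp
 then show ?thesis by (simp add: mult.assoc[symmetric] exp_add[symmetric] right_diff_distrib)
qed

theorem (in wiener) solution_sine_mart:
 assumes l: "0 < l" and sol: "nonneg_solution P l Z"
 shows "sine_mart l P Z"
 unfolding sine_mart_def
proof (intro allI impI)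
 fix \<theta> s t :: real and U :: "real set" and a :: "real => real => real"
 assume U: "finite U" "U \<subseteq> {0..s}" and s: "0 \<le> s" "s < t" and a1: "\<forall>u. continuous_on UNIV (a u)" and a2: "\<forall>u x. 0 \<le> a u x \<and> a u x \<le> 1"
 obtain D :: "nat => real => real" and B0 :: real where D0: "D 0 = sfun l \<theta>"
  and D: "\<And>n x. (D n has_real_derivative D (Suc n) x) (at x)" and Db: "\<And>n x. \<bar>D n x\<bar> \<le> fact n * B0 * l ^ n"
  by (rule sfun_smooth[OF l, where \<theta>=\<theta>]) (rule that)
 define \<kappa> where "\<kappa> = (\<theta>\<^sup>2 + l\<^sup>2) / 2"
 define B where "B = (\<Sum>n<4. \<bar>fact n * B0 * l ^ n\<bar>)"
 have DB: "\<bar>D n x\<bar> \<le> B" if "n < 4" for n x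
 proof -
  have "\<bar>D n x\<bar> \<le> \<bar>fact n * B0 * l ^ n\<bar>" using Db[of n x] by linarith
  also have "\<dots> \<le> B" unfolding B_def using that by (intro member_le_sum) auto
  finally show ?thesis .
 qed
 interpret R: radial P l "D 0" "D 1" "D 2" "D 3" B Z
  by unfold_locales (use l sol D[of 0] D[of 1] D[of 2] DB in \<open>simp_all add: numeral_2_eq_2 numeral_3_eq_3\<close>)
 define h where "h z = (\<Prod>u\<in>U. a u (z u))" for z
 have h: "past_weight r h" if "s \<le> r" for r
  unfolding past_weight_def
 proof (intro conjI allI impI)
  show "h \<in> borel_measurable F_inf" unfolding h_def
   by (rule prod_path_measurable[where Y="\<lambda>z. z", OF measurable_ident_sets[OF refl]]) (use U a1 in auto)
  show "0 \<le> h z" "h z \<le> 1" for z unfolding h_def using a2 by (auto intro: prod_nonneg prod_le_1)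
  fix z z' :: "real => real" assume "\<forall>u. 0 \<le> u --> u \<le> r --> z u = z' u"
  then show "h z = h z'" unfolding h_def using U(2) that by (intro prod.cong refl) force
 qed
 have hm: "(\<lambda>w. h (Z w)) \<in> borel_measurable P" by (rule measurable_compose[OF R.Z past_weightD(1)[OF h[OF order_refl]]])
 \<comment> \<open>With the eigenvalue relation, \<open>generator_formula\<close> becomes a linear
   integral equation for \<open>v\<close>, solved by the exponential in the claim.\<close>
 define v where "v r = (LINT w|P. h (Z w) * D 0 (Z w r))" for r
 have B0: "0 \<le> B" by (rule R.B_nonneg)
 have hb: "\<bar>h (Z w) * D 0 (Z w u)\<bar> \<le> B" for w u
 proof -
  have "\<bar>h (Z w)\<bar> * \<bar>D 0 (Z w u)\<bar> \<le> 1 * B" by (intro mult_mono past_weightD(4)[OF h[OF order_refl]] DB) auto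
  then show ?thesis by (simp add: abs_mult)
 qed
 have vb: "\<bar>v r\<bar> \<le> B" for r unfolding v_def by (rule abs_integral_le[OF hb])
 have step: "set_integrable lborel {p<..q} v" "v q - v p = - \<kappa> * (LINT u:{p<..q}|lborel. v u)" if pq: "s \<le> p" "p < q" for p q
 proof -
  have p0: "0 \<le> p" using s pq by simp
  let ?k = "\<lambda>w u. h (Z w) * (indicat_real {p<..q} u * D 0 (Z w u))"
  have km: "case_prod ?k \<in> borel_measurable (P \<Otimes>\<^sub>M lborel)"
   unfolding case_prod_beta'
   by (rule borel_measurable_times[OF measurable_compose[OF measurable_fst hm] R.Z_joint[OF R.f_borel(1) p0, unfolded real_scaleR_def]])
  interpret PL: pair_sigma_finite P lborel ..
  have ki: "integrable (P \<Otimes>\<^sub>M lborel) (case_prod ?k)"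
  proof (rule integrableI_bounded_set[where A="space P \<times> {p<..q}" and B=B])
   show "space P \<times> {p<..q} \<in> sets (P \<Otimes>\<^sub>M lborel)" by (rule pair_measureI[OF sets.top]) simp
   show "emeasure (P \<Otimes>\<^sub>M lborel) (space P \<times> {p<..q}) < \<infinity>"
    using pq by (subst lborel.emeasure_pair_measure_Times[OF sets.top]) (auto simp: emeasure_space_1[unfolded space_P])
   show "AE z in P \<Otimes>\<^sub>M lborel. z \<in> space P \<times> {p<..q} --> norm (case_prod ?k z) \<le> B"
    using hb by (intro AE_I2) (auto simp: indicator_def)
   show "AE z in P \<Otimes>\<^sub>M lborel. z \<notin> space P \<times> {p<..q} --> case_prod ?k z = 0"
    by (intro AE_I2) (auto simp: space_pair_measure indicator_def)
  qed (rule km)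
  have vk: "indicat_real {p<..q} u *\<^sub>R v u = (LINT w|P. ?k w u)" for u
   unfolding v_def by (cases "u \<in> {p<..q}") auto
  show "set_integrable lborel {p<..q} v"
   unfolding set_integrable_def vk using PL.integrable_snd[OF ki] .
  have "v q - v p = (LINT w|P. h (Z w) * (LINT u:{p<..q}|lborel. R.gen (Z w u)))"
   unfolding v_def by (rule R.generator_formula[OF h[OF pq(1)] p0 pq(2) drift_integrable[OF l sol]]) (use p0 pq in simp)
  also have "\<dots> = (LINT w|P. - \<kappa> * (LINT u|lborel. ?k w u))"
  proof (rule integral_cong_AE)
   show "(\<lambda>w. h (Z w) * (LINT u:{p<..q}|lborel. R.gen (Z w u))) \<in> borel_measurable P"
    by (intro borel_measurable_times hm R.Z_LINT_measurable R.gen_borel p0)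
   show "(\<lambda>w. - \<kappa> * (LINT u|lborel. ?k w u)) \<in> borel_measurable P"
    by (intro borel_measurable_times borel_measurable_const lborel.borel_measurable_lebesgue_integral km)
   show "AE w in P. h (Z w) * (LINT u:{p<..q}|lborel. R.gen (Z w u)) = - \<kappa> * (LINT u|lborel. ?k w u)"
    using R.AE_sol
   proof eventually_elim
    case (elim w)
    have gm: "(\<lambda>u. indicat_real {p<..q} u *\<^sub>R R.gen (Z w u)) \<in> borel_measurable lborel"
     using set_integral_Icc_diff(1)[OF R.gen_integrable[OF elim, of q] p0] p0 pq
     unfolding set_integrable_def by (intro borel_measurable_integrable) simp
    have "(\<lambda>u. indicat_real {p<..q} u *\<^sub>R (- \<kappa> * D 0 (Z w u))) \<in> borel_measurable lborel" if "w \<in> space P"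
     using measurable_Pair2[OF R.Z_joint[OF R.f_borel(1) p0, of q] that]
      borel_measurable_times[OF borel_measurable_const[of "- \<kappa>"]] by (simp add: mult.left_commute)
    moreover have "w \<in> space P" using solvesD(1)[OF elim] by simp
    ultimately have dm: "(\<lambda>u. indicat_real {p<..q} u *\<^sub>R (- \<kappa> * D 0 (Z w u))) \<in> borel_measurable lborel" by blast
    have "(LINT u:{p<..q}|lborel. R.gen (Z w u)) = (LINT u:{p<..q}|lborel. - \<kappa> * D 0 (Z w u))"
     unfolding set_lebesgue_integral_def
    proof (rule integral_cong_AE[OF gm dm])
     show "AE u in lborel. indicat_real {p<..q} u *\<^sub>R R.gen (Z w u) = indicat_real {p<..q} u *\<^sub>R (- \<kappa> * D 0 (Z w u))"
      using solvesD(4)[OF elim]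
     proof eventually_elim
      case (elim u)
      show ?case
      proof (cases "u \<in> {p<..q}")
       case True
       then have "0 < Z w u" using elim p0 by simp
       then have "R.gen (Z w u) = - \<kappa> * D 0 (Z w u)" unfolding R.gen_def \<kappa>_def using sfun_generator[OF l D0 D] D0 by simp
       then show ?thesis by (simp only:)
      qed simp
     qed
    qed
    also have "h (Z w) * \<dots> = - \<kappa> * (LINT u|lborel. ?k w u)"
     unfolding set_lebesgue_integral_def by (simp add: mult.left_commute)
    finally show ?case .
   qed
  qed
  also have "\<dots> = - \<kappa> * (LINT w|P. (LINT u|lborel. ?k w u))" by simp
  also have "(LINT w|P. (LINT u|lborel. ?k w u)) = (LINT u|lborel. (LINT w|P. ?k w u))" by (rule PL.Fubini_integral[OF ki, symmetric])
  also have "\<dots> = (LINT u:{p<..q}|lborel. v u)" unfolding set_lebesgue_integral_def vk ..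
  finally show "v q - v p = - \<kappa> * (LINT u:{p<..q}|lborel. v u)" .
 qed
 have \<kappa>0: "0 \<le> \<kappa>" by (simp add: \<kappa>_def)
 \<comment> \<open>Differentiating the integral equation requires continuity of \<open>v\<close>,
   which follows from the equation itself and the bound on \<open>v\<close>.\<close>
 have lip: "\<bar>v q - v p\<bar> \<le> \<kappa> * B * \<bar>q - p\<bar>" if pq: "s \<le> p" "p < q" for p q
 proof -
  have Ci: "set_integrable lborel {p<..q} (\<lambda>u. B)" by (rule set_integrable_subset[OF set_integrable_Icc_const[of p q]]) auto
  have "\<bar>LINT u:{p<..q}|lborel. v u\<bar> \<le> (LINT u:{p<..q}|lborel. \<bar>v u\<bar>)"
   using set_integral_norm_bound[OF step(1)[OF pq]] by simp
  also have "\<dots> \<le> (LINT u:{p<..q}|lborel. B)" by (intro set_integral_mono set_integrable_abs step(1)[OF pq] Ci vb)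
  also have "\<dots> = B * \<bar>q - p\<bar>" using pq by (simp add: set_lebesgue_integral_def)
  finally have "\<kappa> * \<bar>LINT u:{p<..q}|lborel. v u\<bar> \<le> \<kappa> * (B * \<bar>q - p\<bar>)" by (rule mult_left_mono[OF _ \<kappa>0])
  then show ?thesis unfolding step(2)[OF pq] abs_mult abs_minus_cancel using \<kappa>0 by (simp add: mult.assoc)
 qed
 have "lipschitz_on (\<kappa> * B) {s..t} v"
 proof (rule lipschitz_onI)
  fix x y assume "x \<in> {s..t}" "y \<in> {s..t}"
  then show "dist (v x) (v y) \<le> \<kappa> * B * dist x y"
   using lip[of x y] lip[of y x] unfolding dist_real_def by (cases x y rule: linorder_cases) (auto simp: abs_minus_commute)
 qed (use \<kappa>0 B0 in simp)
 then have cv: "continuous_on {s..t} v" by (rule lipschitz_on_continuous_on)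
 have "v t = exp (- \<kappa> * (t - s)) * v s"
 proof (rule exponential_decay[OF s(2) cv])
  fix r assume r: "r \<in> {s..t}"
  show "v r = v s - \<kappa> * integral {s..r} v"
  proof (cases "r = s")
   case False
   then have sr: "s < r" using r by simp
   have ci: "set_integrable lborel {s..r} v"
    by (rule borel_integrable_atLeastAtMost'[OF continuous_on_subset[OF cv]]) (use r in auto)
   have "(LINT u:{s<..r}|lborel. v u) = (LINT u:{s..r}|lborel. v u)"
    by (rule set_integral_cong_set) (use step(1)[OF order_refl sr] ci AE_lborel_singleton[of s] in
      \<open>auto simp: set_integrable_def set_borel_measurable_def elim!: eventually_mono\<close>)
   also have "\<dots> = integral {s..r} v" by (rule set_borel_integral_eq_integral(2)[OF ci])
   finally show ?thesis using step(2)[OF order_refl sr] by simp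
  qed simp
 qed
 then show "(LINT w|P. (\<Prod>u\<in>U. a u (Z w u)) * sfun l \<theta> (Z w t))
   = exp (- ((\<theta>\<^sup>2 + l\<^sup>2) / 2) * (t - s)) * (LINT w|P. (\<Prod>u\<in>U. a u (Z w u)) * sfun l \<theta> (Z w s))"
  unfolding v_def h_def D0 \<kappa>_def .
qed

section \<open>The decomposition at the time of the maximum\<close>

context penalised
begin

lemma AE_S_inf_finite: "AE w in Q. \<bar>S_inf w\<bar> \<noteq> \<infinity>"
 using AE_good
proof eventually_elim
 case (elim w)
 obtain G where "S_inf w = ereal (w G)" by (rule good_pathE[OF elim])
 then show ?case by simp
qed

lemma prob_space_drift_kernel: "prob_space (drift_kernel x)"
 unfolding drift_kernel_def by (rule prob_space_distr[OF drift_stopped_measurable])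

text \<open>\<open>joint_law\<close> with no condition on the stopped path, as each
  \<open>drift_kernel x\<close> has mass 1.\<close>

lemma distr_S_inf: "distributed Q lborel (\<lambda>w. real_of_ereal (S_inf w)) max_density"
 unfolding distributed_def
proof (intro conjI)
 show X: "(\<lambda>w. real_of_ereal (S_inf w)) \<in> Q \<rightarrow>\<^sub>M lborel" using S_inf_borel_Q by simp
 show "distr Q lborel (\<lambda>w. real_of_ereal (S_inf w)) = density lborel max_density"
 proof (rule measure_eqI)
  fix A assume "A \<in> sets (distr Q lborel (\<lambda>w. real_of_ereal (S_inf w)))"
  then have A: "A \<in> sets borel" by simp
  have "stopped_path (g w) w \<in> space stopped_path_space" if "w \<in> Omega" for w
   using measurable_space[OF stopped_g_measurable, of w] that by simp
  then have "(\<lambda>w. real_of_ereal (S_inf w)) -` A \<inter> space Q = {w \<in> Omega. real_of_ereal (S_inf w) \<in> A \<and> stopped_path (g w) w \<in> space stopped_path_space}"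
   by auto
  then have "emeasure (distr Q lborel (\<lambda>w. real_of_ereal (S_inf w))) A
   = (\<integral>\<^sup>+x. max_density x * indicator A x * emeasure (drift_kernel x) (space stopped_path_space) \<partial>lborel)"
   using A by (simp add: emeasure_distr[OF X] joint_law[OF A sets.top])
  also have "\<dots> = (\<integral>\<^sup>+x. max_density x * indicator A x \<partial>lborel)"
  proof (rule nn_integral_cong)
   fix x
   have "emeasure (drift_kernel x) (space stopped_path_space) = 1"
    using prob_space.emeasure_space_1[OF prob_space_drift_kernel[of x]] by (simp add: drift_kernel_def)
   then show "max_density x * indicator A x * emeasure (drift_kernel x) (space stopped_path_space) = max_density x * indicator A x" by simp
  qed
  also have "\<dots> = emeasure (density lborel max_density) A" using A by (simp add: emeasure_density)
  finally show "emeasure (distr Q lborel (\<lambda>w. real_of_ereal (S_inf w))) A = emeasure (density lborel max_density) A" .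
 qed simp
qed simp

lemma drift_kernel_measurable: "drift_kernel \<in> borel \<rightarrow>\<^sub>M prob_algebra stopped_path_space"
proof (rule measurable_prob_algebraI[OF prob_space_drift_kernel])
 let ?k = "\<lambda>z. stopped_path (hitting_time (fst z) (drifted_path l (snd z))) (drifted_path l (snd z))"
 have B: "(\<lambda>z. drifted_path l (snd z)) \<in> borel \<Otimes>\<^sub>M P \<rightarrow>\<^sub>M F_inf" by (rule measurable_compose[OF measurable_snd drifted_F_inf])
 have k: "?k \<in> borel \<Otimes>\<^sub>M P \<rightarrow>\<^sub>M stopped_path_space"
  by (rule stopped_path_measurable[OF hitting_time_measurable[OF measurable_fst B] B])
 show "drift_kernel \<in> borel \<rightarrow>\<^sub>M subprob_algebra stopped_path_space"
 proof (rule measurable_subprob_algebra)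
  show "subprob_space (drift_kernel x)" for x by (rule prob_space_imp_subprob_space[OF prob_space_drift_kernel])
  show "sets (drift_kernel x) = sets stopped_path_space" for x by (simp add: drift_kernel_def)
  fix A assume A: "A \<in> sets stopped_path_space"
  have "emeasure (drift_kernel x) A = emeasure P (Pair x -` (?k -` A \<inter> space (borel \<Otimes>\<^sub>M P)))" for x
   unfolding drift_kernel_def emeasure_distr[OF drift_stopped_measurable A] by (rule arg_cong[where f="emeasure P"]) (auto simp: space_pair_measure)
  then show "(\<lambda>x. emeasure (drift_kernel x) A) \<in> borel_measurable borel"
   using measurable_emeasure_Pair[OF measurable_sets[OF k A]] by simp
 qed
qed

text \<open>Disintegration: by \<open>joint_law\<close> the mass of a joint event is the integral of
  the kernel against the density of \<open>S_inf\<close>, which is the averaging property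
  characterising the conditional expectation.\<close>

lemma regular_cond_distr_stopped:
 "regular_cond_distr Q borel (\<lambda>w. real_of_ereal (S_inf w)) stopped_path_space (\<lambda>w. stopped_path (g w) w) drift_kernel"
 unfolding regular_cond_distr_def
proof (intro conjI ballI)
 let ?X = "\<lambda>w. real_of_ereal (S_inf w)" and ?Y = "\<lambda>w. stopped_path (g w) w"
 fix B assume B: "B \<in> sets stopped_path_space"
 let ?V = "vimage_algebra (space Q) ?X borel"
 have sub: "subalgebra Q ?V"
  unfolding subalgebra_def using measurable_sets[OF S_inf_borel_Q] by (auto simp: sets_vimage_algebra2)
 interpret V: sigma_finite_subalgebra Q ?V
 proof -
  interpret finite_measure_subalgebra Q ?V by unfold_locales (rule sub)
  show "sigma_finite_subalgebra Q ?V" by unfold_locales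
 qed
 have YB: "?Y -` B \<inter> space Q \<in> sets Q" by (rule measurable_sets[OF stopped_g_measurable B])
 have "(\<lambda>x. emeasure (drift_kernel x) B) \<in> borel_measurable borel"
  by (rule measurable_emeasure_kernel[OF measurable_prob_algebraD[OF drift_kernel_measurable] B])
 then have kB: "(\<lambda>x. measure (drift_kernel x) B) \<in> borel_measurable borel" unfolding measure_def by measurable
 have k01: "0 \<le> measure (drift_kernel x) B" "measure (drift_kernel x) B \<le> 1" for x
  using prob_space.prob_le_1[OF prob_space_drift_kernel] by auto
 have eK: "emeasure (drift_kernel x) B = ennreal (measure (drift_kernel x) B)" for x
  by (rule finite_measure.emeasure_eq_measure) (rule prob_space.finite_measure[OF prob_space_drift_kernel])
 show "AE w in Q. real_cond_exp Q ?V (indicator (?Y -` B \<inter> space Q)) w = measure (drift_kernel (?X w)) B"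
 proof (rule V.real_cond_exp_charact)
  show "integrable Q (indicator (?Y -` B \<inter> space Q) :: _ => real)" using YB by (simp add: Q.emeasure_eq_measure)
  show "integrable Q (\<lambda>w. measure (drift_kernel (?X w)) B)"
   by (rule Q.integrable_const_bound[where B=1, OF _ measurable_compose[OF S_inf_borel_Q kB]]) (use k01 in auto)
  show "(\<lambda>w. measure (drift_kernel (?X w)) B) \<in> borel_measurable ?V"
   by (rule measurable_compose[OF measurable_vimage_algebra1 kB]) simp
  fix A assume "A \<in> sets ?V"
  then obtain C where C: "C \<in> sets borel" "A = ?X -` C \<inter> space Q" by (auto simp: sets_vimage_algebra2)
  have CQ: "A \<in> sets Q" unfolding C(2) by (rule measurable_sets[OF S_inf_borel_Q C(1)])
  have "(\<integral>w\<in>A. indicator (?Y -` B \<inter> space Q) w \<partial>Q) = (LINT w|Q. indicator (A \<inter> (?Y -` B \<inter> space Q)) w)"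
   unfolding set_lebesgue_integral_def by (intro Bochner_Integration.integral_cong refl) (auto simp: indicator_def)
  also have "\<dots> = measure Q (A \<inter> (?Y -` B \<inter> space Q))"
   unfolding Bochner_Integration.integral_indicator using sets.sets_into_space[OF CQ] by (intro arg_cong[where f="measure Q"]) auto
  also have "A \<inter> (?Y -` B \<inter> space Q) = {w \<in> Omega. ?X w \<in> C \<and> ?Y w \<in> B}" unfolding C(2) by auto
  also have "measure Q \<dots> = enn2real (\<integral>\<^sup>+x. max_density x * (indicator C x * ennreal (measure (drift_kernel x) B)) \<partial>lborel)"
   unfolding measure_def[of Q] joint_law[OF C(1) B] eK by (simp add: mult.assoc)
  also have "(\<integral>\<^sup>+x. max_density x * (indicator C x * ennreal (measure (drift_kernel x) B)) \<partial>lborel)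
   = (\<integral>\<^sup>+w. indicator C (?X w) * ennreal (measure (drift_kernel (?X w)) B) \<partial>Q)"
   using C(1) kB by (intro distributed_nn_integral[OF distr_S_inf] borel_measurable_times_ennreal borel_measurable_indicator measurable_compose[OF _ measurable_ennreal]) simp_all
  also have "\<dots> = (\<integral>\<^sup>+w. ennreal (indicator A w * measure (drift_kernel (?X w)) B) \<partial>Q)"
   unfolding C(2) by (intro nn_integral_cong) (auto simp: indicator_def)
  also have "enn2real \<dots> = (\<integral>w\<in>A. measure (drift_kernel (?X w)) B \<partial>Q)"
   unfolding set_lebesgue_integral_def real_scaleR_def
   using k01 CQ by (intro integral_eq_nn_integral[symmetric] borel_measurable_times borel_measurable_indicator measurable_compose[OF S_inf_borel_Q kB]) auto
  finally show "(\<integral>w\<in>A. indicator (?Y -` B \<inter> space Q) w \<partial>Q) = (\<integral>w\<in>A. measure (drift_kernel (?X w)) B \<partial>Q)" .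
 qed
qed (rule S_inf_borel_Q stopped_g_measurable drift_kernel_measurable)+

lemma indep_post_g:
 "Q.indep_set (sets (vimage_algebra (space Q) post_g_path F_inf))
   (sets (vimage_algebra (space Q) (\<lambda>w. stopped_path (g w) w) stopped_path_space))"
proof -
 let ?Y = "\<lambda>w. stopped_path (g w) w"
 have s1: "sets (vimage_algebra (space Q) post_g_path F_inf) = {post_g_path -` C \<inter> Omega |C. C \<in> sets F_inf}"
  using measurable_space[OF post_g_Q] by (subst sets_vimage_algebra2) auto
 have s2: "sets (vimage_algebra (space Q) ?Y stopped_path_space) = {?Y -` B \<inter> Omega |B. B \<in> sets stopped_path_space}"
  using measurable_space[OF stopped_g_measurable] by (subst sets_vimage_algebra2) auto
 show ?thesis unfolding Q.indep_sets2_eq s1 s2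
 proof (intro conjI ballI subsetI)
  show "x \<in> Q.events" if "x \<in> {post_g_path -` C \<inter> Omega |C. C \<in> sets F_inf}" for x
   using that measurable_sets[OF post_g_Q] by auto
  show "x \<in> Q.events" if "x \<in> {?Y -` B \<inter> Omega |B. B \<in> sets stopped_path_space}" for x
   using that measurable_sets[OF stopped_g_measurable] by auto
  fix a b assume "a \<in> {post_g_path -` C \<inter> Omega |C. C \<in> sets F_inf}" "b \<in> {?Y -` B \<inter> Omega |B. B \<in> sets stopped_path_space}"
  then obtain C B where CB: "a = post_g_path -` C \<inter> Omega" "C \<in> sets F_inf" "b = ?Y -` B \<inter> Omega" "B \<in> sets stopped_path_space" by blast
  show "Q.prob (a \<inter> b) = Q.prob a * Q.prob b"
   unfolding measure_def CB post_g_indep[OF CB(4,2)] by (rule enn2real_mult)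
 qed
qed

text \<open>Both processes start at 0, stay nonnegative and satisfy \<open>sine_mart\<close>, so
  \<open>sine_mart_unique\<close> identifies their laws.\<close>

lemma law_post_g:
 assumes sol: "nonneg_solution P l Z"
 shows "distr Q F_inf post_g_path = distr P F_inf Z"
proof (rule sine_mart_unique[OF l_pos Q.finite_measure_axioms finite_measure_axioms post_g_Q])
 show "Z \<in> P \<rightarrow>\<^sub>M F_inf" using sol by (simp add: nonneg_solution_def)
 show "AE w in Q. post_g_path w 0 = 0 \<and> (\<forall>t\<ge>0. 0 \<le> post_g_path w t)" by (rule AE_post_g_pos)
 show "AE w in P. Z w 0 = 0 \<and> (\<forall>t\<ge>0. 0 \<le> Z w t)"
  using AE_solves[OF sol] AE_start by eventually_elim (simp add: solves_start solvesD(3))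
 show "sine_mart l Q post_g_path" by (rule post_g_sine_mart_Q)
 show "sine_mart l P Z" by (rule solution_sine_mart[OF l_pos sol])
qed (simp only: Q.prob_space prob_space)

end
theorem theorem4p7:
  fixes l :: real and \<psi> :: "real \<Rightarrow> real" and P0 Q :: "(real \<Rightarrow> real) measure"
  assumes l_pos: "l > 0"
    and \<psi>_borel: "\<psi> \<in> borel_measurable borel"
    and \<psi>_pos: "\<And>x. \<psi> x > 0"
    and \<psi>_int: "\<And>x. set_integrable lborel {x..} (\<lambda>z. \<psi> z * exp (- l * z))"
    and P0: "wiener_measure P0"
    and Q_prob: "prob_space Q"
    and Q_sets: "sets Q = sets F_inf"
    and Q_eq: "\<And>t \<Gamma>. 0 \<le> t \<Longrightarrow> \<Gamma> \<in> sets (F t) \<Longrightarrow>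
      measure Q \<Gamma> = 1 / (1 - Phi l \<psi> 0) * (LINT \<omega>|P0. indicator \<Gamma> \<omega> * Mart l \<psi> t \<omega>)"
  shows
    "(AE \<omega> in Q. \<bar>S_inf \<omega>\<bar> \<noteq> \<infinity>) \<and>
     distributed Q lborel (\<lambda>\<omega>. real_of_ereal (S_inf \<omega>))
       (\<lambda>x. ennreal (indicator {0<..} x *
          (exp (- l * x) * (phi l \<psi> x + l * (1 - Phi l \<psi> x)) / (1 - Phi l \<psi> 0)))) \<and>
     (\<forall>x>0. exp (- l * x) * (phi l \<psi> x + l * (1 - Phi l \<psi> x)) / (1 - Phi l \<psi> 0)
            = exp (- l * x) * \<psi> x / (1 - Phi l \<psi> 0)) \<and>
     measure Q {\<omega> \<in> space Q. 0 < g \<omega> \<and> g \<omega> < \<infinity>} = 1 \<and>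
     prob_space.indep_set Q
       (sets (vimage_algebra (space Q) post_g_path F_inf))
       (sets (vimage_algebra (space Q) (\<lambda>\<omega>. stopped_path (g \<omega>) \<omega>) stopped_path_space)) \<and>
     (\<forall>Z. nonneg_solution P0 l Z \<longrightarrow> distr Q F_inf post_g_path = distr P0 F_inf Z) \<and>
     regular_cond_distr Q borel (\<lambda>\<omega>. real_of_ereal (S_inf \<omega>))
       stopped_path_space (\<lambda>\<omega>. stopped_path (g \<omega>) \<omega>)
       (\<lambda>x. distr P0 stopped_path_space
          (\<lambda>\<omega>. stopped_path (hitting_time x (drifted_path l \<omega>)) (drifted_path l \<omega>)))"
proof -
 interpret penalised P0 l \<psi> Q
  by (intro penalised.intro wiener.intro penalised_axioms.intro; fact assms)
 \<comment> \<open>The tail integrals in \<open>phi\<close> and \<open>Phi\<close> cancel, so both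
   forms of the density are the same function.\<close>
 have \<psi>: "phi l \<psi> x + l * (1 - Phi l \<psi> x) = \<psi> x" for x
  by (simp add: phi_def Phi_def)
 have "{\<omega> \<in> space Q. 0 < g \<omega> \<and> g \<omega> < \<infinity>} = g -` {0<..<\<infinity>} \<inter> space Q" by auto
 also have "\<dots> \<in> sets Q" by (rule measurable_sets[OF g_borel_Q]) simp
 finally have "measure Q {\<omega> \<in> space Q. 0 < g \<omega> \<and> g \<omega> < \<infinity>} = 1"
  using AE_g_pos by (simp only: Q.prob_Collect_eq_1)
 then show ?thesis
  using AE_S_inf_finite distr_S_inf indep_post_g law_post_g regular_cond_distr_stopped
  unfolding \<psi> I0_eq max_density_def drift_kernel_def[abs_def] by blast
qed

end
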